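(* Let $N\ge 2$, let $\Omega\subset\mathbb{R}^N$ be a bounded domain with smooth boundary, and let $f\in L^N(\Omega)$. Let $\phi:\mathbb{R}\setminus\{0\}\to\mathbb{R}$ be an even function of class $C^1$, let $\Phi(t)=\int_0^t s\phi(s)\,ds$ for $t\in\mathbb{R}$, and assume: (1) $t\phi(t)\to 0$ as $t\to 0$ and $t\phi(t)\to\infty$ as $t\to\infty$; (2) $t\mapsto t\phi(t)$ is strictly increasing on $(0,\infty)$; (3) there exist $\ell,m\in[1,N)$ such that $$\ell-1=\inf_{s>0}\frac{(s\phi(s))'}{\phi(s)}\le\frac{(t\phi(t))'}{\phi(t)}\le m-1\quad\text{for all } t>0;$$ (4) $a:=\inf_{t>0}\frac{t^m}{\Phi(t)}>0$. Then there exists a unique $u\in W_0^{1,\Phi}(\Omega)$ such that $$\int_\Omega\phi(|\nabla u|)\nabla u\cdot\nabla v\,dx=\int_\Omega f v\,dx\quad\text{for all } v\in W_0^{1,\Phi}(\Omega).$$ Moreover, if $\ell>1$ and there exist $r>1$ and constants $c_1,c_2>0$ such that $c_1|t|^r\le\Phi(t)\le c_2|t|^r$ for all $t\in\mathbb{R}$, then $u\in L^\infty(\Omega)$.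
   Context: $L_\Phi(\Omega)$ is the Orlicz space with Luxemburg norm $\|u\|_\Phi=\inf\{\lambda>0:\int_\Omega\Phi(u(x)/\lambda)\,dx\le 1\}$. $W^{1,\Phi}(\Omega)$ is the Orlicz-Sobolev space of functions in $L_\Phi(\Omega)$ whose weak first derivatives lie in $L_\Phi(\Omega)$, with norm $\|u\|_{1,\Phi}=\|u\|_\Phi+\sum_{i=1}^N\|\partial u/\partial x_i\|_\Phi$, and $W_0^{1,\Phi}(\Omega)$ is the closure of $C_0^\infty(\Omega)$ in $W^{1,\Phi}(\Omega)$. The expression $\phi(|\xi|)\xi$ is understood to be $0$ when $\xi=0$. The integral identity is the weak formulation of $-\operatorname{div}(\phi(|\nabla u|)\nabla u)=f$ in $\Omega$, $u=0$ on $\partial\Omega$. *)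

theory Defs
  imports "HOL-Analysis.Analysis"
begin

section \<open>Smooth functions and smooth domains\<close>

definition partial_deriv :: "'n \<Rightarrow> (real^'n \<Rightarrow> real) \<Rightarrow> real^'n \<Rightarrow> real" where
  "partial_deriv i h x = frechet_derivative h (at x) (axis i 1)"

fun Ck :: "nat \<Rightarrow> (real^'n \<Rightarrow> real) \<Rightarrow> bool" where
  "Ck 0 h = continuous_on UNIV h"
| "Ck (Suc k) h = ((\<forall>x. h differentiable (at x)) \<and> (\<forall>i. Ck k (partial_deriv i h)))"

definition smooth :: "(real^'n \<Rightarrow> real) \<Rightarrow> bool" where
  "smooth h = (\<forall>k. Ck k h)"

definition test_functions :: "(real^'n) set \<Rightarrow> (real^'n \<Rightarrow> real) set" where
  "test_functions \<Omega> =
     {\<eta>. smooth \<eta> \<and> compact (closure {x. \<eta> x \<noteq> 0}) \<and> closure {x. \<eta> x \<noteq> 0} \<subseteq> \<Omega>}"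

text \<open>
  Near each boundary point, in suitably rotated or reflected coordinates, the domain is the region
  above the graph of a smooth function of \<open>N - 1\<close> variables. Such a function is represented as a
  smooth function on \<open>\<real>\<^sup>N\<close> that does not depend on the \<open>k\<close>-th coordinate.
\<close>
definition smooth_boundary :: "(real^'n) set \<Rightarrow> bool" where
  "smooth_boundary \<Omega> = (\<forall>x0\<in>frontier \<Omega>. \<exists>r>0. \<exists>(T :: real^'n \<Rightarrow> real^'n) k \<gamma>.
     orthogonal_transformation T \<and> smooth \<gamma> \<and>
     (\<forall>y z. (\<forall>i. i \<noteq> k \<longrightarrow> y $ i = z $ i) \<longrightarrow> \<gamma> y = \<gamma> z) \<and>
     \<Omega> \<inter> ball x0 r = {x \<in> ball x0 r. T x $ k > \<gamma> (T x)})"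

section \<open>Lebesgue and Orlicz spaces\<close>

text \<open>
  Members of the function spaces are represented by functions on \<open>\<real>\<^sup>N\<close> of which only the restriction
  to \<open>\<Omega>\<close> matters; equality of elements is equality almost everywhere on \<open>\<Omega>\<close>.
\<close>

definition Lp_space :: "real \<Rightarrow> (real^'n) set \<Rightarrow> (real^'n \<Rightarrow> real) set" where
  "Lp_space p \<Omega> = {u \<in> borel_measurable (lebesgue_on \<Omega>).
     integrable (lebesgue_on \<Omega>) (\<lambda>x. \<bar>u x\<bar> powr p)}"

definition Linfty_space :: "(real^'n) set \<Rightarrow> (real^'n \<Rightarrow> real) set" where
  "Linfty_space \<Omega> = {u \<in> borel_measurable (lebesgue_on \<Omega>).
     \<exists>C. AE x in lebesgue_on \<Omega>. \<bar>u x\<bar> \<le> C}"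

definition Orlicz_space :: "(real \<Rightarrow> real) \<Rightarrow> (real^'n) set \<Rightarrow> (real^'n \<Rightarrow> real) set" where
  "Orlicz_space \<Phi> \<Omega> = {u \<in> borel_measurable (lebesgue_on \<Omega>).
     \<exists>c>0. (\<integral>\<^sup>+x. ennreal (\<Phi> (u x / c)) \<partial>lebesgue_on \<Omega>) < \<infinity>}"

definition Luxemburg_norm :: "(real \<Rightarrow> real) \<Rightarrow> (real^'n) set \<Rightarrow> (real^'n \<Rightarrow> real) \<Rightarrow> real" where
  "Luxemburg_norm \<Phi> \<Omega> u =
     Inf {c. c > 0 \<and> (\<integral>\<^sup>+x. ennreal (\<Phi> (u x / c)) \<partial>lebesgue_on \<Omega>) \<le> 1}"

section \<open>Weak derivatives and Orlicz--Sobolev spaces\<close>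

definition loc_integrable :: "(real^'n) set \<Rightarrow> (real^'n \<Rightarrow> real) \<Rightarrow> bool" where
  "loc_integrable \<Omega> u = (\<forall>K. compact K \<and> K \<subseteq> \<Omega> \<longrightarrow> integrable (lebesgue_on K) u)"

definition has_weak_partial ::
    "(real^'n) set \<Rightarrow> 'n \<Rightarrow> (real^'n \<Rightarrow> real) \<Rightarrow> (real^'n \<Rightarrow> real) \<Rightarrow> bool" where
  "has_weak_partial \<Omega> i u g = (loc_integrable \<Omega> u \<and> loc_integrable \<Omega> g \<and>
     (\<forall>\<eta>\<in>test_functions \<Omega>.
        (LINT x|lebesgue_on \<Omega>. u x * partial_deriv i \<eta> x) = - (LINT x|lebesgue_on \<Omega>. g x * \<eta> x)))"

text \<open>Weak derivatives are unique almost everywhere, so the choice is immaterial.\<close>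
definition weak_partial :: "(real^'n) set \<Rightarrow> 'n \<Rightarrow> (real^'n \<Rightarrow> real) \<Rightarrow> real^'n \<Rightarrow> real" where
  "weak_partial \<Omega> i u = (SOME g. has_weak_partial \<Omega> i u g)"

definition weak_grad :: "(real^'n) set \<Rightarrow> (real^'n \<Rightarrow> real) \<Rightarrow> real^'n \<Rightarrow> real^'n" where
  "weak_grad \<Omega> u x = (\<chi> i. weak_partial \<Omega> i u x)"

definition W1 :: "(real \<Rightarrow> real) \<Rightarrow> (real^'n) set \<Rightarrow> (real^'n \<Rightarrow> real) set" where
  "W1 \<Phi> \<Omega> = {u \<in> Orlicz_space \<Phi> \<Omega>. \<forall>i. \<exists>g\<in>Orlicz_space \<Phi> \<Omega>. has_weak_partial \<Omega> i u g}"

definition W1_norm :: "(real \<Rightarrow> real) \<Rightarrow> (real^'n) set \<Rightarrow> (real^'n \<Rightarrow> real) \<Rightarrow> real" where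
  "W1_norm \<Phi> \<Omega> u = Luxemburg_norm \<Phi> \<Omega> u + (\<Sum>i\<in>UNIV. Luxemburg_norm \<Phi> \<Omega> (weak_partial \<Omega> i u))"

definition W10 :: "(real \<Rightarrow> real) \<Rightarrow> (real^'n) set \<Rightarrow> (real^'n \<Rightarrow> real) set" where
  "W10 \<Phi> \<Omega> = {u \<in> W1 \<Phi> \<Omega>.
     \<forall>\<epsilon>>0. \<exists>\<eta>\<in>test_functions \<Omega>. W1_norm \<Phi> \<Omega> (\<lambda>x. u x - \<eta> x) < \<epsilon>}"

section \<open>The boundary value problem\<close>

text \<open>
  The value of \<open>\<phi>\<close> at \<open>0\<close> is irrelevant in both definitions below: the interval integral
  ignores endpoints, and \<open>\<phi> 0 *\<^sub>R 0 = 0\<close>.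
\<close>

definition Phi :: "(real \<Rightarrow> real) \<Rightarrow> real \<Rightarrow> real" where
  "Phi \<phi> t = (LBINT s=0..ereal t. s * \<phi> s)"

text \<open>
  Integrability is required explicitly, because the Bochner integral of a non-integrable function
  is \<open>0\<close> by convention.
\<close>
definition weak_solution ::
    "(real \<Rightarrow> real) \<Rightarrow> (real^'n) set \<Rightarrow> (real^'n \<Rightarrow> real) \<Rightarrow> (real^'n \<Rightarrow> real) \<Rightarrow> bool" where
  "weak_solution \<phi> \<Omega> f u = (u \<in> W10 (Phi \<phi>) \<Omega> \<and>
     (\<forall>v\<in>W10 (Phi \<phi>) \<Omega>.
        integrable (lebesgue_on \<Omega>)
          (\<lambda>x. (\<phi> (norm (weak_grad \<Omega> u x)) *\<^sub>R weak_grad \<Omega> u x) \<bullet> weak_grad \<Omega> v x) \<and>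
        integrable (lebesgue_on \<Omega>) (\<lambda>x. f x * v x) \<and>
        (LINT x|lebesgue_on \<Omega>.
           (\<phi> (norm (weak_grad \<Omega> u x)) *\<^sub>R weak_grad \<Omega> u x) \<bullet> weak_grad \<Omega> v x)
          = (LINT x|lebesgue_on \<Omega>. f x * v x)))"

end

theory Submission
  imports Defs
begin

text \<open>
The solution is the minimiser of the energy \<open>\<integral> \<Phi>(|\<nabla>u|) - \<integral> f u\<close>. By Sobolev's inequality
  \<open>W\<^sub>0\<^sup>1\<^sup>,\<^sup>1 \<subseteq> L\<^bsup>N/(N-1)\<^esup>\<close> the load is controlled by \<open>\<integral> |\<nabla>u|\<close>, and since \<open>\<Phi>\<close> is superlinear the energy is
  coercive. For \<open>l = 1\<close> the space is not reflexive, so no weak compactness is used: strict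
  convexity and superlinearity give a pointwise bound of \<open>|\<xi> - \<zeta>|\<close> by \<open>\<epsilon> (1 + \<Phi>(|\<xi>|) + \<Phi>(|\<zeta>|))\<close> plus a multiple
  of the midpoint convexity gap, which makes the gradients of a minimising sequence of test functions
  Cauchy in \<open>L\<^sup>1\<close>. By Fatou's lemma the limit \<open>u\<close> has at most the minimal energy, but it is only known to lie in
  \<open>W\<^sub>0\<^sup>1\<^sup>,\<^sup>1\<close> with \<open>\<nabla>u \<in> L\<^sub>\<Phi>\<close>. That it lies in the closure of the test functions is where the boundary
  enters: localise by a partition of unity, shift into the domain, and mollify; the
  \<open>\<Delta>\<^sub>2\<close> condition, i.e. the upper bound \<open>m - 1\<close>, turns modular convergence into norm convergence.

  For boundedness test with smooth approximations of \<open>(u - k)\<^sup>+\<close>. Superlinearity absorbs the load, so \<open>\<integral> |\<nabla>(u - k)\<^sup>+|\<close> is at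
  most a multiple of \<open>|{u > k}|\<close>, and Sobolev's inequality gives \<open>(h - k) |{u > h}| \<le> A |{u > k}|\<^bsup>1+1/N\<^esup>\<close>,
  which forces \<open>|{u > d}| = 0\<close> for some \<open>d\<close>.
\<close>

section \<open>Smooth functions\<close>

text \<open>The space \<open>W10\<close> fixes its elements only almost everywhere, measures them by
  an infimum and obtains gradients from a choice operator. The analysis is therefore done with a
  predicate \<open>W u \<xi>\<close> on pairs of Borel functions on the whole space that vanish off
  \<Omega>, where closeness to test functions is measured by the modular \<integral> \<Phi>; the
  passage to \<open>W10\<close> and back, up to null sets, happens once. Extension by zero also lets
  the boundary condition be expressed as a weak gradient identity whose test functions need not
  vanish on the boundary. The infimum of the energy is taken over test functions alone and extends
  to the closure because the modular is stable under small perturbations. Sobolev's inequality is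
  used in the form \<integral> |g u| \<le> (\<integral> |g|^N + 1) \<integral> |\<nabla>u|: with g
  the load, the indicator of \<Omega>, or a normalised indicator of a level set, it gives
  coercivity, Poincare's inequality and the decay of level sets. Truncations are smoothed because
  composites with test functions have to remain test functions.\<close>

lemma partial_deriv_eq:
  assumes "(h has_derivative h') (at x)"
  shows "partial_deriv i h x = h' (axis i 1)"
  using frechet_derivative_at[OF assms] by (simp add: partial_deriv_def)

lemma differentiable_imp_has_derivative_partials:
  fixes h :: "real^'n \<Rightarrow> real"
  assumes "h differentiable (at x)"
  shows "(h has_derivative (\<lambda>y. \<Sum>i\<in>UNIV. y $ i * partial_deriv i h x)) (at x)"
proof -
  have d: "(h has_derivative frechet_derivative h (at x)) (at x)"
    using assms by (simp add: frechet_derivative_works)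
  then have lin: "linear (frechet_derivative h (at x))"
    by (rule has_derivative_linear)
  have "frechet_derivative h (at x) = (\<lambda>y. \<Sum>i\<in>UNIV. y $ i * partial_deriv i h x)"
  proof
    fix y :: "real^'n"
    have "frechet_derivative h (at x) y = frechet_derivative h (at x) (\<Sum>i\<in>UNIV. y $ i *\<^sub>R axis i 1)"
      by (simp add: basis_expansion flip: scalar_mult_eq_scaleR)
    also have "\<dots> = (\<Sum>i\<in>UNIV. y $ i * partial_deriv i h x)"
      by (simp add: linear_sum[OF lin] linear_scale[OF lin] partial_deriv_def)
    finally show "frechet_derivative h (at x) y = (\<Sum>i\<in>UNIV. y $ i * partial_deriv i h x)" .
  qed
  then show ?thesis using d by simp
qed

lemma Ck_Suc_imp_Ck: "Ck (Suc k) h \<Longrightarrow> Ck k h"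
proof (induction k arbitrary: h)
  case 0
  then show ?case
    by (auto intro!: differentiable_imp_continuous_on simp: differentiable_on_def)
qed auto

lemma smooth_imp_Ck: "smooth h \<Longrightarrow> Ck k h"
  by (simp add: smooth_def)

lemma smooth_continuous: "smooth h \<Longrightarrow> continuous_on UNIV h"
  using smooth_imp_Ck[of h 0] by simp

lemma smooth_differentiable: "smooth h \<Longrightarrow> h differentiable (at x)"
  using smooth_imp_Ck[of h 1] by simp

lemma smooth_partial_deriv: "smooth h \<Longrightarrow> smooth (partial_deriv i h)"
  unfolding smooth_def by (metis Ck.simps(2))

lemma Ck_const: "Ck k (\<lambda>x. c)"
proof (induction k arbitrary: c)
  case (Suc k)
  have "partial_deriv i (\<lambda>x. c) = (\<lambda>x. 0)" for i :: 'a
    by (rule ext) (simp add: partial_deriv_eq[OF has_derivative_const])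
  with Suc show ?case by simp
qed simp

lemma partial_deriv_add:
  assumes "f differentiable (at x)" "g differentiable (at x)"
  shows "partial_deriv i (\<lambda>x. f x + g x) x = partial_deriv i f x + partial_deriv i g x"
  using partial_deriv_eq[OF has_derivative_add[OF assms[unfolded frechet_derivative_works]]]
  by (simp add: partial_deriv_def)

lemma partial_deriv_mult:
  assumes "f differentiable (at x)" "g differentiable (at x)"
  shows "partial_deriv i (\<lambda>x. f x * g x) x = f x * partial_deriv i g x + partial_deriv i f x * g x"
  using partial_deriv_eq[OF has_derivative_mult[OF assms[unfolded frechet_derivative_works]]]
  by (simp add: partial_deriv_def)

lemma partial_deriv_compose:
  assumes "(F has_real_derivative d) (at (q x))" "q differentiable (at x)"
  shows "partial_deriv i (\<lambda>x. F (q x)) x = d * partial_deriv i q x"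
    "(\<lambda>x. F (q x)) differentiable (at x)"
proof -
  have q: "(q has_derivative frechet_derivative q (at x)) (at x)"
    using assms(2) by (simp add: frechet_derivative_works)
  have *: "((\<lambda>x. F (q x)) has_derivative (\<lambda>h. d * frechet_derivative q (at x) h)) (at x)"
    using has_derivative_compose[OF q assms(1)[unfolded has_field_derivative_def]] .
  show "partial_deriv i (\<lambda>x. F (q x)) x = d * partial_deriv i q x"
    using partial_deriv_eq[OF *, of i] by (simp add: partial_deriv_def)
  show "(\<lambda>x. F (q x)) differentiable (at x)" using * by (auto simp: differentiable_def)
qed

lemma Ck_add: "Ck k f \<Longrightarrow> Ck k g \<Longrightarrow> Ck k (\<lambda>x. f x + g x)"
proof (induction k arbitrary: f g)
  case 0 then show ?case by (auto intro: continuous_intros)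
next
  case (Suc k)
  have "partial_deriv i (\<lambda>x. f x + g x) = (\<lambda>x. partial_deriv i f x + partial_deriv i g x)" for i
    using Suc.prems by (intro ext partial_deriv_add) auto
  with Suc show ?case by auto
qed

lemma Ck_mult: "Ck k f \<Longrightarrow> Ck k g \<Longrightarrow> Ck k (\<lambda>x. f x * g x)"
proof (induction k arbitrary: f g)
  case 0 then show ?case by (auto intro: continuous_intros)
next
  case (Suc k)
  have "partial_deriv i (\<lambda>x. f x * g x) = (\<lambda>x. f x * partial_deriv i g x + partial_deriv i f x * g x)" for i
    using Suc.prems by (intro ext partial_deriv_mult) auto
  moreover have "Ck k f" "Ck k g" using Suc.prems Ck_Suc_imp_Ck by blast+
  ultimately show ?case using Suc by (auto intro!: Ck_add)
qed

text \<open>A partial derivative of 1/S is -(1/S)^2 times one of S, a product of functions that are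
  C^k by induction.\<close>

lemma Ck_inverse: "Ck k S \<Longrightarrow> (\<And>x. S x > 0) \<Longrightarrow> Ck k (\<lambda>x. inverse (S x))"
proof (induction k)
  case 0
  then have "\<forall>x. S x \<noteq> 0" by (metis less_irrefl)
  with 0 show ?case by (simp add: continuous_on_inverse)
next
  case (Suc k)
  have nz: "S x \<noteq> 0" for x using Suc.prems(2)[of x] by simp
  have c: "partial_deriv i (\<lambda>x. inverse (S x)) x = - (inverse (S x) ^ Suc (Suc 0)) * partial_deriv i S x"
    "(\<lambda>x. inverse (S x)) differentiable (at x)" for i x
    using partial_deriv_compose[where q = S, OF DERIV_inverse[OF nz]] Suc.prems(1) by auto
  have "partial_deriv i (\<lambda>x. inverse (S x)) = (\<lambda>x. (-1) * (inverse (S x) * (inverse (S x) * partial_deriv i S x)))" for i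
    by (rule ext) (simp add: c)
  moreover have "Ck k (\<lambda>x. inverse (S x))" using Suc Ck_Suc_imp_Ck by blast
  then have "Ck k (\<lambda>x. (-1) * (inverse (S x) * (inverse (S x) * partial_deriv i S x)))" for i
    using Suc.prems(1) by (intro Ck_mult Ck_const) auto
  ultimately show ?case using c(2) by simp
qed

lemma Ck_component: "Ck k (\<lambda>x. x $ i)"
proof (cases k)
  case 0 then show ?thesis by (auto intro!: continuous_intros)
next
  case (Suc j)
  have d: "((\<lambda>x::real^'a. x $ i) has_derivative (\<lambda>x. x $ i)) (at x)" for x
    by (rule bounded_linear_imp_has_derivative) (rule bounded_linear_vec_nth)
  have "partial_deriv l (\<lambda>x. x $ i) = (\<lambda>x. (axis l 1 :: real^'a) $ i)" for l
    by (rule ext) (rule partial_deriv_eq[OF d])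
  then show ?thesis using d Suc by (auto simp: Ck_const differentiable_def)
qed

lemma smooth_const: "smooth (\<lambda>x. c)"
  by (simp add: smooth_def Ck_const)
lemma smooth_add: "smooth f \<Longrightarrow> smooth g \<Longrightarrow> smooth (\<lambda>x. f x + g x)"
  by (simp add: smooth_def Ck_add)
lemma smooth_mult: "smooth f \<Longrightarrow> smooth g \<Longrightarrow> smooth (\<lambda>x. f x * g x)"
  by (simp add: smooth_def Ck_mult)
lemma smooth_inverse: "smooth f \<Longrightarrow> (\<And>x. f x > 0) \<Longrightarrow> smooth (\<lambda>x. inverse (f x))"
  by (simp add: smooth_def Ck_inverse)
lemma smooth_component: "smooth (\<lambda>x. x $ i)"
  by (simp add: smooth_def Ck_component)
lemma smooth_cmult: "smooth f \<Longrightarrow> smooth (\<lambda>x. c * f x)"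
  by (intro smooth_mult smooth_const)
lemma smooth_diff: "smooth f \<Longrightarrow> smooth g \<Longrightarrow> smooth (\<lambda>x. f x - g x)"
  using smooth_add[of f "\<lambda>x. -1 * g x"] smooth_cmult[of g "-1"] by simp
lemma smooth_sum: "(\<And>j. j \<in> A \<Longrightarrow> smooth (f j)) \<Longrightarrow> smooth (\<lambda>x. \<Sum>j\<in>A. f j x)"
  by (induction A rule: infinite_finite_induct) (auto intro: smooth_const smooth_add)

lemmas smooth_intros = smooth_const smooth_add smooth_mult smooth_component smooth_diff smooth_sum

lemma partial_deriv_reflect:
  assumes that: "h differentiable (at (c - x))"
  shows "partial_deriv i (\<lambda>x. h (c - x)) x = - partial_deriv i h (c - x)"
    and "(\<lambda>x. h (c - x)) differentiable (at x)"
proof -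
  let ?D = "frechet_derivative h (at (c - x))"
  have h: "(h has_derivative ?D) (at (c - x))"
    using that by (simp add: frechet_derivative_works)
  have "((\<lambda>x. c - x) has_derivative (\<lambda>x. - x)) (at x)" by (auto intro!: derivative_eq_intros)
  from has_derivative_compose[OF this h]
  have *: "((\<lambda>x. h (c - x)) has_derivative (\<lambda>x. ?D (- x))) (at x)" .
  show "partial_deriv i (\<lambda>x. h (c - x)) x = - partial_deriv i h (c - x)"
    using partial_deriv_eq[OF *, of i] has_derivative_linear[OF h] by (simp add: partial_deriv_def linear_neg)
  show "(\<lambda>x. h (c - x)) differentiable (at x)" using * by (auto simp: differentiable_def)
qed

lemma smooth_reflect: "smooth h \<Longrightarrow> smooth (\<lambda>x. h (c - x))"
proof -
  have "Ck k h \<Longrightarrow> Ck k (\<lambda>x. h (c - x))" for k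
  proof (induction k arbitrary: h)
    case 0
    then show ?case by (auto intro!: continuous_on_compose2[of UNIV h] continuous_intros)
  next
    case (Suc k)
    have "partial_deriv i (\<lambda>x. h (c - x)) = (\<lambda>x. (-1) * partial_deriv i h (c - x))" for i
      using Suc.prems by (intro ext) (simp add: partial_deriv_reflect)
    moreover have "Ck k (\<lambda>x. (-1) * partial_deriv i h (c - x))" for i
      by (intro Ck_mult Ck_const Suc.IH) (use Suc.prems in auto)
    ultimately show ?case using Suc.prems by (auto intro: partial_deriv_reflect)
  qed
  then show "smooth h \<Longrightarrow> smooth (\<lambda>x. h (c - x))" by (simp add: smooth_def)
qed

section \<open>Exponentially flat functions and bumps\<close>

text \<open>The polynomial factor makes the family closed under differentiation; the classical
  exp(-1/t) is the member with p = 1.\<close>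

definition flat :: "real poly \<Rightarrow> real \<Rightarrow> real" where
  "flat p t = (if t > 0 then poly p (1 / t) * exp (- (1 / t)) else 0)"

lemma poly_exp_tendsto_0: "((\<lambda>y::real. poly p y * exp (- y)) \<longlongrightarrow> 0) at_top"
proof (induction p)
  case 0 then show ?case by simp
next
  case (pCons a p)
  have *: "((\<lambda>y::real. y ^ n * exp (- y)) \<longlongrightarrow> 0) at_top" for n
    using tendsto_power_div_exp_0[of n] by (simp add: exp_minus field_simps)
  have "((\<lambda>y::real. y * poly p y * exp (- y)) \<longlongrightarrow> 0) at_top" for p :: "real poly"
  proof -
    have "((\<lambda>y::real. \<Sum>i\<le>degree p. coeff p i * (y ^ Suc i * exp (- y))) \<longlongrightarrow> 0) at_top"
      by (rule tendsto_null_sum, rule tendsto_mult_right_zero, rule *)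
    then show ?thesis by (simp add: poly_altdef sum_distrib_left sum_distrib_right mult_ac)
  qed
  from tendsto_add[OF tendsto_mult_right_zero[OF *[of 0], of a] this[of p]]
  show ?case by (simp add: algebra_simps)
qed

lemma flat_tendsto_0: "((\<lambda>t. flat p t) \<longlongrightarrow> 0) (at_right 0)"
proof -
  have "((\<lambda>t. poly p (inverse t) * exp (- (inverse t))) \<longlongrightarrow> 0) (at_right (0::real))"
    by (rule filterlim_compose[OF poly_exp_tendsto_0 filterlim_inverse_at_top_right])
  moreover have "\<forall>\<^sub>F t in at_right 0. poly p (inverse t) * exp (- (inverse t)) = flat p t"
    using eventually_at_right_less[of "0::real"] by eventually_elim (simp add: flat_def inverse_eq_divide)
  ultimately show ?thesis by (rule Lim_transform_eventually)
qed

text \<open>With s = 1/t the derivative of p(s) exp(-s) is s^2 (p - p')(s) exp(-s), again a member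
  of the family. At 0 the difference quotient \<open>flat p s / s\<close> is
  \<open>flat (p * [:0,1:]) s\<close>, which tends to 0.\<close>

lemma flat_has_real_derivative:
  "(flat p has_real_derivative flat ((p - pderiv p) * [:0, 0, 1:]) t) (at t)"
proof -
  consider "t > 0" | "t < 0" | "t = 0" by linarith
  then show ?thesis
  proof cases
    case 1
    have "((\<lambda>t. poly p (1 / t) * exp (- (1 / t))) has_real_derivative flat ((p - pderiv p) * [:0, 0, 1:]) t) (at t)"
      using 1 by (auto intro!: derivative_eq_intros DERIV_chain2[OF poly_DERIV]
          simp: flat_def field_simps power2_eq_square)
    moreover have "\<forall>\<^sub>F s in nhds t. s > 0"
      using 1 order_tendstoD(1) filterlim_ident by blast
    then have "\<forall>\<^sub>F s in nhds t. flat p s = poly p (1 / s) * exp (- (1 / s))"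
      by eventually_elim (simp add: flat_def)
    ultimately show ?thesis by (subst DERIV_cong_ev[OF refl _ refl])
  next
    case 2
    have "\<forall>\<^sub>F s in nhds t. s < 0"
      using 2 order_tendstoD(2) filterlim_ident by blast
    then have "\<forall>\<^sub>F s in nhds t. flat p s = 0"
      by eventually_elim (simp add: flat_def)
    moreover have "flat ((p - pderiv p) * [:0, 0, 1:]) t = 0" using 2 by (simp add: flat_def)
    ultimately show ?thesis using DERIV_cong_ev[OF refl _ refl, of "flat p" "\<lambda>_. 0" t 0] by simp
  next
    case 3
    have "((\<lambda>s. flat p s / s) \<longlongrightarrow> 0) (at_right 0)"
    proof (rule Lim_transform_eventually[OF flat_tendsto_0[of "p * [:0,1:]"]])
      show "\<forall>\<^sub>F s in at_right 0. flat (p * [:0,1:]) s = flat p s / s"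
        using eventually_at_right_less[of "0::real"] by eventually_elim (simp add: flat_def)
    qed
    moreover have "((\<lambda>s. flat p s / s) \<longlongrightarrow> 0) (at_left 0)"
    proof (rule Lim_transform_eventually[OF tendsto_const])
      show "\<forall>\<^sub>F s in at_left 0. 0 = flat p s / s"
        using eventually_at_left_real[of "-1" 0] by (auto elim!: eventually_mono simp: flat_def)
    qed
    ultimately have "((\<lambda>s. flat p s / s) \<longlongrightarrow> 0) (at 0)"
      by (simp add: filterlim_at_split)
    then show ?thesis using 3 by (simp add: has_field_derivative_iff flat_def)
  qed
qed

lemma smooth_flat:
  assumes "smooth q" shows "smooth (\<lambda>x. flat p (q x))"
proof -
  have "Ck k (\<lambda>x. flat p (q x))" for k
  proof (induction k arbitrary: p)
    case 0
    have "continuous_on UNIV (flat p)"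
      using flat_has_real_derivative DERIV_continuous_on by blast
    then show ?case using smooth_continuous[OF assms]
      by (auto intro: continuous_on_compose2)
  next
    case (Suc k)
    note c = partial_deriv_compose[OF flat_has_real_derivative smooth_differentiable[OF assms]]
    have "partial_deriv i (\<lambda>x. flat p (q x)) = (\<lambda>x. flat ((p - pderiv p) * [:0, 0, 1:]) (q x) * partial_deriv i q x)" for i
      by (rule ext) (rule c)
    moreover have "Ck k (partial_deriv i q)" for i
      using smooth_partial_deriv[OF assms] smooth_imp_Ck by blast
    ultimately show ?case using Suc c(2) by (auto intro!: Ck_mult)
  qed
  then show ?thesis by (simp add: smooth_def)
qed

definition bump :: "real^'n \<Rightarrow> real \<Rightarrow> real^'n \<Rightarrow> real" where
  "bump c r x = flat 1 (r\<^sup>2 - (norm (x - c))\<^sup>2)"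

lemma smooth_norm_diff_sq: "smooth (\<lambda>x. (norm (x - c))\<^sup>2)"
proof -
  have "(\<lambda>x. (norm (x - c))\<^sup>2) = (\<lambda>x. \<Sum>i\<in>UNIV. (x $ i - c $ i) * (x $ i - c $ i))"
    by (simp add: norm_vec_def L2_set_def sum_nonneg power2_eq_square)
  then show ?thesis by (auto intro!: smooth_intros)
qed

lemma smooth_bump: "smooth (bump c r)"
  unfolding bump_def[abs_def] by (intro smooth_flat smooth_intros smooth_norm_diff_sq)

lemma bump_nonneg: "bump c r x \<ge> 0"
  by (simp add: bump_def flat_def)

lemma bump_pos_iff: "r > 0 \<Longrightarrow> bump c r x > 0 \<longleftrightarrow> x \<in> ball c r"
  using power2_less_imp_less[of "norm (x - c)" r] power_strict_mono[of "norm (x - c)" r 2]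
  by (auto simp: bump_def flat_def dist_norm norm_minus_commute)

lemma bump_nonzero_iff: "r > 0 \<Longrightarrow> bump c r x \<noteq> 0 \<longleftrightarrow> x \<in> ball c r"
  using bump_pos_iff[of r c x] bump_nonneg[of c r x] by auto

section \<open>Integration by parts\<close>

lemma lborel_distr_translate: "distr lborel borel (\<lambda>x. x + c) = (lborel :: 'a::euclidean_space measure)"
  using lborel_distr_plus[of c] by (simp add: add.commute[of _ c])

lemma lborel_distr_reflect: "distr lborel borel (\<lambda>x. c - x) = (lborel :: 'a::euclidean_space measure)"
  by (subst (2) lborel_affine[of "-1" c]) (auto simp: density_1)

lemma
  fixes f :: "'a::euclidean_space \<Rightarrow> 'b::{banach, second_countable_topology}"
  assumes [measurable]: "f \<in> borel_measurable borel"
  shows lborel_integral_translate: "(\<integral>x. f (x + c) \<partial>lborel) = (\<integral>x. f x \<partial>lborel)"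
    and lborel_integrable_translate: "integrable lborel (\<lambda>x. f (x + c)) \<longleftrightarrow> integrable lborel f"
    and lborel_integral_reflect: "(\<integral>x. f (c - x) \<partial>lborel) = (\<integral>x. f x \<partial>lborel)"
    and lborel_integrable_reflect: "integrable lborel (\<lambda>x. f (c - x)) \<longleftrightarrow> integrable lborel f"
proof -
  show "(\<integral>x. f (x + c) \<partial>lborel) = (\<integral>x. f x \<partial>lborel)"
    by (subst (2) lborel_distr_translate[of c, symmetric]) (simp add: integral_distr)
  show "integrable lborel (\<lambda>x. f (x + c)) \<longleftrightarrow> integrable lborel f"
    by (subst (2) lborel_distr_translate[of c, symmetric]) (simp add: integrable_distr_eq)
  show "(\<integral>x. f (c - x) \<partial>lborel) = (\<integral>x. f x \<partial>lborel)"
    by (subst (2) lborel_distr_reflect[of c, symmetric]) (simp add: integral_distr)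
  show "integrable lborel (\<lambda>x. f (c - x)) \<longleftrightarrow> integrable lborel f"
    by (subst (2) lborel_distr_reflect[of c, symmetric]) (simp add: integrable_distr_eq)
qed

lemma
  fixes f :: "'a::euclidean_space \<Rightarrow> ennreal"
  assumes [measurable]: "f \<in> borel_measurable borel"
  shows lborel_nn_integral_translate: "(\<integral>\<^sup>+x. f (x + c) \<partial>lborel) = (\<integral>\<^sup>+x. f x \<partial>lborel)"
    and lborel_nn_integral_reflect: "(\<integral>\<^sup>+x. f (c - x) \<partial>lborel) = (\<integral>\<^sup>+x. f x \<partial>lborel)"
proof -
  show "(\<integral>\<^sup>+x. f (x + c) \<partial>lborel) = (\<integral>\<^sup>+x. f x \<partial>lborel)"
    by (subst (2) lborel_distr_translate[of c, symmetric]) (simp add: nn_integral_distr)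
  show "(\<integral>\<^sup>+x. f (c - x) \<partial>lborel) = (\<integral>\<^sup>+x. f x \<partial>lborel)"
    by (subst (2) lborel_distr_reflect[of c, symmetric]) (simp add: nn_integral_distr)
qed

lemma continuous_borel: "continuous_on UNIV f \<Longrightarrow> f \<in> borel_measurable borel"
  by (rule borel_measurable_continuous_onI)

lemma integrable_bounded_support:
  fixes f :: "'a::euclidean_space \<Rightarrow> 'b::{banach, second_countable_topology}"
  assumes "continuous_on UNIV f" "bounded {x. f x \<noteq> 0}"
  shows "integrable lborel f"
proof -
  have "integrable lborel (\<lambda>x. indicator (closure {x. f x \<noteq> 0}) x *\<^sub>R f x)"
    using assms by (intro borel_integrable_compact continuous_on_subset[OF assms(1)]) auto
  moreover have "(\<lambda>x. indicator (closure {x. f x \<noteq> 0}) x *\<^sub>R f x) = f"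
    using closure_subset[of "{x. f x \<noteq> 0}"] by (fastforce simp: indicator_def)
  ultimately show ?thesis by simp
qed

lemma bounded_range_bounded_support:
  fixes f :: "'a::euclidean_space \<Rightarrow> real"
  assumes "continuous_on UNIV f" "bounded {x. f x \<noteq> 0}"
  obtains B where "B > 0" "\<And>x. \<bar>f x\<bar> \<le> B"
proof -
  have "compact (f ` closure {x. f x \<noteq> 0})"
    using assms by (intro compact_continuous_image continuous_on_subset[OF assms(1)]) auto
  then obtain B where B: "B > 0" "\<And>y. y \<in> f ` closure {x. f x \<noteq> 0} \<Longrightarrow> norm y \<le> B"
    using compact_imp_bounded bounded_pos by metis
  show ?thesis
  proof
    show "B > 0" by fact
    fix x show "\<bar>f x\<bar> \<le> B"
      using B(2)[of "f x"] B(1) closure_subset[of "{x. f x \<noteq> 0}"] by (cases "f x = 0") auto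
  qed
qed

section \<open>Integrals of partial derivatives\<close>

lemma partial_deriv_zero_outside:
  assumes "x \<notin> closure {x. h x \<noteq> 0}"
  shows "partial_deriv i h x = 0"
proof -
  have op: "open (- closure {x. h x \<noteq> 0})" by (intro open_Compl closed_closure)
  have z: "h y = 0" if "y \<in> - closure {x. h x \<noteq> 0}" for y
    using that closure_subset[of "{x. h x \<noteq> 0}"] by (metis (mono_tags) ComplD mem_Collect_eq subsetD)
  have "(h has_derivative (\<lambda>x. 0)) (at x)"
  proof (rule has_derivative_transform_within_open[OF has_derivative_const op])
    show "x \<in> - closure {x. h x \<noteq> 0}" using assms by simp
    show "0 = h y" if "y \<in> - closure {x. h x \<noteq> 0}" for y using z[OF that] by (rule sym)
  qed
  from partial_deriv_eq[OF this] show ?thesis .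
qed

lemma partial_deriv_support: "{x. partial_deriv i h x \<noteq> 0} \<subseteq> closure {x. h x \<noteq> 0}"
  using partial_deriv_zero_outside by blast

lemma bounded_partial_deriv_support:
  "bounded {x. h x \<noteq> 0} \<Longrightarrow> bounded {x. partial_deriv i h x \<noteq> 0}"
  using bounded_closure bounded_subset partial_deriv_support by metis

lemma line_derivative:
  assumes "h differentiable (at (x + t *\<^sub>R axis i 1))"
  shows "((\<lambda>t. h (x + t *\<^sub>R axis i 1)) has_real_derivative partial_deriv i h (x + t *\<^sub>R axis i 1)) (at t)"
proof -
  let ?D = "frechet_derivative h (at (x + t *\<^sub>R axis i 1))"
  have h: "(h has_derivative ?D) (at (x + t *\<^sub>R axis i 1))"
    using assms by (simp add: frechet_derivative_works)
  have "((\<lambda>t. x + t *\<^sub>R axis i 1) has_derivative (\<lambda>s. s *\<^sub>R axis i 1)) (at t)"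
    by (auto intro!: derivative_eq_intros)
  from has_derivative_compose[OF this h]
  have "((\<lambda>t. h (x + t *\<^sub>R axis i 1)) has_derivative (\<lambda>s. ?D (s *\<^sub>R axis i 1))) (at t)" .
  moreover have "(\<lambda>s. ?D (s *\<^sub>R axis i 1)) = (*) (partial_deriv i h (x + t *\<^sub>R axis i 1))"
    using has_derivative_linear[OF h] by (auto simp: partial_deriv_def linear_scale)
  ultimately show ?thesis by (simp add: has_field_derivative_def)
qed

text \<open>Difference quotients in direction i have integral 0 by translation invariance. The mean
  value theorem bounds them by a bound of the derivative, and for steps at most 1 they live in one
  fixed ball, so dominated convergence applies.\<close>

lemma integral_partial_deriv_zero:
  fixes h :: "real^'n \<Rightarrow> real"
  assumes diff: "\<And>x. h differentiable (at x)" and cont: "continuous_on UNIV (partial_deriv i h)"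
    and supp: "bounded {x. h x \<noteq> 0}"
  shows "(\<integral>x. partial_deriv i h x \<partial>lborel) = 0"
proof -
  let ?D = "partial_deriv i h"
  have hc: "continuous_on UNIV h"
    using diff by (intro differentiable_imp_continuous_on) (simp add: differentiable_on_def)
  have h_int: "integrable lborel h" by (rule integrable_bounded_support[OF hc supp])
  note [measurable] = continuous_borel[OF hc] continuous_borel[OF cont]
  obtain B where B: "B > 0" "\<And>x. \<bar>?D x\<bar> \<le> B"
    using bounded_range_bounded_support[OF cont bounded_partial_deriv_support[OF supp]] by blast
  define s where "s n = 1 / real (Suc n)" for n
  have s: "0 < s n" "s n \<le> 1" for n by (auto simp: s_def)
  have s0: "s \<longlonglongrightarrow> 0" unfolding s_def by (rule LIMSEQ_Suc[OF lim_1_over_n])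
  define q where "q n x = (h (x + s n *\<^sub>R axis i 1) - h x) / s n" for n x
  obtain R where R: "\<And>x. h x \<noteq> 0 \<Longrightarrow> norm x \<le> R"
    using supp unfolding bounded_iff by blast
  have q0: "(\<integral>x. q n x \<partial>lborel) = 0" for n
    unfolding q_def using h_int
    by (simp add: Bochner_Integration.integral_diff lborel_integrable_translate lborel_integral_translate)
  have qD: "(\<lambda>n. q n x) \<longlonglongrightarrow> ?D x" for x
  proof -
    have "((\<lambda>t. h (x + t *\<^sub>R axis i 1)) has_real_derivative ?D x) (at 0)"
      using line_derivative[of h x 0 i] diff by simp
    then have "((\<lambda>t. (h (x + t *\<^sub>R axis i 1) - h x) / t) \<longlongrightarrow> ?D x) (at 0)"
      by (simp add: has_field_derivative_iff)
    moreover have "filterlim s (at 0) sequentially"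
      using s0 s(1) by (auto simp: filterlim_at less_imp_neq[THEN not_sym])
    ultimately show ?thesis unfolding q_def by (rule filterlim_compose)
  qed
  have qB: "norm (q n x) \<le> B * indicator (cball 0 (R + 1)) x" for n x
  proof (cases "x \<in> cball 0 (R + 1)")
    case True
    obtain z where z: "h (x + s n *\<^sub>R axis i 1) - h (x + 0 *\<^sub>R axis i 1) = (s n - 0) * ?D (x + z *\<^sub>R axis i 1)"
      using MVT2[of 0 "s n" "\<lambda>t. h (x + t *\<^sub>R axis i 1)" "\<lambda>t. ?D (x + t *\<^sub>R axis i 1)"]
        line_derivative[OF diff] s(1) by blast
    then have "q n x = ?D (x + z *\<^sub>R axis i 1)" using s(1)[of n] by (simp add: q_def)
    with B True show ?thesis by simp
  next
    case False
    have "norm x \<le> norm (x + s n *\<^sub>R axis i 1) + norm (s n *\<^sub>R axis i (1::real) :: real^'n)"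
      using norm_triangle_ineq4[of "x + s n *\<^sub>R axis i 1" "s n *\<^sub>R axis i 1"] by simp
    then have "norm x \<le> norm (x + s n *\<^sub>R axis i 1) + 1"
      using s[of n] by simp
    with False R[of x] R[of "x + s n *\<^sub>R axis i 1"] have "h x = 0" "h (x + s n *\<^sub>R axis i 1) = 0"
      by fastforce+
    with False show ?thesis by (simp add: q_def)
  qed
  have "(\<lambda>n. \<integral>x. q n x \<partial>lborel) \<longlonglongrightarrow> (\<integral>x. ?D x \<partial>lborel)"
  proof (rule integral_dominated_convergence)
    show "q n \<in> borel_measurable lborel" for n unfolding q_def by measurable
    show "integrable lborel (\<lambda>x. B * indicator (cball (0::real^'n) (R + 1)) x)"
      by (intro integrable_mult_right integrable_real_indicator) (use emeasure_bounded_finite[of "cball (0::real^'n) (R + 1)"] in \<open>auto simp: less_top\<close>)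
  qed (use qD qB in auto)
  then show ?thesis using q0 by (simp add: LIMSEQ_const_iff)
qed

lemma integral_by_parts:
  fixes g h :: "real^'n \<Rightarrow> real"
  assumes diff: "\<And>x. g differentiable (at x)" "\<And>x. h differentiable (at x)"
    and cont: "continuous_on UNIV (partial_deriv i g)" "continuous_on UNIV (partial_deriv i h)"
    and supp: "bounded {x. h x \<noteq> 0}"
  shows "(\<integral>x. g x * partial_deriv i h x \<partial>lborel) = - (\<integral>x. partial_deriv i g x * h x \<partial>lborel)"
proof -
  have gc: "continuous_on UNIV g" and hc: "continuous_on UNIV h"
    using diff by (auto intro!: differentiable_imp_continuous_on simp: differentiable_on_def)
  have eq: "partial_deriv i (\<lambda>x. g x * h x) = (\<lambda>x. g x * partial_deriv i h x + partial_deriv i g x * h x)"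
    using diff by (intro ext partial_deriv_mult) auto
  have "(\<integral>x. partial_deriv i (\<lambda>x. g x * h x) x \<partial>lborel) = 0"
  proof (rule integral_partial_deriv_zero)
    show "continuous_on UNIV (partial_deriv i (\<lambda>x. g x * h x))"
      unfolding eq using gc hc cont by (intro continuous_intros)
    show "bounded {x. g x * h x \<noteq> 0}" using supp by (rule bounded_subset) auto
  qed (use diff in auto)
  moreover have "integrable lborel (\<lambda>x. g x * partial_deriv i h x)"
    using bounded_partial_deriv_support[OF supp, of i] gc cont
    by (intro integrable_bounded_support continuous_intros) (auto elim: bounded_subset)
  moreover have "integrable lborel (\<lambda>x. partial_deriv i g x * h x)"
    using supp hc cont
    by (intro integrable_bounded_support continuous_intros) (auto elim: bounded_subset)
  ultimately show ?thesis unfolding eq by simp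
qed

section \<open>The Gagliardo--Nirenberg--Sobolev inequality\<close>

text \<open>Line integrals may be infinite, hence a power function on \<open>ennreal\<close>.
  Sending 0 to 0 and \<infinity> to \<infinity> keeps it multiplicative, with 0 times \<infinity>
  equal to 0.\<close>

definition pw :: "real \<Rightarrow> ennreal \<Rightarrow> ennreal" where
  "pw p x = (if x = \<infinity> then \<infinity> else ennreal (enn2real x powr p))"

lemma pw_ennreal: "0 \<le> x \<Longrightarrow> pw p (ennreal x) = ennreal (x powr p)"
  by (simp add: pw_def)

lemma pw_0 [simp]: "pw p 0 = 0"
  by (simp add: pw_def)

lemma pw_top [simp]: "pw p top = top"
  by (simp add: pw_def)

lemma pw_eq_0_iff: "pw p x = 0 \<longleftrightarrow> x = 0"
  by (cases x) (auto simp: pw_def)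

lemma measurable_pw [measurable]: "pw p \<in> borel_measurable borel"
  unfolding pw_def by measurable

lemma pw_mult: "pw p (x * y) = pw p x * pw p y"
proof (cases "x = top \<or> y = top")
  case True
  then show ?thesis
    by (cases "x = 0 \<or> y = 0") (auto simp: ennreal_mult_top ennreal_top_mult pw_eq_0_iff)
next
  case False
  then obtain a b where "x = ennreal a" "0 \<le> a" "y = ennreal b" "0 \<le> b"
    by (metis ennreal_cases)
  then show ?thesis by (simp add: pw_ennreal powr_mult flip: ennreal_mult)
qed

lemma pw_mono: "0 \<le> p \<Longrightarrow> x \<le> y \<Longrightarrow> pw p x \<le> pw p y"
  by (cases y; cases x) (auto simp: pw_ennreal ennreal_leI powr_mono2 top_unique)

lemma pw_prod: "pw p (\<Prod>i\<in>I. f i) = (\<Prod>i\<in>I. pw p (f i))"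
proof (induction I rule: infinite_finite_induct)
  case (insert x F)
  then show ?case by (simp add: pw_mult)
qed (use pw_ennreal[of 1 p] in auto)

lemma prod_pw_le_mean:
  fixes a :: "'i \<Rightarrow> ennreal"
  assumes I: "finite I" "I \<noteq> {}"
  shows "(\<Prod>i\<in>I. pw (1 / card I) (a i)) \<le> (\<Sum>i\<in>I. a i) / of_nat (card I)"
proof (cases "\<exists>i\<in>I. a i = top")
  case True
  then obtain i where "i \<in> I" "a i = top" by blast
  then have "(\<Sum>i\<in>I. a i) = top" using member_le_sum[of i I a] I by (simp add: top_unique)
  then show ?thesis by (simp add: ennreal_top_divide)
next
  case False
  define b where "b i = enn2real (a i)" for i
  have b: "a i = ennreal (b i)" "0 \<le> b i" if "i \<in> I" for i
    using False that by (auto simp: b_def less_top)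
  have k: "real (card I) > 0" using I by (simp add: card_gt_0_iff)
  have "(\<Prod>i\<in>I. pw (1 / card I) (a i)) = ennreal ((\<Prod>i\<in>I. b i) powr (1 / card I))"
  proof -
    have "(\<Prod>i\<in>I. a i) = ennreal (\<Prod>i\<in>I. b i)"
      using b by (simp add: prod_ennreal cong: prod.cong)
    then show ?thesis using b by (simp only: pw_ennreal prod_nonneg flip: pw_prod)
  qed
  also have "\<dots> \<le> ennreal (\<Sum>i\<in>I. b i / card I)"
    by (intro ennreal_leI arith_geom_mean I b)
  also have "(\<Sum>i\<in>I. b i / card I) = (\<Sum>i\<in>I. b i) / card I"
    by (simp add: sum_divide_distrib)
  also have "ennreal \<dots> = ennreal (\<Sum>i\<in>I. b i) / of_nat (card I)"
    using k b by (subst divide_ennreal[symmetric]) (auto simp: sum_nonneg ennreal_of_nat_eq_real_of_nat)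
  also have "ennreal (\<Sum>i\<in>I. b i) = (\<Sum>i\<in>I. a i)"
    using b by (simp cong: sum.cong)
  finally show ?thesis .
qed

text \<open>Apply the inequality of geometric and arithmetic means pointwise to \<open>F i x\<close>
  divided by \<open>a i\<close>, the integral of \<open>F i\<close>; after integration each quotient
  contributes 1. If some \<open>a i\<close> is 0, the product vanishes almost everywhere; otherwise
  an infinite \<open>a i\<close> makes the right-hand side infinite.\<close>

lemma Hoelder_prod:
  fixes F :: "'i \<Rightarrow> 'a \<Rightarrow> ennreal"
  assumes I: "finite I" "I \<noteq> {}" and [measurable]: "\<And>i. i \<in> I \<Longrightarrow> F i \<in> borel_measurable M"
  shows "(\<integral>\<^sup>+x. (\<Prod>i\<in>I. pw (1 / card I) (F i x)) \<partial>M) \<le> (\<Prod>i\<in>I. pw (1 / card I) (\<integral>\<^sup>+x. F i x \<partial>M))"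
proof -
  let ?p = "1 / real (card I)"
  define a where "a i = (\<integral>\<^sup>+x. F i x \<partial>M)" for i
  consider "\<exists>i\<in>I. a i = 0" | "\<forall>i\<in>I. a i \<noteq> 0" "\<exists>i\<in>I. a i = top" | "\<forall>i\<in>I. a i \<noteq> 0 \<and> a i \<noteq> top" by blast
  then show ?thesis
  proof cases
    case 1
    then obtain i where i: "i \<in> I" "a i = 0" by blast
    then have "AE x in M. F i x = 0" by (simp add: a_def nn_integral_0_iff_AE)
    then have "AE x in M. (\<Prod>i\<in>I. pw ?p (F i x)) = 0"
      by eventually_elim (use i I in \<open>auto simp: pw_eq_0_iff\<close>)
    then have "(\<integral>\<^sup>+x. (\<Prod>i\<in>I. pw ?p (F i x)) \<partial>M) = (\<integral>\<^sup>+x. 0 \<partial>M)"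
      by (rule nn_integral_cong_AE)
    then show ?thesis by simp
  next
    case 2
    then obtain i where i: "i \<in> I" "a i = top" by blast
    have "(\<Prod>j\<in>I. pw ?p (a j)) = pw ?p (a i) * (\<Prod>j\<in>I - {i}. pw ?p (a j))"
      using I i by (intro prod.remove)
    also have "(\<Prod>j\<in>I - {i}. pw ?p (a j)) \<noteq> 0"
      using 2 I by (simp add: pw_eq_0_iff)
    then have "pw ?p (a i) * (\<Prod>j\<in>I - {i}. pw ?p (a j)) = top"
      using i by (simp add: ennreal_top_mult)
    finally show ?thesis by (simp add: a_def)
  next
    case 3
    have inv: "a i * inverse (a i) = 1" if "i \<in> I" for i
      using 3 that ennreal_divide_self[of "a i"] by (simp add: divide_ennreal_def less_top)
    have "(\<Prod>i\<in>I. pw ?p (F i x)) \<le> (\<Prod>i\<in>I. pw ?p (a i)) * ((\<Sum>i\<in>I. F i x * inverse (a i)) / of_nat (card I))" for x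
    proof -
      have "(\<Prod>i\<in>I. pw ?p (F i x)) = (\<Prod>i\<in>I. pw ?p (a i * (F i x * inverse (a i))))"
        by (intro prod.cong refl) (metis inv mult.commute mult.left_commute mult.right_neutral)
      also have "\<dots> = (\<Prod>i\<in>I. pw ?p (a i)) * (\<Prod>i\<in>I. pw ?p (F i x * inverse (a i)))"
        by (simp only: pw_mult prod.distrib)
      also have "\<dots> \<le> (\<Prod>i\<in>I. pw ?p (a i)) * ((\<Sum>i\<in>I. F i x * inverse (a i)) / of_nat (card I))"
        by (intro mult_left_mono prod_pw_le_mean I) simp
      finally show ?thesis .
    qed
    then have "(\<integral>\<^sup>+x. (\<Prod>i\<in>I. pw ?p (F i x)) \<partial>M)
        \<le> (\<integral>\<^sup>+x. (\<Prod>i\<in>I. pw ?p (a i)) * ((\<Sum>i\<in>I. F i x * inverse (a i)) / of_nat (card I)) \<partial>M)"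
      by (rule nn_integral_mono)
    also have "\<dots> = (\<Prod>i\<in>I. pw ?p (a i)) * ((\<Sum>i\<in>I. a i * inverse (a i)) / of_nat (card I))"
      by (simp add: nn_integral_cmult nn_integral_divide nn_integral_sum nn_integral_multc a_def)
    also have "(\<Sum>i\<in>I. a i * inverse (a i)) = of_nat (card I)"
      by (simp add: inv)
    also have "(of_nat (card I) :: ennreal) / of_nat (card I) = 1"
      using I by (intro ennreal_divide_self) (auto simp: of_nat_less_top)
    finally show ?thesis by (simp add: a_def)
  qed
qed

section \<open>Iterated line integrals\<close>

text \<open>The result stays a function on the full space, constant along b. Coordinates can thus be
  integrated out one by one without splitting the space into a product.\<close>

definition line_int :: "'a::euclidean_space \<Rightarrow> ('a \<Rightarrow> ennreal) \<Rightarrow> 'a \<Rightarrow> ennreal" where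
  "line_int b h x = (\<integral>\<^sup>+t. h (x + t *\<^sub>R b) \<partial>lborel)"

abbreviation lines_int :: "'a::euclidean_space list \<Rightarrow> ('a \<Rightarrow> ennreal) \<Rightarrow> 'a \<Rightarrow> ennreal" where
  "lines_int bs h \<equiv> foldr line_int bs h"

lemma measurable_line_int [measurable]:
  assumes [measurable]: "h \<in> borel_measurable borel"
  shows "line_int b h \<in> borel_measurable borel"
proof -
  have "(\<lambda>x. \<integral>\<^sup>+t. h (x + t *\<^sub>R b) \<partial>lborel) \<in> borel_measurable borel"
    by (rule lborel.borel_measurable_nn_integral) measurable
  then show ?thesis by (simp add: line_int_def[abs_def])
qed

lemma measurable_lines_int [measurable]:
  "h \<in> borel_measurable borel \<Longrightarrow> lines_int bs h \<in> borel_measurable borel"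
  by (induction bs) auto

lemma line_int_commute:
  assumes [measurable]: "h \<in> borel_measurable borel"
  shows "line_int a (line_int b h) = line_int b (line_int a h)"
proof
  fix x
  have [measurable]: "(\<lambda>(s, t). h (x + s *\<^sub>R a + t *\<^sub>R b)) \<in> borel_measurable (lborel \<Otimes>\<^sub>M lborel)"
    by measurable
  show "line_int a (line_int b h) x = line_int b (line_int a h) x"
    unfolding line_int_def
    by (subst lborel_pair.Fubini') (simp_all add: add_ac)
qed

lemma lines_int_commute:
  assumes h: "h \<in> borel_measurable borel"
  shows "lines_int bs (line_int b h) = line_int b (lines_int bs h)"
proof (induction bs)
  case (Cons a bs)
  then show ?case
    using line_int_commute[OF measurable_lines_int[OF h]] by simp
qed simp

lemma line_int_translate:
  assumes [measurable]: "h \<in> borel_measurable borel"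
  shows "line_int b h (x + t *\<^sub>R b) = line_int b h x"
  using lborel_nn_integral_translate[of "\<lambda>s. h (x + s *\<^sub>R b)" t]
  by (simp add: line_int_def algebra_simps)

lemma nn_integral_PiM_lines:
  fixes h :: "'a::euclidean_space \<Rightarrow> ennreal"
  assumes [measurable]: "h \<in> borel_measurable borel" and "distinct bs"
  shows "(\<integral>\<^sup>+f. h (x + (\<Sum>b\<in>set bs. f b *\<^sub>R b)) \<partial>(\<Pi>\<^sub>M b\<in>set bs. lborel)) = lines_int bs h x"
  using assms(2)
proof (induction bs arbitrary: x)
  case Nil
  interpret product_sigma_finite "\<lambda>_::'a. lborel :: real measure" ..
  show ?case by (simp add: PiM_empty)
next
  case (Cons a bs)
  interpret product_sigma_finite "\<lambda>_::'a. lborel :: real measure" ..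
  have "(\<integral>\<^sup>+f. h (x + (\<Sum>b\<in>set (a # bs). f b *\<^sub>R b)) \<partial>(\<Pi>\<^sub>M b\<in>set (a # bs). lborel))
    = (\<integral>\<^sup>+t. (\<integral>\<^sup>+f. h (x + (\<Sum>b\<in>insert a (set bs). (f(a := t)) b *\<^sub>R b)) \<partial>(\<Pi>\<^sub>M b\<in>set bs. lborel)) \<partial>lborel)"
    using Cons.prems unfolding list.set by (subst product_nn_integral_insert_rev) auto
  also have "\<dots> = (\<integral>\<^sup>+t. (\<integral>\<^sup>+f. h ((x + t *\<^sub>R a) + (\<Sum>b\<in>set bs. f b *\<^sub>R b)) \<partial>(\<Pi>\<^sub>M b\<in>set bs. lborel)) \<partial>lborel)"
  proof (intro nn_integral_cong)
    fix t :: real and f :: "'a \<Rightarrow> real"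
    have "(\<Sum>b\<in>set bs. (f(a := t)) b *\<^sub>R b) = (\<Sum>b\<in>set bs. f b *\<^sub>R b)"
      using Cons.prems by (intro sum.cong) auto
    then show "h (x + (\<Sum>b\<in>insert a (set bs). (f(a := t)) b *\<^sub>R b)) = h ((x + t *\<^sub>R a) + (\<Sum>b\<in>set bs. f b *\<^sub>R b))"
      using Cons.prems by (simp add: add.assoc)
  qed
  also have "\<dots> = (\<integral>\<^sup>+t. lines_int bs h (x + t *\<^sub>R a) \<partial>lborel)"
    using Cons by simp
  finally show ?case by (simp add: line_int_def[of a])
qed

text \<open>Once all basis directions are integrated out, the base point x only translates the
  Lebesgue integral.\<close>

lemma nn_integral_lborel_lines:
  fixes h :: "'a::euclidean_space \<Rightarrow> ennreal"
  assumes [measurable]: "h \<in> borel_measurable borel" and "distinct bs" "set bs = Basis"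
  shows "lines_int bs h x = (\<integral>\<^sup>+y. h y \<partial>lborel)"
proof -
  have "(\<integral>\<^sup>+y. h y \<partial>lborel) = (\<integral>\<^sup>+y. h (y + x) \<partial>lborel)"
    by (rule lborel_nn_integral_translate[symmetric]) fact
  also have "\<dots> = (\<integral>\<^sup>+f. h ((\<Sum>b\<in>Basis. f b *\<^sub>R b) + x) \<partial>(\<Pi>\<^sub>M b\<in>Basis. lborel))"
    by (subst lborel_eq) (simp add: nn_integral_distr)
  also have "\<dots> = lines_int bs h x"
    using nn_integral_PiM_lines[OF assms(1,2), of x] assms(3) by (simp add: add.commute)
  finally show ?thesis ..
qed

text \<open>The induction of Gagliardo and Nirenberg: integrating out one more direction \<open>b\<close>, the factor
  belonging to \<open>b\<close> is constant along that direction, and Hoelder applies to the other ones.\<close>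
lemma lines_int_prod_le:
  fixes g :: "'a::euclidean_space \<Rightarrow> 'a \<Rightarrow> ennreal"
  assumes g [measurable]: "\<And>b. g b \<in> borel_measurable borel"
    and dim: "DIM('a) \<ge> 2" and p: "p = 1 / real (DIM('a) - 1)"
  shows "distinct bs \<Longrightarrow> set bs \<subseteq> Basis \<Longrightarrow>
    lines_int bs (\<lambda>x. \<Prod>b\<in>Basis. pw p (line_int b (g b) x)) x
    \<le> (\<Prod>b\<in>Basis. pw p (if b \<in> set bs then lines_int bs (g b) x else lines_int bs (line_int b (g b)) x))"
proof (induction bs arbitrary: x)
  case Nil
  then show ?case by simp
next
  case (Cons a bs)
  define R where "R b x = (if b \<in> set bs then lines_int bs (g b) x else lines_int bs (line_int b (g b)) x)" for b x
  have [measurable]: "R b \<in> borel_measurable borel" for b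
    unfolding R_def by (cases "b \<in> set bs") auto
  have a: "a \<in> Basis" "a \<notin> set bs" using Cons.prems by auto
  have Ra: "R a y = line_int a (lines_int bs (g a)) y" for y
    using a lines_int_commute[OF g] by (simp add: R_def)
  have card: "card (Basis - {a}) = DIM('a) - 1" using a by simp
  have ne: "Basis - {a} \<noteq> {}"
  proof
    assume "Basis - {a} = {}"
    then have "card (Basis - {a}) = 0" by (metis card.empty)
    with card dim show False by linarith
  qed
  have "lines_int (a # bs) (\<lambda>x. \<Prod>b\<in>Basis. pw p (line_int b (g b) x)) x
      = (\<integral>\<^sup>+t. lines_int bs (\<lambda>x. \<Prod>b\<in>Basis. pw p (line_int b (g b) x)) (x + t *\<^sub>R a) \<partial>lborel)"
    by (simp add: line_int_def)
  also have "\<dots> \<le> (\<integral>\<^sup>+t. (\<Prod>b\<in>Basis. pw p (R b (x + t *\<^sub>R a))) \<partial>lborel)"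
    using Cons unfolding R_def by (intro nn_integral_mono) auto
  also have "\<dots> = (\<integral>\<^sup>+t. pw p (R a x) * (\<Prod>b\<in>Basis - {a}. pw p (R b (x + t *\<^sub>R a))) \<partial>lborel)"
    using a by (intro nn_integral_cong)
      (simp add: prod.remove[of Basis a] Ra line_int_translate)
  also have "\<dots> = pw p (R a x) * (\<integral>\<^sup>+t. (\<Prod>b\<in>Basis - {a}. pw p (R b (x + t *\<^sub>R a))) \<partial>lborel)"
    by (rule nn_integral_cmult) measurable
  also have "\<dots> \<le> pw p (R a x) * (\<Prod>b\<in>Basis - {a}. pw p (\<integral>\<^sup>+t. R b (x + t *\<^sub>R a) \<partial>lborel))"
    using Hoelder_prod[of "Basis - {a}" "\<lambda>b t. R b (x + t *\<^sub>R a)" lborel] ne card p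
    by (intro mult_left_mono) auto
  also have "\<dots> = (\<Prod>b\<in>Basis. pw p (if b \<in> set (a # bs) then lines_int (a # bs) (g b) x
      else lines_int (a # bs) (line_int b (g b)) x))"
  proof -
    have eq: "(\<integral>\<^sup>+t. R b (x + t *\<^sub>R a) \<partial>lborel) = (if b \<in> set (a # bs) then lines_int (a # bs) (g b) x
      else lines_int (a # bs) (line_int b (g b)) x)" if "b \<in> Basis - {a}" for b
      using that by (auto simp: R_def line_int_def[of a])
    show ?thesis
      by (subst prod.remove[OF finite_Basis a(1)], intro arg_cong2[where f = "(*)"] prod.cong refl arg_cong[OF eq])
        (simp add: Ra)
  qed
  finally show ?case .
qed

lemma Basis_vec_real: "(Basis :: (real^'n) set) = range (\<lambda>i. axis i 1)"
  by (auto simp: Basis_vec_def)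

text \<open>The fundamental theorem of calculus on the segment from x to x + T e_i; its far end has
  norm at least T - |x| > R and lies outside the support.\<close>

lemma abs_le_line_int:
  fixes \<eta> :: "real^'n \<Rightarrow> real"
  assumes diff: "\<And>x. \<eta> differentiable (at x)" and cont: "continuous_on UNIV (partial_deriv i \<eta>)"
    and supp: "bounded {x. \<eta> x \<noteq> 0}"
  shows "ennreal \<bar>\<eta> x\<bar> \<le> line_int (axis i 1) (\<lambda>y. ennreal \<bar>partial_deriv i \<eta> y\<bar>) x"
proof -
  let ?D = "\<lambda>t. partial_deriv i \<eta> (x + t *\<^sub>R axis i 1)"
  obtain R where R: "\<And>x. \<eta> x \<noteq> 0 \<Longrightarrow> norm x \<le> R" using supp unfolding bounded_iff by blast
  define T where "T = \<bar>R\<bar> + norm x + 1"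
  have T: "T > 0" by (simp add: T_def add_nonneg_pos)
  have "norm (T *\<^sub>R axis i (1::real) :: real^'n) \<le> norm (x + T *\<^sub>R axis i 1) + norm x"
    using norm_triangle_ineq4[of "x + T *\<^sub>R axis i 1" x] by simp
  then have "R < norm (x + T *\<^sub>R axis i 1)" using T by (simp add: T_def)
  then have zero: "\<eta> (x + T *\<^sub>R axis i 1) = 0" using R by fastforce
  have Dc: "continuous_on S ?D" for S
    by (rule continuous_on_compose2[OF cont]) (auto intro!: continuous_intros)
  have int: "integrable lborel (\<lambda>t. indicator {0..T} t *\<^sub>R ?D t)"
    by (intro borel_integrable_compact compact_Icc Dc)
  have "(\<integral>t. indicator {0..T} t *\<^sub>R ?D t \<partial>lborel) = \<eta> (x + T *\<^sub>R axis i 1) - \<eta> (x + 0 *\<^sub>R axis i 1)"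
    using T Dc line_derivative[OF diff]
    by (intro integral_FTC_atLeastAtMost)
      (auto simp flip: has_real_derivative_iff_has_vector_derivative intro: has_field_derivative_at_within)
  then have "ennreal \<bar>\<eta> x\<bar> = ennreal (norm (\<integral>t. indicator {0..T} t *\<^sub>R ?D t \<partial>lborel))"
    by (simp add: zero)
  also have "\<dots> \<le> (\<integral>\<^sup>+t. ennreal (norm (indicator {0..T} t *\<^sub>R ?D t)) \<partial>lborel)"
    by (rule integral_norm_bound_ennreal[OF int])
  also have "\<dots> \<le> (\<integral>\<^sup>+t. ennreal \<bar>?D t\<bar> \<partial>lborel)"
    by (intro nn_integral_mono ennreal_leI) (simp add: indicator_def)
  finally show ?thesis by (simp add: line_int_def)
qed

text \<open>|\<eta>|^N is at most the product over all directions of the line integrals of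
  |\<partial>_i \<eta>|. The power 1/(N-1) of this product is integrated by
  \<open>lines_int_prod_le\<close>, with \<open>bs\<close> exhausting the basis.\<close>

lemma Gagliardo_Nirenberg_Sobolev:
  fixes \<eta> :: "real^'n \<Rightarrow> real"
  assumes dim: "CARD('n) \<ge> 2"
    and diff: "\<And>x. \<eta> differentiable (at x)" and cont: "\<And>i. continuous_on UNIV (partial_deriv i \<eta>)"
    and supp: "bounded {x. \<eta> x \<noteq> 0}" and p: "p = 1 / real (CARD('n) - 1)"
  shows "(\<integral>\<^sup>+x. pw p (ennreal (\<bar>\<eta> x\<bar> ^ CARD('n))) \<partial>lborel)
    \<le> (\<Prod>i\<in>UNIV. pw p (\<integral>\<^sup>+x. ennreal \<bar>partial_deriv i \<eta> x\<bar> \<partial>lborel))"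
proof -
  \<comment> \<open>Partial derivatives are indexed by coordinates, line integrals by basis vectors;
    \<open>THE\<close> translates between the two.\<close>
  define D :: "real^'n \<Rightarrow> real^'n \<Rightarrow> ennreal"
    where "D b = (\<lambda>y. ennreal \<bar>partial_deriv (THE i. b = axis i 1) \<eta> y\<bar>)" for b
  have inj: "inj (\<lambda>i. axis i 1 :: real^'n)" by (auto simp: inj_on_def axis_eq_axis)
  have Da: "D (axis i 1) = (\<lambda>y. ennreal \<bar>partial_deriv i \<eta> y\<bar>)" for i
    by (simp add: D_def axis_eq_axis)
  have [measurable]: "D b \<in> borel_measurable borel" for b
    unfolding D_def using continuous_borel[OF cont] by measurable
  obtain bs :: "(real^'n) list" where bs: "distinct bs" "set bs = Basis"
    using finite_distinct_list[OF finite_Basis] by blast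
  have "pw p (ennreal (\<bar>\<eta> x\<bar> ^ CARD('n))) \<le> (\<Prod>b\<in>Basis. pw p (line_int b (D b) x))" for x
  proof -
    have "ennreal (\<bar>\<eta> x\<bar> ^ CARD('n)) = (\<Prod>i\<in>(UNIV::'n set). ennreal \<bar>\<eta> x\<bar>)"
      by (simp add: ennreal_power)
    also have "\<dots> \<le> (\<Prod>i\<in>(UNIV::'n set). line_int (axis i 1) (D (axis i 1)) x)"
      unfolding Da using abs_le_line_int[OF diff cont supp] by (intro prod_mono_ennreal)
    also have "\<dots> = (\<Prod>b\<in>Basis. line_int b (D b) x)"
      unfolding Basis_vec_real by (simp add: prod.reindex[OF inj])
    finally show ?thesis using p by (simp add: pw_mono flip: pw_prod)
  qed
  then have "(\<integral>\<^sup>+x. pw p (ennreal (\<bar>\<eta> x\<bar> ^ CARD('n))) \<partial>lborel)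
      \<le> (\<integral>\<^sup>+x. (\<Prod>b\<in>Basis. pw p (line_int b (D b) x)) \<partial>lborel)"
    by (rule nn_integral_mono)
  also have "\<dots> = lines_int bs (\<lambda>x. \<Prod>b\<in>Basis. pw p (line_int b (D b) x)) 0"
    by (rule nn_integral_lborel_lines[symmetric, OF _ bs]) measurable
  also have "\<dots> \<le> (\<Prod>b\<in>Basis. pw p (if b \<in> set bs then lines_int bs (D b) 0 else lines_int bs (line_int b (D b)) 0))"
    using dim p bs by (intro lines_int_prod_le) auto
  also have "\<dots> = (\<Prod>b\<in>Basis. pw p (\<integral>\<^sup>+x. D b x \<partial>lborel))"
    using bs by (intro prod.cong) (simp_all add: nn_integral_lborel_lines)
  also have "\<dots> = (\<Prod>i\<in>UNIV. pw p (\<integral>\<^sup>+x. ennreal \<bar>partial_deriv i \<eta> x\<bar> \<partial>lborel))"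
    unfolding Basis_vec_real by (simp add: prod.reindex[OF inj] Da)
  finally show ?thesis .
qed

text \<open>Young's inequality for the conjugate exponents N and N/(N-1) with constants 1: if y
  \<le> x^(N-1) the first term dominates x y, otherwise the second does.\<close>

lemma young_root:
  fixes x y :: real
  assumes "0 \<le> x" "0 \<le> y" "2 \<le> N"
  shows "x * y \<le> x ^ N + (y ^ N) powr (1 / real (N - 1))"
proof (cases "y \<le> x ^ (N - 1)")
  case True
  then have "x * y \<le> x * x ^ (N - 1)" using assms by (intro mult_left_mono)
  also have "\<dots> = x ^ N" using assms by (metis Suc_1 Suc_le_D Suc_le_lessD diff_Suc_1 power_Suc zero_less_Suc Suc_pred le_trans)
  finally show ?thesis by (simp add: add_increasing2)
next
  case False
  let ?p = "1 / real (N - 1)"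
  have k: "real (N - 1) > 0" using assms by simp
  from False have "x ^ (N - 1) \<le> y" by simp
  then have "(x ^ (N - 1)) powr ?p \<le> y powr ?p" using assms k by (intro powr_mono2) auto
  moreover have "(x ^ (N - 1)) powr ?p = x"
  proof (cases "x = 0")
    case False
    then show ?thesis using assms k by (simp add: powr_powr flip: powr_realpow)
  qed (use assms in simp)
  ultimately have x: "x \<le> y powr ?p" by simp
  have y: "y > 0" using False assms by (smt (verit) zero_le_power)
  have "x * y \<le> y powr ?p * y" using x assms by (intro mult_right_mono)
  also have "\<dots> = y powr (?p + 1)" using y by (simp add: powr_add)
  also have "?p + 1 = real N * ?p" using k assms by (simp add: field_simps of_nat_diff)
  also have "y powr \<dots> = (y ^ N) powr ?p" using y by (simp add: powr_powr flip: powr_realpow)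
  finally show ?thesis using assms by (simp add: add_increasing)
qed

text \<open>Sobolev's inequality in dual form. It follows from the previous inequality by Young's
  inequality, applied to a multiple of \<open>\<eta>\<close> whose gradient has \<open>L\<^sup>1\<close> norm close to \<open>1\<close>.\<close>
lemma Sobolev_dual:
  fixes \<eta> f :: "real^'n \<Rightarrow> real"
  assumes dim: "CARD('n) \<ge> 2"
    and diff: "\<And>x. \<eta> differentiable (at x)" and cont: "\<And>i. continuous_on UNIV (partial_deriv i \<eta>)"
    and supp: "bounded {x. \<eta> x \<noteq> 0}"
    and [measurable]: "f \<in> borel_measurable borel"
    and F: "(\<integral>\<^sup>+x. ennreal (\<bar>f x\<bar> ^ CARD('n)) \<partial>lborel) \<le> ennreal F" "0 \<le> F"
    and G: "\<And>i. (\<integral>\<^sup>+x. ennreal \<bar>partial_deriv i \<eta> x\<bar> \<partial>lborel) \<le> ennreal G" "0 \<le> G"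
  shows "(\<integral>\<^sup>+x. ennreal (\<bar>f x\<bar> * \<bar>\<eta> x\<bar>) \<partial>lborel) \<le> ennreal ((F + 1) * G)"
proof -
  let ?p = "1 / real (CARD('n) - 1)"
  have ec: "continuous_on UNIV \<eta>"
    using diff by (intro differentiable_imp_continuous_on) (simp add: differentiable_on_def)
  note [measurable] = continuous_borel[OF ec] continuous_borel[OF cont]
  \<comment> \<open>A level l strictly above G is positive even if G = 0, so \<eta> can be divided
    by it; at the end l decreases to G.\<close>
  have *: "(\<integral>\<^sup>+x. ennreal (\<bar>f x\<bar> * \<bar>\<eta> x\<bar>) \<partial>lborel) \<le> ennreal ((F + 1) * l)" if l: "G < l" for l
  proof -
    have l0: "l > 0" using l G by simp
    define \<zeta> where "\<zeta> = (\<lambda>x. inverse l * \<eta> x)"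
    have \<zeta>D: "partial_deriv i \<zeta> x = inverse l * partial_deriv i \<eta> x" "\<zeta> differentiable (at x)" for i x
      using partial_deriv_compose[where F = "\<lambda>y. inverse l * y" and d = "inverse l" and q = \<eta>] diff
        DERIV_cmult_Id by (auto simp: \<zeta>_def)
    have \<zeta>D': "partial_deriv i \<zeta> = (\<lambda>x. inverse l * partial_deriv i \<eta> x)" for i
      by (rule ext) (rule \<zeta>D)
    have "(\<integral>\<^sup>+x. ennreal \<bar>partial_deriv i \<zeta> x\<bar> \<partial>lborel) \<le> 1" for i
    proof -
      have "(\<integral>\<^sup>+x. ennreal \<bar>partial_deriv i \<zeta> x\<bar> \<partial>lborel) = (\<integral>\<^sup>+x. ennreal (inverse l) * ennreal \<bar>partial_deriv i \<eta> x\<bar> \<partial>lborel)"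
        using l0 by (simp add: \<zeta>D' abs_mult ennreal_mult)
      also have "\<dots> = ennreal (inverse l) * (\<integral>\<^sup>+x. ennreal \<bar>partial_deriv i \<eta> x\<bar> \<partial>lborel)"
        by (rule nn_integral_cmult) measurable
      also have "\<dots> \<le> ennreal (inverse l) * ennreal G" by (intro mult_left_mono G) simp
      also have "\<dots> \<le> ennreal 1" using l l0 G by (simp add: field_simps flip: ennreal_mult)
      finally show ?thesis by simp
    qed
    then have "pw ?p (\<integral>\<^sup>+x. ennreal \<bar>partial_deriv i \<zeta> x\<bar> \<partial>lborel) \<le> pw ?p 1" for i
      by (intro pw_mono) auto
    then have le1: "(\<Prod>i\<in>UNIV. pw ?p (\<integral>\<^sup>+x. ennreal \<bar>partial_deriv i \<zeta> x\<bar> \<partial>lborel)) \<le> 1"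
      using prod_mono_ennreal[of UNIV "\<lambda>i. pw ?p (\<integral>\<^sup>+x. ennreal \<bar>partial_deriv i \<zeta> x\<bar> \<partial>lborel)" "\<lambda>i. 1"]
        pw_ennreal[of 1 ?p] by simp
    have "(\<integral>\<^sup>+x. pw ?p (ennreal (\<bar>\<zeta> x\<bar> ^ CARD('n))) \<partial>lborel) \<le> 1"
    proof (rule order_trans[OF Gagliardo_Nirenberg_Sobolev le1])
      show "continuous_on UNIV (partial_deriv i \<zeta>)" for i
        unfolding \<zeta>D' using cont by (intro continuous_intros)
      show "bounded {x. \<zeta> x \<noteq> 0}" using supp by (rule bounded_subset) (auto simp: \<zeta>_def)
    qed (use dim \<zeta>D in auto)
    moreover have "\<zeta> \<in> borel_measurable borel" unfolding \<zeta>_def by measurable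
    note [measurable] = this
    have "(\<integral>\<^sup>+x. ennreal (\<bar>f x\<bar> * \<bar>\<zeta> x\<bar>) \<partial>lborel)
      \<le> (\<integral>\<^sup>+x. ennreal (\<bar>f x\<bar> ^ CARD('n)) + pw ?p (ennreal (\<bar>\<zeta> x\<bar> ^ CARD('n))) \<partial>lborel)"
      using young_root[of "\<bar>f x\<bar>" "\<bar>\<zeta> x\<bar>" "CARD('n)" for x] dim
      by (intro nn_integral_mono) (simp add: pw_ennreal ennreal_leI flip: ennreal_plus)
    moreover have "\<dots> = (\<integral>\<^sup>+x. ennreal (\<bar>f x\<bar> ^ CARD('n)) \<partial>lborel) + (\<integral>\<^sup>+x. pw ?p (ennreal (\<bar>\<zeta> x\<bar> ^ CARD('n))) \<partial>lborel)"
      by (rule nn_integral_add) measurable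
    ultimately have "(\<integral>\<^sup>+x. ennreal (\<bar>f x\<bar> * \<bar>\<zeta> x\<bar>) \<partial>lborel) \<le> ennreal F + 1"
      using add_mono[OF F(1)] order_trans by fastforce
    then have "ennreal l * (\<integral>\<^sup>+x. ennreal (\<bar>f x\<bar> * \<bar>\<zeta> x\<bar>) \<partial>lborel) \<le> ennreal l * ennreal (F + 1)"
      using F by (intro mult_left_mono) auto
    moreover have "ennreal l * (\<integral>\<^sup>+x. ennreal (\<bar>f x\<bar> * \<bar>\<zeta> x\<bar>) \<partial>lborel) = (\<integral>\<^sup>+x. ennreal (\<bar>f x\<bar> * \<bar>\<eta> x\<bar>) \<partial>lborel)"
      using l0 by (subst nn_integral_cmult[symmetric])
        (auto simp: \<zeta>_def abs_mult field_simps simp flip: ennreal_mult intro!: nn_integral_cong)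
    moreover have "ennreal l * ennreal (F + 1) = ennreal ((F + 1) * l)"
      using l0 F by (subst ennreal_mult[symmetric]) (auto simp: mult.commute)
    ultimately show ?thesis by (simp only:)
  qed
  have lim: "((\<lambda>l. ennreal ((F + 1) * l)) \<longlongrightarrow> ennreal ((F + 1) * G)) (at_right G)"
    by (intro tendsto_ennrealI tendsto_intros)
  show ?thesis
    by (rule tendsto_lowerbound[OF lim]) (auto intro!: eventually_at_rightI[of G "G + 1"] *)
qed

section \<open>The Orlicz function\<close>

text \<open>Here \<alpha>(t) = t \<phi>(t) is the derivative of \<Phi>. The inequality t \<alpha>(t)
  \<le> m \<Phi>(t) is the infinitesimal form of the \<Delta>_2 condition; it also stands in for the
  conjugate function in the inequalities of Young type.\<close>

locale growth =
  fixes \<Phi> \<alpha> :: "real \<Rightarrow> real" and m :: real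
  assumes \<Phi>_deriv: "(\<Phi> has_real_derivative \<alpha> t) (at t)"
    and \<Phi>_0 [simp]: "\<Phi> 0 = 0"
    and \<alpha>_cont: "continuous_on UNIV \<alpha>"
    and \<alpha>_odd: "\<alpha> (- t) = - \<alpha> t"
    and \<alpha>_mono: "strict_mono \<alpha>"
    and \<alpha>_top: "filterlim \<alpha> at_top at_top"
    and m: "m \<ge> 1"
    and \<Delta>: "t \<ge> 0 \<Longrightarrow> t * \<alpha> t \<le> m * \<Phi> t"
begin

lemma \<alpha>_0 [simp]: "\<alpha> 0 = 0"
  using \<alpha>_odd[of 0] by simp

lemma \<alpha>_less_iff [simp]: "\<alpha> s < \<alpha> t \<longleftrightarrow> s < t"
  using \<alpha>_mono by (rule strict_mono_less)

lemma \<alpha>_le_iff [simp]: "\<alpha> s \<le> \<alpha> t \<longleftrightarrow> s \<le> t"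
  using \<alpha>_mono by (rule strict_mono_less_eq)

lemma \<alpha>_pos: "t > 0 \<Longrightarrow> \<alpha> t > 0"
  using \<alpha>_less_iff[of 0 t] by simp

lemma \<alpha>_nonneg: "t \<ge> 0 \<Longrightarrow> \<alpha> t \<ge> 0"
  using \<alpha>_le_iff[of 0 t] by simp

lemma \<Phi>_tangent_strict:
  assumes "s \<noteq> t"
  shows "\<Phi> t + \<alpha> t * (s - t) < \<Phi> s"
proof (cases "t < s")
  case True
  obtain z where z: "t < z" "z < s" "\<Phi> s - \<Phi> t = (s - t) * \<alpha> z"
    using MVT2[OF True, of \<Phi> \<alpha>] \<Phi>_deriv by blast
  then have "(s - t) * \<alpha> t < (s - t) * \<alpha> z" by (intro mult_strict_left_mono) auto
  with z show ?thesis by (simp add: algebra_simps)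
next
  case False
  with assms have "s < t" by simp
  then obtain z where z: "s < z" "z < t" "\<Phi> t - \<Phi> s = (t - s) * \<alpha> z"
    using MVT2[of s t \<Phi> \<alpha>] \<Phi>_deriv by blast
  then have "(t - s) * \<alpha> z < (t - s) * \<alpha> t" using \<open>s < t\<close> by (intro mult_strict_left_mono) auto
  with z show ?thesis by (simp add: algebra_simps)
qed

lemma \<Phi>_tangent: "\<Phi> t + \<alpha> t * (s - t) \<le> \<Phi> s"
  using \<Phi>_tangent_strict[of s t] by (cases "s = t") auto

lemma \<Phi>_nonneg [simp]: "0 \<le> \<Phi> t"
  using \<Phi>_tangent[of 0 t] by simp

lemma \<Phi>_pos: "t \<noteq> 0 \<Longrightarrow> 0 < \<Phi> t"
  using \<Phi>_tangent_strict[of t 0] by simp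

lemma \<Phi>_even [simp]: "\<Phi> (- t) = \<Phi> t"
proof -
  have "((\<lambda>t. \<Phi> (- t) - \<Phi> t) has_real_derivative 0) (at t)" for t
  proof -
    have "((\<lambda>t::real. - t) has_real_derivative - 1) (at t)" by (auto intro!: derivative_eq_intros)
    from DERIV_diff[OF DERIV_chain2[OF \<Phi>_deriv this] \<Phi>_deriv] show ?thesis
      by (simp add: \<alpha>_odd)
  qed
  then have "\<Phi> (- t) - \<Phi> t = \<Phi> (- 0) - \<Phi> 0" by (rule DERIV_isconst_all[rule_format])
  then show ?thesis by simp
qed

lemma \<Phi>_abs [simp]: "\<Phi> \<bar>t\<bar> = \<Phi> t"
  by (cases "0 \<le> t") auto

lemma \<Phi>_mono: assumes "\<bar>s\<bar> \<le> \<bar>t\<bar>" shows "\<Phi> s \<le> \<Phi> t"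
proof -
  have "0 \<le> \<alpha> \<bar>s\<bar> * (\<bar>t\<bar> - \<bar>s\<bar>)" using assms by (intro mult_nonneg_nonneg \<alpha>_nonneg) auto
  then show ?thesis using \<Phi>_tangent[of "\<bar>s\<bar>" "\<bar>t\<bar>"] by simp
qed

lemma \<Phi>_continuous: "continuous_on S \<Phi>"
  using \<Phi>_deriv DERIV_continuous_on continuous_on_subset by blast

lemma \<Phi>_measurable [measurable]: "\<Phi> \<in> borel_measurable borel"
  by (rule continuous_borel[OF \<Phi>_continuous])

lemma \<alpha>_measurable [measurable]: "\<alpha> \<in> borel_measurable borel"
  by (rule continuous_borel[OF \<alpha>_cont])

lemma \<Phi>_le_\<alpha>: "\<Phi> t \<le> t * \<alpha> t"
  using \<Phi>_tangent[of t 0] by (simp add: mult.commute)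

lemma \<Phi>_contract:
  assumes "0 \<le> c" "c \<le> 1" shows "\<Phi> (c * t) \<le> c * \<Phi> t"
proof -
  have "c * (\<Phi> (c * t) + \<alpha> (c * t) * (t - c * t)) \<le> c * \<Phi> t"
    using assms by (intro mult_left_mono \<Phi>_tangent)
  moreover have "(1 - c) * (\<Phi> (c * t) + \<alpha> (c * t) * (0 - c * t)) \<le> (1 - c) * \<Phi> 0"
    using assms by (intro mult_left_mono \<Phi>_tangent) simp
  ultimately show ?thesis by (simp add: algebra_simps)
qed

text \<open>c^(-m) \<Phi>(c|t|) is nonincreasing in c, because its derivative has the sign of c|t|
  \<alpha>(c|t|) - m \<Phi>(c|t|). This is \<Delta>_2 with an explicit power.\<close>

lemma \<Phi>_scale:
  assumes "1 \<le> C" "\<bar>s\<bar> \<le> C * \<bar>t\<bar>" shows "\<Phi> s \<le> C powr m * \<Phi> t"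
proof (cases "t = 0")
  case False
  define g where "g c = \<Phi> (c * \<bar>t\<bar>) * c powr (- m)" for c
  have "g C \<le> g 1"
  proof (rule DERIV_nonpos_imp_nonincreasing[OF assms(1)])
    fix c :: real assume c: "1 \<le> c" "c \<le> C"
    have D: "(g has_real_derivative \<alpha> (c * \<bar>t\<bar>) * \<bar>t\<bar> * c powr (- m) + \<Phi> (c * \<bar>t\<bar>) * ((- m) * c powr (- m - 1))) (at c)"
      unfolding g_def using c
      by (auto intro!: derivative_eq_intros DERIV_chain2[OF \<Phi>_deriv] has_real_derivative_powr)
    have "c * (\<alpha> (c * \<bar>t\<bar>) * \<bar>t\<bar>) - m * \<Phi> (c * \<bar>t\<bar>) \<le> 0"
      using \<Delta>[of "c * \<bar>t\<bar>"] c by (simp add: mult_ac)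
    then have "(c * (\<alpha> (c * \<bar>t\<bar>) * \<bar>t\<bar>) - m * \<Phi> (c * \<bar>t\<bar>)) * c powr (- m - 1) \<le> 0"
      by (rule mult_nonpos_nonneg) simp
    moreover have "c powr (- m) = c * c powr (- m - 1)"
      using c by (simp add: powr_diff)
    ultimately have "\<alpha> (c * \<bar>t\<bar>) * \<bar>t\<bar> * c powr (- m) + \<Phi> (c * \<bar>t\<bar>) * ((- m) * c powr (- m - 1)) \<le> 0"
      by (simp add: algebra_simps)
    with D show "\<exists>y. (g has_real_derivative y) (at c) \<and> y \<le> 0" by blast
  qed
  then have "\<Phi> (C * \<bar>t\<bar>) \<le> C powr m * \<Phi> t"
    using assms by (simp add: g_def powr_minus field_simps)
  moreover have "\<Phi> s \<le> \<Phi> (C * \<bar>t\<bar>)" using assms by (intro \<Phi>_mono) (simp add: abs_mult)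
  ultimately show ?thesis by simp
qed (use assms in simp)

lemma \<Phi>_add: "\<Phi> (s + t) \<le> 2 powr m * (\<Phi> s + \<Phi> t)"
proof (cases "\<bar>s\<bar> \<le> \<bar>t\<bar>")
  case True
  then have "\<Phi> (s + t) \<le> 2 powr m * \<Phi> t" by (intro \<Phi>_scale) auto
  then show ?thesis by (simp add: distrib_left add_increasing)
next
  case False
  then have "\<Phi> (s + t) \<le> 2 powr m * \<Phi> s" by (intro \<Phi>_scale) auto
  then show ?thesis by (simp add: distrib_left add_increasing2)
qed

text \<open>The graph of \<Phi> lies above its tangent at a point T with \<alpha>(T) \<ge>
  1/\<epsilon>; the constant C is T itself.\<close>

lemma superlinear: assumes "0 < \<epsilon>" obtains C where "0 \<le> C" "\<And>t. \<bar>t\<bar> \<le> \<epsilon> * \<Phi> t + C"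
proof -
  have "\<forall>\<^sub>F t in at_top. 1 / \<epsilon> \<le> \<alpha> t" using \<alpha>_top by (simp add: filterlim_at_top)
  moreover have "\<forall>\<^sub>F t in at_top. (0::real) \<le> t" by (rule eventually_ge_at_top)
  ultimately obtain T where T: "1 / \<epsilon> \<le> \<alpha> T" "0 \<le> T"
    using eventually_happens[OF eventually_conj] by fastforce
  have a: "\<alpha> T > 0" using T assms by (smt (verit) divide_pos_pos)
  show ?thesis
  proof
    show "\<bar>t\<bar> \<le> \<epsilon> * \<Phi> t + T" for t
    proof -
      have "\<alpha> T * \<bar>t\<bar> \<le> \<Phi> t + \<alpha> T * T"
        using \<Phi>_tangent[of T "\<bar>t\<bar>"] \<Phi>_nonneg[of T] unfolding \<Phi>_abs right_diff_distrib by linarith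
      then have "\<bar>t\<bar> \<le> \<Phi> t / \<alpha> T + T" using a by (simp add: field_simps)
      also have "\<Phi> t / \<alpha> T \<le> \<epsilon> * \<Phi> t"
        using mult_right_mono[OF T(1), of "\<epsilon> * \<Phi> t"] a assms by (simp add: field_simps)
      finally show ?thesis by simp
    qed
  qed (use T in auto)
qed

text \<open>For |t| > \<epsilon> convexity gives \<Phi>(\<epsilon>)/\<epsilon> \<le> \<Phi>(t)/|t|.
  In contrast to \<open>superlinear\<close>, the additive constant is the small one, so that a small
  modular forces a small L^1 norm.\<close>

lemma le_eps_plus: assumes "0 < \<epsilon>" obtains C where "0 \<le> C" "\<And>t. \<bar>t\<bar> \<le> \<epsilon> + C * \<Phi> t"
proof
  show "\<bar>t\<bar> \<le> \<epsilon> + \<epsilon> / \<Phi> \<epsilon> * \<Phi> t" for t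
  proof (cases "\<bar>t\<bar> \<le> \<epsilon>")
    case False
    then have "\<Phi> (\<epsilon> / \<bar>t\<bar> * \<bar>t\<bar>) \<le> \<epsilon> / \<bar>t\<bar> * \<Phi> \<bar>t\<bar>"
      using assms by (intro \<Phi>_contract) auto
    then have "\<bar>t\<bar> * \<Phi> \<epsilon> \<le> \<epsilon> * \<Phi> t" using False assms by (simp add: field_simps)
    then show ?thesis using assms \<Phi>_pos[of \<epsilon>] by (simp add: field_simps add_increasing)
  qed (simp add: add_increasing2 assms less_imp_le)
qed (use assms in simp)

text \<open>If t \<le> \<delta> s, then \<alpha>(s) t \<le> \<delta> s \<alpha>(s) \<le> \<delta> m
  \<Phi>(s). Otherwise s < t/\<delta>, and \<alpha>(s) t is at most m \<Phi>(t/\<delta>), which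
  \<open>\<Phi>_scale\<close> compares with \<Phi>(t).\<close>

lemma young_eps:
  assumes "0 < \<epsilon>" obtains C where "0 \<le> C" "\<And>s t. 0 \<le> s \<Longrightarrow> 0 \<le> t \<Longrightarrow> \<alpha> s * t \<le> \<epsilon> * \<Phi> s + C * \<Phi> t"
proof -
  define \<delta> where "\<delta> = min 1 (\<epsilon> / m)"
  have \<delta>: "0 < \<delta>" "\<delta> \<le> 1" "\<delta> * m \<le> \<epsilon>" using assms m by (auto simp: \<delta>_def min_def field_simps)
  show ?thesis
  proof
    fix s t :: real assume st: "0 \<le> s" "0 \<le> t"
    show "\<alpha> s * t \<le> \<epsilon> * \<Phi> s + (m * (1 / \<delta>) powr m) * \<Phi> t"
    proof (cases "t \<le> \<delta> * s")
      case True
      then have "\<alpha> s * t \<le> \<alpha> s * (\<delta> * s)" using st by (intro mult_left_mono \<alpha>_nonneg)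
      also have "\<dots> \<le> \<delta> * (m * \<Phi> s)" using \<Delta>[of s] st \<delta> by (simp add: mult_ac mult_left_mono)
      also have "\<dots> \<le> \<epsilon> * \<Phi> s" using mult_right_mono[OF \<delta>(3), of "\<Phi> s"] by (simp add: mult_ac)
      finally show ?thesis using m by (simp add: add_increasing2)
    next
      case False
      then have "s \<le> t / \<delta>" using \<delta> by (simp add: field_simps)
      then have "\<alpha> s * t \<le> \<alpha> (t / \<delta>) * (t / \<delta>)"
        using st \<delta> mult_left_mono[OF \<delta>(2) st(2)] by (intro mult_mono \<alpha>_nonneg) (auto simp: field_simps)
      also have "\<dots> \<le> m * \<Phi> (t / \<delta>)" using \<Delta>[of "t / \<delta>"] st \<delta> by (simp add: mult_ac)
      also have "\<dots> \<le> m * ((1 / \<delta>) powr m * \<Phi> t)"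
        using m \<delta> by (intro mult_left_mono \<Phi>_scale) (auto simp: abs_divide)
      finally show ?thesis using assms by (simp add: add_increasing mult_ac)
    qed
  qed (use m in simp)
qed

lemma young: assumes "0 \<le> s" "0 \<le> t" shows "\<alpha> s * t \<le> m * (\<Phi> s + \<Phi> t)"
proof -
  have "\<alpha> s * t \<le> \<alpha> (max s t) * max s t" using assms by (intro mult_mono \<alpha>_nonneg) auto
  also have "\<dots> \<le> m * \<Phi> (max s t)" using \<Delta>[of "max s t"] assms by (simp add: mult.commute)
  also have "\<dots> \<le> m * (\<Phi> s + \<Phi> t)" using m by (intro mult_left_mono) (auto simp: max_def)
  finally show ?thesis .
qed

section \<open>The vector field of the equation\<close>

text \<open>This is \<phi>(|\<xi>|) \<xi>, the gradient of \<Phi>(|\<xi>|). At \<xi> = 0 the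
  coefficient is 0/0 = 0, and the vector it multiplies is 0 as well.\<close>

definition flux :: "'v::real_inner \<Rightarrow> 'v" where
  "flux \<xi> = (\<alpha> (norm \<xi>) / norm \<xi>) *\<^sub>R \<xi>"

lemma norm_flux: "norm (flux \<xi>) = \<alpha> (norm \<xi>)"
  by (cases "\<xi> = 0") (simp_all add: flux_def \<alpha>_nonneg)

lemma flux_self: "flux \<xi> \<bullet> \<xi> = \<alpha> (norm \<xi>) * norm \<xi>"
  by (cases "\<xi> = 0") (simp_all add: flux_def dot_square_norm power2_eq_square)

lemma flux_inner_le: "\<bar>flux \<xi> \<bullet> \<zeta>\<bar> \<le> m * (\<Phi> (norm \<xi>) + \<Phi> (norm \<zeta>))"
  using Cauchy_Schwarz_ineq2[of "flux \<xi>" \<zeta>] young[of "norm \<xi>" "norm \<zeta>"] by (simp add: norm_flux)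

text \<open>For different norms strictness comes from the scalar tangent inequality after
  Cauchy-Schwarz; for equal norms it comes from Cauchy-Schwarz itself, where equality would force
  \<zeta> = \<xi>.\<close>

lemma flux_tangent_strict:
  assumes "\<zeta> \<noteq> \<xi>"
  shows "\<Phi> (norm \<xi>) + flux \<xi> \<bullet> (\<zeta> - \<xi>) < \<Phi> (norm \<zeta>)"
proof -
  have le: "flux \<xi> \<bullet> \<zeta> \<le> \<alpha> (norm \<xi>) * norm \<zeta>"
    using norm_cauchy_schwarz[of "flux \<xi>" \<zeta>] by (simp add: norm_flux)
  have eq: "\<Phi> (norm \<xi>) + flux \<xi> \<bullet> (\<zeta> - \<xi>) = \<Phi> (norm \<xi>) + flux \<xi> \<bullet> \<zeta> - \<alpha> (norm \<xi>) * norm \<xi>"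
    by (simp add: inner_diff_right flux_self)
  show ?thesis
  proof (cases "norm \<zeta> = norm \<xi>")
    case False
    then show ?thesis using \<Phi>_tangent_strict[of "norm \<zeta>" "norm \<xi>"] le eq by (simp add: algebra_simps)
  next
    case True
    then have nz: "norm \<xi> > 0" using assms by auto
    have "\<xi> \<bullet> \<zeta> < norm \<xi> * norm \<zeta>"
    proof (rule ccontr)
      assume "\<not> ?thesis"
      then have "\<xi> \<bullet> \<zeta> = norm \<xi> * norm \<zeta>" using norm_cauchy_schwarz[of \<xi> \<zeta>] by simp
      then have "norm \<xi> *\<^sub>R \<zeta> = norm \<zeta> *\<^sub>R \<xi>" by (simp add: norm_cauchy_schwarz_eq)
      with True nz assms show False by simp
    qed
    then have "\<alpha> (norm \<xi>) / norm \<xi> * (\<xi> \<bullet> \<zeta>) < \<alpha> (norm \<xi>) / norm \<xi> * (norm \<xi> * norm \<zeta>)"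
      using nz by (intro mult_strict_left_mono divide_pos_pos \<alpha>_pos)
    then have "flux \<xi> \<bullet> \<zeta> < \<alpha> (norm \<xi>) * norm \<xi>"
      using nz True by (simp add: flux_def)
    with eq True show ?thesis by simp
  qed
qed

lemma flux_tangent: "\<Phi> (norm \<xi>) + flux \<xi> \<bullet> (\<zeta> - \<xi>) \<le> \<Phi> (norm \<zeta>)"
  using flux_tangent_strict[of \<zeta> \<xi>] by (cases "\<zeta> = \<xi>") auto

lemma flux_monotone_strict:
  assumes "\<zeta> \<noteq> \<xi>" shows "0 < (flux \<xi> - flux \<zeta>) \<bullet> (\<xi> - \<zeta>)"
  using flux_tangent_strict[OF assms] flux_tangent_strict[of \<xi> \<zeta>] assms
  by (simp add: inner_diff_left inner_diff_right)

text \<open>Only the origin is critical, and there |flux \<xi>| = \<alpha>(|\<xi>|) tends to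
  0.\<close>

lemma flux_continuous: "continuous_on UNIV (flux :: 'v::real_inner \<Rightarrow> 'v)"
proof -
  have c: "continuous_on UNIV (\<lambda>\<xi>::'v. \<alpha> (norm \<xi>))"
    by (rule continuous_on_compose2[OF \<alpha>_cont]) (auto intro!: continuous_intros)
  then have c': "isCont (\<lambda>\<xi>::'v. \<alpha> (norm \<xi>)) \<xi>" for \<xi> :: 'v
    by (simp add: continuous_on_eq_continuous_at)
  have "isCont flux \<xi>" for \<xi> :: 'v
  proof (cases "\<xi> = 0")
    case True
    have "((\<lambda>\<xi>::'v. norm (flux \<xi>)) \<longlongrightarrow> 0) (at 0)"
      using c'[of 0] by (simp add: norm_flux isCont_def)
    then show ?thesis using True by (simp add: isCont_def tendsto_norm_zero_iff flux_def[of 0])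
  next
    case False
    with c' show ?thesis unfolding flux_def by (intro continuous_intros) auto
  qed
  then show ?thesis by (simp add: continuous_on_eq_continuous_at)
qed

lemma \<Phi>_norm_continuous: "continuous_on UNIV (\<lambda>\<xi>::'v::real_normed_vector. \<Phi> (norm \<xi>))"
  by (intro continuous_on_compose2[OF \<Phi>_continuous[of UNIV]] continuous_intros) auto

section \<open>Quantitative strict convexity\<close>

definition gap :: "'v::real_inner \<Rightarrow> 'v \<Rightarrow> real" where
  "gap \<xi> \<zeta> = (\<Phi> (norm \<xi>) + \<Phi> (norm \<zeta>)) / 2 - \<Phi> (norm ((1 / 2) *\<^sub>R (\<xi> + \<zeta>)))"

text \<open>Both end points lie strictly above the tangent plane at the midpoint c, and the two
  linear terms cancel.\<close>

lemma gap_pos: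
  fixes \<xi> \<zeta> :: "'v::real_inner"
  assumes "\<xi> \<noteq> \<zeta>" shows "0 < gap \<xi> \<zeta>"
proof -
  define c where "c = (1 / 2) *\<^sub>R (\<xi> + \<zeta>)"
  have half: "x - (1 / 2) *\<^sub>R (x + y) = (1 / 2) *\<^sub>R (x - y)" for x y :: 'v
  proof -
    have "x - (1 / 2) *\<^sub>R (x + y) = (1 - 1 / 2) *\<^sub>R x - (1 / 2) *\<^sub>R y"
      by (simp only: scaleR_left_diff_distrib scaleR_one scaleR_add_right diff_diff_eq)
    then show ?thesis by (simp add: scaleR_diff_right)
  qed
  have e: "\<xi> - c = (1 / 2) *\<^sub>R (\<xi> - \<zeta>)" "\<zeta> - c = (1 / 2) *\<^sub>R (\<zeta> - \<xi>)"
    using half[of \<xi> \<zeta>] half[of \<zeta> \<xi>] by (simp_all add: c_def add.commute)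
  have "(\<xi> - c) + (\<zeta> - c) = (1 / 2) *\<^sub>R ((\<xi> - \<zeta>) + (\<zeta> - \<xi>))"
    unfolding e by (simp only: scaleR_add_right)
  then have s: "(\<xi> - c) + (\<zeta> - c) = 0" by simp
  have "\<xi> - c \<noteq> 0" "\<zeta> - c \<noteq> 0" unfolding e using assms by simp_all
  then have "\<xi> \<noteq> c" "\<zeta> \<noteq> c" by (metis diff_self)+
  have "flux c \<bullet> (\<xi> - c) + flux c \<bullet> (\<zeta> - c) = 0"
    by (simp only: s inner_zero_right flip: inner_add_right)
  moreover have "0 < (X + Y) / 2 - P" if "P + a < X" "P + b < Y" "a + b = 0" for P X Y a b :: real
    using that by (simp add: field_simps)
  ultimately show ?thesis
    using flux_tangent_strict[OF \<open>\<xi> \<noteq> c\<close>] flux_tangent_strict[OF \<open>\<zeta> \<noteq> c\<close>]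
    unfolding gap_def c_def[symmetric] by blast
qed

lemma gap_nonneg: "0 \<le> gap \<xi> \<zeta>"
proof (cases "\<xi> = \<zeta>")
  case True
  have "(1 / 2) *\<^sub>R (\<zeta> + \<zeta>) = \<zeta>" by (simp flip: scaleR_2)
  with True show ?thesis by (simp add: gap_def)
qed (simp add: gap_pos less_imp_le)

text \<open>Pairs closer than \<epsilon> cost only the constant term. On the compact set S of the
  other pairs with norms at most 4B the gap has a positive minimum. If one norm exceeds 4B,
  superlinearity alone bounds |\<xi>| + |\<zeta>|.\<close>

lemma diff_le_gap:
  assumes "0 < \<epsilon>"
  obtains C where "0 \<le> C"
    "\<And>\<xi> \<zeta>::'v::euclidean_space. norm (\<xi> - \<zeta>) \<le> \<epsilon> * (1 + \<Phi> (norm \<xi>) + \<Phi> (norm \<zeta>)) + C * gap \<xi> \<zeta>"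
proof -
  obtain B where B: "0 \<le> B" "\<And>t. \<bar>t\<bar> \<le> \<epsilon> / 2 * \<Phi> t + B"
    using superlinear[of "\<epsilon> / 2"] assms by auto
  \<comment> \<open>Adding |t| \<le> \<epsilon>/2 \<Phi>(t) + B for both vectors leaves a constant
    2B, which half of a sum of norms above 4B absorbs.\<close>
  define S where "S = {z :: 'v \<times> 'v. norm (fst z) \<le> 4 * B \<and> norm (snd z) \<le> 4 * B \<and> \<epsilon> \<le> norm (fst z - snd z)}"
  have "S = (cball 0 (4 * B) \<times> cball 0 (4 * B)) \<inter> {z. \<epsilon> \<le> norm (fst z - snd z)}"
    by (auto simp: S_def)
  moreover have "closed {z :: 'v \<times> 'v. \<epsilon> \<le> norm (fst z - snd z)}"
    by (intro closed_Collect_le continuous_intros)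
  ultimately have "compact S" by (simp add: compact_Int_closed compact_Times)
  have gc: "continuous_on S (\<lambda>z. gap (fst z) (snd z))"
    unfolding gap_def
    by (intro continuous_intros continuous_on_compose2[OF \<Phi>_norm_continuous]) auto
  obtain \<delta> where \<delta>: "0 < \<delta>" "\<And>z. z \<in> S \<Longrightarrow> \<delta> \<le> gap (fst z) (snd z)"
  proof (cases "S = {}")
    case True then show ?thesis using that[of 1] by simp
  next
    case False
    obtain z where "z \<in> S" "\<And>y. y \<in> S \<Longrightarrow> gap (fst z) (snd z) \<le> gap (fst y) (snd y)"
      using continuous_attains_inf[OF \<open>compact S\<close> False gc] by blast
    moreover have "gap (fst z) (snd z) > 0" using \<open>z \<in> S\<close> assms by (intro gap_pos) (auto simp: S_def)
    ultimately show ?thesis using that by blast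
  qed
  show ?thesis
  proof
    fix \<xi> \<zeta> :: 'v
    \<comment> \<open>On S the sum of the norms is at most 8B and the gap at least \<delta>, hence
      the factor 8B/\<delta>.\<close>
    have g: "0 \<le> 8 * B / \<delta> * gap \<xi> \<zeta>" using B \<delta> by (intro mult_nonneg_nonneg gap_nonneg divide_nonneg_nonneg) auto
    have t: "norm (\<xi> - \<zeta>) \<le> norm \<xi> + norm \<zeta>" by (rule norm_triangle_ineq4)
    consider "norm (\<xi> - \<zeta>) < \<epsilon>" | "(\<xi>, \<zeta>) \<in> S" | "norm \<xi> > 4 * B \<or> norm \<zeta> > 4 * B"
      by (fastforce simp: S_def)
    then show "norm (\<xi> - \<zeta>) \<le> \<epsilon> * (1 + \<Phi> (norm \<xi>) + \<Phi> (norm \<zeta>)) + 8 * B / \<delta> * gap \<xi> \<zeta>"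
    proof cases
      case 1
      then show ?thesis using g assms by (simp add: distrib_left add_increasing2)
    next
      case 2
      have "norm \<xi> + norm \<zeta> \<le> 8 * B" using 2 by (simp add: S_def)
      moreover have "8 * B / \<delta> * \<delta> \<le> 8 * B / \<delta> * gap \<xi> \<zeta>"
        using \<delta>(2)[OF 2] \<delta>(1) B by (intro mult_left_mono) auto
      moreover have "8 * B / \<delta> * \<delta> = 8 * B" using \<delta>(1) by simp
      ultimately have "norm (\<xi> - \<zeta>) \<le> 8 * B / \<delta> * gap \<xi> \<zeta>" using t by linarith
      then show ?thesis using assms by (simp add: add_increasing)
    next
      case 3
      have n: "4 * B \<le> x + y" if "4 * B < x \<or> 4 * B < y" "0 \<le> x" "0 \<le> y" for x y :: real
        using that by auto
      from 3 have "2 * B \<le> (norm \<xi> + norm \<zeta>) / 2" using n[of "norm \<xi>" "norm \<zeta>"] by simp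
      moreover have "norm \<xi> + norm \<zeta> \<le> (\<epsilon> * (\<Phi> (norm \<xi>) + \<Phi> (norm \<zeta>))) / 2 + 2 * B"
        using B(2)[of "norm \<xi>"] B(2)[of "norm \<zeta>"] by (simp add: distrib_left add_divide_distrib)
      moreover have "s \<le> X" if "2 * B \<le> s / 2" "s \<le> X / 2 + 2 * B" for s X
        using that by simp
      ultimately have "norm \<xi> + norm \<zeta> \<le> \<epsilon> * (\<Phi> (norm \<xi>) + \<Phi> (norm \<zeta>))" by blast
      with t g assms show ?thesis by (simp add: distrib_left)
    qed
  qed (use B \<delta> in auto)
qed

text \<open>The factor of \<Phi>(|\<xi>|) can be brought arbitrarily close to 1, which makes the
  modular stable under approximation. The tangent at s + t gives \<Phi>(s + t) \<le> \<Phi>(s) +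
  \<alpha>(s + t) t; Young's inequality is taken with \<epsilon>/2^m because the resulting \<Phi>(s
  + t) is split once more by \<open>\<Phi>_add\<close>.\<close>

lemma \<Phi>_perturb:
  assumes "0 < \<epsilon>"
  obtains C where "0 \<le> C"
    "\<And>\<xi> d::'v::real_normed_vector. \<Phi> (norm (\<xi> + d)) \<le> (1 + \<epsilon>) * \<Phi> (norm \<xi>) + C * \<Phi> (norm d)"
proof -
  let ?K = "2 powr m"
  have K: "?K > 0" by simp
  obtain C where C: "0 \<le> C" "\<And>s t. 0 \<le> s \<Longrightarrow> 0 \<le> t \<Longrightarrow> \<alpha> s * t \<le> \<epsilon> / ?K * \<Phi> s + C * \<Phi> t"
    using young_eps[of "\<epsilon> / ?K"] assms K by auto
  show ?thesis
  proof
    fix \<xi> d :: 'v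
    define s t where "s = norm \<xi>" and "t = norm d"
    have st: "0 \<le> s" "0 \<le> t" by (auto simp: s_def t_def)
    have "\<Phi> (norm (\<xi> + d)) \<le> \<Phi> (s + t)"
      using norm_triangle_ineq[of \<xi> d] by (intro \<Phi>_mono) (simp add: s_def t_def)
    moreover have "\<Phi> (s + t) \<le> \<Phi> s + \<alpha> (s + t) * t"
      using \<Phi>_tangent[of "s + t" s] by (simp add: algebra_simps)
    moreover have "\<alpha> (s + t) * t \<le> \<epsilon> / ?K * \<Phi> (s + t) + C * \<Phi> t"
      using C(2)[of "s + t" t] st by simp
    moreover have "\<epsilon> / ?K * \<Phi> (s + t) \<le> \<epsilon> / ?K * (?K * (\<Phi> s + \<Phi> t))"
      using assms by (intro mult_left_mono \<Phi>_add) simp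
    moreover have "\<epsilon> / ?K * (?K * (\<Phi> s + \<Phi> t)) = \<epsilon> * (\<Phi> s + \<Phi> t)" using K by simp
    ultimately show "\<Phi> (norm (\<xi> + d)) \<le> (1 + \<epsilon>) * \<Phi> (norm \<xi>) + (C + \<epsilon>) * \<Phi> (norm d)"
      unfolding s_def[symmetric] t_def[symmetric] by (simp add: algebra_simps)
  qed (use C assms in simp)
qed

lemma \<Phi>_norm_add:
  "\<Phi> (norm (\<xi> + \<zeta> :: 'v::real_normed_vector)) \<le> 2 powr m * (\<Phi> (norm \<xi>) + \<Phi> (norm \<zeta>))"
proof -
  have "\<Phi> (norm (\<xi> + \<zeta>)) \<le> \<Phi> (norm \<xi> + norm \<zeta>)" by (intro \<Phi>_mono) (simp add: norm_triangle_ineq)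
  then show ?thesis using \<Phi>_add[of "norm \<xi>" "norm \<zeta>"] by linarith
qed

lemma \<Phi>_component_le: "\<Phi> (\<xi> $ i) \<le> \<Phi> (norm (\<xi> :: real^'n))"
  by (intro \<Phi>_mono) (simp add: component_le_norm_cart)

lemma \<Phi>_norm_le_sum:
  "\<Phi> (norm (\<xi> :: real^'n)) \<le> real CARD('n) powr m * (\<Sum>i\<in>UNIV. \<Phi> (\<xi> $ i))"
proof -
  obtain i where i: "\<And>j. \<bar>\<xi> $ j\<bar> \<le> \<bar>\<xi> $ i\<bar>"
  proof -
    have "Max (range (\<lambda>j. \<bar>\<xi> $ j\<bar>)) \<in> range (\<lambda>j. \<bar>\<xi> $ j\<bar>)" by (intro Max_in) auto
    then obtain i where "Max (range (\<lambda>j. \<bar>\<xi> $ j\<bar>)) = \<bar>\<xi> $ i\<bar>" by blast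
    then show ?thesis using that by (metis Max_ge UNIV_I finite_class.finite_UNIV finite_imageI rangeI)
  qed
  have "norm \<xi> \<le> (\<Sum>j\<in>UNIV. \<bar>\<xi> $ j\<bar>)" by (rule norm_le_l1_cart)
  also have "\<dots> \<le> (\<Sum>j\<in>(UNIV::'n set). \<bar>\<xi> $ i\<bar>)" using i by (intro sum_mono)
  finally have "\<Phi> (norm \<xi>) \<le> real CARD('n) powr m * \<Phi> (\<xi> $ i)"
    by (intro \<Phi>_scale) (auto simp: Suc_le_eq)
  also have "\<Phi> (\<xi> $ i) \<le> (\<Sum>i\<in>UNIV. \<Phi> (\<xi> $ i))" by (rule member_le_sum) auto
  finally show ?thesis by (simp add: mult_left_mono)
qed

end

section \<open>Mollification\<close>

text \<open>Mollification is needed both for \<Phi> and in L^1, that is for the absolute value; the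
  locale collects what the two share. Convexity appears as existence of supporting lines, the form
  that Jensen's inequality uses.\<close>

locale modular =
  fixes \<Psi> :: "real \<Rightarrow> real" and K :: real
  assumes \<Psi>_cont: "continuous_on UNIV \<Psi>" and \<Psi>_0 [simp]: "\<Psi> 0 = 0"
    and \<Psi>_mono: "\<bar>s\<bar> \<le> \<bar>t\<bar> \<Longrightarrow> \<Psi> s \<le> \<Psi> t"
    and K: "1 \<le> K" and \<Psi>_add: "\<Psi> (s + t) \<le> K * (\<Psi> s + \<Psi> t)"
    and \<Psi>_tangent: "\<exists>c. \<forall>s. \<Psi> t + c * (s - t) \<le> \<Psi> s"
begin

lemma \<Psi>_nonneg [simp]: "0 \<le> \<Psi> t"
  using \<Psi>_mono[of 0 t] by simp

lemma \<Psi>_measurable [measurable]: "\<Psi> \<in> borel_measurable borel"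
  by (rule continuous_borel[OF \<Psi>_cont])

lemma nn_integral_\<Psi>_add:
  assumes [measurable]: "f \<in> borel_measurable M" "g \<in> borel_measurable M"
  shows "(\<integral>\<^sup>+x. ennreal (\<Psi> (f x + g x)) \<partial>M)
    \<le> ennreal K * ((\<integral>\<^sup>+x. ennreal (\<Psi> (f x)) \<partial>M) + (\<integral>\<^sup>+x. ennreal (\<Psi> (g x)) \<partial>M))"
proof -
  have "(\<integral>\<^sup>+x. ennreal (\<Psi> (f x + g x)) \<partial>M) \<le> (\<integral>\<^sup>+x. ennreal K * (ennreal (\<Psi> (f x)) + ennreal (\<Psi> (g x))) \<partial>M)"
  proof (intro nn_integral_mono)
    fix x
    have "ennreal (\<Psi> (f x + g x)) \<le> ennreal (K * (\<Psi> (f x) + \<Psi> (g x)))"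
      by (intro ennreal_leI \<Psi>_add)
    then show "ennreal (\<Psi> (f x + g x)) \<le> ennreal K * (ennreal (\<Psi> (f x)) + ennreal (\<Psi> (g x)))"
      using K by (simp add: ennreal_mult)
  qed
  also have "\<dots> = ennreal K * ((\<integral>\<^sup>+x. ennreal (\<Psi> (f x)) \<partial>M) + (\<integral>\<^sup>+x. ennreal (\<Psi> (g x)) \<partial>M))"
    by (simp add: nn_integral_cmult nn_integral_add)
  finally show ?thesis .
qed

lemma \<Psi>_tendsto: "((\<lambda>n. f n) \<longlongrightarrow> t) F \<Longrightarrow> ((\<lambda>n. \<Psi> (f n)) \<longlongrightarrow> \<Psi> t) F"
  using \<Psi>_cont by (auto simp: continuous_on_eq_continuous_at intro: isCont_tendsto_compose)

text \<open>Clip g at a large height n, take continuous functions that converge to g almost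
  everywhere, clip them at the same height and cut them off outside a ball. Both errors vanish by
  dominated convergence.\<close>

lemma approx_continuous:
  fixes g :: "'a::euclidean_space \<Rightarrow> real"
  assumes g [measurable]: "g \<in> borel_measurable borel" and supp: "bounded {x. g x \<noteq> 0}"
    and fin: "(\<integral>\<^sup>+x. ennreal (\<Psi> (g x)) \<partial>lborel) < \<infinity>" and e: "0 < e"
  obtains k where "continuous_on UNIV k" "bounded {x. k x \<noteq> 0}" "(\<integral>\<^sup>+x. ennreal (\<Psi> (g x - k x)) \<partial>lborel) \<le> ennreal e"
proof -
  obtain R where R: "\<And>x. g x \<noteq> 0 \<Longrightarrow> norm x \<le> R" using supp unfolding bounded_iff by blast
  define r where "r = e / (2 * K)"
  have r: "0 < r" "K * (r + r) = e" using e K by (auto simp: r_def field_simps)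
  define clip where "clip M t = max (- M) (min M t)" for M t :: real
  have "(\<lambda>n. \<integral>\<^sup>+x. ennreal (\<Psi> (g x - clip (real n) (g x))) \<partial>lborel) \<longlonglongrightarrow> (\<integral>\<^sup>+x. 0 \<partial>(lborel :: 'a measure))"
  proof (rule nn_integral_dominated_convergence[where w = "\<lambda>x. ennreal (\<Psi> (g x))"])
    show "AE x in lborel. ennreal (\<Psi> (g x - clip (real n) (g x))) \<le> ennreal (\<Psi> (g x))" for n
      by (intro AE_I2 ennreal_leI \<Psi>_mono) (auto simp: clip_def)
    show "AE x in lborel. (\<lambda>n. ennreal (\<Psi> (g x - clip (real n) (g x)))) \<longlonglongrightarrow> 0"
    proof (intro AE_I2 tendsto_eventually)
      fix x
      obtain N where "\<bar>g x\<bar> \<le> real N" using real_arch_simple by blast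
      then show "\<forall>\<^sub>F n in sequentially. ennreal (\<Psi> (g x - clip (real n) (g x))) = 0"
        by (intro eventually_sequentiallyI[of N]) (simp add: clip_def)
    qed
  qed (use fin in \<open>simp_all add: clip_def\<close>)
  then have "\<forall>\<^sub>F n in sequentially. (\<integral>\<^sup>+x. ennreal (\<Psi> (g x - clip (real n) (g x))) \<partial>lborel) < ennreal r"
    using r by (intro order_tendstoD(2)) auto
  then obtain n where n: "(\<integral>\<^sup>+x. ennreal (\<Psi> (g x - clip (real n) (g x))) \<partial>lborel) < ennreal r"
    by (metis (no_types, lifting) eventually_happens sequentially_bot)
  define u where "u x = clip (real n) (g x)" for x
  have [measurable]: "u \<in> borel_measurable borel" unfolding u_def clip_def by measurable
  have "g measurable_on UNIV"
    by (rule lebesgue_measurable_imp_measurable_on) (auto intro: measurable_completion)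
  then obtain N h where N: "negligible N" and h: "\<And>n. continuous_on UNIV (h n)"
    and lim: "\<And>x. x \<notin> N \<Longrightarrow> (\<lambda>n. h n x) \<longlonglongrightarrow> g x"
    unfolding measurable_on_def by auto
  define cut where "cut x = max 0 (min 1 (R + 1 - norm x))" for x :: 'a
  define v where "v j x = cut x * clip (real n) (h j x)" for j x
  have vc: "continuous_on UNIV (v j)" for j
    unfolding v_def cut_def clip_def by (intro continuous_intros h)
  have v0: "v j x = 0" if "x \<notin> cball 0 (R + 1)" for j x
    using that by (simp add: v_def cut_def)
  have u0: "u x = 0" if "x \<notin> cball 0 (R + 1)" for x
    using that R[of x] by (cases "g x = 0") (auto simp: u_def clip_def)
  have vm: "v j \<in> borel_measurable borel" for j by (rule continuous_borel[OF vc])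
  note [measurable] = vm
  have [measurable]: "cball (0::'a) (R + 1) \<in> sets borel" by simp
  have "(\<lambda>j. \<integral>\<^sup>+x. ennreal (\<Psi> (u x - v j x)) \<partial>lborel) \<longlonglongrightarrow> (\<integral>\<^sup>+x. 0 \<partial>(lborel :: 'a measure))"
  proof (rule nn_integral_dominated_convergence[where w = "\<lambda>x. ennreal (\<Psi> (2 * real n)) * indicator (cball 0 (R + 1)) x"])
    show "AE x in lborel. ennreal (\<Psi> (u x - v j x)) \<le> ennreal (\<Psi> (2 * real n)) * indicator (cball 0 (R + 1)) x" for j
    proof (intro AE_I2)
      fix x
      show "ennreal (\<Psi> (u x - v j x)) \<le> ennreal (\<Psi> (2 * real n)) * indicator (cball 0 (R + 1)) x"
      proof (cases "x \<in> cball 0 (R + 1)")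
        case True
        have "\<bar>v j x\<bar> = cut x * \<bar>clip (real n) (h j x)\<bar>" by (simp add: v_def cut_def abs_mult)
        also have "\<dots> \<le> 1 * real n" by (intro mult_mono) (auto simp: cut_def clip_def)
        finally have "\<bar>v j x\<bar> \<le> real n" by simp
        moreover have "\<bar>u x\<bar> \<le> real n" by (auto simp: u_def clip_def)
        ultimately have "\<Psi> (u x - v j x) \<le> \<Psi> (2 * real n)" by (intro \<Psi>_mono) linarith
        with True show ?thesis by (simp add: ennreal_leI)
      qed (simp add: u0 v0)
    qed
    show "(\<integral>\<^sup>+x. ennreal (\<Psi> (2 * real n)) * indicator (cball 0 (R + 1)) (x::'a) \<partial>lborel) < \<infinity>"
      using emeasure_bounded_finite[of "cball (0::'a) (R + 1)"]
      by (simp add: nn_integral_cmult_indicator ennreal_mult_less_top less_top)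
    have "AE x in lebesgue. x \<notin> N" using N by (simp add: negligible_iff_null_sets AE_not_in)
    then have "AE x in lborel. x \<notin> N" by (simp add: AE_completion_iff)
    then show "AE x in lborel. (\<lambda>j. ennreal (\<Psi> (u x - v j x))) \<longlonglongrightarrow> 0"
    proof eventually_elim
      fix x assume "x \<notin> N"
      then have "(\<lambda>j. v j x) \<longlonglongrightarrow> cut x * u x"
        unfolding v_def u_def clip_def by (intro tendsto_intros lim)
      moreover have "cut x * u x = u x"
        using R[of x] by (cases "g x = 0") (auto simp: cut_def u_def clip_def)
      ultimately have "(\<lambda>j. \<Psi> (u x - v j x)) \<longlonglongrightarrow> \<Psi> (u x - u x)"
        by (intro \<Psi>_tendsto tendsto_intros) simp
      then show "(\<lambda>j. ennreal (\<Psi> (u x - v j x))) \<longlonglongrightarrow> 0"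
        using tendsto_ennrealI by fastforce
    qed
  qed measurable
  then have "\<forall>\<^sub>F j in sequentially. (\<integral>\<^sup>+x. ennreal (\<Psi> (u x - v j x)) \<partial>lborel) < ennreal r"
    using r by (intro order_tendstoD(2)) auto
  then obtain j where j: "(\<integral>\<^sup>+x. ennreal (\<Psi> (u x - v j x)) \<partial>lborel) < ennreal r"
    by (metis (no_types, lifting) eventually_happens sequentially_bot)
  show ?thesis
  proof
    show "continuous_on UNIV (v j)" by (rule vc)
    show "bounded {x. v j x \<noteq> 0}"
      using v0[of _ j] by (intro bounded_subset[OF bounded_cball[of 0 "R + 1"]]) blast
    have "(\<integral>\<^sup>+x. ennreal (\<Psi> (g x - v j x)) \<partial>lborel) = (\<integral>\<^sup>+x. ennreal (\<Psi> ((g x - u x) + (u x - v j x))) \<partial>lborel)"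
      by simp
    also have "\<dots> \<le> ennreal K * ((\<integral>\<^sup>+x. ennreal (\<Psi> (g x - u x)) \<partial>lborel) + (\<integral>\<^sup>+x. ennreal (\<Psi> (u x - v j x)) \<partial>lborel))"
      by (rule nn_integral_\<Psi>_add) measurable
    also have "\<dots> \<le> ennreal K * (ennreal r + ennreal r)"
      using n j by (intro mult_left_mono add_mono) (auto simp: u_def)
    also have "\<dots> = ennreal e" using r K by (simp flip: ennreal_plus ennreal_mult)
    finally show "(\<integral>\<^sup>+x. ennreal (\<Psi> (g x - v j x)) \<partial>lborel) \<le> ennreal e" .
  qed
qed

text \<open>For a continuous k of bounded support this is uniform continuity; g differs from k by a
  small modular, both before and after the shift.\<close>

lemma translation_continuous:
  fixes g :: "'a::euclidean_space \<Rightarrow> real"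
  assumes g [measurable]: "g \<in> borel_measurable borel" and supp: "bounded {x. g x \<noteq> 0}"
    and fin: "(\<integral>\<^sup>+x. ennreal (\<Psi> (g x)) \<partial>lborel) < \<infinity>" and e: "0 < e"
  obtains d where "0 < d" "\<And>z. norm z < d \<Longrightarrow> (\<integral>\<^sup>+x. ennreal (\<Psi> (g (x - z) - g x)) \<partial>lborel) \<le> ennreal e"
proof -
  \<comment> \<open>Three errors of size r, joined by two applications of \<open>\<Psi>_add\<close>,
    amount to K(r + K(r + r)) \<le> 3 K^2 r.\<close>
  define r where "r = e / (3 * K\<^sup>2)"
  have r: "0 < r" "3 * (K * K * r) = e" using e K by (auto simp: r_def field_simps power2_eq_square)
  obtain k where kc: "continuous_on UNIV k" and ks: "bounded {x. k x \<noteq> 0}"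
    and k: "(\<integral>\<^sup>+x. ennreal (\<Psi> (g x - k x)) \<partial>lborel) \<le> ennreal r"
    using approx_continuous[OF g supp fin r(1)] by blast
  note [measurable] = continuous_borel[OF kc]
  obtain R where R: "\<And>x. k x \<noteq> 0 \<Longrightarrow> norm x \<le> R" using ks unfolding bounded_iff by blast
  define V where "V = measure lborel (cball (0::'a) (R + 1))"
  have V: "emeasure lborel (cball (0::'a) (R + 1)) = ennreal V" "0 \<le> V"
    using emeasure_bounded_finite[of "cball (0::'a) (R + 1)"]
    by (auto simp: V_def emeasure_eq_ennreal_measure less_top)
  have "(\<Psi> \<longlongrightarrow> \<Psi> 0) (at 0)" by (rule \<Psi>_tendsto) simp
  then have "\<forall>\<^sub>F t in at 0. \<Psi> t < r / (V + 1)"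
    using r V by (intro order_tendstoD(2)) auto
  then obtain \<eta> where \<eta>1: "0 < \<eta>" and \<eta>': "\<And>t. t \<noteq> 0 \<Longrightarrow> \<bar>t\<bar> < \<eta> \<Longrightarrow> \<Psi> t < r / (V + 1)"
    unfolding eventually_at by (auto simp: dist_real_def)
  have \<eta>2: "\<Psi> t \<le> r / (V + 1)" if "\<bar>t\<bar> < \<eta>" for t
    using \<eta>'[of t] that r V by (cases "t = 0") auto
  note \<eta> = \<eta>1 \<eta>2
  have "uniformly_continuous_on (cball 0 (R + 2)) k"
    by (intro compact_uniformly_continuous continuous_on_subset[OF kc]) auto
  then obtain d where d: "0 < d" "\<And>x y. x \<in> cball 0 (R + 2) \<Longrightarrow> y \<in> cball 0 (R + 2) \<Longrightarrow> dist x y < d \<Longrightarrow> dist (k x) (k y) < \<eta>"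
    unfolding uniformly_continuous_on_def using \<eta>(1) by blast
  show ?thesis
  proof
    show "0 < min d 1" using d by simp
    fix z :: 'a assume z: "norm z < min d 1"
    have pt: "ennreal (\<Psi> (k (x - z) - k x)) \<le> ennreal (r / (V + 1)) * indicator (cball 0 (R + 1)) x" for x
    proof (cases "norm x \<le> R + 1")
      case True
      then have "norm (x - z) \<le> R + 2" using z norm_triangle_ineq4[of x z] by simp
      then have "\<bar>k (x - z) - k x\<bar> < \<eta>"
        using d(2)[of "x - z" x] True z by (simp add: dist_norm norm_minus_commute)
      then show ?thesis using \<eta>(2) True by (simp add: ennreal_leI)
    next
      case False
      have "norm x \<le> norm (x - z) + norm z" using norm_triangle_ineq[of "x - z" z] by simp
      then have "k x = 0" "k (x - z) = 0" using False z R[of x] R[of "x - z"] by fastforce+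
      then show ?thesis by simp
    qed
    have A: "(\<integral>\<^sup>+x. ennreal (\<Psi> (g (x - z) - k (x - z))) \<partial>lborel) \<le> ennreal r"
      using lborel_nn_integral_translate[of "\<lambda>x. ennreal (\<Psi> (g x - k x))" "- z"] k by simp
    have C: "(\<integral>\<^sup>+x. ennreal (\<Psi> (k x - g x)) \<partial>lborel) \<le> ennreal r"
      using k \<Psi>_mono[of "k x - g x" "g x - k x" for x]
      by (intro order_trans[OF nn_integral_mono k]) (auto intro!: ennreal_leI \<Psi>_mono)
    have "(\<integral>\<^sup>+x. ennreal (\<Psi> (k (x - z) - k x)) \<partial>lborel) \<le> (\<integral>\<^sup>+x. ennreal (r / (V + 1)) * indicator (cball 0 (R + 1)) (x::'a) \<partial>lborel)"
      by (intro nn_integral_mono pt)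
    also have "\<dots> = ennreal (r / (V + 1) * V)"
      using V r by (simp add: nn_integral_cmult_indicator) (subst ennreal_mult[symmetric], auto)
    also have "\<dots> \<le> ennreal r" using V r by (intro ennreal_leI) (simp add: field_simps)
    finally have B: "(\<integral>\<^sup>+x. ennreal (\<Psi> (k (x - z) - k x)) \<partial>lborel) \<le> ennreal r" .
    have "(\<integral>\<^sup>+x. ennreal (\<Psi> (g (x - z) - g x)) \<partial>lborel)
      = (\<integral>\<^sup>+x. ennreal (\<Psi> ((g (x - z) - k (x - z)) + ((k (x - z) - k x) + (k x - g x)))) \<partial>lborel)"
      by simp
    also have "\<dots> \<le> ennreal K * ((\<integral>\<^sup>+x. ennreal (\<Psi> (g (x - z) - k (x - z))) \<partial>lborel)
        + (\<integral>\<^sup>+x. ennreal (\<Psi> ((k (x - z) - k x) + (k x - g x))) \<partial>lborel))"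
      by (rule nn_integral_\<Psi>_add) measurable
    also have "\<dots> \<le> ennreal K * (ennreal r + ennreal K * (ennreal r + ennreal r))"
      by (intro mult_left_mono add_mono A order_trans[OF nn_integral_\<Psi>_add]) (auto intro!: mult_left_mono add_mono B C)
    also have "\<dots> = ennreal (K * (r + K * (r + r)))"
      using K r by (simp flip: ennreal_plus ennreal_mult)
    also have "\<dots> \<le> ennreal e"
    proof (rule ennreal_leI)
      have "1 * (K * r) \<le> K * (K * r)" using K r by (intro mult_right_mono) auto
      then show "K * (r + K * (r + r)) \<le> e" using r(2) by (simp add: algebra_simps)
    qed
    finally show "(\<integral>\<^sup>+x. ennreal (\<Psi> (g (x - z) - g x)) \<partial>lborel) \<le> ennreal e" .
  qed
qed

text \<open>Integrate the supporting line at the mean value against the probability density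
  \<rho>.\<close>

lemma Jensen:
  fixes \<rho> v :: "'a::euclidean_space \<Rightarrow> real"
  assumes \<rho>: "integrable lborel \<rho>" "\<And>z. 0 \<le> \<rho> z" "(\<integral>z. \<rho> z \<partial>lborel) = 1"
    and v [measurable]: "v \<in> borel_measurable borel" and \<rho>v: "integrable lborel (\<lambda>z. \<rho> z * v z)"
  shows "ennreal (\<Psi> (\<integral>z. \<rho> z * v z \<partial>lborel)) \<le> (\<integral>\<^sup>+z. ennreal (\<rho> z * \<Psi> (v z)) \<partial>lborel)"
proof (cases "(\<integral>\<^sup>+z. ennreal (\<rho> z * \<Psi> (v z)) \<partial>lborel) < \<infinity>")
  case True
  have [measurable]: "\<rho> \<in> borel_measurable borel" using borel_measurable_integrable[OF \<rho>(1)] by simp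
  have int: "integrable lborel (\<lambda>z. \<rho> z * \<Psi> (v z))"
    using True \<rho>(2) by (intro integrableI_nonneg) auto
  define s where "s = (\<integral>z. \<rho> z * v z \<partial>lborel)"
  obtain c where c: "\<And>t. \<Psi> s + c * (t - s) \<le> \<Psi> t" using \<Psi>_tangent by blast
  have "\<Psi> s = (\<integral>z. \<Psi> s * \<rho> z + c * (\<rho> z * v z - s * \<rho> z) \<partial>lborel)"
    using \<rho> \<rho>v by (simp add: s_def)
  also have "\<dots> \<le> (\<integral>z. \<rho> z * \<Psi> (v z) \<partial>lborel)"
  proof (rule integral_mono[OF _ int])
    fix z show "\<Psi> s * \<rho> z + c * (\<rho> z * v z - s * \<rho> z) \<le> \<rho> z * \<Psi> (v z)"
      using mult_left_mono[OF c[of "v z"] \<rho>(2)[of z]] by (simp add: algebra_simps)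
  qed (use \<rho> \<rho>v in auto)
  finally show ?thesis
    using int \<rho>(2) by (simp add: s_def nn_integral_eq_integral ennreal_leI)
qed (simp add: not_less top_unique)

end

section \<open>Convolution with smooth kernels\<close>

definition conv :: "('a::euclidean_space \<Rightarrow> real) \<Rightarrow> ('a \<Rightarrow> real) \<Rightarrow> 'a \<Rightarrow> real" where
  "conv \<rho> w x = (\<integral>y. \<rho> (x - y) * w y \<partial>lborel)"

lemma conv_alt:
  assumes [measurable]: "\<rho> \<in> borel_measurable borel" "w \<in> borel_measurable borel"
  shows "conv \<rho> w x = (\<integral>z. \<rho> z * w (x - z) \<partial>lborel)"
  using lborel_integral_reflect[of "\<lambda>z. \<rho> z * w (x - z)" x] by (simp add: conv_def)

lemma conv_nonzeroD: "conv \<rho> w x \<noteq> 0 \<Longrightarrow> \<exists>y. w y \<noteq> 0 \<and> \<rho> (x - y) \<noteq> 0"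
  unfolding conv_def by (rule ccontr) (metis (mono_tags, lifting) Bochner_Integration.integral_cong integral_zero mult_eq_0_iff)

lemma integrable_mult_bounded:
  fixes \<rho> w :: "'a::euclidean_space \<Rightarrow> real"
  assumes "integrable lborel w" "\<rho> \<in> borel_measurable borel" "\<And>x. \<bar>\<rho> x\<bar> \<le> B"
  shows "integrable lborel (\<lambda>x. \<rho> x * w x)"
proof (rule Bochner_Integration.integrable_bound[OF integrable_mult_right[OF assms(1), of B]])
  show "(\<lambda>x. \<rho> x * w x) \<in> borel_measurable lborel"
    using assms borel_measurable_integrable[OF assms(1)] by measurable
  show "AE x in lborel. norm (\<rho> x * w x) \<le> norm (B * w x)"
    using assms(3) by (intro AE_I2) (metis abs_ge_self abs_mult mult_right_mono norm_ge_zero order_trans real_norm_def)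
qed

lemma integrable_kernel:
  fixes \<rho> w :: "'a::euclidean_space \<Rightarrow> real"
  assumes "integrable lborel w" "continuous_on UNIV \<rho>" "bounded {x. \<rho> x \<noteq> 0}"
  shows "integrable lborel (\<lambda>y. \<rho> (x - y) * w y)"
proof -
  obtain B where B: "\<And>x. \<bar>\<rho> x\<bar> \<le> B" using bounded_range_bounded_support[OF assms(2,3)] by blast
  have "continuous_on UNIV (\<lambda>y. \<rho> (x - y))"
    by (rule continuous_on_compose2[OF assms(2)]) (auto intro!: continuous_intros)
  then show ?thesis using assms(1) B by (intro integrable_mult_bounded[where B = B] continuous_borel)
qed

text \<open>Jensen's inequality and Tonelli's theorem bound the error by the \<rho>-average of
  translation errors. The kernel must live in a small ball around 0 but need not be centred, which
  leaves room for shifted kernels.\<close>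

lemma (in modular) conv_approx:
  fixes g :: "'a::euclidean_space \<Rightarrow> real"
  assumes g: "integrable lborel g" and supp: "bounded {x. g x \<noteq> 0}"
    and fin: "(\<integral>\<^sup>+x. ennreal (\<Psi> (g x)) \<partial>lborel) < \<infinity>" and e: "0 < e"
  obtains d where "0 < d"
    "\<And>\<rho>. \<lbrakk>continuous_on UNIV \<rho>; \<And>z. 0 \<le> \<rho> z; (\<integral>z. \<rho> z \<partial>lborel) = 1; \<And>z. \<rho> z \<noteq> 0 \<Longrightarrow> norm z < d\<rbrakk>
      \<Longrightarrow> (\<integral>\<^sup>+x. ennreal (\<Psi> (conv \<rho> g x - g x)) \<partial>lborel) \<le> ennreal e"
proof -
  have gm [measurable]: "g \<in> borel_measurable borel" using borel_measurable_integrable[OF g] by simp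
  obtain d where d: "0 < d" "\<And>z. norm z < d \<Longrightarrow> (\<integral>\<^sup>+x. ennreal (\<Psi> (g (x - z) - g x)) \<partial>lborel) \<le> ennreal e"
    using translation_continuous[OF gm supp fin e] by blast
  show ?thesis
  proof
    show "0 < d" by fact
    fix \<rho> :: "'a \<Rightarrow> real"
    assume \<rho>: "continuous_on UNIV \<rho>" "\<And>z. 0 \<le> \<rho> z" "(\<integral>z. \<rho> z \<partial>lborel) = 1" "\<And>z. \<rho> z \<noteq> 0 \<Longrightarrow> norm z < d"
    have bs: "bounded {x. \<rho> x \<noteq> 0}"
      using \<rho>(4) by (intro bounded_subset[OF bounded_ball[of 0 d]]) auto
    note [measurable] = continuous_borel[OF \<rho>(1)]
    obtain B where B: "\<And>x. \<bar>\<rho> x\<bar> \<le> B" using bounded_range_bounded_support[OF \<rho>(1) bs] by blast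
    have \<rho>i: "integrable lborel \<rho>" by (rule integrable_bounded_support[OF \<rho>(1) bs])
    have \<rho>g: "integrable lborel (\<lambda>z. \<rho> z * g (x - z))" for x
      by (rule integrable_mult_bounded[where B = B]) (use g B in \<open>auto simp: lborel_integrable_reflect\<close>)
    have "ennreal (\<Psi> (conv \<rho> g x - g x)) \<le> (\<integral>\<^sup>+z. ennreal (\<rho> z * \<Psi> (g (x - z) - g x)) \<partial>lborel)" for x
    proof -
      have "conv \<rho> g x - g x = (\<integral>z. \<rho> z * (g (x - z) - g x) \<partial>lborel)"
        using \<rho> \<rho>i \<rho>g[of x] by (simp add: conv_alt right_diff_distrib)
      moreover have "integrable lborel (\<lambda>z. \<rho> z * (g (x - z) - g x))"
        using \<rho>i \<rho>g[of x] by (simp add: right_diff_distrib)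
      ultimately show ?thesis using Jensen[OF \<rho>i \<rho>(2,3), of "\<lambda>z. g (x - z) - g x"] by simp
    qed
    then have "(\<integral>\<^sup>+x. ennreal (\<Psi> (conv \<rho> g x - g x)) \<partial>lborel)
      \<le> (\<integral>\<^sup>+x. (\<integral>\<^sup>+z. ennreal (\<rho> z * \<Psi> (g (x - z) - g x)) \<partial>lborel) \<partial>lborel)"
      by (rule nn_integral_mono)
    also have "\<dots> = (\<integral>\<^sup>+z. (\<integral>\<^sup>+x. ennreal (\<rho> z * \<Psi> (g (x - z) - g x)) \<partial>lborel) \<partial>lborel)"
      by (rule lborel_pair.Fubini') measurable
    also have "\<dots> = (\<integral>\<^sup>+z. ennreal (\<rho> z) * (\<integral>\<^sup>+x. ennreal (\<Psi> (g (x - z) - g x)) \<partial>lborel) \<partial>lborel)"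
      using \<rho>(2) by (simp add: ennreal_mult nn_integral_cmult)
    also have "\<dots> \<le> (\<integral>\<^sup>+z. ennreal (\<rho> z) * ennreal e \<partial>lborel)"
    proof (intro nn_integral_mono)
      fix z show "ennreal (\<rho> z) * (\<integral>\<^sup>+x. ennreal (\<Psi> (g (x - z) - g x)) \<partial>lborel) \<le> ennreal (\<rho> z) * ennreal e"
        using d(2)[of z] \<rho>(4)[of z] by (cases "\<rho> z = 0") (auto intro: mult_left_mono)
    qed
    also have "\<dots> = ennreal e"
      using \<rho> \<rho>i by (simp add: nn_integral_multc nn_integral_eq_integral)
    finally show "(\<integral>\<^sup>+x. ennreal (\<Psi> (conv \<rho> g x - g x)) \<partial>lborel) \<le> ennreal e" .
  qed
qed

lemma modular_abs: "modular abs 1"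
proof
  show "\<exists>c. \<forall>s. \<bar>t\<bar> + c * (s - t) \<le> \<bar>s\<bar>" for t :: real
    by (rule exI[of _ "sgn t"]) (auto simp: sgn_if abs_if)
qed (auto intro!: continuous_intros)

lemma (in growth) modular_\<Phi>: "modular \<Phi> (2 powr m)"
proof
  show "1 \<le> 2 powr m" using m by (simp add: ge_one_powr_ge_zero)
  show "\<exists>c. \<forall>s. \<Phi> t + c * (s - t) \<le> \<Phi> s" for t using \<Phi>_tangent by blast
qed (use \<Phi>_continuous \<Phi>_mono \<Phi>_add in auto)

text \<open>Differentiation under the integral: \<rho> is Lipschitz with constant L, so the
  remainder of the first-order expansion, divided by |h|, is dominated by 2 L |w|.\<close>

lemma conv_has_derivative:
  fixes \<rho> w :: "real^'n \<Rightarrow> real"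
  assumes \<rho>: "smooth \<rho>" "bounded {x. \<rho> x \<noteq> 0}" and w: "integrable lborel w"
  shows "(conv \<rho> w has_derivative (\<lambda>h. \<Sum>i\<in>UNIV. h $ i * conv (partial_deriv i \<rho>) w x)) (at x)"
proof -
  have \<rho>c: "continuous_on UNIV \<rho>" by (rule smooth_continuous[OF \<rho>(1)])
  have pc: "continuous_on UNIV (partial_deriv i \<rho>)" for i
    by (rule smooth_continuous[OF smooth_partial_deriv[OF \<rho>(1)]])
  have ps: "bounded {x. partial_deriv i \<rho> x \<noteq> 0}" for i
    by (rule bounded_partial_deriv_support[OF \<rho>(2)])
  note [measurable] = continuous_borel[OF \<rho>c] continuous_borel[OF pc]
  have [measurable]: "w \<in> borel_measurable borel" using borel_measurable_integrable[OF w] by simp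
  define D where "D z h = (\<Sum>i\<in>UNIV. h $ i * partial_deriv i \<rho> z)" for z h
  have D: "(\<rho> has_derivative D z) (at z)" for z
    unfolding D_def by (rule differentiable_imp_has_derivative_partials[OF smooth_differentiable[OF \<rho>(1)]])
  obtain B where B: "\<And>i x. \<bar>partial_deriv i \<rho> x\<bar> \<le> B i"
  proof -
    have "\<forall>i. \<exists>b. \<forall>x. \<bar>partial_deriv i \<rho> x\<bar> \<le> b"
      using bounded_range_bounded_support[OF pc ps] by metis
    then show ?thesis using that by metis
  qed
  define L where "L = (\<Sum>i\<in>UNIV. B i)"
  have DL: "\<bar>D z h\<bar> \<le> L * norm h" for z h
  proof -
    have "\<bar>D z h\<bar> \<le> (\<Sum>i\<in>UNIV. \<bar>h $ i * partial_deriv i \<rho> z\<bar>)" unfolding D_def by (rule sum_abs)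
    also have "\<dots> \<le> (\<Sum>i\<in>UNIV. norm h * B i)"
      unfolding abs_mult by (intro sum_mono mult_mono component_le_norm_cart B) auto
    finally show ?thesis by (simp add: L_def sum_distrib_left mult.commute)
  qed
  have lip: "\<bar>\<rho> a - \<rho> b\<bar> \<le> L * norm (a - b)" for a b
  proof -
    have "norm (\<rho> a - \<rho> b) \<le> L * norm (a - b)"
      using D DL by (intro differentiable_bound[of UNIV \<rho> D]) (auto intro: onorm_le)
    then show ?thesis by simp
  qed
  define q where "q h y = (\<rho> (x + h - y) - \<rho> (x - y) - D (x - y) h) / norm h * w y" for h y
  have qB: "norm (q h y) \<le> 2 * L * \<bar>w y\<bar>" if "h \<noteq> 0" for h y
  proof -
    have "\<bar>\<rho> (x + h - y) - \<rho> (x - y) - D (x - y) h\<bar> \<le> 2 * L * norm h"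
      using lip[of "x + h - y" "x - y"] DL[of "x - y" h] by (simp add: algebra_simps)
    then have "\<bar>\<rho> (x + h - y) - \<rho> (x - y) - D (x - y) h\<bar> / norm h \<le> 2 * L"
      using that by (simp add: field_simps)
    then have "\<bar>\<rho> (x + h - y) - \<rho> (x - y) - D (x - y) h\<bar> / norm h * \<bar>w y\<bar> \<le> 2 * L * \<bar>w y\<bar>"
      by (rule mult_right_mono) simp
    then show ?thesis by (simp add: q_def abs_mult)
  qed
  have int: "integrable lborel (\<lambda>y. \<rho> (z - y) * w y)" "integrable lborel (\<lambda>y. partial_deriv i \<rho> (z - y) * w y)" for z i
    using w \<rho>c \<rho>(2) pc ps by (auto intro!: integrable_kernel)
  have eq: "norm (conv \<rho> w (x + h) - conv \<rho> w x - (\<Sum>i\<in>UNIV. h $ i * conv (partial_deriv i \<rho>) w x)) / norm h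
      = norm (\<integral>y. q h y \<partial>lborel)" for h
  proof -
    have "(\<integral>y. q h y \<partial>lborel) = (\<integral>y. (\<rho> (x + h - y) * w y - \<rho> (x - y) * w y
        - (\<Sum>i\<in>UNIV. h $ i * (partial_deriv i \<rho> (x - y) * w y))) / norm h \<partial>lborel)"
      by (intro Bochner_Integration.integral_cong refl)
        (simp add: q_def D_def left_diff_distrib sum_distrib_right mult.assoc)
    also have "\<dots> = (conv \<rho> w (x + h) - conv \<rho> w x - (\<Sum>i\<in>UNIV. h $ i * conv (partial_deriv i \<rho>) w x)) / norm h"
      using int by (simp add: conv_def)
    finally show ?thesis by simp
  qed
  have "((\<lambda>h. \<integral>y. q h y \<partial>lborel) \<longlongrightarrow> 0) (at 0)"
    unfolding tendsto_at_iff_sequentially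
  proof (intro allI impI)
    fix X :: "nat \<Rightarrow> real^'n" assume X: "\<forall>i. X i \<in> UNIV - {0}" "X \<longlonglongrightarrow> 0"
    have "(\<lambda>n. \<integral>y. q (X n) y \<partial>lborel) \<longlonglongrightarrow> (\<integral>y. 0 \<partial>(lborel :: (real^'n) measure))"
    proof (rule integral_dominated_convergence[where w = "\<lambda>y. 2 * L * \<bar>w y\<bar>"])
      show "integrable lborel (\<lambda>y. 2 * L * \<bar>w y\<bar>)" using w by simp
      show "q (X n) \<in> borel_measurable lborel" for n unfolding q_def D_def by measurable
      show "AE y in lborel. norm (q (X n) y) \<le> 2 * L * \<bar>w y\<bar>" for n using qB X by auto
      show "AE y in lborel. (\<lambda>n. q (X n) y) \<longlonglongrightarrow> 0"
      proof (intro AE_I2)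
        fix y
        have e: "x + X n - y = x - y + X n" for n by simp
        have "(\<lambda>h. norm (\<rho> (x - y + h) - \<rho> (x - y) - D (x - y) h) / norm h) \<midarrow>0\<rightarrow> 0"
          using D[of "x - y"] by (simp add: has_derivative_at)
        then have "(\<lambda>n. norm (\<rho> (x - y + X n) - \<rho> (x - y) - D (x - y) (X n)) / norm (X n)) \<longlonglongrightarrow> 0"
          using X unfolding tendsto_at_iff_sequentially by (auto simp: comp_def)
        then have "(\<lambda>n. norm (\<rho> (x - y + X n) - \<rho> (x - y) - D (x - y) (X n)) / norm (X n) * \<bar>w y\<bar>) \<longlonglongrightarrow> 0"
          by (rule tendsto_mult_left_zero)
        then have "(\<lambda>n. \<bar>q (X n) y\<bar>) \<longlonglongrightarrow> 0"
          by (simp only: q_def abs_mult abs_divide abs_norm_cancel real_norm_def e)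
        then show "(\<lambda>n. q (X n) y) \<longlonglongrightarrow> 0" by (simp add: tendsto_rabs_zero_iff)
      qed
    qed simp
    then show "((\<lambda>h. \<integral>y. q h y \<partial>lborel) \<circ> X) \<longlonglongrightarrow> 0" by (simp add: comp_def)
  qed
  then have "((\<lambda>h. norm (\<integral>y. q h y \<partial>lborel)) \<longlongrightarrow> 0) (at 0)" by (rule tendsto_norm_zero)
  moreover have "bounded_linear (\<lambda>h. \<Sum>i\<in>UNIV. h $ i * conv (partial_deriv i \<rho>) w x)"
    by (intro bounded_linear_sum bounded_linear_mult_const bounded_linear_vec_nth)
  ultimately show ?thesis unfolding has_derivative_at eq by simp
qed

lemma partial_deriv_conv:
  fixes \<rho> w :: "real^'n \<Rightarrow> real"
  assumes "smooth \<rho>" "bounded {x. \<rho> x \<noteq> 0}" "integrable lborel w"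
  shows "partial_deriv i (conv \<rho> w) x = conv (partial_deriv i \<rho>) w x"
proof -
  have "(\<Sum>j\<in>UNIV. axis i 1 $ j * conv (partial_deriv j \<rho>) w x) = (\<Sum>j\<in>UNIV. if j = i then conv (partial_deriv j \<rho>) w x else 0)"
    by (intro sum.cong) (auto simp: axis_def)
  then show ?thesis using partial_deriv_eq[OF conv_has_derivative[OF assms], of i x] by simp
qed

lemma smooth_conv:
  fixes \<rho> w :: "real^'n \<Rightarrow> real"
  assumes "smooth \<rho>" "bounded {x. \<rho> x \<noteq> 0}" "integrable lborel w"
  shows "smooth (conv \<rho> w)"
proof -
  have "Ck k (conv \<rho> w)" if "smooth \<rho>" "bounded {x. \<rho> x \<noteq> 0}" for k and \<rho> :: "real^'n \<Rightarrow> real"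
    using that
  proof (induction k arbitrary: \<rho>)
    case 0
    then show ?case using conv_has_derivative[OF 0 assms(3)]
      by (auto intro!: differentiable_imp_continuous_on differentiableI simp: differentiable_on_def)
  next
    case (Suc k)
    have "partial_deriv i (conv \<rho> w) = conv (partial_deriv i \<rho>) w" for i
      by (rule ext) (rule partial_deriv_conv[OF Suc.prems assms(3)])
    then show ?case using Suc conv_has_derivative[OF Suc.prems assms(3)]
      by (auto intro: differentiableI simp: smooth_partial_deriv bounded_partial_deriv_support)
  qed
  with assms show ?thesis by (simp add: smooth_def)
qed

text \<open>A centre c away from 0 makes the convolution shift its argument in a prescribed
  direction.\<close>

lemma exists_mollifier:
  fixes c :: "real^'n"
  assumes "0 < d"
  obtains \<rho> where "smooth \<rho>" "\<And>z. 0 \<le> \<rho> z" "(\<integral>z. \<rho> z \<partial>lborel) = 1" "\<And>z. \<rho> z \<noteq> 0 \<Longrightarrow> z \<in> ball c d"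
proof -
  define I where "I = (\<integral>z. bump c d z \<partial>lborel)"
  have bc: "continuous_on UNIV (bump c d)" by (rule smooth_continuous[OF smooth_bump])
  note [measurable] = continuous_borel[OF bc]
  have bi: "integrable lborel (bump c d)"
    using bump_nonzero_iff[OF assms, of c]
    by (intro integrable_bounded_support bc bounded_subset[OF bounded_ball[of c d]]) auto
  have "I \<noteq> 0"
  proof
    assume "I = 0"
    then have "AE z in lborel. bump c d z = 0"
      using integral_nonneg_eq_0_iff_AE[OF bi] bump_nonneg by (auto simp: I_def)
    then have "AE z in lborel. z \<notin> ball c d"
      by eventually_elim (use bump_nonzero_iff[OF assms] in auto)
    then have "ball c d \<in> null_sets lborel" by (subst AE_iff_null_sets) auto
    then have "measure lborel (ball c d) = 0" by (rule measure_eq_0_null_sets)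
    then show False using content_ball_pos[OF assms, of c] by simp
  qed
  moreover have "I \<ge> 0" unfolding I_def by (intro Bochner_Integration.integral_nonneg bump_nonneg)
  ultimately have I: "I > 0" by simp
  show ?thesis
  proof
    show "smooth (\<lambda>z. inverse I * bump c d z)" by (intro smooth_intros smooth_bump)
    show "0 \<le> inverse I * bump c d z" for z using I bump_nonneg[of c d z] by simp
    show "(\<integral>z. inverse I * bump c d z \<partial>lborel) = 1" using I by (simp add: I_def[symmetric])
    show "inverse I * bump c d z \<noteq> 0 \<Longrightarrow> z \<in> ball c d" for z
      using bump_nonzero_iff[OF assms, of c z] by auto
  qed
qed

section \<open>The closure of the test functions\<close>

sublocale growth \<subseteq> mod: modular \<Phi> "2 powr m"
  by (rule modular_\<Phi>)

lemma partial_deriv_sum: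
  assumes "\<And>j. j \<in> A \<Longrightarrow> f j differentiable (at x)"
  shows "partial_deriv i (\<lambda>x. \<Sum>j\<in>A. f j x) x = (\<Sum>j\<in>A. partial_deriv i (f j) x)"
  using partial_deriv_eq[OF has_derivative_sum[of A f "\<lambda>j. frechet_derivative (f j) (at x)" "at x"]] assms
  by (simp add: frechet_derivative_works partial_deriv_def)

lemma test_functionsD:
  assumes "\<eta> \<in> test_functions \<Omega>"
  shows "smooth \<eta>" "bounded {x. \<eta> x \<noteq> 0}" "x \<notin> \<Omega> \<Longrightarrow> \<eta> x = 0" "x \<notin> \<Omega> \<Longrightarrow> partial_deriv i \<eta> x = 0"
proof -
  show "smooth \<eta>" using assms by (simp add: test_functions_def)
  have c: "compact (closure {x. \<eta> x \<noteq> 0})" "closure {x. \<eta> x \<noteq> 0} \<subseteq> \<Omega>"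
    using assms by (auto simp: test_functions_def)
  show "bounded {x. \<eta> x \<noteq> 0}" using c(1) by simp
  show "x \<notin> \<Omega> \<Longrightarrow> \<eta> x = 0" using c(2) closure_subset[of "{x. \<eta> x \<noteq> 0}"] by blast
  show "x \<notin> \<Omega> \<Longrightarrow> partial_deriv i \<eta> x = 0" using c(2) by (intro partial_deriv_zero_outside) blast
qed

lemma test_functionsI:
  assumes "smooth \<eta>" "compact C" "C \<subseteq> \<Omega>" "\<And>x. \<eta> x \<noteq> 0 \<Longrightarrow> x \<in> C"
  shows "\<eta> \<in> test_functions \<Omega>"
proof -
  have "closure {x. \<eta> x \<noteq> 0} \<subseteq> C"
    using assms by (intro closure_minimal compact_imp_closed) auto
  moreover have "bounded {x. \<eta> x \<noteq> 0}"
    using assms by (intro bounded_subset[OF compact_imp_bounded[OF assms(2)]]) auto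
  ultimately show ?thesis using assms by (auto simp: test_functions_def)
qed

definition grad :: "(real^'n \<Rightarrow> real) \<Rightarrow> real^'n \<Rightarrow> real^'n" where
  "grad \<eta> x = (\<chi> i. partial_deriv i \<eta> x)"

lemma grad_component [simp]: "grad \<eta> x $ i = partial_deriv i \<eta> x"
  by (simp add: grad_def)

lemma borel_measurable_vecI:
  fixes f :: "'a \<Rightarrow> real^'n"
  assumes "\<And>i. (\<lambda>x. f x $ i) \<in> borel_measurable M"
  shows "f \<in> borel_measurable M"
  by (rule borel_measurable_euclidean_space[THEN iffD2])
    (use assms in \<open>auto simp: Basis_vec_def inner_axis\<close>)

lemma borel_measurable_vec_nth [measurable]:
  "f \<in> borel_measurable M \<Longrightarrow> (\<lambda>x. (f x :: real^'n) $ i) \<in> borel_measurable M"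
  by (rule borel_measurable_continuous_on[of "\<lambda>x. x $ i", simplified]) (auto intro!: continuous_intros)

lemma smooth_measurable:
  assumes "smooth \<eta>"
  shows "\<eta> \<in> borel_measurable borel" "partial_deriv i \<eta> \<in> borel_measurable borel" "grad \<eta> \<in> borel_measurable borel"
  using continuous_borel[OF smooth_continuous[OF assms]]
    continuous_borel[OF smooth_continuous[OF smooth_partial_deriv[OF assms]]]
  by (auto intro!: borel_measurable_vecI)

locale growth_domain = growth +
  fixes \<Omega> :: "(real^'n) set"
  assumes open_\<Omega>: "open \<Omega>" and bounded_\<Omega>: "bounded \<Omega>"
begin

abbreviation "\<T> \<equiv> test_functions \<Omega>"

abbreviation nm :: "(real^'n \<Rightarrow> real) \<Rightarrow> ennreal" where
  "nm u \<equiv> (\<integral>\<^sup>+x. ennreal (\<Phi> (u x)) \<partial>lborel)"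

text \<open>The working form of W_0^{1,\<Phi>}(\<Omega>): the gradient \<xi> is carried along as an
  argument, and approximation is measured by the modular. Up to null sets these pairs are the
  members of \<open>W10\<close> with their weak gradients, by \<open>W_in_W10\<close> and
  \<open>W10_imp_W\<close>.\<close>

definition W :: "(real^'n \<Rightarrow> real) \<Rightarrow> (real^'n \<Rightarrow> real^'n) \<Rightarrow> bool" where
  "W u \<xi> \<longleftrightarrow> u \<in> borel_measurable borel \<and> \<xi> \<in> borel_measurable borel \<and> (\<forall>x. x \<notin> \<Omega> \<longrightarrow> u x = 0 \<and> \<xi> x = 0)
    \<and> nm u < \<infinity> \<and> nm (\<lambda>x. norm (\<xi> x)) < \<infinity>
    \<and> (\<forall>e>0. \<exists>\<eta>\<in>\<T>. nm (\<lambda>x. u x - \<eta> x) \<le> ennreal e \<and> nm (\<lambda>x. norm (\<xi> x - grad \<eta> x)) \<le> ennreal e)"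

lemma WD:
  assumes "W u \<xi>"
  shows "u \<in> borel_measurable borel" "\<xi> \<in> borel_measurable borel" "x \<notin> \<Omega> \<Longrightarrow> u x = 0" "x \<notin> \<Omega> \<Longrightarrow> \<xi> x = 0"
    "nm u < \<infinity>" "nm (\<lambda>x. norm (\<xi> x)) < \<infinity>"
  using assms unfolding W_def by blast+

lemma W_approx:
  assumes "W u \<xi>" "0 < e"
  obtains \<eta> where "\<eta> \<in> \<T>" "nm (\<lambda>x. u x - \<eta> x) \<le> ennreal e" "nm (\<lambda>x. norm (\<xi> x - grad \<eta> x)) \<le> ennreal e"
  using assms unfolding W_def by blast

lemma nm_finite_bounded:
  assumes "continuous_on UNIV f" "bounded {x. f x \<noteq> 0}"
  shows "nm f < \<infinity>"
proof -
  have "integrable lborel (\<lambda>x. \<Phi> (f x))"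
  proof (rule integrable_bounded_support)
    show "continuous_on UNIV (\<lambda>x. \<Phi> (f x))"
      by (rule continuous_on_compose2[OF \<Phi>_continuous assms(1)]) auto
    show "bounded {x. \<Phi> (f x) \<noteq> 0}" using assms(2) by (rule bounded_subset) auto
  qed
  then show ?thesis by (simp add: nn_integral_eq_integral)
qed

lemma nm_norm_le_sum:
  fixes \<xi> :: "real^'n \<Rightarrow> real^'n"
  assumes [measurable]: "\<xi> \<in> borel_measurable borel"
  shows "nm (\<lambda>x. norm (\<xi> x)) \<le> ennreal (real CARD('n) powr m) * (\<Sum>i\<in>UNIV. nm (\<lambda>x. \<xi> x $ i))"
proof -
  have "nm (\<lambda>x. norm (\<xi> x)) \<le> (\<integral>\<^sup>+x. ennreal (real CARD('n) powr m) * (\<Sum>i\<in>UNIV. ennreal (\<Phi> (\<xi> x $ i))) \<partial>lborel)"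
  proof (intro nn_integral_mono)
    fix x
    have "ennreal (\<Phi> (norm (\<xi> x))) \<le> ennreal (real CARD('n) powr m * (\<Sum>i\<in>UNIV. \<Phi> (\<xi> x $ i)))"
      by (intro ennreal_leI \<Phi>_norm_le_sum)
    also have "\<dots> = ennreal (real CARD('n) powr m) * (\<Sum>i\<in>UNIV. ennreal (\<Phi> (\<xi> x $ i)))"
      by (subst ennreal_mult) (auto simp: sum_nonneg sum_ennreal)
    finally show "ennreal (\<Phi> (norm (\<xi> x))) \<le> ennreal (real CARD('n) powr m) * (\<Sum>i\<in>UNIV. ennreal (\<Phi> (\<xi> x $ i)))" .
  qed
  also have "\<dots> = ennreal (real CARD('n) powr m) * (\<Sum>i\<in>UNIV. nm (\<lambda>x. \<xi> x $ i))"
    by (simp add: nn_integral_cmult nn_integral_sum del: sum_ennreal)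
  finally show ?thesis .
qed

lemma nm_component_le: "nm (\<lambda>x. \<xi> x $ i) \<le> nm (\<lambda>x. norm (\<xi> x))"
  by (intro nn_integral_mono ennreal_leI \<Phi>_component_le)

lemma nm_norm_add:
  fixes f g :: "real^'n \<Rightarrow> 'b::{real_normed_vector, second_countable_topology}"
  assumes [measurable]: "f \<in> borel_measurable borel" "g \<in> borel_measurable borel"
  shows "nm (\<lambda>x. norm (f x + g x)) \<le> ennreal (2 powr m) * (nm (\<lambda>x. norm (f x)) + nm (\<lambda>x. norm (g x)))"
proof -
  have "nm (\<lambda>x. norm (f x + g x)) \<le> (\<integral>\<^sup>+x. ennreal (2 powr m) * (ennreal (\<Phi> (norm (f x))) + ennreal (\<Phi> (norm (g x)))) \<partial>lborel)"
  proof (intro nn_integral_mono)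
    fix x
    have "ennreal (\<Phi> (norm (f x + g x))) \<le> ennreal (2 powr m * (\<Phi> (norm (f x)) + \<Phi> (norm (g x))))"
      by (intro ennreal_leI \<Phi>_norm_add)
    then show "ennreal (\<Phi> (norm (f x + g x))) \<le> ennreal (2 powr m) * (ennreal (\<Phi> (norm (f x))) + ennreal (\<Phi> (norm (g x))))"
      by (simp add: ennreal_mult)
  qed
  also have "\<dots> = ennreal (2 powr m) * (nm (\<lambda>x. norm (f x)) + nm (\<lambda>x. norm (g x)))"
    by (simp add: nn_integral_cmult nn_integral_add)
  finally show ?thesis .
qed

lemma nm_scale_le:
  fixes f g :: "real^'n \<Rightarrow> real"
  assumes "1 \<le> C" "\<And>x. \<bar>f x\<bar> \<le> C * \<bar>g x\<bar>" and [measurable]: "g \<in> borel_measurable borel"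
  shows "nm f \<le> ennreal (C powr m) * nm g"
proof -
  have "nm f \<le> (\<integral>\<^sup>+x. ennreal (C powr m) * ennreal (\<Phi> (g x)) \<partial>lborel)"
    using assms \<Phi>_scale by (intro nn_integral_mono) (simp add: ennreal_leI flip: ennreal_mult)
  also have "\<dots> = ennreal (C powr m) * nm g" by (rule nn_integral_cmult) measurable
  finally show ?thesis .
qed

lemma nm_scale_finite:
  assumes "1 \<le> C" "\<And>x. \<bar>f x\<bar> \<le> C * \<bar>g x\<bar>" "g \<in> borel_measurable borel" "nm g < \<infinity>"
  shows "nm f < \<infinity>"
  by (rule order.strict_trans1[OF nm_scale_le[OF assms(1-3)]]) (use assms(4) in \<open>simp add: ennreal_mult_less_top\<close>)

lemma nm_add_finite:
  assumes "f \<in> borel_measurable borel" "g \<in> borel_measurable borel" "nm f < \<infinity>" "nm g < \<infinity>"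
  shows "nm (\<lambda>x. f x + g x) < \<infinity>"
  using mod.nn_integral_\<Psi>_add[of f lborel g] assms
  by (auto intro: order.strict_trans1 simp: ennreal_mult_less_top)

lemma nm_norm_finiteI:
  fixes \<xi> :: "real^'n \<Rightarrow> real^'n"
  assumes "\<xi> \<in> borel_measurable borel" "\<And>i. nm (\<lambda>x. \<xi> x $ i) < \<infinity>"
  shows "nm (\<lambda>x. norm (\<xi> x)) < \<infinity>"
  using nm_norm_le_sum[OF assms(1)] by (rule order.strict_trans1) (use assms(2) in \<open>simp add: ennreal_mult_less_top\<close>)

text \<open>Superlinearity gives |g| \<le> \<Phi>(g) + C, and the constant is integrable over the
  bounded set \<Omega>.\<close>

lemma nm_finite_integrable:
  assumes [measurable]: "g \<in> borel_measurable borel" and supp: "\<And>x. x \<notin> \<Omega> \<Longrightarrow> g x = 0" and fin: "nm g < \<infinity>"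
  shows "integrable lborel g"
proof -
  obtain C where C: "0 \<le> C" "\<And>t. \<bar>t\<bar> \<le> 1 * \<Phi> t + C" using superlinear[of 1] by auto
  have "(\<integral>\<^sup>+x. ennreal (norm (g x)) \<partial>lborel) \<le> (\<integral>\<^sup>+x. ennreal (\<Phi> (g x)) + ennreal C * indicator \<Omega> x \<partial>lborel)"
    using C supp by (intro nn_integral_mono) (auto simp: indicator_def ennreal_leI simp flip: ennreal_plus)
  also have "\<dots> = nm g + ennreal C * emeasure lborel \<Omega>"
    using open_\<Omega> by (subst nn_integral_add) (auto simp: nn_integral_cmult_indicator)
  also have "\<dots> < \<infinity>"
    using fin emeasure_bounded_finite[OF bounded_\<Omega>] by (simp add: ennreal_mult_less_top)
  finally show ?thesis by (intro integrableI_bounded) auto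
qed

lemma W_test: "\<eta> \<in> \<T> \<Longrightarrow> W \<eta> (grad \<eta>)"
proof -
  assume \<eta>: "\<eta> \<in> \<T>"
  note D = test_functionsD[OF \<eta>]
  note M = smooth_measurable[OF D(1)]
  have "nm (\<lambda>x. norm (grad \<eta> x)) < \<infinity>"
    using nm_finite_bounded[OF smooth_continuous[OF smooth_partial_deriv[OF D(1)]] bounded_partial_deriv_support[OF D(2)]]
    by (intro nm_norm_finiteI M) simp
  moreover have "nm \<eta> < \<infinity>" by (rule nm_finite_bounded[OF smooth_continuous[OF D(1)] D(2)])
  moreover have "grad \<eta> x = 0" if "x \<notin> \<Omega>" for x using D(4)[OF that] by (simp add: vec_eq_iff)
  ultimately show ?thesis using \<eta> M D(3) unfolding W_def by (auto intro!: bexI[of _ \<eta>])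
qed

lemma grad_add: "smooth \<eta> \<Longrightarrow> smooth \<theta> \<Longrightarrow> grad (\<lambda>x. \<eta> x + \<theta> x) x = grad \<eta> x + grad \<theta> x"
  by (simp add: vec_eq_iff partial_deriv_add smooth_differentiable)

lemma grad_cmult: "smooth \<eta> \<Longrightarrow> grad (\<lambda>x. c * \<eta> x) x = c *\<^sub>R grad \<eta> x"
proof -
  assume \<eta>: "smooth \<eta>"
  have "partial_deriv i (\<lambda>x. c * \<eta> x) x = c * partial_deriv i \<eta> x" for i
    using partial_deriv_compose(1)[where F = "\<lambda>y. c * y" and q = \<eta>] DERIV_cmult_Id smooth_differentiable[OF \<eta>] by blast
  then show ?thesis by (simp add: vec_eq_iff)
qed

lemma test_functions_support:
  assumes "\<eta> \<in> \<T>"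
  shows "compact (closure {x. \<eta> x \<noteq> 0})" "closure {x. \<eta> x \<noteq> 0} \<subseteq> \<Omega>" "\<eta> x \<noteq> 0 \<Longrightarrow> x \<in> closure {x. \<eta> x \<noteq> 0}"
  using assms closure_subset[of "{x. \<eta> x \<noteq> 0}"] by (auto simp: test_functions_def)

lemma test_add:
  assumes \<eta>: "\<eta> \<in> \<T>" and \<theta>: "\<theta> \<in> \<T>"
  shows "(\<lambda>x. \<eta> x + \<theta> x) \<in> \<T>"
proof (rule test_functionsI)
  show "smooth (\<lambda>x. \<eta> x + \<theta> x)" using \<eta> \<theta> by (intro smooth_add test_functionsD(1))
  show "compact (closure {x. \<eta> x \<noteq> 0} \<union> closure {x. \<theta> x \<noteq> 0})"
    using test_functions_support(1)[OF \<eta>] test_functions_support(1)[OF \<theta>] by (rule compact_Un)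
  show "closure {x. \<eta> x \<noteq> 0} \<union> closure {x. \<theta> x \<noteq> 0} \<subseteq> \<Omega>"
    using test_functions_support(2)[OF \<eta>] test_functions_support(2)[OF \<theta>] by (rule Un_least)
  show "x \<in> closure {x. \<eta> x \<noteq> 0} \<union> closure {x. \<theta> x \<noteq> 0}" if "\<eta> x + \<theta> x \<noteq> 0" for x
  proof -
    have "\<eta> x \<noteq> 0 \<or> \<theta> x \<noteq> 0" using that by auto
    then show ?thesis using test_functions_support(3)[OF \<eta>] test_functions_support(3)[OF \<theta>] by blast
  qed
qed

lemma test_cmult:
  assumes \<eta>: "\<eta> \<in> \<T>"
  shows "(\<lambda>x. c * \<eta> x) \<in> \<T>"
proof (rule test_functionsI[OF _ test_functions_support(1,2)[OF \<eta>]])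
  show "smooth (\<lambda>x. c * \<eta> x)" using \<eta> by (intro smooth_cmult test_functionsD(1))
  show "x \<in> closure {x. \<eta> x \<noteq> 0}" if "c * \<eta> x \<noteq> 0" for x
    using that test_functions_support(3)[OF \<eta>] by simp
qed

lemma test_zero: "(\<lambda>x. 0) \<in> \<T>"
  by (rule test_functionsI[where C = "{}"]) (auto intro: smooth_const)

lemma W_add:
  assumes u: "W u \<xi>" and v: "W v \<zeta>"
  shows "W (\<lambda>x. u x + v x) (\<lambda>x. \<xi> x + \<zeta> x)"
proof -
  note [measurable] = WD(1,2)[OF u] WD(1,2)[OF v]
  have "\<exists>\<eta>\<in>\<T>. nm (\<lambda>x. u x + v x - \<eta> x) \<le> ennreal e \<and> nm (\<lambda>x. norm (\<xi> x + \<zeta> x - grad \<eta> x)) \<le> ennreal e" if e: "0 < e" for e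
  proof -
    define r where "r = e / (2 * 2 powr m)"
    have r: "0 < r" "ennreal (2 powr m) * (ennreal r + ennreal r) = ennreal e"
      using e by (auto simp: r_def simp flip: ennreal_plus ennreal_mult)
    obtain \<eta> where \<eta>: "\<eta> \<in> \<T>" "nm (\<lambda>x. u x - \<eta> x) \<le> ennreal r" "nm (\<lambda>x. norm (\<xi> x - grad \<eta> x)) \<le> ennreal r"
      using W_approx[OF u r(1)] by blast
    obtain \<theta> where \<theta>: "\<theta> \<in> \<T>" "nm (\<lambda>x. v x - \<theta> x) \<le> ennreal r" "nm (\<lambda>x. norm (\<zeta> x - grad \<theta> x)) \<le> ennreal r"
      using W_approx[OF v r(1)] by blast
    note [measurable] = smooth_measurable[OF test_functionsD(1)[OF \<eta>(1)]] smooth_measurable[OF test_functionsD(1)[OF \<theta>(1)]]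
    have "nm (\<lambda>x. u x + v x - (\<eta> x + \<theta> x)) = nm (\<lambda>x. (u x - \<eta> x) + (v x - \<theta> x))"
      by (simp add: algebra_simps)
    also have "\<dots> \<le> ennreal (2 powr m) * (ennreal r + ennreal r)"
      by (intro order_trans[OF mod.nn_integral_\<Psi>_add] mult_left_mono add_mono \<eta> \<theta>) auto
    finally have 1: "nm (\<lambda>x. u x + v x - (\<eta> x + \<theta> x)) \<le> ennreal e" using r by simp
    have "nm (\<lambda>x. norm (\<xi> x + \<zeta> x - grad (\<lambda>x. \<eta> x + \<theta> x) x)) = nm (\<lambda>x. norm ((\<xi> x - grad \<eta> x) + (\<zeta> x - grad \<theta> x)))"
      using \<eta> \<theta> by (simp add: grad_add test_functionsD(1) algebra_simps)
    also have "\<dots> \<le> ennreal (2 powr m) * (ennreal r + ennreal r)"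
      by (intro order_trans[OF nm_norm_add] mult_left_mono add_mono \<eta> \<theta>) auto
    finally have "nm (\<lambda>x. norm (\<xi> x + \<zeta> x - grad (\<lambda>x. \<eta> x + \<theta> x) x)) \<le> ennreal e" using r by simp
    with 1 show ?thesis by (intro bexI[of _ "\<lambda>x. \<eta> x + \<theta> x"] conjI test_add[OF \<eta>(1) \<theta>(1)])
  qed
  moreover have "nm (\<lambda>x. norm (\<xi> x + \<zeta> x)) < \<infinity>"
    using WD(6)[OF u] WD(6)[OF v]
    by (intro order.strict_trans1[OF nm_norm_add]) (auto simp: ennreal_mult_less_top)
  moreover have "nm (\<lambda>x. u x + v x) < \<infinity>"
    using WD(1,5)[OF u] WD(1,5)[OF v] by (intro nm_add_finite)
  ultimately show ?thesis
    using WD(3,4)[OF u] WD(3,4)[OF v] unfolding W_def by auto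
qed

lemma W_cmult:
  assumes u: "W u \<xi>"
  shows "W (\<lambda>x. c * u x) (\<lambda>x. c *\<^sub>R \<xi> x)"
proof -
  note [measurable] = WD(1,2)[OF u]
  define C where "C = max 1 \<bar>c\<bar>"
  have C: "1 \<le> C" "\<bar>c\<bar> \<le> C" by (auto simp: C_def)
  have "\<exists>\<eta>\<in>\<T>. nm (\<lambda>x. c * u x - \<eta> x) \<le> ennreal e \<and> nm (\<lambda>x. norm (c *\<^sub>R \<xi> x - grad \<eta> x)) \<le> ennreal e" if e: "0 < e" for e
  proof -
    define r where "r = e / C powr m"
    have r: "0 < r" "ennreal (C powr m) * ennreal r = ennreal e"
      using e C by (auto simp: r_def simp flip: ennreal_mult)
    obtain \<eta> where \<eta>: "\<eta> \<in> \<T>" "nm (\<lambda>x. u x - \<eta> x) \<le> ennreal r" "nm (\<lambda>x. norm (\<xi> x - grad \<eta> x)) \<le> ennreal r"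
      using W_approx[OF u r(1)] by blast
    note [measurable] = smooth_measurable[OF test_functionsD(1)[OF \<eta>(1)]]
    have "nm (\<lambda>x. c * u x - c * \<eta> x) \<le> ennreal (C powr m) * nm (\<lambda>x. u x - \<eta> x)"
      using C by (intro nm_scale_le) (auto simp: abs_mult mult_right_mono simp flip: right_diff_distrib)
    also have "\<dots> \<le> ennreal (C powr m) * ennreal r" by (intro mult_left_mono \<eta>) simp
    finally have 1: "nm (\<lambda>x. c * u x - c * \<eta> x) \<le> ennreal e" using r by simp
    have "nm (\<lambda>x. norm (c *\<^sub>R \<xi> x - grad (\<lambda>x. c * \<eta> x) x)) \<le> ennreal (C powr m) * nm (\<lambda>x. norm (\<xi> x - grad \<eta> x))"
      using C \<eta> by (intro nm_scale_le)
        (auto simp: grad_cmult test_functionsD(1) mult_right_mono simp flip: scaleR_diff_right)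
    also have "\<dots> \<le> ennreal (C powr m) * ennreal r" by (intro mult_left_mono \<eta>) simp
    finally have "nm (\<lambda>x. norm (c *\<^sub>R \<xi> x - grad (\<lambda>x. c * \<eta> x) x)) \<le> ennreal e" using r by simp
    with 1 show ?thesis by (intro bexI[of _ "\<lambda>x. c * \<eta> x"] conjI test_cmult[OF \<eta>(1)])
  qed
  moreover have "nm (\<lambda>x. norm (c *\<^sub>R \<xi> x)) < \<infinity>"
    using C by (intro nm_scale_finite[OF C(1) _ _ WD(6)[OF u]]) (auto simp: mult_right_mono)
  moreover have "nm (\<lambda>x. c * u x) < \<infinity>"
    using C by (intro nm_scale_finite[OF C(1) _ _ WD(5)[OF u]]) (auto simp: abs_mult mult_right_mono)
  ultimately show ?thesis
    using WD(3,4)[OF u] unfolding W_def by auto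
qed

lemma W_zero: "W (\<lambda>x. 0) (\<lambda>x. 0)"
proof -
  have "grad (\<lambda>x. 0) = (\<lambda>x. 0 :: real^'n)"
    using grad_cmult[of "\<lambda>x. 0" 0] by (auto simp: smooth_const)
  then show ?thesis using W_test[OF test_zero] by simp
qed

lemma W_sum:
  assumes "finite F" "\<And>j. j \<in> F \<Longrightarrow> W (u j) (\<xi> j)"
  shows "W (\<lambda>x. \<Sum>j\<in>F. u j x) (\<lambda>x. \<Sum>j\<in>F. \<xi> j x)"
  using assms by (induction F) (auto intro: W_zero W_add)

section \<open>Weak gradients on the whole space and shifted mollification\<close>

text \<open>The test functions need not vanish on the boundary of \<Omega>. For functions extended
  by zero the identity thus also encodes the boundary condition: no boundary term arises.\<close>

definition weak_grad_on :: "(real^'n \<Rightarrow> real) \<Rightarrow> (real^'n \<Rightarrow> real^'n) \<Rightarrow> bool" where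
  "weak_grad_on u \<xi> \<longleftrightarrow> (\<forall>\<zeta> i. smooth \<zeta> \<longrightarrow> bounded {x. \<zeta> x \<noteq> 0} \<longrightarrow>
     (\<integral>x. u x * partial_deriv i \<zeta> x \<partial>lborel) = - (\<integral>x. \<xi> x $ i * \<zeta> x \<partial>lborel))"

text \<open>Mollifying with a kernel concentrated near \<open>t e\<close> shifts the support into \<open>\<Omega>\<close>.\<close>
lemma W_shift:
  assumes w: "w \<in> borel_measurable borel" "g \<in> borel_measurable borel"
    and off: "\<And>x. x \<notin> \<Omega> \<Longrightarrow> w x = 0" "\<And>x. x \<notin> \<Omega> \<Longrightarrow> g x = 0"
    and fin: "nm w < \<infinity>" "nm (\<lambda>x. norm (g x)) < \<infinity>"
    and wg: "weak_grad_on w g"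
    and C: "compact C" "\<And>x. w x \<noteq> 0 \<Longrightarrow> x \<in> C"
    and t0: "0 < t0" "\<And>t x. 0 < t \<Longrightarrow> t < t0 \<Longrightarrow> x \<in> C \<Longrightarrow> x + t *\<^sub>R e \<in> \<Omega>"
  shows "W w g"
proof -
  note [measurable] = w
  have wi: "integrable lborel w" by (rule nm_finite_integrable[OF w(1) off(1) fin(1)])
  have bsupp: "bounded {x. f x \<noteq> 0}" if "\<And>x. x \<notin> \<Omega> \<Longrightarrow> f x = 0" for f :: "real^'n \<Rightarrow> real"
    using that by (intro bounded_subset[OF bounded_\<Omega>]) auto
  have gfin: "nm (\<lambda>x. g x $ i) < \<infinity>" for i using nm_component_le fin(2) by (rule order.strict_trans1)
  have gi: "integrable lborel (\<lambda>x. g x $ i)" for i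
    using off(2) gfin by (intro nm_finite_integrable) auto
  have "\<exists>\<eta>\<in>\<T>. nm (\<lambda>x. w x - \<eta> x) \<le> ennreal \<epsilon> \<and> nm (\<lambda>x. norm (g x - grad \<eta> x)) \<le> ennreal \<epsilon>" if \<epsilon>: "0 < \<epsilon>" for \<epsilon>
  proof -
    \<comment> \<open>\<open>nm_norm_le_sum\<close> bounds the gradient error by N^m times the sum
      of N component errors.\<close>
    define r where "r = \<epsilon> / (real CARD('n) powr m * real CARD('n))"
    have r: "0 < r" using \<epsilon> by (simp add: r_def)
    obtain d0 where d0: "0 < d0" "\<And>\<rho>. \<lbrakk>continuous_on UNIV \<rho>; \<And>z. 0 \<le> \<rho> z; (\<integral>z. \<rho> z \<partial>lborel) = 1; \<And>z. \<rho> z \<noteq> 0 \<Longrightarrow> norm z < d0\<rbrakk>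
      \<Longrightarrow> nm (\<lambda>x. conv \<rho> w x - w x) \<le> ennreal \<epsilon>"
      using mod.conv_approx[OF wi bsupp[OF off(1)] fin(1) \<epsilon>] by blast
    define good where "good i d \<longleftrightarrow> 0 < d \<and> (\<forall>\<rho>. continuous_on UNIV \<rho> \<longrightarrow> (\<forall>z. 0 \<le> \<rho> z) \<longrightarrow> (\<integral>z. \<rho> z \<partial>lborel) = 1
      \<longrightarrow> (\<forall>z. \<rho> z \<noteq> 0 \<longrightarrow> norm z < d) \<longrightarrow> nm (\<lambda>x. conv \<rho> (\<lambda>x. g x $ i) x - g x $ i) \<le> ennreal r)" for i d
    have "\<exists>d. good i d" for i
    proof -
      have b: "bounded {x. g x $ i \<noteq> 0}" using off(2) by (intro bsupp) simp
      obtain d where "0 < d" "\<And>\<rho>. \<lbrakk>continuous_on UNIV \<rho>; \<And>z. 0 \<le> \<rho> z; (\<integral>z. \<rho> z \<partial>lborel) = 1; \<And>z. \<rho> z \<noteq> 0 \<Longrightarrow> norm z < d\<rbrakk>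
          \<Longrightarrow> nm (\<lambda>x. conv \<rho> (\<lambda>x. g x $ i) x - g x $ i) \<le> ennreal r"
        by (rule mod.conv_approx[OF gi[of i] b gfin[of i] r]) blast
      then have "good i d" unfolding good_def by blast
      then show ?thesis ..
    qed
    then obtain d where "\<And>i. good i (d i)" by metis
    then have d: "0 < d i" "\<lbrakk>continuous_on UNIV \<rho>; \<And>z. 0 \<le> \<rho> z; (\<integral>z. \<rho> z \<partial>lborel) = 1; \<And>z. \<rho> z \<noteq> 0 \<Longrightarrow> norm z < d i\<rbrakk>
      \<Longrightarrow> nm (\<lambda>x. conv \<rho> (\<lambda>x. g x $ i) x - g x $ i) \<le> ennreal r" for i \<rho>
      unfolding good_def by blast+
    define D where "D = min d0 (Min (range d))"
    have D: "0 < D" "D \<le> d0" "\<And>i. D \<le> d i" using d(1) d0(1) by (auto simp: D_def min_le_iff_disj)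
    \<comment> \<open>Half of D is spent on the shift t e, the other half on the radius \<delta> of
      the kernel, which therefore lives in the ball of radius D around 0.\<close>
    define t where "t = min (t0 / 2) (D / 2 / (norm e + 1))"
    have t: "0 < t" "t < t0" 
    proof -
      show "0 < t" using t0(1) D(1) by (simp add: t_def add_nonneg_pos)
      have "t \<le> t0 / 2" unfolding t_def by (rule min.cobounded1)
      then show "t < t0" using t0(1) by simp
    qed
    have "t \<le> D / 2 / (norm e + 1)" unfolding t_def by (rule min.cobounded2)
    moreover have "0 < norm e + 1" by (simp add: add_nonneg_pos)
    ultimately have "t * (norm e + 1) \<le> D / 2" using pos_le_divide_eq by blast
    then have te: "norm (t *\<^sub>R e) < D / 2" using t by (simp add: algebra_simps)
    \<comment> \<open>The set C that carries w, shifted by t e, is compact in \<Omega>; the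
      convolution lives within distance \<delta> of it, hence still inside \<Omega>.\<close>
    define C' where "C' = (\<lambda>x. x + t *\<^sub>R e) ` C"
    have "compact C'" unfolding C'_def by (intro compact_continuous_image continuous_intros C)
    moreover have "C' \<subseteq> \<Omega>" using t0(2) t by (auto simp: C'_def)
    ultimately obtain \<delta>0 where \<delta>0: "0 < \<delta>0" "(\<Union>x\<in>C'. ball x \<delta>0) \<subseteq> \<Omega>"
      using compact_subset_open_imp_ball_epsilon_subset[OF _ open_\<Omega>] by metis
    define \<delta> where "\<delta> = min (\<delta>0 / 2) (D / 2)"
    have \<delta>: "0 < \<delta>" "\<delta> < \<delta>0" "\<delta> \<le> D / 2" using \<delta>0 D by (auto simp: \<delta>_def)
    obtain \<rho> where \<rho>: "smooth \<rho>" "\<And>z. 0 \<le> \<rho> z" "(\<integral>z. \<rho> z \<partial>lborel) = 1" "\<And>z. \<rho> z \<noteq> 0 \<Longrightarrow> z \<in> ball (t *\<^sub>R e) \<delta>"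
      using exists_mollifier[OF \<delta>(1)] by blast
    have \<rho>c: "continuous_on UNIV \<rho>" by (rule smooth_continuous[OF \<rho>(1)])
    have \<rho>n: "norm z < D" if "\<rho> z \<noteq> 0" for z
    proof -
      have "norm z \<le> norm (t *\<^sub>R e) + dist (t *\<^sub>R e) z"
        using norm_triangle_ineq[of "t *\<^sub>R e" "z - t *\<^sub>R e"] by (simp add: dist_norm norm_minus_commute)
      then show ?thesis using \<rho>(4)[OF that] te \<delta>(3) by simp
    qed
    have \<rho>b: "bounded {x. \<rho> x \<noteq> 0}" using \<rho>n by (intro bounded_subset[OF bounded_ball[of 0 D]]) auto
    define \<eta> where "\<eta> = conv \<rho> w"
    have "\<eta> \<in> \<T>"
    proof (rule test_functionsI)
      show "smooth \<eta>" unfolding \<eta>_def by (rule smooth_conv[OF \<rho>(1) \<rho>b wi])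
      show "compact {x + y |x y. x \<in> C' \<and> y \<in> cball 0 \<delta>}"
        using \<open>compact C'\<close> by (intro compact_sums) auto
      show "{x + y |x y. x \<in> C' \<and> y \<in> cball 0 \<delta>} \<subseteq> \<Omega>"
        using \<delta>0(2) \<delta> by (fastforce simp: dist_norm)
      show "x \<in> {x + y |x y. x \<in> C' \<and> y \<in> cball 0 \<delta>}" if nz: "\<eta> x \<noteq> 0" for x
      proof -
        obtain y where y: "w y \<noteq> 0" "\<rho> (x - y) \<noteq> 0" using conv_nonzeroD[of \<rho> w x] nz unfolding \<eta>_def by blast
        have "x = (y + t *\<^sub>R e) + (x - y - t *\<^sub>R e)" by simp
        moreover have "y + t *\<^sub>R e \<in> C'" using C(2)[OF y(1)] by (auto simp: C'_def)
        moreover have "x - y - t *\<^sub>R e \<in> cball 0 \<delta>"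
          using \<rho>(4)[OF y(2)] by (simp add: dist_norm norm_minus_commute)
        ultimately show ?thesis by blast
      qed
    qed
    moreover have "nm (\<lambda>x. w x - \<eta> x) \<le> ennreal \<epsilon>"
    proof -
      have "nm (\<lambda>x. w x - \<eta> x) = nm (\<lambda>x. \<eta> x - w x)"
        by (intro nn_integral_cong) (metis \<Phi>_even minus_diff_eq)
      also have "\<dots> \<le> ennreal \<epsilon>" unfolding \<eta>_def
        using \<rho>c \<rho> \<rho>n D(2) by (intro d0(2)) (auto intro: less_le_trans)
      finally show ?thesis .
    qed
    moreover have "nm (\<lambda>x. norm (g x - grad \<eta> x)) \<le> ennreal \<epsilon>"
    proof -
      \<comment> \<open>The function y \<mapsto> \<rho>(x - y) may reach across the boundary, so the
        identity is needed for test functions on the whole space.\<close>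
      have pd: "partial_deriv i \<eta> x = conv \<rho> (\<lambda>x. g x $ i) x" for i x
      proof -
        have ref: "partial_deriv i (\<lambda>y. \<rho> (x - y)) y = - partial_deriv i \<rho> (x - y)" for y
          by (rule partial_deriv_reflect) (rule smooth_differentiable[OF \<rho>(1)])
        have "smooth (\<lambda>y. \<rho> (x - y))" by (rule smooth_reflect[OF \<rho>(1)])
        moreover have "bounded {y. \<rho> (x - y) \<noteq> 0}"
        proof (rule bounded_subset[OF bounded_ball[of x D]])
          show "{y. \<rho> (x - y) \<noteq> 0} \<subseteq> ball x D" using \<rho>n by (auto simp: dist_norm)
        qed
        ultimately have "(\<integral>y. w y * partial_deriv i (\<lambda>y. \<rho> (x - y)) y \<partial>lborel) = - (\<integral>y. g y $ i * \<rho> (x - y) \<partial>lborel)"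
          using wg by (simp add: weak_grad_on_def)
        then have "(\<integral>y. partial_deriv i \<rho> (x - y) * w y \<partial>lborel) = (\<integral>y. \<rho> (x - y) * g y $ i \<partial>lborel)"
          by (simp add: ref mult.commute)
        then show ?thesis
          unfolding \<eta>_def partial_deriv_conv[OF \<rho>(1) \<rho>b wi] by (simp add: conv_def)
      qed
      have gm [measurable]: "grad \<eta> \<in> borel_measurable borel"
        unfolding \<eta>_def by (rule smooth_measurable(3)[OF smooth_conv[OF \<rho>(1) \<rho>b wi]])
      have "nm (\<lambda>x. (g x - grad \<eta> x) $ i) \<le> ennreal r" for i
      proof -
        have "nm (\<lambda>x. (g x - grad \<eta> x) $ i) = nm (\<lambda>x. conv \<rho> (\<lambda>x. g x $ i) x - g x $ i)"
          by (intro nn_integral_cong) (metis \<Phi>_even minus_diff_eq pd grad_component vector_minus_component)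
        also have "\<dots> \<le> ennreal r"
          using \<rho>c \<rho> \<rho>n D(3)[of i] by (intro d(2)) (auto intro: less_le_trans)
        finally show ?thesis .
      qed
      then have "(\<Sum>i\<in>UNIV. nm (\<lambda>x. (g x - grad \<eta> x) $ i)) \<le> (\<Sum>i\<in>(UNIV::'n set). ennreal r)"
        by (intro sum_mono)
      also have "\<dots> = ennreal (real CARD('n) * r)"
        using r by (subst ennreal_mult) (auto simp: ennreal_of_nat_eq_real_of_nat)
      finally have "nm (\<lambda>x. norm (g x - grad \<eta> x)) \<le> ennreal (real CARD('n) powr m) * ennreal (real CARD('n) * r)"
        by (intro order_trans[OF nm_norm_le_sum] mult_left_mono) auto
      also have "\<dots> = ennreal \<epsilon>" using \<epsilon> by (subst ennreal_mult[symmetric]) (auto simp: r_def)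
      finally show ?thesis .
    qed
    ultimately show ?thesis by blast
  qed
  then show ?thesis using w off fin unfolding W_def by blast
qed

end

section \<open>Density of the test functions\<close>

text \<open>The segment property: near each point of the closure, one fixed direction e moves the
  closure into \<Omega> for all small t. In this form the regularity of the boundary enters.\<close>

definition shiftable :: "(real^'n) set \<Rightarrow> bool" where
  "shiftable \<Omega> \<longleftrightarrow> (\<forall>x\<in>closure \<Omega>. \<exists>r>0. \<exists>e. \<exists>t0>0. \<forall>t y. 0 < t \<longrightarrow> t < t0 \<longrightarrow> y \<in> closure \<Omega> \<inter> cball x r \<longrightarrow> y + t *\<^sub>R e \<in> \<Omega>)"

text \<open>At interior points e = 0 works. At a boundary point e is the vector that T maps to the
  k-th axis: points of the closure satisfy the graph inequality weakly, and moving along e raises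
  the k-th coordinate but leaves \<gamma> unchanged.\<close>

lemma smooth_boundary_shiftable:
  fixes \<Omega> :: "(real^'n) set"
  assumes "open \<Omega>" "smooth_boundary \<Omega>"
  shows "shiftable \<Omega>"
  unfolding shiftable_def
proof
  fix x assume x: "x \<in> closure \<Omega>"
  show "\<exists>r>0. \<exists>e. \<exists>t0>0. \<forall>t y. 0 < t \<longrightarrow> t < t0 \<longrightarrow> y \<in> closure \<Omega> \<inter> cball x r \<longrightarrow> y + t *\<^sub>R e \<in> \<Omega>"
  proof (cases "x \<in> \<Omega>")
    case True
    then obtain r where "0 < r" "cball x r \<subseteq> \<Omega>" using assms(1) open_contains_cball by blast
    then show ?thesis by (intro exI[of _ r] conjI exI[of _ 0] exI[of _ 1]) auto
  next
    case False
    then have "x \<in> frontier \<Omega>" using x assms(1) by (simp add: frontier_def interior_open)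
    with assms(2) have "\<exists>r>0. \<exists>(T :: real^'n \<Rightarrow> real^'n) k \<gamma>. orthogonal_transformation T \<and> smooth \<gamma> \<and>
        (\<forall>y z. (\<forall>i. i \<noteq> k \<longrightarrow> y $ i = z $ i) \<longrightarrow> \<gamma> y = \<gamma> z) \<and> \<Omega> \<inter> ball x r = {y \<in> ball x r. T y $ k > \<gamma> (T y)}"
      unfolding smooth_boundary_def by (rule bspec)
    then obtain r and T :: "real^'n \<Rightarrow> real^'n" and k \<gamma> where r: "0 < r"
      and T: "orthogonal_transformation T" and \<gamma>: "smooth \<gamma>"
      and ind': "\<forall>y z. (\<forall>i. i \<noteq> k \<longrightarrow> y $ i = z $ i) \<longrightarrow> \<gamma> y = \<gamma> z"
      and eq: "\<Omega> \<inter> ball x r = {y \<in> ball x r. T y $ k > \<gamma> (T y)}"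
      by (elim exE conjE) (rule that)
    have ind: "\<gamma> y = \<gamma> z" if "\<And>i. i \<noteq> k \<Longrightarrow> y $ i = z $ i" for y z
      using ind' that by simp
    have lin: "linear T" using T by (simp add: orthogonal_transformation_def)
    obtain e where e: "T e = axis k 1"
      using orthogonal_transformation_surj[OF T] by (metis surj_def)
    have ne: "norm e = 1" using orthogonal_transformation_norm[OF T, of e] e by simp
    have cont: "continuous_on UNIV (\<lambda>y. \<gamma> (T y))"
      using linear_continuous_on[OF linear_conv_bounded_linear[THEN iffD1, OF lin]]
      by (intro continuous_on_compose2[OF smooth_continuous[OF \<gamma>]]) auto
    have contk: "continuous_on UNIV (\<lambda>y. T y $ k)"
      by (intro continuous_intros linear_continuous_on linear_conv_bounded_linear[THEN iffD1, OF lin])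
    have cl: "\<gamma> (T y) \<le> T y $ k" if y: "y \<in> closure \<Omega>" "y \<in> ball x r" for y
    proof -
      have "y \<in> closure (\<Omega> \<inter> ball x r)"
        using y open_Int_closure_subset[of "ball x r" \<Omega>] by (auto simp: Int_commute)
      also have "\<dots> \<subseteq> {y. \<gamma> (T y) \<le> T y $ k}"
        using eq by (intro closure_minimal closed_Collect_le cont contk) auto
      finally show ?thesis by simp
    qed
    show ?thesis
    proof (intro exI[of _ "r / 2"] conjI exI[of _ e] allI impI)
      fix t y assume t: "0 < t" "t < r / 2" and y: "y \<in> closure \<Omega> \<inter> cball x (r / 2)"
      have Ty: "T (y + t *\<^sub>R e) = T y + t *\<^sub>R axis k 1"
        by (simp add: linear_add[OF lin] linear_scale[OF lin] e)
      have "\<gamma> (T (y + t *\<^sub>R e)) = \<gamma> (T y)" by (rule ind) (simp add: Ty axis_def)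
      also have "\<dots> \<le> T y $ k" using y r by (intro cl) auto
      also have "\<dots> < T (y + t *\<^sub>R e) $ k" using t by (simp add: Ty)
      finally have "\<gamma> (T (y + t *\<^sub>R e)) < T (y + t *\<^sub>R e) $ k" .
      moreover have "dist x (y + t *\<^sub>R e) \<le> dist x y + dist y (y + t *\<^sub>R e)" by (rule dist_triangle)
      then have "y + t *\<^sub>R e \<in> ball x r" using y t ne by (simp add: dist_norm)
      ultimately show "y + t *\<^sub>R e \<in> \<Omega>" using eq by blast
    qed (use r in auto)
  qed
qed

section \<open>Localisation by a partition of unity\<close>

text \<open>Bumps divided by their sum are smooth only where the sum is positive. The sum is
  therefore changed away from C into a function that is positive everywhere, which makes every
  \<theta> j smooth on the whole space.\<close>

lemma partition_of_unity:
  fixes C :: "(real^'n) set"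
  assumes "compact C" "\<And>x. x \<in> C \<Longrightarrow> 0 < r x"
  shows "\<exists>F \<theta>. finite F \<and> F \<subseteq> C \<and> (\<forall>j. smooth (\<theta> j)) \<and> (\<forall>j\<in>F. \<forall>x. \<theta> j x \<noteq> 0 \<longrightarrow> x \<in> cball j (r j))
    \<and> (\<forall>x\<in>C. (\<Sum>j\<in>F. \<theta> j x) = (1::real))"
proof -
  have "C \<subseteq> (\<Union>x\<in>C. ball x (r x))" using assms(2) by force
  then obtain F where F: "F \<subseteq> C" "finite F" "C \<subseteq> (\<Union>x\<in>F. ball x (r x))"
    using compactE_image[OF assms(1), of C "\<lambda>x. ball x (r x)"] by auto
  define S0 where "S0 x = (\<Sum>j\<in>F. bump j (r j) x)" for x
  have S0s: "smooth S0" unfolding S0_def[abs_def] by (intro smooth_sum smooth_bump)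
  have pos: "0 < S0 x" if x: "x \<in> C" for x
  proof -
    obtain j where j: "j \<in> F" "x \<in> ball j (r j)" using F(3) x by blast
    then have "0 < bump j (r j) x" using assms(2) F bump_pos_iff by blast
    moreover have "bump j (r j) x \<le> S0 x"
      unfolding S0_def using j F by (intro member_le_sum) (auto simp: bump_nonneg)
    ultimately show ?thesis by simp
  qed
  obtain c where c: "0 < c" "\<And>x. x \<in> C \<Longrightarrow> c \<le> S0 x"
  proof (cases "C = {}")
    case True then show ?thesis using that[of 1] by simp
  next
    case False
    have "continuous_on C S0" by (rule continuous_on_subset[OF smooth_continuous[OF S0s]]) simp
    from continuous_attains_inf[OF assms(1) False this] obtain y where "y \<in> C" "\<And>x. x \<in> C \<Longrightarrow> S0 y \<le> S0 x"
      by blast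
    then show ?thesis using that[of "S0 y"] pos by blast
  qed
  \<comment> \<open>The added term vanishes where S0 \<ge> c, in particular on C, and is positive
    where S0 = 0.\<close>
  define S where "S x = S0 x + flat 1 (c - S0 x)" for x
  have S0n: "0 \<le> S0 x" for x unfolding S0_def by (intro sum_nonneg bump_nonneg)
  have fn: "0 \<le> flat 1 t" for t by (simp add: flat_def)
  have Sp: "0 < S x" for x
  proof (cases "S0 x = 0")
    case True then show ?thesis using c by (simp add: S_def flat_def)
  next
    case False then show ?thesis using S0n[of x] fn[of "c - S0 x"] by (simp add: S_def)
  qed
  have Ss: "smooth S" unfolding S_def[abs_def] by (intro smooth_intros smooth_flat S0s)
  define \<theta> where "\<theta> j x = bump j (r j) x * inverse (S x)" for j x
  have "smooth (\<theta> j)" for j unfolding \<theta>_def[abs_def] by (intro smooth_mult smooth_bump smooth_inverse Ss Sp)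
  moreover have "x \<in> cball j (r j)" if "j \<in> F" "\<theta> j x \<noteq> 0" for j x
  proof -
    have "0 < r j" using assms(2) F that by blast
    then show ?thesis using that bump_nonzero_iff[of "r j" j x] by (auto simp: \<theta>_def)
  qed
  moreover have "(\<Sum>j\<in>F. \<theta> j x) = 1" if "x \<in> C" for x
  proof -
    have "S x = S0 x" using c(2)[OF that] by (simp add: S_def flat_def)
    moreover have "(\<Sum>j\<in>F. \<theta> j x) = S0 x * inverse (S x)" by (simp add: \<theta>_def S0_def sum_distrib_right)
    ultimately show ?thesis using pos[OF that] by simp
  qed
  ultimately show ?thesis using F(1,2) by (intro exI[of _ F] exI[of _ \<theta>]) simp
qed

lemma smooth_bound_on_bounded:
  assumes "smooth (h :: real^'n \<Rightarrow> real)" "bounded \<Omega>"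
  obtains B where "1 \<le> B" "\<And>x. x \<in> \<Omega> \<Longrightarrow> \<bar>h x\<bar> \<le> B"
proof -
  have "compact (h ` closure \<Omega>)"
    using assms by (intro compact_continuous_image continuous_on_subset[OF smooth_continuous]) auto
  then obtain B where B: "\<And>y. y \<in> h ` closure \<Omega> \<Longrightarrow> norm y \<le> B"
    using compact_imp_bounded bounded_iff by metis
  show ?thesis
  proof
    show "\<bar>h x\<bar> \<le> max 1 B" if "x \<in> \<Omega>" for x
      using B[of "h x"] that closure_subset[of \<Omega>] by fastforce
  qed simp
qed

lemma smooth_product_rule:
  assumes "smooth f" "smooth g"
  shows "partial_deriv i (\<lambda>x. f x * g x) x = f x * partial_deriv i g x + partial_deriv i f x * g x"
  using assms by (intro partial_deriv_mult smooth_differentiable)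

context growth_domain begin

lemma nm_finite_mult_smooth:
  assumes u: "u \<in> borel_measurable borel" "\<And>x. x \<notin> \<Omega> \<Longrightarrow> u x = 0" "nm u < \<infinity>" and h: "smooth h"
  shows "nm (\<lambda>x. h x * u x) < \<infinity>"
proof -
  obtain B where B: "1 \<le> B" "\<And>x. x \<in> \<Omega> \<Longrightarrow> \<bar>h x\<bar> \<le> B"
    using smooth_bound_on_bounded[OF h bounded_\<Omega>] by blast
  show ?thesis
  proof (rule nm_scale_finite[OF B(1) _ u(1,3)])
    fix x show "\<bar>h x * u x\<bar> \<le> B * \<bar>u x\<bar>"
      using B(2)[of x] u(2)[of x] by (cases "x \<in> \<Omega>") (auto simp: abs_mult mult_right_mono)
  qed
qed

text \<open>The product \<theta> j u lives in a piece of the closure that a single direction shifts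
  into \<Omega>, so \<open>W_shift\<close> applies to it, with the gradient given by the product
  rule. The products add up to u.\<close>

theorem W_density:
  assumes shift: "shiftable \<Omega>"
    and u: "u \<in> borel_measurable borel" "\<xi> \<in> borel_measurable borel"
    and off: "\<And>x. x \<notin> \<Omega> \<Longrightarrow> u x = 0" "\<And>x. x \<notin> \<Omega> \<Longrightarrow> \<xi> x = 0"
    and fin: "nm u < \<infinity>" "nm (\<lambda>x. norm (\<xi> x)) < \<infinity>"
    and wg: "weak_grad_on u \<xi>"
  shows "W u \<xi>"
proof -
  note [measurable] = u
  have \<xi>fin: "nm (\<lambda>x. \<xi> x $ i) < \<infinity>" for i using nm_component_le fin(2) by (rule order.strict_trans1)
  have "\<forall>x\<in>closure \<Omega>. \<exists>r. 0 < r \<and> (\<exists>e. \<exists>t0>0. \<forall>t y. 0 < t \<longrightarrow> t < t0 \<longrightarrow> y \<in> closure \<Omega> \<inter> cball x r \<longrightarrow> y + t *\<^sub>R e \<in> \<Omega>)"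
    using shift unfolding shiftable_def by blast
  from bchoice[OF this] obtain r where r: "\<And>x. x \<in> closure \<Omega> \<Longrightarrow> 0 < r x"
    "\<And>x. x \<in> closure \<Omega> \<Longrightarrow> \<exists>e. \<exists>t0>0. \<forall>t y. 0 < t \<longrightarrow> t < t0 \<longrightarrow> y \<in> closure \<Omega> \<inter> cball x (r x) \<longrightarrow> y + t *\<^sub>R e \<in> \<Omega>"
    by blast
  have comp: "compact (closure \<Omega>)" using bounded_\<Omega> by simp
  have "\<exists>F \<theta>. finite F \<and> F \<subseteq> closure \<Omega> \<and> (\<forall>j. smooth (\<theta> j))
      \<and> (\<forall>j\<in>F. \<forall>x. \<theta> j x \<noteq> 0 \<longrightarrow> x \<in> cball j (r j)) \<and> (\<forall>x\<in>closure \<Omega>. (\<Sum>j\<in>F. \<theta> j x) = (1::real))"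
    by (rule partition_of_unity[OF comp]) (rule r(1))
  then obtain F \<theta> where F: "finite F" "F \<subseteq> closure \<Omega>" and \<theta>': "\<forall>j. smooth (\<theta> j)"
    "\<forall>j\<in>F. \<forall>x. \<theta> j x \<noteq> 0 \<longrightarrow> x \<in> cball j (r j)" "\<forall>x\<in>closure \<Omega>. (\<Sum>j\<in>F. \<theta> j x) = 1"
    by (elim exE conjE) (rule that)
  have \<theta>: "smooth (\<theta> j)" "j \<in> F \<Longrightarrow> \<theta> j x \<noteq> 0 \<Longrightarrow> x \<in> cball j (r j)" "x \<in> closure \<Omega> \<Longrightarrow> (\<Sum>j\<in>F. \<theta> j x) = 1" for j x
    using \<theta>' by blast+
  define w where "w j x = \<theta> j x * u x" for j x
  define g where "g j x = \<theta> j x *\<^sub>R \<xi> x + u x *\<^sub>R grad (\<theta> j) x" for j x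
  have pdm [measurable]: "\<theta> j \<in> borel_measurable borel" "partial_deriv i (\<theta> j) \<in> borel_measurable borel"
    "grad (\<theta> j) \<in> borel_measurable borel" for i j
    by (rule smooth_measurable[OF \<theta>(1)])+
  have "W (w j) (g j)" if j: "j \<in> F" for j
  proof -
    obtain e t0 where t0: "0 < t0" "\<And>t y. 0 < t \<Longrightarrow> t < t0 \<Longrightarrow> y \<in> closure \<Omega> \<inter> cball j (r j) \<Longrightarrow> y + t *\<^sub>R e \<in> \<Omega>"
      using r(2)[of j] j F(2) by blast
    show ?thesis
    proof (rule W_shift[OF _ _ _ _ _ _ _ _ _ t0])
      show "w j \<in> borel_measurable borel" "g j \<in> borel_measurable borel"
        unfolding w_def g_def by measurable
      show "nm (w j) < \<infinity>" unfolding w_def using u(1) off(1) fin(1) \<theta>(1) by (intro nm_finite_mult_smooth)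
      show "nm (\<lambda>x. norm (g j x)) < \<infinity>"
      proof (rule nm_norm_finiteI)
        fix i
        have "nm (\<lambda>x. \<theta> j x * \<xi> x $ i) < \<infinity>" using off(2) \<xi>fin \<theta>(1) by (intro nm_finite_mult_smooth) auto
        moreover have "nm (\<lambda>x. partial_deriv i (\<theta> j) x * u x) < \<infinity>"
          using u(1) off(1) fin(1) \<theta>(1) by (intro nm_finite_mult_smooth smooth_partial_deriv)
        ultimately have "nm (\<lambda>x. \<theta> j x * \<xi> x $ i + partial_deriv i (\<theta> j) x * u x) < \<infinity>"
          by (intro nm_add_finite) auto
        then show "nm (\<lambda>x. g j x $ i) < \<infinity>" by (simp add: g_def mult.commute)
      qed (unfold g_def, measurable)
      show "weak_grad_on (w j) (g j)"
        unfolding weak_grad_on_def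
      proof (intro allI impI)
        fix \<zeta> :: "real^'n \<Rightarrow> real" and i assume \<zeta>: "smooth \<zeta>" "bounded {x. \<zeta> x \<noteq> 0}"
        have ui: "integrable lborel u" by (rule nm_finite_integrable[OF u(1) off(1) fin(1)])
        have \<xi>i: "integrable lborel (\<lambda>x. \<xi> x $ i)" using off(2) \<xi>fin by (intro nm_finite_integrable) auto
        have int: "integrable lborel (\<lambda>x. (h x * k x) * f x)" if "integrable lborel f" "smooth h" "smooth k" "bounded {x. k x \<noteq> 0}"
          for f h k :: "real^'n \<Rightarrow> real"
        proof -
          have c: "continuous_on UNIV (\<lambda>x. h x * k x)" using that by (intro continuous_intros smooth_continuous)
          have "bounded {x. h x * k x \<noteq> 0}" using that(4) by (rule bounded_subset) auto
          then obtain B where "\<And>x. \<bar>h x * k x\<bar> \<le> B" using bounded_range_bounded_support[OF c] by blast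
          then show ?thesis by (intro integrable_mult_bounded[OF that(1) continuous_borel[OF c]])
        qed
        note ps = smooth_partial_deriv[OF \<zeta>(1)] bounded_partial_deriv_support[OF \<zeta>(2)]
        have i1: "integrable lborel (\<lambda>x. \<theta> j x * partial_deriv i \<zeta> x * u x)" by (intro int ui \<theta> ps)
        have i2: "integrable lborel (\<lambda>x. partial_deriv i (\<theta> j) x * \<zeta> x * u x)" by (intro int ui smooth_partial_deriv \<theta> \<zeta>)
        have i3: "integrable lborel (\<lambda>x. \<theta> j x * \<zeta> x * \<xi> x $ i)" by (intro int \<xi>i \<theta> \<zeta>)
        have "smooth (\<lambda>x. \<theta> j x * \<zeta> x)" "bounded {x. \<theta> j x * \<zeta> x \<noteq> 0}"
          using \<theta>(1) \<zeta> by (auto intro: smooth_mult elim!: bounded_subset)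
        then have "(\<integral>x. u x * partial_deriv i (\<lambda>x. \<theta> j x * \<zeta> x) x \<partial>lborel) = - (\<integral>x. \<xi> x $ i * (\<theta> j x * \<zeta> x) \<partial>lborel)"
          using wg by (simp add: weak_grad_on_def)
        then have "(\<integral>x. \<theta> j x * partial_deriv i \<zeta> x * u x + partial_deriv i (\<theta> j) x * \<zeta> x * u x \<partial>lborel)
            = - (\<integral>x. \<theta> j x * \<zeta> x * \<xi> x $ i \<partial>lborel)"
          unfolding smooth_product_rule[OF \<theta>(1) \<zeta>(1)] by (simp add: algebra_simps)
        then have "(\<integral>x. \<theta> j x * partial_deriv i \<zeta> x * u x \<partial>lborel)
            = - ((\<integral>x. \<theta> j x * \<zeta> x * \<xi> x $ i \<partial>lborel) + (\<integral>x. partial_deriv i (\<theta> j) x * \<zeta> x * u x \<partial>lborel))"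
          using i1 i2 by simp
        also have "\<dots> = - (\<integral>x. \<theta> j x * \<zeta> x * \<xi> x $ i + partial_deriv i (\<theta> j) x * \<zeta> x * u x \<partial>lborel)"
          using i2 i3 by simp
        finally show "(\<integral>x. w j x * partial_deriv i \<zeta> x \<partial>lborel) = - (\<integral>x. g j x $ i * \<zeta> x \<partial>lborel)"
          by (simp add: w_def g_def algebra_simps)
      qed
      show "compact (closure \<Omega> \<inter> cball j (r j))" using comp by (intro compact_Int) auto
      show "x \<in> closure \<Omega> \<inter> cball j (r j)" if "w j x \<noteq> 0" for x
        using that \<theta>(2)[OF j, of x] off(1)[of x] closure_subset[of \<Omega>] by (auto simp: w_def)
    qed (use off in \<open>auto simp: w_def g_def\<close>)
  qed
  then have "W (\<lambda>x. \<Sum>j\<in>F. w j x) (\<lambda>x. \<Sum>j\<in>F. g j x)" by (intro W_sum F)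
  moreover have "(\<Sum>j\<in>F. w j x) = u x" for x
    using \<theta>(3)[of x] off(1)[of x] closure_subset[of \<Omega>] by (cases "x \<in> \<Omega>") (auto simp: w_def simp flip: sum_distrib_right)
  moreover have "(\<Sum>j\<in>F. g j x) = \<xi> x" for x
  proof (cases "x \<in> \<Omega>")
    case True
    \<comment> \<open>On the open set \<Omega> the \<theta> j sum to the constant 1, so their
      gradients cancel.\<close>
    have "(\<Sum>j\<in>F. partial_deriv i (\<theta> j) x) = 0" for i
    proof -
      have "((\<lambda>x. \<Sum>j\<in>F. \<theta> j x) has_derivative (\<lambda>x. 0)) (at x)"
      proof (rule has_derivative_transform_within_open[OF has_derivative_const open_\<Omega> True])
        show "1 = (\<Sum>j\<in>F. \<theta> j y)" if "y \<in> \<Omega>" for y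
          using \<theta>(3)[of y] that closure_subset[of \<Omega>] by (simp add: subset_iff)
      qed
      from partial_deriv_eq[OF this] show ?thesis
        by (simp add: partial_deriv_sum smooth_differentiable[OF \<theta>(1)])
    qed
    then have "(\<Sum>j\<in>F. grad (\<theta> j) x) = 0" by (simp add: vec_eq_iff)
    moreover have "(\<Sum>j\<in>F. \<theta> j x) = 1" using \<theta>(3)[of x] True closure_subset[of \<Omega>] by blast
    ultimately show ?thesis
      by (simp add: g_def sum.distrib flip: scaleR_sum_left scaleR_sum_right)
  qed (simp add: g_def off)
  ultimately show ?thesis by simp
qed

end

section \<open>The fundamental lemma of the calculus of variations\<close>

lemma nn_integral_lebesgue_on:
  assumes "S \<in> sets borel"
  shows "(\<integral>\<^sup>+x. f x \<partial>lebesgue_on S) = (\<integral>\<^sup>+x. f x * indicator S x \<partial>lborel)"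
  using assms by (simp add: nn_integral_restrict_space nn_integral_completion)

lemma AE_lebesgue_on_iff:
  assumes "S \<in> sets borel"
  shows "(AE x in lebesgue_on S. P x) \<longleftrightarrow> (AE x in lborel. x \<in> S \<longrightarrow> P x)"
  using assms by (simp add: AE_restrict_space_iff AE_completion_iff)

lemma borel_lebesgue_on: "f \<in> borel_measurable borel \<Longrightarrow> f \<in> borel_measurable (lebesgue_on S)"
  by (intro measurable_restrict_space1 measurable_completion) simp

lemma
  fixes f :: "'a::euclidean_space \<Rightarrow> real"
  assumes S: "S \<in> sets borel" and [measurable]: "f \<in> borel_measurable borel"
  shows integral_lebesgue_on_borel: "(\<integral>x. f x \<partial>lebesgue_on S) = (\<integral>x. indicator S x * f x \<partial>lborel)"
    and integrable_lebesgue_on_borel: "integrable (lebesgue_on S) f \<longleftrightarrow> integrable lborel (\<lambda>x. indicator S x * f x)"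
proof -
  have "(\<lambda>x. indicator S x * f x) \<in> borel_measurable borel" using S by measurable
  then show "(\<integral>x. f x \<partial>lebesgue_on S) = (\<integral>x. indicator S x * f x \<partial>lborel)"
    "integrable (lebesgue_on S) f \<longleftrightarrow> integrable lborel (\<lambda>x. indicator S x * f x)"
    using S by (simp_all add: integral_restrict_space integrable_restrict_space integral_completion integrable_completion)
qed

text \<open>Members of the function spaces are only Lebesgue measurable on S, whereas translation
  and convolution require Borel functions on the whole space.\<close>

lemma ex_borel_representative:
  fixes v :: "'a::euclidean_space \<Rightarrow> real"
  assumes v: "v \<in> borel_measurable (lebesgue_on S)" and S: "S \<in> sets borel"
  obtains u where "u \<in> borel_measurable borel" "\<And>x. x \<notin> S \<Longrightarrow> u x = 0" "AE x in lebesgue_on S. v x = u x"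
proof -
  have "(\<lambda>x. if x \<in> S then v x else 0) \<in> borel_measurable lebesgue"
    using v S by (intro borel_measurable_if_I) auto
  then obtain g where g: "g \<in> borel_measurable lborel" "AE x in lborel. (if x \<in> S then v x else 0) = g x"
    using completion_ex_borel_measurable_real by blast
  show ?thesis
  proof
    show "(\<lambda>x. indicator S x * g x) \<in> borel_measurable borel" using g(1) S by simp
    show "AE x in lebesgue_on S. v x = indicator S x * g x"
      unfolding AE_lebesgue_on_iff[OF S] using g(2) by eventually_elim (auto split: if_splits)
  qed simp
qed

lemma integrable_loc_mult:
  fixes h \<zeta> :: "real^'n \<Rightarrow> real"
  assumes h: "loc_integrable \<Omega> h" and \<Omega>: "open \<Omega>" and \<zeta>: "continuous_on UNIV \<zeta>"
    and K: "compact K" "K \<subseteq> \<Omega>" "\<And>x. \<zeta> x \<noteq> 0 \<Longrightarrow> x \<in> K"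
  shows "integrable (lebesgue_on \<Omega>) (\<lambda>x. h x * \<zeta> x)"
proof -
  have "bounded {x. \<zeta> x \<noteq> 0}" using K by (intro bounded_subset[OF compact_imp_bounded[OF K(1)]]) auto
  then obtain B where B: "\<And>x. \<bar>\<zeta> x\<bar> \<le> B" using bounded_range_bounded_support[OF \<zeta>] by blast
  have Ks: "K \<in> sets borel" and Os: "\<Omega> \<in> sets borel" using K \<Omega> by (auto intro: borel_compact)
  have hi: "integrable lebesgue (\<lambda>x. indicator K x * h x)"
    using h K Ks by (auto simp: loc_integrable_def integrable_restrict_space)
  have "integrable lebesgue (\<lambda>x. indicator \<Omega> x * (h x * \<zeta> x))"
  proof (rule Bochner_Integration.integrable_bound[OF integrable_mult_right[OF hi, of B]])
    have eq: "(\<lambda>x. indicator \<Omega> x * (h x * \<zeta> x)) = (\<lambda>x. (indicator K x * h x) * \<zeta> x)"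
      using K by (force simp: indicator_def)
    have "\<zeta> \<in> borel_measurable lebesgue"
      using continuous_borel[OF \<zeta>] by (intro measurable_completion) simp
    then show "(\<lambda>x. indicator \<Omega> x * (h x * \<zeta> x)) \<in> borel_measurable lebesgue"
      unfolding eq using borel_measurable_integrable[OF hi] by measurable
    show "AE x in lebesgue. norm (indicator \<Omega> x * (h x * \<zeta> x)) \<le> norm (B * (indicator K x * h x))"
    proof (intro AE_I2)
      fix x
      have "norm (indicator \<Omega> x * (h x * \<zeta> x)) = \<bar>\<zeta> x\<bar> * \<bar>indicator K x * h x\<bar>"
        using fun_cong[OF eq, of x] by (simp add: abs_mult)
      also have "\<dots> \<le> \<bar>B\<bar> * \<bar>indicator K x * h x\<bar>"
        using B[of x] by (intro mult_right_mono) auto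
      finally show "norm (indicator \<Omega> x * (h x * \<zeta> x)) \<le> norm (B * (indicator K x * h x))" by (simp add: abs_mult)
    qed
  qed
  then show ?thesis using Os by (simp add: integrable_restrict_space)
qed

text \<open>Near a compact subset of \<open>\<Omega>\<close>
  all mollifications of \<open>h\<close> vanish, and they converge to \<open>h\<close> in \<open>L\<^sup>1\<close>.\<close>
lemma AE_zero_if_orthogonal_to_test_functions:
  fixes h :: "real^'n \<Rightarrow> real"
  assumes \<Omega>: "open \<Omega>" and h: "loc_integrable \<Omega> h"
    and orth: "\<And>\<eta>. \<eta> \<in> test_functions \<Omega> \<Longrightarrow> (\<integral>x. h x * \<eta> x \<partial>lebesgue_on \<Omega>) = 0"
  shows "AE x in lebesgue_on \<Omega>. h x = 0"
proof -
  interpret modular abs 1 by (rule modular_abs)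
  have Os: "\<Omega> \<in> sets borel" using \<Omega> by simp
  have *: "AE x in lborel. x \<in> K \<longrightarrow> h x = 0" if K: "compact K" "K \<subseteq> \<Omega>" for K
  proof -
    obtain \<delta> where \<delta>: "0 < \<delta>" "(\<Union>x\<in>K. ball x \<delta>) \<subseteq> \<Omega>"
      using compact_subset_open_imp_ball_epsilon_subset[OF K(1) \<Omega> K(2)] by blast
    \<comment> \<open>Kernels of radius at most \<delta>/2 around points of K stay in K', which is
      compact in \<Omega>; there h has an integrable Borel version.\<close>
    define K' where "K' = {x + y |x y. x \<in> K \<and> y \<in> cball 0 (\<delta> / 2)}"
    have K': "compact K'" "K' \<subseteq> \<Omega>" "\<And>x. x \<in> K \<Longrightarrow> cball x (\<delta> / 2) \<subseteq> K'"
    proof -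
      show "compact K'" unfolding K'_def using K by (intro compact_sums) auto
      show "K' \<subseteq> \<Omega>" unfolding K'_def using \<delta> by (fastforce simp: dist_norm)
      fix x assume x: "x \<in> K"
      show "cball x (\<delta> / 2) \<subseteq> K'"
      proof
        fix y assume "y \<in> cball x (\<delta> / 2)"
        then have "y - x \<in> cball 0 (\<delta> / 2)" by (simp add: dist_norm norm_minus_commute)
        then show "y \<in> K'" unfolding K'_def using x
          by (intro CollectI exI[of _ x] exI[of _ "y - x"]) auto
      qed
    qed
    have K's: "K' \<in> sets borel" using K' by (intro borel_compact)
    have hi: "integrable (lebesgue_on K') h" using h K' by (simp add: loc_integrable_def)
    obtain g where g: "g \<in> borel_measurable borel" "\<And>x. x \<notin> K' \<Longrightarrow> g x = 0" "AE x in lebesgue_on K'. h x = g x"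
      using ex_borel_representative[OF borel_measurable_integrable[OF hi] K's] by blast
    have gh: "AE x in lborel. x \<in> K' \<longrightarrow> h x = g x" using g(3) by (simp add: AE_lebesgue_on_iff[OF K's])
    note [measurable] = g(1)
    have ind: "(\<lambda>x. indicator K' x * g x) = g" using g(2) by (intro ext) (auto simp: indicator_def)
    have "integrable (lebesgue_on K') g"
      using integrable_cong_AE[OF borel_measurable_integrable[OF hi] borel_lebesgue_on[OF g(1)] g(3)] hi by simp
    then have gi: "integrable lborel g" by (simp add: integrable_lebesgue_on_borel[OF K's g(1)] ind)
    have gsupp: "bounded {x. g x \<noteq> 0}"
      using g(2) by (intro bounded_subset[OF compact_imp_bounded[OF K'(1)]]) auto
    have gfin: "(\<integral>\<^sup>+x. ennreal \<bar>g x\<bar> \<partial>lborel) < \<infinity>"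
      using gi by (simp add: integrable_iff_bounded)
    \<comment> \<open>For x in K the function y \<mapsto> \<rho>(x - y) is a test function on
      \<Omega>, so orthogonality states that the convolution vanishes at x.\<close>
    have conv0: "conv \<rho> g x = 0" if \<rho>: "smooth \<rho>" "\<And>z. \<rho> z \<noteq> 0 \<Longrightarrow> norm z \<le> \<delta> / 2" and x: "x \<in> K" for \<rho> x
    proof -
      have "(\<lambda>y. \<rho> (x - y)) \<in> test_functions \<Omega>"
      proof (rule test_functionsI)
        show "smooth (\<lambda>y. \<rho> (x - y))" by (rule smooth_reflect[OF \<rho>(1)])
        show "compact (cball x (\<delta> / 2))" by simp
        show "cball x (\<delta> / 2) \<subseteq> \<Omega>" using K' x by blast
        show "y \<in> cball x (\<delta> / 2)" if "\<rho> (x - y) \<noteq> 0" for y using \<rho>(2)[OF that] by (simp add: dist_norm)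
      qed
      then have 0: "(\<integral>y. h y * \<rho> (x - y) \<partial>lebesgue_on \<Omega>) = 0" by (rule orth)
      note \<rho>c = smooth_continuous[OF smooth_reflect[OF \<rho>(1)], of x]
      have i: "integrable (lebesgue_on \<Omega>) (\<lambda>y. h y * \<rho> (x - y))"
      proof (rule integrable_loc_mult[OF h \<Omega> \<rho>c K'(1,2)])
        fix y assume "\<rho> (x - y) \<noteq> 0"
        from \<rho>(2)[OF this] show "y \<in> K'" using K'(3)[OF x] by (auto simp: dist_norm)
      qed
      have m: "(\<lambda>y. \<rho> (x - y) * g y) \<in> borel_measurable borel"
        using continuous_borel[OF \<rho>c] by measurable
      have "(\<integral>y. h y * \<rho> (x - y) \<partial>lebesgue_on \<Omega>) = (\<integral>y. \<rho> (x - y) * g y \<partial>lebesgue_on \<Omega>)"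
      proof (rule integral_cong_AE)
        show "AE y in lebesgue_on \<Omega>. h y * \<rho> (x - y) = \<rho> (x - y) * g y"
          unfolding AE_lebesgue_on_iff[OF Os] using gh
        proof eventually_elim
          fix y assume y: "y \<in> K' \<longrightarrow> h y = g y"
          show "y \<in> \<Omega> \<longrightarrow> h y * \<rho> (x - y) = \<rho> (x - y) * g y"
          proof (cases "\<rho> (x - y) = 0")
            case False
            then have "y \<in> K'" using \<rho>(2)[OF False] K'(3)[OF x] by (auto simp: dist_norm)
            with y show ?thesis by simp
          qed simp
        qed
      qed (rule borel_measurable_integrable[OF i] borel_lebesgue_on[OF m])+
      also have "\<dots> = (\<integral>y. indicator \<Omega> y * (\<rho> (x - y) * g y) \<partial>lborel)"
        by (rule integral_lebesgue_on_borel[OF Os m])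
      also have "\<dots> = conv \<rho> g x"
        unfolding conv_def using g(2) K'(2) by (intro Bochner_Integration.integral_cong) (auto simp: indicator_def)
      finally show ?thesis using 0 by simp
    qed
    \<comment> \<open>On K the convolution is 0, so |g| is the mollification error there,
      arbitrarily small in L^1.\<close>
    have small: "(\<integral>\<^sup>+x. ennreal \<bar>g x\<bar> * indicator K x \<partial>lborel) \<le> 0 + ennreal e" if e: "0 < e" for e
    proof -
      obtain d where d: "0 < d" "\<And>\<rho>. \<lbrakk>continuous_on UNIV \<rho>; \<And>z. 0 \<le> \<rho> z; (\<integral>z. \<rho> z \<partial>lborel) = 1; \<And>z. \<rho> z \<noteq> 0 \<Longrightarrow> norm z < d\<rbrakk>
        \<Longrightarrow> (\<integral>\<^sup>+x. ennreal \<bar>conv \<rho> g x - g x\<bar> \<partial>lborel) \<le> ennreal e"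
        by (rule conv_approx[OF gi gsupp gfin e]) blast
      have md: "0 < min d (\<delta> / 2)" using d \<delta> by simp
      obtain \<rho> :: "real^'n \<Rightarrow> real" where \<rho>: "smooth \<rho>" "\<And>z. 0 \<le> \<rho> z" "(\<integral>z. \<rho> z \<partial>lborel) = 1" "\<And>z. \<rho> z \<noteq> 0 \<Longrightarrow> z \<in> ball 0 (min d (\<delta> / 2))"
        using exists_mollifier[OF md] by blast
      have n: "norm z < min d (\<delta> / 2)" if "\<rho> z \<noteq> 0" for z using \<rho>(4)[OF that] by simp
      have "(\<integral>\<^sup>+x. ennreal \<bar>g x\<bar> * indicator K x \<partial>lborel) \<le> (\<integral>\<^sup>+x. ennreal \<bar>conv \<rho> g x - g x\<bar> \<partial>lborel)"
      proof (rule nn_integral_mono)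
        fix x
        show "ennreal \<bar>g x\<bar> * indicator K x \<le> ennreal \<bar>conv \<rho> g x - g x\<bar>"
          using conv0[OF \<rho>(1), of x] n by (cases "x \<in> K") (auto simp: less_imp_le)
      qed
      also have "\<dots> \<le> ennreal e" using \<rho> n smooth_continuous[OF \<rho>(1)] by (intro d(2)) auto
      finally show ?thesis by simp
    qed
    have "(\<integral>\<^sup>+x. ennreal \<bar>g x\<bar> * indicator K x \<partial>lborel) \<le> 0"
      by (rule ennreal_le_epsilon) (rule small)
    then have "(\<integral>\<^sup>+x. ennreal \<bar>g x\<bar> * indicator K x \<partial>lborel) = 0" by simp
    moreover have "K \<in> sets borel" using K by (intro borel_compact)
    ultimately have "AE x in lborel. ennreal \<bar>g x\<bar> * indicator K x = 0"
      by (subst (asm) nn_integral_0_iff_AE) auto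
    then show ?thesis using gh
    proof eventually_elim
      fix x assume a: "ennreal \<bar>g x\<bar> * indicator K x = 0" "x \<in> K' \<longrightarrow> h x = g x"
      show "x \<in> K \<longrightarrow> h x = 0"
      proof
        assume x: "x \<in> K"
        then have "x \<in> K'" using K'(3)[OF x] \<delta> by (meson centre_in_cball half_gt_zero less_imp_le subsetD)
        with a x show "h x = 0" by simp
      qed
    qed
  qed
  obtain C :: "nat \<Rightarrow> (real^'n) set" where C: "\<And>n. compact (C n)" "\<And>n. C n \<subseteq> \<Omega>" "\<Union>(range C) = \<Omega>"
    using open_Union_compact_subsets[OF \<Omega>] by metis
  have "AE x in lborel. \<forall>n. x \<in> C n \<longrightarrow> h x = 0" unfolding AE_all_countable using * C by blast
  then show ?thesis unfolding AE_lebesgue_on_iff[OF Os] by eventually_elim (use C in blast)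
qed

lemma loc_integrable_diff: "loc_integrable \<Omega> f \<Longrightarrow> loc_integrable \<Omega> g \<Longrightarrow> loc_integrable \<Omega> (\<lambda>x. f x - g x)"
  by (simp add: loc_integrable_def)

lemma integrable_loc_test:
  assumes "open \<Omega>" "loc_integrable \<Omega> h" "\<eta> \<in> test_functions \<Omega>"
  shows "integrable (lebesgue_on \<Omega>) (\<lambda>x. h x * \<eta> x)"
    "integrable (lebesgue_on \<Omega>) (\<lambda>x. h x * partial_deriv i \<eta> x)"
proof -
  have K: "compact (closure {x. \<eta> x \<noteq> 0})" "closure {x. \<eta> x \<noteq> 0} \<subseteq> \<Omega>" and s: "smooth \<eta>"
    using assms by (auto simp: test_functions_def)
  show "integrable (lebesgue_on \<Omega>) (\<lambda>x. h x * \<eta> x)"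
    using closure_subset[of "{x. \<eta> x \<noteq> 0}"]
    by (intro integrable_loc_mult[OF assms(2,1) smooth_continuous[OF s] K]) blast
  show "integrable (lebesgue_on \<Omega>) (\<lambda>x. h x * partial_deriv i \<eta> x)"
    using partial_deriv_support[of i \<eta>]
    by (intro integrable_loc_mult[OF assms(2,1) smooth_continuous[OF smooth_partial_deriv[OF s]] K]) blast
qed

section \<open>Uniqueness of weak derivatives\<close>

lemma has_weak_partial_unique:
  assumes \<Omega>: "open \<Omega>" and g: "has_weak_partial \<Omega> i u g" and g': "has_weak_partial \<Omega> i u g'"
  shows "AE x in lebesgue_on \<Omega>. g x = g' x"
proof -
  have "AE x in lebesgue_on \<Omega>. g x - g' x = 0"
  proof (rule AE_zero_if_orthogonal_to_test_functions[OF \<Omega>])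
    show "loc_integrable \<Omega> (\<lambda>x. g x - g' x)"
      using g g' by (intro loc_integrable_diff) (auto simp: has_weak_partial_def)
    show "(\<integral>x. (g x - g' x) * \<eta> x \<partial>lebesgue_on \<Omega>) = 0" if \<eta>: "\<eta> \<in> test_functions \<Omega>" for \<eta>
    proof -
      have "(\<integral>x. (g x - g' x) * \<eta> x \<partial>lebesgue_on \<Omega>) = (\<integral>x. g x * \<eta> x \<partial>lebesgue_on \<Omega>) - (\<integral>x. g' x * \<eta> x \<partial>lebesgue_on \<Omega>)"
        using integrable_loc_test(1)[OF \<Omega> _ \<eta>] g g' by (simp add: left_diff_distrib has_weak_partial_def)
      then show ?thesis using g g' \<eta> unfolding has_weak_partial_def by fastforce
    qed
  qed
  then show ?thesis by eventually_elim simp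
qed

text \<open>The choice operator in \<open>weak_partial\<close> is harmless: by uniqueness its value
  agrees with any known weak derivative.\<close>

lemma weak_partial_AE_eq:
  assumes "open \<Omega>" "has_weak_partial \<Omega> i u g"
  shows "AE x in lebesgue_on \<Omega>. weak_partial \<Omega> i u x = g x"
  unfolding weak_partial_def
  by (rule has_weak_partial_unique[OF assms(1) someI[of "has_weak_partial \<Omega> i u", OF assms(2)] assms(2)])

lemma has_weak_partial_diff:
  assumes \<Omega>: "open \<Omega>" and g: "has_weak_partial \<Omega> i u g" and g': "has_weak_partial \<Omega> i v g'"
  shows "has_weak_partial \<Omega> i (\<lambda>x. u x - v x) (\<lambda>x. g x - g' x)"
  using g g' integrable_loc_test[OF \<Omega>]
  by (auto simp: has_weak_partial_def left_diff_distrib loc_integrable_diff)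

section \<open>Comparison with the Orlicz--Sobolev space\<close>

context growth_domain begin

lemma \<Omega>_borel [measurable]: "\<Omega> \<in> sets borel"
  using open_\<Omega> by simp

text \<open>\<open>le_eps_plus\<close> integrated over \<Omega>. The constant \<epsilon> is spread
  over the volume V; dividing by V + 1 covers volume 0.\<close>

lemma L1_le_modular:
  assumes "0 < \<epsilon>"
  obtains C where "0 \<le> C" "\<And>f. f \<in> borel_measurable borel \<Longrightarrow> (\<And>x. x \<notin> \<Omega> \<Longrightarrow> f x = 0) \<Longrightarrow>
    (\<integral>\<^sup>+x. ennreal \<bar>f x\<bar> \<partial>lborel) \<le> ennreal \<epsilon> + ennreal C * nm f"
proof -
  define V where "V = measure lborel \<Omega>"
  have V: "emeasure lborel \<Omega> = ennreal V" "0 \<le> V"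
    using emeasure_bounded_finite[OF bounded_\<Omega>] by (auto simp: V_def emeasure_eq_ennreal_measure less_top)
  have e: "0 < \<epsilon> / (V + 1)" using assms V by simp
  obtain C where C: "0 \<le> C" "\<And>t. \<bar>t\<bar> \<le> \<epsilon> / (V + 1) + C * \<Phi> t" using le_eps_plus[OF e] by blast
  show ?thesis
  proof
    show "0 \<le> C" by fact
    fix f :: "real^'n \<Rightarrow> real" assume [measurable]: "f \<in> borel_measurable borel" and off: "\<And>x. x \<notin> \<Omega> \<Longrightarrow> f x = 0"
    have "(\<integral>\<^sup>+x. ennreal \<bar>f x\<bar> \<partial>lborel) \<le> (\<integral>\<^sup>+x. ennreal (\<epsilon> / (V + 1)) * indicator \<Omega> x + ennreal C * ennreal (\<Phi> (f x)) \<partial>lborel)"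
    proof (intro nn_integral_mono)
      fix x
      show "ennreal \<bar>f x\<bar> \<le> ennreal (\<epsilon> / (V + 1)) * indicator \<Omega> x + ennreal C * ennreal (\<Phi> (f x))"
      proof (cases "x \<in> \<Omega>")
        case True
        have "ennreal \<bar>f x\<bar> \<le> ennreal (\<epsilon> / (V + 1) + C * \<Phi> (f x))" by (intro ennreal_leI C)
        then show ?thesis using True C e by (simp add: ennreal_mult)
      qed (simp add: off)
    qed
    also have "\<dots> = ennreal (\<epsilon> / (V + 1) * V) + ennreal C * nm f"
      using V e by (simp add: nn_integral_add nn_integral_cmult nn_integral_cmult_indicator) (subst ennreal_mult[symmetric], auto)
    also have "\<dots> \<le> ennreal \<epsilon> + ennreal C * nm f"
      using assms V by (intro add_right_mono ennreal_leI) (simp add: field_simps)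
    finally show "(\<integral>\<^sup>+x. ennreal \<bar>f x\<bar> \<partial>lborel) \<le> ennreal \<epsilon> + ennreal C * nm f" .
  qed
qed

lemma W_integrable:
  assumes "W u \<xi>"
  shows "integrable lborel u" "integrable lborel (\<lambda>x. \<xi> x $ i)" "integrable lborel \<xi>"
proof -
  note [measurable] = WD(1,2)[OF assms]
  show "integrable lborel u" using WD[OF assms] by (intro nm_finite_integrable) auto
  show "integrable lborel (\<lambda>x. \<xi> x $ i)"
    using WD[OF assms] nm_component_le[of \<xi> i] by (intro nm_finite_integrable) (auto intro: order.strict_trans1)
  have "integrable lborel (\<lambda>x. norm (\<xi> x))" using WD[OF assms] by (intro nm_finite_integrable) auto
  then show "integrable lborel \<xi>" by (simp add: integrable_norm_iff)
qed

lemma W_diff: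
  assumes "W u \<xi>" "W v \<zeta>"
  shows "W (\<lambda>x. u x - v x) (\<lambda>x. \<xi> x - \<zeta> x)"
  using W_add[OF assms(1) W_cmult[OF assms(2), of "-1"]] by simp

text \<open>Modular closeness gives closeness in L^1: half of e is the additive constant in
  \<open>L1_le_modular\<close>, and r satisfies C r \<le> e/2.\<close>

lemma W_L1_approx:
  assumes u: "W u \<xi>" and e: "0 < e"
  obtains \<eta> where "\<eta> \<in> \<T>" "(\<integral>\<^sup>+x. ennreal \<bar>u x - \<eta> x\<bar> \<partial>lborel) \<le> ennreal e"
    "(\<integral>\<^sup>+x. ennreal (norm (\<xi> x - grad \<eta> x)) \<partial>lborel) \<le> ennreal e"
    "nm (\<lambda>x. u x - \<eta> x) \<le> ennreal e" "nm (\<lambda>x. norm (\<xi> x - grad \<eta> x)) \<le> ennreal e"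
proof -
  obtain C where C: "0 \<le> C" "\<And>f. f \<in> borel_measurable borel \<Longrightarrow> (\<And>x. x \<notin> \<Omega> \<Longrightarrow> f x = 0) \<Longrightarrow>
    (\<integral>\<^sup>+x. ennreal \<bar>f x\<bar> \<partial>lborel) \<le> ennreal (e / 2) + ennreal C * nm f"
    using L1_le_modular[of "e / 2"] e by auto
  define r where "r = min e (e / (2 * (C + 1)))"
  have "r \<le> e / (2 * (C + 1))" by (simp add: r_def)
  then have "C * r \<le> C * (e / (2 * (C + 1)))" using C(1) by (rule mult_left_mono)
  also have "\<dots> \<le> e / 2" using C(1) e by (simp add: field_simps)
  finally have r: "0 < r" "r \<le> e" "C * r \<le> e / 2" using C(1) e by (auto simp: r_def)
  obtain \<eta> where \<eta>: "\<eta> \<in> \<T>" "nm (\<lambda>x. u x - \<eta> x) \<le> ennreal r" "nm (\<lambda>x. norm (\<xi> x - grad \<eta> x)) \<le> ennreal r"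
    using W_approx[OF u r(1)] by blast
  note D = WD(1-4)[OF W_diff[OF u W_test[OF \<eta>(1)]]]
  note [measurable] = D(1,2)
  have *: "(\<integral>\<^sup>+x. ennreal \<bar>f x\<bar> \<partial>lborel) \<le> ennreal e"
    if "f \<in> borel_measurable borel" "\<And>x. x \<notin> \<Omega> \<Longrightarrow> f x = 0" "nm f \<le> ennreal r" for f
  proof -
    have "(\<integral>\<^sup>+x. ennreal \<bar>f x\<bar> \<partial>lborel) \<le> ennreal (e / 2) + ennreal C * ennreal r"
      by (intro order_trans[OF C(2)] add_left_mono mult_left_mono that) auto
    also have "\<dots> = ennreal (e / 2 + C * r)" using C r e by (simp add: ennreal_mult)
    also have "\<dots> \<le> ennreal e" using r by (intro ennreal_leI) simp
    finally show ?thesis .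
  qed
  show ?thesis
  proof
    show "\<eta> \<in> \<T>" by fact
    show "(\<integral>\<^sup>+x. ennreal \<bar>u x - \<eta> x\<bar> \<partial>lborel) \<le> ennreal e" by (rule *[OF D(1,3) \<eta>(2)])
    have "(\<integral>\<^sup>+x. ennreal \<bar>norm (\<xi> x - grad \<eta> x)\<bar> \<partial>lborel) \<le> ennreal e"
      by (rule *[OF _ _ \<eta>(3)]) (use D(4) in auto)
    then show "(\<integral>\<^sup>+x. ennreal (norm (\<xi> x - grad \<eta> x)) \<partial>lborel) \<le> ennreal e" by simp
    show "nm (\<lambda>x. u x - \<eta> x) \<le> ennreal e" "nm (\<lambda>x. norm (\<xi> x - grad \<eta> x)) \<le> ennreal e"
      using \<eta> r by (auto intro: order_trans ennreal_leI)
  qed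
qed

lemma integral_mult_close:
  fixes f g \<zeta> :: "real^'n \<Rightarrow> real"
  assumes "integrable lborel f" "integrable lborel g" and \<zeta>: "\<zeta> \<in> borel_measurable borel" "\<And>x. \<bar>\<zeta> x\<bar> \<le> B"
    and le: "(\<integral>\<^sup>+x. ennreal \<bar>f x - g x\<bar> \<partial>lborel) \<le> ennreal e" "0 \<le> e"
  shows "\<bar>(\<integral>x. f x * \<zeta> x \<partial>lborel) - (\<integral>x. g x * \<zeta> x \<partial>lborel)\<bar> \<le> B * e"
proof -
  have i: "integrable lborel (\<lambda>x. \<zeta> x * f x)" "integrable lborel (\<lambda>x. \<zeta> x * g x)"
    using assms by (auto intro!: integrable_mult_bounded)
  have d: "integrable lborel (\<lambda>x. \<bar>f x - g x\<bar>)" using assms by simp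
  have "(\<integral>x. \<bar>f x - g x\<bar> \<partial>lborel) \<le> e"
    using le nn_integral_eq_integral[OF d] by simp
  have B: "0 \<le> B" using \<zeta>(2)[of 0] by simp
  have "\<bar>(\<integral>x. f x * \<zeta> x \<partial>lborel) - (\<integral>x. g x * \<zeta> x \<partial>lborel)\<bar> = \<bar>\<integral>x. \<zeta> x * f x - \<zeta> x * g x \<partial>lborel\<bar>"
    using i by (simp add: mult.commute)
  also have "\<dots> \<le> (\<integral>x. \<bar>\<zeta> x * f x - \<zeta> x * g x\<bar> \<partial>lborel)" by (rule integral_abs_bound)
  also have "\<dots> \<le> (\<integral>x. B * \<bar>f x - g x\<bar> \<partial>lborel)"
  proof (rule integral_mono[OF integrable_abs[OF Bochner_Integration.integrable_diff[OF i]] integrable_mult_right[OF d]])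
    show "\<bar>\<zeta> x * f x - \<zeta> x * g x\<bar> \<le> B * \<bar>f x - g x\<bar>" for x
      using mult_right_mono[OF \<zeta>(2)[of x], of "\<bar>f x - g x\<bar>"] by (simp add: abs_mult flip: right_diff_distrib)
  qed
  also have "\<dots> \<le> B * e" using B \<open>(\<integral>x. \<bar>f x - g x\<bar> \<partial>lborel) \<le> e\<close> by (simp add: mult_left_mono)
  finally show ?thesis .
qed

lemma abs_component_le: "ennreal \<bar>(v :: real^'n) $ i\<bar> \<le> ennreal (norm v)"
  by (intro ennreal_leI component_le_norm_cart)

text \<open>Both sides of the identity are continuous in L^1 because \<zeta> and its derivative are
  bounded; for test functions it is integration by parts. Since L^1 approximation suffices, the
  lemma also covers the limit of a minimising sequence before that limit is known to satisfy
  \<open>W\<close>.\<close>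

lemma weak_grad_on_L1_limit:
  assumes u: "integrable lborel u" "\<And>i. integrable lborel (\<lambda>x. \<xi> x $ i)"
    and app: "\<And>e. 0 < e \<Longrightarrow> \<exists>\<eta>\<in>\<T>. (\<integral>\<^sup>+x. ennreal \<bar>u x - \<eta> x\<bar> \<partial>lborel) \<le> ennreal e \<and>
      (\<integral>\<^sup>+x. ennreal (norm (\<xi> x - grad \<eta> x)) \<partial>lborel) \<le> ennreal e"
  shows "weak_grad_on u \<xi>"
  unfolding weak_grad_on_def
proof (intro allI impI)
  fix \<zeta> :: "real^'n \<Rightarrow> real" and i assume \<zeta>: "smooth \<zeta>" "bounded {x. \<zeta> x \<noteq> 0}"
  note ps = smooth_partial_deriv[OF \<zeta>(1)] bounded_partial_deriv_support[OF \<zeta>(2)]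
  obtain B where B: "0 < B" "\<And>x. \<bar>\<zeta> x\<bar> \<le> B" using bounded_range_bounded_support[OF smooth_continuous[OF \<zeta>(1)] \<zeta>(2)] by blast
  obtain B' where B': "0 < B'" "\<And>x. \<bar>partial_deriv i \<zeta> x\<bar> \<le> B'"
    using bounded_range_bounded_support[OF smooth_continuous[OF ps(1)] ps(2)] by blast
  let ?L = "(\<integral>x. u x * partial_deriv i \<zeta> x \<partial>lborel)" and ?R = "(\<integral>x. \<xi> x $ i * \<zeta> x \<partial>lborel)"
  have "\<bar>?L + ?R\<bar> \<le> 0 + e" if "0 < e" for e
  proof -
    define r where "r = e / (B + B')"
    have "(B + B') * r = e" using B B' by (simp add: r_def)
    then have r2: "B * r + B' * r = e" by (simp only: distrib_right)
    have "0 < r" using that B B' by (simp add: r_def)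
    note r = this r2
    obtain \<eta> where \<eta>: "\<eta> \<in> \<T>" "(\<integral>\<^sup>+x. ennreal \<bar>u x - \<eta> x\<bar> \<partial>lborel) \<le> ennreal r"
      "(\<integral>\<^sup>+x. ennreal (norm (\<xi> x - grad \<eta> x)) \<partial>lborel) \<le> ennreal r"
      using app[OF r(1)] by blast
    note W\<eta> = W_integrable[OF W_test[OF \<eta>(1)]]
    have "(\<integral>\<^sup>+x. ennreal \<bar>\<xi> x $ i - grad \<eta> x $ i\<bar> \<partial>lborel) \<le> ennreal r"
      using abs_component_le[of "\<xi> x - grad \<eta> x" i for x]
      by (intro order_trans[OF nn_integral_mono \<eta>(3)]) simp
    then have "\<bar>?R - (\<integral>x. grad \<eta> x $ i * \<zeta> x \<partial>lborel)\<bar> \<le> B * r"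
      using B r W\<eta>(2)[of i] u(2) smooth_measurable(1)[OF \<zeta>(1)] by (intro integral_mult_close) auto
    moreover have "\<bar>?L - (\<integral>x. \<eta> x * partial_deriv i \<zeta> x \<partial>lborel)\<bar> \<le> B' * r"
      using B' r W\<eta>(1) u(1) smooth_measurable(2)[OF \<zeta>(1)] \<eta>(2) by (intro integral_mult_close) auto
    moreover have "(\<integral>x. \<eta> x * partial_deriv i \<zeta> x \<partial>lborel) = - (\<integral>x. grad \<eta> x $ i * \<zeta> x \<partial>lborel)"
      using integral_by_parts[of \<eta> \<zeta> i] \<zeta> test_functionsD(1)[OF \<eta>(1)]
      by (simp add: smooth_differentiable smooth_continuous smooth_partial_deriv)
    ultimately show ?thesis using r(2) by linarith
  qed
  then have "\<bar>?L + ?R\<bar> \<le> 0" by (rule field_le_epsilon)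
  then show "?L = - ?R" by simp
qed

lemma W_weak_grad_on:
  assumes u: "W u \<xi>" shows "weak_grad_on u \<xi>"
proof (rule weak_grad_on_L1_limit)
  show "integrable lborel u" "integrable lborel (\<lambda>x. \<xi> x $ i)" for i by (rule W_integrable[OF u])+
  fix e :: real assume "0 < e"
  then show "\<exists>\<eta>\<in>\<T>. (\<integral>\<^sup>+x. ennreal \<bar>u x - \<eta> x\<bar> \<partial>lborel) \<le> ennreal e \<and>
      (\<integral>\<^sup>+x. ennreal (norm (\<xi> x - grad \<eta> x)) \<partial>lborel) \<le> ennreal e"
    by (rule W_L1_approx[OF u]) blast
qed

lemma W_has_weak_partial:
  assumes u: "W u \<xi>"
  shows "has_weak_partial \<Omega> i u (\<lambda>x. \<xi> x $ i)"
  unfolding has_weak_partial_def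
proof (intro conjI ballI)
  note [measurable] = WD(1,2)[OF u]
  have li: "loc_integrable \<Omega> f" if f: "integrable lborel f" for f :: "real^'n \<Rightarrow> real"
    unfolding loc_integrable_def
  proof (intro allI impI)
    fix K assume "compact K \<and> K \<subseteq> \<Omega>"
    then have K: "K \<in> sets borel" by (auto intro: borel_compact)
    have "f \<in> borel_measurable borel" using borel_measurable_integrable[OF f] by simp
    then show "integrable (lebesgue_on K) f"
      using f K integrable_mult_indicator[of K lborel f] by (simp add: integrable_lebesgue_on_borel)
  qed
  show "loc_integrable \<Omega> u" "loc_integrable \<Omega> (\<lambda>x. \<xi> x $ i)" by (intro li W_integrable[OF u])+
  fix \<eta> assume \<eta>: "\<eta> \<in> \<T>"
  note [measurable] = smooth_measurable[OF test_functionsD(1)[OF \<eta>]]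
  have "(\<integral>x. u x * partial_deriv i \<eta> x \<partial>lebesgue_on \<Omega>) = (\<integral>x. u x * partial_deriv i \<eta> x \<partial>lborel)"
    using WD(3)[OF u] by (subst integral_lebesgue_on_borel)
      (auto simp: indicator_def intro!: Bochner_Integration.integral_cong)
  moreover have "(\<integral>x. \<xi> x $ i * \<eta> x \<partial>lebesgue_on \<Omega>) = (\<integral>x. \<xi> x $ i * \<eta> x \<partial>lborel)"
    using WD(4)[OF u] by (subst integral_lebesgue_on_borel)
      (auto simp: indicator_def intro!: Bochner_Integration.integral_cong)
  ultimately show "(\<integral>x. u x * partial_deriv i \<eta> x \<partial>lebesgue_on \<Omega>) = - (\<integral>x. \<xi> x $ i * \<eta> x \<partial>lebesgue_on \<Omega>)"
    using W_weak_grad_on[OF u] test_functionsD(1,2)[OF \<eta>] by (simp add: weak_grad_on_def)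
qed

section \<open>Luxemburg norm and modular\<close>

definition om :: "(real^'n \<Rightarrow> real) \<Rightarrow> ennreal" where
  "om w = (\<integral>\<^sup>+x. ennreal (\<Phi> (w x)) \<partial>lebesgue_on \<Omega>)"

lemma om_eq_nm: "(\<And>x. x \<notin> \<Omega> \<Longrightarrow> w x = 0) \<Longrightarrow> om w = nm w"
  unfolding om_def by (subst nn_integral_lebesgue_on) (auto simp: indicator_def intro!: nn_integral_cong)

lemma om_cong_AE: "AE x in lebesgue_on \<Omega>. v x = w x \<Longrightarrow> om v = om w"
  unfolding om_def by (intro nn_integral_cong_AE) auto

lemma Luxemburg_le:
  assumes "0 < c" "om (\<lambda>x. w x / c) \<le> 1"
  shows "Luxemburg_norm \<Phi> \<Omega> w \<le> c"
  unfolding Luxemburg_norm_def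
  by (rule cInf_lower) (use assms in \<open>auto simp: om_def intro!: bdd_belowI[of _ 0] less_imp_le\<close>)

text \<open>By \<open>\<Phi>_scale\<close>, dividing the argument by c \<le> 1 raises the modular at
  most by the factor c^(-m).\<close>

lemma Luxemburg_le_modular:
  assumes [measurable]: "w \<in> borel_measurable borel" and off: "\<And>x. x \<notin> \<Omega> \<Longrightarrow> w x = 0"
    and v: "AE x in lebesgue_on \<Omega>. v x = w x" and c: "0 < c" "c \<le> 1" and le: "nm w \<le> ennreal (c powr m)"
  shows "Luxemburg_norm \<Phi> \<Omega> v \<le> c"
proof (rule Luxemburg_le[OF c(1)])
  have "om (\<lambda>x. v x / c) = om (\<lambda>x. w x / c)" by (rule om_cong_AE) (use v in \<open>eventually_elim, simp\<close>)
  also have "\<dots> = nm (\<lambda>x. w x / c)" by (rule om_eq_nm) (simp add: off)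
  also have "\<dots> \<le> ennreal ((1 / c) powr m) * nm w"
    using c by (intro nm_scale_le) auto
  also have "\<dots> \<le> ennreal ((1 / c) powr m) * ennreal (c powr m)" by (intro mult_left_mono le) simp
  also have "\<dots> = 1" using c by (simp add: powr_divide flip: ennreal_mult)
  finally show "om (\<lambda>x. v x / c) \<le> 1" .
qed

text \<open>The infimum of an empty set of reals carries no information, so some admissible c must
  be known before the Luxemburg norm can be used. By convexity c = max 1 M is admissible if the
  modular is M.\<close>

lemma Luxemburg_nonempty:
  assumes w: "w \<in> borel_measurable borel" and off: "\<And>x. x \<notin> \<Omega> \<Longrightarrow> w x = 0"
    and v: "AE x in lebesgue_on \<Omega>. v x = w x" and fin: "nm w < \<infinity>"
  shows "{c. c > 0 \<and> (\<integral>\<^sup>+x. ennreal (\<Phi> (v x / c)) \<partial>lebesgue_on \<Omega>) \<le> 1} \<noteq> {}"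
proof -
  note [measurable] = w
  obtain M where M: "nm w = ennreal M" "0 \<le> M" using fin by (cases "nm w") auto
  define c where "c = max 1 M"
  have c: "1 \<le> c" "M \<le> c" by (auto simp: c_def)
  have "om (\<lambda>x. v x / c) = om (\<lambda>x. w x / c)" by (rule om_cong_AE) (use v in \<open>eventually_elim, simp\<close>)
  also have "\<dots> = nm (\<lambda>x. w x / c)" by (rule om_eq_nm) (simp add: off)
  also have "\<dots> \<le> (\<integral>\<^sup>+x. ennreal (1 / c) * ennreal (\<Phi> (w x)) \<partial>lborel)"
  proof (rule nn_integral_mono)
    fix x show "ennreal (\<Phi> (w x / c)) \<le> ennreal (1 / c) * ennreal (\<Phi> (w x))"
      using \<Phi>_contract[of "1 / c" "w x"] c by (simp add: ennreal_leI flip: ennreal_mult)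
  qed
  also have "\<dots> = ennreal (1 / c) * ennreal M" by (simp add: nn_integral_cmult M)
  also have "\<dots> \<le> 1" using c M by (simp add: field_simps flip: ennreal_mult)
  finally have "om (\<lambda>x. v x / c) \<le> 1" .
  then show ?thesis using c unfolding om_def by (auto intro!: exI[of _ c])
qed

lemma Luxemburg_nonneg:
  assumes "{c. c > 0 \<and> (\<integral>\<^sup>+x. ennreal (\<Phi> (v x / c)) \<partial>lebesgue_on \<Omega>) \<le> 1} \<noteq> {}"
  shows "0 \<le> Luxemburg_norm \<Phi> \<Omega> v"
  unfolding Luxemburg_norm_def using assms by (rule cInf_greatest) simp

text \<open>Convexity gives \<Phi>(w) \<le> c \<Phi>(w/c) for an admissible c < e \<le> 1.\<close>

lemma modular_le_Luxemburg:
  assumes ne: "{c. c > 0 \<and> (\<integral>\<^sup>+x. ennreal (\<Phi> (v x / c)) \<partial>lebesgue_on \<Omega>) \<le> 1} \<noteq> {}"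
    and lt: "Luxemburg_norm \<Phi> \<Omega> v < e" "e \<le> 1"
    and [measurable]: "w \<in> borel_measurable borel" and off: "\<And>x. x \<notin> \<Omega> \<Longrightarrow> w x = 0"
    and v: "AE x in lebesgue_on \<Omega>. v x = w x"
  shows "nm w \<le> ennreal e"
proof -
  obtain c where c: "0 < c" "om (\<lambda>x. v x / c) \<le> 1" "c < e"
    using cInf_lessD[OF ne lt(1)[unfolded Luxemburg_norm_def]] by (auto simp: om_def)
  have "nm w \<le> (\<integral>\<^sup>+x. ennreal c * ennreal (\<Phi> (w x / c)) \<partial>lborel)"
  proof (rule nn_integral_mono)
    fix x show "ennreal (\<Phi> (w x)) \<le> ennreal c * ennreal (\<Phi> (w x / c))"
      using \<Phi>_contract[of c "w x / c"] c lt(2) by (simp add: ennreal_leI flip: ennreal_mult)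
  qed
  also have "\<dots> = ennreal c * nm (\<lambda>x. w x / c)" by (rule nn_integral_cmult) measurable
  also have "nm (\<lambda>x. w x / c) = om (\<lambda>x. w x / c)" by (rule om_eq_nm[symmetric]) (simp add: off)
  also have "\<dots> = om (\<lambda>x. v x / c)" by (rule om_cong_AE) (use v in \<open>eventually_elim, simp\<close>)
  also have "ennreal c * \<dots> \<le> ennreal c * 1" by (intro mult_left_mono c) simp
  also have "\<dots> \<le> ennreal e" using c by (simp add: ennreal_leI)
  finally show ?thesis .
qed

text \<open>By \<Delta>_2 the scaling constant in the definition of the Orlicz space can be
  removed.\<close>

lemma Orlicz_modular_finite:
  assumes v: "v \<in> Orlicz_space \<Phi> \<Omega>" and w: "w \<in> borel_measurable borel" "\<And>x. x \<notin> \<Omega> \<Longrightarrow> w x = 0"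
    and ae: "AE x in lebesgue_on \<Omega>. v x = w x"
  shows "nm w < \<infinity>"
proof -
  note [measurable] = w(1)
  obtain c where c: "0 < c" "om (\<lambda>x. v x / c) < \<infinity>" using v by (auto simp: Orlicz_space_def om_def)
  have "om (\<lambda>x. v x / c) = om (\<lambda>x. w x / c)" by (rule om_cong_AE) (use ae in \<open>eventually_elim, simp\<close>)
  also have "\<dots> = nm (\<lambda>x. w x / c)" by (rule om_eq_nm) (simp add: w)
  finally have "nm (\<lambda>x. w x / c) < \<infinity>" using c by simp
  then show ?thesis
  proof (rule nm_scale_finite[of "max 1 c", rotated 3])
    show "\<bar>w x\<bar> \<le> max 1 c * \<bar>w x / c\<bar>" for x
    proof -
      have "\<bar>w x\<bar> = c * \<bar>w x / c\<bar>" using c by simp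
      also have "\<dots> \<le> max 1 c * \<bar>w x / c\<bar>" by (intro mult_right_mono) auto
      finally show ?thesis .
    qed
  qed auto
qed

lemma Orlicz_of_modular:
  assumes "w \<in> borel_measurable borel" "\<And>x. x \<notin> \<Omega> \<Longrightarrow> w x = 0" "nm w < \<infinity>"
  shows "w \<in> Orlicz_space \<Phi> \<Omega>"
proof -
  have "om (\<lambda>x. w x / 1) < \<infinity>" using om_eq_nm[of w] assms by simp
  then show ?thesis using assms(1) by (auto simp: Orlicz_space_def om_def borel_lebesgue_on intro!: exI[of _ 1])
qed

lemma W_weak_partial:
  assumes "W u \<xi>"
  shows "AE x in lebesgue_on \<Omega>. weak_partial \<Omega> i u x = \<xi> x $ i"
  by (rule weak_partial_AE_eq[OF open_\<Omega> W_has_weak_partial[OF assms]])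

lemma AE_weak_gradI:
  assumes "\<And>i. AE x in lebesgue_on \<Omega>. weak_partial \<Omega> i u x = \<xi> x $ i"
  shows "AE x in lebesgue_on \<Omega>. weak_grad \<Omega> u x = \<xi> x"
proof -
  have "AE x in lebesgue_on \<Omega>. \<forall>i\<in>UNIV. weak_partial \<Omega> i u x = \<xi> x $ i"
    using assms by (intro AE_finite_allI) auto
  then show ?thesis by eventually_elim (simp add: weak_grad_def vec_eq_iff)
qed

lemma W_in_W10:
  assumes u: "W u \<xi>"
  shows "u \<in> W10 \<Phi> \<Omega>" "AE x in lebesgue_on \<Omega>. weak_grad \<Omega> u x = \<xi> x"
proof -
  show "AE x in lebesgue_on \<Omega>. weak_grad \<Omega> u x = \<xi> x" by (rule AE_weak_gradI[OF W_weak_partial[OF u]])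
  have fin: "nm (\<lambda>x. \<xi> x $ i) < \<infinity>" for i using nm_component_le WD(6)[OF u] by (rule order.strict_trans1)
  note [measurable] = WD(1,2)[OF u]
  have W1: "u \<in> W1 \<Phi> \<Omega>"
  proof -
    have "(\<lambda>x. \<xi> x $ i) \<in> Orlicz_space \<Phi> \<Omega>" for i
      using WD(4)[OF u] fin by (intro Orlicz_of_modular) auto
    moreover have "u \<in> Orlicz_space \<Phi> \<Omega>" using WD[OF u] by (intro Orlicz_of_modular) auto
    ultimately show ?thesis using W_has_weak_partial[OF u] unfolding W1_def by blast
  qed
  have "\<exists>\<eta>\<in>\<T>. W1_norm \<Phi> \<Omega> (\<lambda>x. u x - \<eta> x) < \<epsilon>" if \<epsilon>: "0 < \<epsilon>" for \<epsilon>
  proof -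
    \<comment> \<open>The Sobolev norm is a sum of 1 + N Luxemburg norms, each at most c; the factor
      2 makes the final inequality strict.\<close>
    define c where "c = min 1 (\<epsilon> / (2 * (1 + real CARD('n))))"
    have "c \<le> \<epsilon> / (2 * (1 + real CARD('n)))" by (simp add: c_def)
    then have "c * (2 * (1 + real CARD('n))) \<le> \<epsilon>" by (simp add: pos_le_divide_eq)
    then have c: "0 < c" "c \<le> 1" "c + real CARD('n) * c < \<epsilon>" using \<epsilon> by (auto simp: c_def algebra_simps)
    have "0 < c powr m" using c by simp
    then obtain \<eta> where \<eta>: "\<eta> \<in> \<T>" "nm (\<lambda>x. u x - \<eta> x) \<le> ennreal (c powr m)" "nm (\<lambda>x. norm (\<xi> x - grad \<eta> x)) \<le> ennreal (c powr m)"
      by (rule W_approx[OF u])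
    have d: "W (\<lambda>x. u x - \<eta> x) (\<lambda>x. \<xi> x - grad \<eta> x)" by (rule W_diff[OF u W_test[OF \<eta>(1)]])
    note [measurable] = WD(1,2)[OF d]
    have "Luxemburg_norm \<Phi> \<Omega> (\<lambda>x. u x - \<eta> x) \<le> c"
      using WD(3)[OF d] \<eta>(2) c by (intro Luxemburg_le_modular[where w = "\<lambda>x. u x - \<eta> x"]) auto
    moreover have "Luxemburg_norm \<Phi> \<Omega> (weak_partial \<Omega> i (\<lambda>x. u x - \<eta> x)) \<le> c" for i
    proof (rule Luxemburg_le_modular[OF _ _ W_weak_partial[OF d] c(1,2)])
      show "nm (\<lambda>x. (\<xi> x - grad \<eta> x) $ i) \<le> ennreal (c powr m)"
        using nm_component_le \<eta>(3) by (rule order_trans)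
      show "(\<lambda>x. (\<xi> x - grad \<eta> x) $ i) \<in> borel_measurable borel"
        by (rule borel_measurable_vec_nth[OF WD(2)[OF d]])
    qed (use WD(4)[OF d] in auto)
    then have "(\<Sum>i\<in>UNIV. Luxemburg_norm \<Phi> \<Omega> (weak_partial \<Omega> i (\<lambda>x. u x - \<eta> x))) \<le> (\<Sum>i\<in>(UNIV::'n set). c)"
      by (intro sum_mono)
    ultimately have "W1_norm \<Phi> \<Omega> (\<lambda>x. u x - \<eta> x) \<le> c + real CARD('n) * c" unfolding W1_norm_def by simp
    then show ?thesis using c \<eta>(1) by (intro bexI[of _ \<eta>]) auto
  qed
  with W1 show "u \<in> W10 \<Phi> \<Omega>" by (simp add: W10_def)
qed

text \<open>Borel versions of v and of its weak derivatives form the pair, and approximation in norm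
  becomes approximation in modular, component by component.\<close>

lemma W10_imp_W:
  assumes v: "v \<in> W10 \<Phi> \<Omega>"
  obtains u \<xi> where "W u \<xi>" "AE x in lebesgue_on \<Omega>. v x = u x" "AE x in lebesgue_on \<Omega>. weak_grad \<Omega> v x = \<xi> x"
proof -
  have vO: "v \<in> Orlicz_space \<Phi> \<Omega>" using v by (simp add: W10_def W1_def)
  have "\<forall>i. \<exists>g. g \<in> Orlicz_space \<Phi> \<Omega> \<and> has_weak_partial \<Omega> i v g" using v by (auto simp: W10_def W1_def)
  from choice[OF this] obtain g where g': "\<forall>i. g i \<in> Orlicz_space \<Phi> \<Omega> \<and> has_weak_partial \<Omega> i v (g i)" ..
  have g: "g i \<in> Orlicz_space \<Phi> \<Omega>" "has_weak_partial \<Omega> i v (g i)" for i using g' by simp_all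
  have Om: "w \<in> borel_measurable (lebesgue_on \<Omega>)" if "w \<in> Orlicz_space \<Phi> \<Omega>" for w
    using that by (simp add: Orlicz_space_def)
  obtain u where u: "u \<in> borel_measurable borel" "\<And>x. x \<notin> \<Omega> \<Longrightarrow> u x = 0" "AE x in lebesgue_on \<Omega>. v x = u x"
    by (rule ex_borel_representative[OF Om[OF vO] \<Omega>_borel]) blast
  have "\<forall>i. \<exists>h. h \<in> borel_measurable borel \<and> (\<forall>x. x \<notin> \<Omega> \<longrightarrow> h x = 0) \<and> (AE x in lebesgue_on \<Omega>. g i x = h x)"
  proof
    fix i
    obtain h where "h \<in> borel_measurable borel" "\<And>x. x \<notin> \<Omega> \<Longrightarrow> h x = 0" "AE x in lebesgue_on \<Omega>. g i x = h x"
      by (rule ex_borel_representative[OF Om[OF g(1)[of i]] \<Omega>_borel]) blast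
    then show "\<exists>h. h \<in> borel_measurable borel \<and> (\<forall>x. x \<notin> \<Omega> \<longrightarrow> h x = 0) \<and> (AE x in lebesgue_on \<Omega>. g i x = h x)"
      by (intro exI[of _ h] conjI allI impI)
  qed
  from choice[OF this] obtain h where h': "\<forall>i. h i \<in> borel_measurable borel \<and> (\<forall>x. x \<notin> \<Omega> \<longrightarrow> h i x = 0) \<and> (AE x in lebesgue_on \<Omega>. g i x = h i x)" ..
  have h: "h i \<in> borel_measurable borel" "x \<notin> \<Omega> \<Longrightarrow> h i x = 0" "AE x in lebesgue_on \<Omega>. g i x = h i x" for i x
    using h' by simp_all
  define \<xi> where "\<xi> x = (\<chi> i. h i x)" for x
  have \<xi>i: "\<xi> x $ i = h i x" for x i by (simp add: \<xi>_def)
  have \<xi>m: "\<xi> \<in> borel_measurable borel" using h(1) by (intro borel_measurable_vecI) (simp add: \<xi>i)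
  note [measurable] = u(1) \<xi>m h(1)
  have \<xi>0: "\<xi> x = 0" if "x \<notin> \<Omega>" for x using h(2)[OF that] by (simp add: vec_eq_iff \<xi>i)
  have ufin: "nm u < \<infinity>" by (rule Orlicz_modular_finite[OF vO u])
  have hfin: "nm (h i) < \<infinity>" for i by (rule Orlicz_modular_finite[OF g(1) h])
  have \<xi>fin: "nm (\<lambda>x. norm (\<xi> x)) < \<infinity>" using hfin by (intro nm_norm_finiteI \<xi>m) (simp add: \<xi>i)
  have "\<exists>\<eta>\<in>\<T>. nm (\<lambda>x. u x - \<eta> x) \<le> ennreal e \<and> nm (\<lambda>x. norm (\<xi> x - grad \<eta> x)) \<le> ennreal e" if e: "0 < e" for e
  proof -
    define N where "N = real CARD('n) powr m * real CARD('n)"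
    have N: "0 < N" by (simp add: N_def)
    define r where "r = min 1 (min e (e / N))"
    have "r \<le> e / N" by (simp add: r_def)
    then have r: "0 < r" "r \<le> 1" "r \<le> e" "N * r \<le> e" using e N by (auto simp: r_def field_simps)
    obtain \<eta> where \<eta>: "\<eta> \<in> \<T>" "W1_norm \<Phi> \<Omega> (\<lambda>x. v x - \<eta> x) < r" using v r(1) by (auto simp: W10_def)
    note D = WD[OF W_test[OF \<eta>(1)]]
    note [measurable] = D(1,2)
    have Dfin: "nm (\<lambda>x. partial_deriv i \<eta> x) < \<infinity>" for i
      using nm_component_le[of "grad \<eta>" i] D(6) by (auto intro: order.strict_trans1)
    have [measurable]: "(\<lambda>x. partial_deriv i \<eta> x) \<in> borel_measurable borel" for i
      by (rule smooth_measurable(2)[OF test_functionsD(1)[OF \<eta>(1)]])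
    have nmneg: "nm (\<lambda>x. - f x) = nm f" for f by simp
    have f0: "nm (\<lambda>x. u x - \<eta> x) < \<infinity>" using nm_add_finite[of u "\<lambda>x. - \<eta> x"] ufin D(5) by simp
    have fi: "nm (\<lambda>x. h i x - partial_deriv i \<eta> x) < \<infinity>" for i
      using nm_add_finite[of "h i" "\<lambda>x. - partial_deriv i \<eta> x"] hfin Dfin by simp
    have ae0: "AE x in lebesgue_on \<Omega>. v x - \<eta> x = u x - \<eta> x" using u(3) by eventually_elim simp
    have wp: "has_weak_partial \<Omega> i (\<lambda>x. v x - \<eta> x) (\<lambda>x. g i x - partial_deriv i \<eta> x)" for i
      using has_weak_partial_diff[OF open_\<Omega> g(2) W_has_weak_partial[OF W_test[OF \<eta>(1)]]] by simp
    have aei: "AE x in lebesgue_on \<Omega>. weak_partial \<Omega> i (\<lambda>x. v x - \<eta> x) x = h i x - partial_deriv i \<eta> x" for i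
      using weak_partial_AE_eq[OF open_\<Omega> wp[of i]] h(3)[of i] by eventually_elim simp
    have off0: "u x - \<eta> x = 0" if "x \<notin> \<Omega>" for x using u(2) D(3) that by simp
    have offi: "h i x - partial_deriv i \<eta> x = 0" if "x \<notin> \<Omega>" for x i
      using h(2) test_functionsD(4)[OF \<eta>(1)] that by simp
    have m0: "(\<lambda>x. u x - \<eta> x) \<in> borel_measurable borel" by measurable
    have mi: "(\<lambda>x. h i x - partial_deriv i \<eta> x) \<in> borel_measurable borel" for i by measurable
    have ne0: "{c. c > 0 \<and> (\<integral>\<^sup>+x. ennreal (\<Phi> ((v x - \<eta> x) / c)) \<partial>lebesgue_on \<Omega>) \<le> 1} \<noteq> {}"
      by (rule Luxemburg_nonempty[OF m0 _ ae0 f0]) (rule off0)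
    have nei: "{c. c > 0 \<and> (\<integral>\<^sup>+x. ennreal (\<Phi> (weak_partial \<Omega> i (\<lambda>x. v x - \<eta> x) x / c)) \<partial>lebesgue_on \<Omega>) \<le> 1} \<noteq> {}" for i
      by (rule Luxemburg_nonempty[OF mi _ aei fi]) (rule offi)
    let ?L = "\<lambda>i. Luxemburg_norm \<Phi> \<Omega> (weak_partial \<Omega> i (\<lambda>x. v x - \<eta> x))"
    \<comment> \<open>Nonnegativity of all summands allows each single Luxemburg norm to be bounded
      by the whole Sobolev norm.\<close>
    have L: "0 \<le> Luxemburg_norm \<Phi> \<Omega> (\<lambda>x. v x - \<eta> x)" "0 \<le> ?L i" for i
      by (rule Luxemburg_nonneg[OF ne0]) (rule Luxemburg_nonneg[OF nei])
    have "0 \<le> (\<Sum>i\<in>UNIV. ?L i)" using L(2) by (rule sum_nonneg)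
    then have lt0: "Luxemburg_norm \<Phi> \<Omega> (\<lambda>x. v x - \<eta> x) < r" using \<eta>(2) unfolding W1_norm_def by linarith
    have lti: "?L i < r" for i
    proof -
      have "?L i \<le> (\<Sum>i\<in>UNIV. ?L i)" using L(2) by (intro member_le_sum) auto
      then show ?thesis using \<eta>(2) L(1) unfolding W1_norm_def by linarith
    qed
    have "nm (\<lambda>x. u x - \<eta> x) \<le> ennreal r"
      by (rule modular_le_Luxemburg[OF ne0 lt0 r(2) m0 _ ae0]) (rule off0)
    then have 1: "nm (\<lambda>x. u x - \<eta> x) \<le> ennreal e" using r(3) by (auto intro: order_trans ennreal_leI)
    have "nm (\<lambda>x. h i x - partial_deriv i \<eta> x) \<le> ennreal r" for i
      by (rule modular_le_Luxemburg[OF nei lti r(2) mi _ aei]) (rule offi)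
    then have "nm (\<lambda>x. (\<xi> x - grad \<eta> x) $ i) \<le> ennreal r" for i by (simp add: \<xi>i)
    then have "(\<Sum>i\<in>UNIV. nm (\<lambda>x. (\<xi> x - grad \<eta> x) $ i)) \<le> (\<Sum>i\<in>(UNIV::'n set). ennreal r)"
      by (intro sum_mono)
    also have "\<dots> = ennreal (real CARD('n) * r)"
      using r by (subst ennreal_mult) (auto simp: ennreal_of_nat_eq_real_of_nat)
    finally have "nm (\<lambda>x. norm (\<xi> x - grad \<eta> x)) \<le> ennreal (real CARD('n) powr m) * ennreal (real CARD('n) * r)"
      by (intro order_trans[OF nm_norm_le_sum] mult_left_mono) auto
    also have "\<dots> = ennreal (N * r)" using r by (subst ennreal_mult[symmetric]) (auto simp: N_def)
    also have "\<dots> \<le> ennreal e" using r by (intro ennreal_leI)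
    finally show ?thesis using 1 \<eta>(1) by blast
  qed
  then have W: "W u \<xi>" using u \<xi>m \<xi>0 ufin \<xi>fin unfolding W_def by blast
  have "AE x in lebesgue_on \<Omega>. weak_partial \<Omega> i v x = \<xi> x $ i" for i
    using weak_partial_AE_eq[OF open_\<Omega> g(2)[of i]] h(3)[of i] by eventually_elim (simp add: \<xi>i)
  then show ?thesis using that[OF W u(3)] AE_weak_gradI by blast
qed

end

section \<open>Limits, Sobolev and Poincare inequalities\<close>

text \<open>The increments have summable L^1 norms, hence are absolutely summable almost everywhere;
  the sequence is their telescoping sum.\<close>

lemma L1_Cauchy_AE_convergent:
  fixes s :: "nat \<Rightarrow> 'a \<Rightarrow> 'b::{banach, second_countable_topology}"
  assumes [measurable]: "\<And>n. s n \<in> borel_measurable M"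
    and le: "\<And>n. (\<integral>\<^sup>+x. ennreal (norm (s (Suc n) x - s n x)) \<partial>M) \<le> ennreal ((1 / 2) ^ n)"
  shows "AE x in M. convergent (\<lambda>n. s n x)"
proof -
  have "(\<integral>\<^sup>+x. (\<Sum>n. ennreal (norm (s (Suc n) x - s n x))) \<partial>M) = (\<Sum>n. \<integral>\<^sup>+x. ennreal (norm (s (Suc n) x - s n x)) \<partial>M)"
    by (rule nn_integral_suminf) measurable
  also have "\<dots> \<le> (\<Sum>n. ennreal ((1 / 2) ^ n))" by (intro suminf_le le) auto
  also have "\<dots> = ennreal (\<Sum>n. (1 / 2) ^ n)" by (intro suminf_ennreal2) (auto intro: summable_geometric)
  finally have "(\<integral>\<^sup>+x. (\<Sum>n. ennreal (norm (s (Suc n) x - s n x))) \<partial>M) \<noteq> \<infinity>" by (auto simp: top_unique)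
  then have "AE x in M. (\<Sum>n. ennreal (norm (s (Suc n) x - s n x))) \<noteq> \<infinity>"
    by (rule nn_integral_PInf_AE[rotated]) measurable
  then show ?thesis
  proof eventually_elim
    fix x assume "(\<Sum>n. ennreal (norm (s (Suc n) x - s n x))) \<noteq> \<infinity>"
    then have "summable (\<lambda>n. norm (s (Suc n) x - s n x))" by (intro summable_suminf_not_top) auto
    then have "summable (\<lambda>n. s (Suc n) x - s n x)" by (rule summable_norm_cancel)
    then have "convergent (\<lambda>n. \<Sum>k<n. s (Suc k) x - s k x)" by (simp add: summable_iff_convergent)
    moreover have "(\<Sum>k<n. s (Suc k) x - s k x) = s n x - s 0 x" for n
      by (rule sum_lessThan_telescope)
    ultimately have "convergent (\<lambda>n. s n x - s 0 x)" by (simp only:)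
    then have "convergent (\<lambda>n. (s n x - s 0 x) + s 0 x)" by (intro convergent_add convergent_const)
    then show "convergent (\<lambda>n. s n x)" by simp
  qed
qed

lemma nn_integral_le_of_AE_limit:
  fixes s :: "nat \<Rightarrow> 'a \<Rightarrow> real"
  assumes [measurable]: "\<And>n. s n \<in> borel_measurable M" "g \<in> borel_measurable M"
    and lim: "AE x in M. (\<lambda>n. s n x) \<longlonglongrightarrow> g x"
    and le: "\<forall>\<^sub>F n in sequentially. (\<integral>\<^sup>+x. ennreal (s n x) \<partial>M) \<le> C"
  shows "(\<integral>\<^sup>+x. ennreal (g x) \<partial>M) \<le> C"
proof -
  have "(\<integral>\<^sup>+x. ennreal (g x) \<partial>M) = (\<integral>\<^sup>+x. liminf (\<lambda>n. ennreal (s n x)) \<partial>M)"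
  proof (rule nn_integral_cong_AE, use lim in eventually_elim)
    fix x assume "(\<lambda>n. s n x) \<longlonglongrightarrow> g x"
    then have "(\<lambda>n. ennreal (s n x)) \<longlonglongrightarrow> ennreal (g x)" by (rule tendsto_ennrealI)
    then show "ennreal (g x) = liminf (\<lambda>n. ennreal (s n x))" by (simp add: lim_imp_Liminf)
  qed
  also have "\<dots> \<le> liminf (\<lambda>n. \<integral>\<^sup>+x. ennreal (s n x) \<partial>M)" by (rule nn_integral_liminf) measurable
  also have "\<dots> \<le> C"
    using le by (intro Liminf_le) auto
  finally show ?thesis .
qed

context growth_domain begin

text \<open>L^1 convergence at rate 1/(n+1) gives a subsequence converging almost everywhere; it
  keeps the rates because \<open>r n\<close> is at least n.\<close>

lemma W_sequence:
  assumes u: "W u \<xi>"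
  obtains \<eta> where "\<And>n. \<eta> n \<in> \<T>" "\<And>n. nm (\<lambda>x. u x - \<eta> n x) \<le> ennreal (1 / Suc n)"
    "\<And>n. nm (\<lambda>x. norm (\<xi> x - grad (\<eta> n) x)) \<le> ennreal (1 / Suc n)"
    "\<And>n. (\<integral>\<^sup>+x. ennreal (norm (\<xi> x - grad (\<eta> n) x)) \<partial>lborel) \<le> ennreal (1 / Suc n)"
    "AE x in lborel. (\<lambda>n. \<eta> n x) \<longlonglongrightarrow> u x"
proof -
  have "\<forall>n. \<exists>\<eta>. \<eta> \<in> \<T> \<and> (\<integral>\<^sup>+x. ennreal \<bar>u x - \<eta> x\<bar> \<partial>lborel) \<le> ennreal (1 / Suc n) \<and>
    (\<integral>\<^sup>+x. ennreal (norm (\<xi> x - grad \<eta> x)) \<partial>lborel) \<le> ennreal (1 / Suc n) \<and>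
    nm (\<lambda>x. u x - \<eta> x) \<le> ennreal (1 / Suc n) \<and> nm (\<lambda>x. norm (\<xi> x - grad \<eta> x)) \<le> ennreal (1 / Suc n)"
  proof
    fix n :: nat
    have "0 < 1 / real (Suc n)" by simp
    then show "\<exists>\<eta>. \<eta> \<in> \<T> \<and> (\<integral>\<^sup>+x. ennreal \<bar>u x - \<eta> x\<bar> \<partial>lborel) \<le> ennreal (1 / Suc n) \<and>
      (\<integral>\<^sup>+x. ennreal (norm (\<xi> x - grad \<eta> x)) \<partial>lborel) \<le> ennreal (1 / Suc n) \<and>
      nm (\<lambda>x. u x - \<eta> x) \<le> ennreal (1 / Suc n) \<and> nm (\<lambda>x. norm (\<xi> x - grad \<eta> x)) \<le> ennreal (1 / Suc n)"
      by (rule W_L1_approx[OF u]) blast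
  qed
  from choice[OF this] obtain \<eta> where \<eta>': "\<forall>n. \<eta> n \<in> \<T> \<and> (\<integral>\<^sup>+x. ennreal \<bar>u x - \<eta> n x\<bar> \<partial>lborel) \<le> ennreal (1 / Suc n) \<and>
    (\<integral>\<^sup>+x. ennreal (norm (\<xi> x - grad (\<eta> n) x)) \<partial>lborel) \<le> ennreal (1 / Suc n) \<and>
    nm (\<lambda>x. u x - \<eta> n x) \<le> ennreal (1 / Suc n) \<and> nm (\<lambda>x. norm (\<xi> x - grad (\<eta> n) x)) \<le> ennreal (1 / Suc n)" ..
  have \<eta>: "\<eta> n \<in> \<T>" "(\<integral>\<^sup>+x. ennreal \<bar>u x - \<eta> n x\<bar> \<partial>lborel) \<le> ennreal (1 / Suc n)"
    "(\<integral>\<^sup>+x. ennreal (norm (\<xi> x - grad (\<eta> n) x)) \<partial>lborel) \<le> ennreal (1 / Suc n)"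
    "nm (\<lambda>x. u x - \<eta> n x) \<le> ennreal (1 / Suc n)" "nm (\<lambda>x. norm (\<xi> x - grad (\<eta> n) x)) \<le> ennreal (1 / Suc n)" for n
    using \<eta>' by blast+
  have i: "integrable lborel (\<lambda>x. u x - \<eta> n x)" for n
    by (intro Bochner_Integration.integrable_diff W_integrable(1)[OF u] W_integrable(1)[OF W_test[OF \<eta>(1)]])
  have "(\<lambda>n. \<integral>x. norm (u x - \<eta> n x) \<partial>lborel) \<longlonglongrightarrow> 0"
  proof (rule tendsto_sandwich[OF _ _ tendsto_const LIMSEQ_Suc[OF lim_1_over_n]])
    show "\<forall>\<^sub>F n in sequentially. (\<integral>x. norm (u x - \<eta> n x) \<partial>lborel) \<le> 1 / real (Suc n)"
      using \<eta>(2) nn_integral_eq_integral[OF integrable_norm[OF i]] by (intro always_eventually allI) simp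
  qed (intro always_eventually allI Bochner_Integration.integral_nonneg, simp)
  from tendsto_L1_AE_subseq[OF i this]
  obtain r where r: "strict_mono r" "AE x in lborel. (\<lambda>n. u x - \<eta> (r n) x) \<longlonglongrightarrow> 0" by auto
  have le: "ennreal (1 / Suc (r n)) \<le> ennreal (1 / Suc n)" for n
    using seq_suble[OF r(1), of n] by (intro ennreal_leI frac_le) auto
  show ?thesis
  proof (rule that[of "\<lambda>n. \<eta> (r n)"])
    show "AE x in lborel. (\<lambda>n. \<eta> (r n) x) \<longlonglongrightarrow> u x"
      using r(2)
    proof eventually_elim
      fix x assume "(\<lambda>n. u x - \<eta> (r n) x) \<longlonglongrightarrow> 0"
      from tendsto_diff[OF tendsto_const[of "u x"] this] show "(\<lambda>n. \<eta> (r n) x) \<longlonglongrightarrow> u x" by simp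
    qed
  qed (use \<eta> le order_trans in \<open>blast+\<close>)
qed

section \<open>Sobolev and Poincare inequalities on the closure\<close>

lemma Sobolev_test:
  assumes dim: "CARD('n) \<ge> 2" and \<eta>: "\<eta> \<in> \<T>" and g: "g \<in> borel_measurable borel"
    and F: "(\<integral>\<^sup>+x. ennreal (\<bar>g x\<bar> ^ CARD('n)) \<partial>lborel) \<le> ennreal F" "0 \<le> F"
  shows "(\<integral>\<^sup>+x. ennreal (\<bar>g x\<bar> * \<bar>\<eta> x\<bar>) \<partial>lborel) \<le> ennreal ((F + 1) * (\<integral>x. norm (grad \<eta> x) \<partial>lborel))"
proof (rule Sobolev_dual[OF dim _ _ _ g F])
  note D = test_functionsD(1,2)[OF \<eta>]
  show "\<eta> differentiable (at x)" for x by (rule smooth_differentiable[OF D(1)])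
  show "continuous_on UNIV (partial_deriv i \<eta>)" for i by (rule smooth_continuous[OF smooth_partial_deriv[OF D(1)]])
  show "bounded {x. \<eta> x \<noteq> 0}" by (rule D(2))
  have i: "integrable lborel (\<lambda>x. norm (grad \<eta> x))" by (rule integrable_norm[OF W_integrable(3)[OF W_test[OF \<eta>]]])
  show "0 \<le> (\<integral>x. norm (grad \<eta> x) \<partial>lborel)" by (intro Bochner_Integration.integral_nonneg) simp
  show "(\<integral>\<^sup>+x. ennreal \<bar>partial_deriv i \<eta> x\<bar> \<partial>lborel) \<le> ennreal (\<integral>x. norm (grad \<eta> x) \<partial>lborel)" for i
    using abs_component_le[of "grad \<eta> x" i for x] nn_integral_eq_integral[OF i]
    by (metis (no_types, lifting) AE_I2 grad_component nn_integral_mono norm_ge_zero)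
qed

text \<open>Approximating test functions converge almost everywhere and their gradients in L^1, so
  Fatou's lemma transfers the inequality. The error 1/(k+1) is valid for all n \<ge> k and
  disappears as k grows.\<close>

lemma Sobolev_W:
  assumes dim: "CARD('n) \<ge> 2" and u: "W u \<xi>" and g: "g \<in> borel_measurable borel"
    and F: "(\<integral>\<^sup>+x. ennreal (\<bar>g x\<bar> ^ CARD('n)) \<partial>lborel) \<le> ennreal F" "0 \<le> F"
  shows "(\<integral>\<^sup>+x. ennreal (\<bar>g x\<bar> * \<bar>u x\<bar>) \<partial>lborel) \<le> ennreal ((F + 1) * (\<integral>x. norm (\<xi> x) \<partial>lborel))"
proof -
  obtain \<eta> where \<eta>: "\<And>n. \<eta> n \<in> \<T>" "\<And>n. (\<integral>\<^sup>+x. ennreal (norm (\<xi> x - grad (\<eta> n) x)) \<partial>lborel) \<le> ennreal (1 / Suc n)"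
    "AE x in lborel. (\<lambda>n. \<eta> n x) \<longlonglongrightarrow> u x"
    by (rule W_sequence[OF u]) blast
  note [measurable] = WD(1,2)[OF u] g
  have [measurable]: "\<eta> n \<in> borel_measurable borel" for n by (rule smooth_measurable(1)[OF test_functionsD(1)[OF \<eta>(1)]])
  have gi: "integrable lborel (grad (\<eta> n))" for n by (rule W_integrable(3)[OF W_test[OF \<eta>(1)]])
  note \<xi>i = W_integrable(3)[OF u]
  have nle: "(\<integral>x. norm (grad (\<eta> n) x) \<partial>lborel) \<le> (\<integral>x. norm (\<xi> x) \<partial>lborel) + 1 / Suc n" for n
  proof -
    have d: "integrable lborel (\<lambda>x. norm (\<xi> x - grad (\<eta> n) x))" using \<xi>i gi by simp
    have "(\<integral>x. norm (grad (\<eta> n) x) \<partial>lborel) \<le> (\<integral>x. norm (\<xi> x) + norm (\<xi> x - grad (\<eta> n) x) \<partial>lborel)"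
    proof (rule integral_mono)
      show "norm (grad (\<eta> n) x) \<le> norm (\<xi> x) + norm (\<xi> x - grad (\<eta> n) x)" for x
        using norm_triangle_ineq4[of "\<xi> x" "\<xi> x - grad (\<eta> n) x"] by simp
    qed (use \<xi>i gi d in auto)
    also have "\<dots> = (\<integral>x. norm (\<xi> x) \<partial>lborel) + (\<integral>x. norm (\<xi> x - grad (\<eta> n) x) \<partial>lborel)"
      using \<xi>i d by simp
    also have "(\<integral>x. norm (\<xi> x - grad (\<eta> n) x) \<partial>lborel) \<le> 1 / Suc n"
      using \<eta>(2)[of n] nn_integral_eq_integral[OF d] by simp
    finally show ?thesis by simp
  qed
  have "(\<integral>\<^sup>+x. ennreal (\<bar>g x\<bar> * \<bar>u x\<bar>) \<partial>lborel) \<le> ennreal ((F + 1) * ((\<integral>x. norm (\<xi> x) \<partial>lborel) + 1 / Suc k))" for k :: nat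
  proof (rule nn_integral_le_of_AE_limit)
    show "AE x in lborel. (\<lambda>n. \<bar>g x\<bar> * \<bar>\<eta> n x\<bar>) \<longlonglongrightarrow> \<bar>g x\<bar> * \<bar>u x\<bar>"
      using \<eta>(3) by eventually_elim (intro tendsto_intros)
    show "\<forall>\<^sub>F n in sequentially. (\<integral>\<^sup>+x. ennreal (\<bar>g x\<bar> * \<bar>\<eta> n x\<bar>) \<partial>lborel)
        \<le> ennreal ((F + 1) * ((\<integral>x. norm (\<xi> x) \<partial>lborel) + 1 / Suc k))"
    proof (rule eventually_sequentiallyI[of k])
      fix n assume n: "k \<le> n"
      have "1 / real (Suc n) \<le> 1 / real (Suc k)" using n by (intro frac_le) auto
      then have "(F + 1) * (\<integral>x. norm (grad (\<eta> n) x) \<partial>lborel) \<le> (F + 1) * ((\<integral>x. norm (\<xi> x) \<partial>lborel) + 1 / Suc k)"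
        using nle[of n] F by (intro mult_left_mono) linarith+
      then show "(\<integral>\<^sup>+x. ennreal (\<bar>g x\<bar> * \<bar>\<eta> n x\<bar>) \<partial>lborel) \<le> ennreal ((F + 1) * ((\<integral>x. norm (\<xi> x) \<partial>lborel) + 1 / Suc k))"
        using Sobolev_test[OF dim \<eta>(1) g F] by (auto intro: order_trans ennreal_leI)
    qed
  qed measurable
  moreover have "(\<lambda>k. ennreal ((F + 1) * ((\<integral>x. norm (\<xi> x) \<partial>lborel) + 1 / Suc k))) \<longlonglongrightarrow> ennreal ((F + 1) * ((\<integral>x. norm (\<xi> x) \<partial>lborel) + 0))"
    by (intro tendsto_ennrealI tendsto_intros LIMSEQ_Suc[OF lim_1_over_n])
  ultimately show ?thesis by (intro LIMSEQ_le_const[of _ _ "\<integral>\<^sup>+x. ennreal (\<bar>g x\<bar> * \<bar>u x\<bar>) \<partial>lborel"]) auto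
qed

definition vol :: real where "vol = measure lborel \<Omega>"

lemma vol: "emeasure lborel \<Omega> = ennreal vol" "0 \<le> vol"
  using emeasure_bounded_finite[OF bounded_\<Omega>] by (auto simp: vol_def emeasure_eq_ennreal_measure less_top)

text \<open>Sobolev's inequality with the indicator of \<Omega> as weight, whose N-th power
  integrates to the volume.\<close>

lemma Poincare_W:
  assumes dim: "CARD('n) \<ge> 2" and u: "W u \<xi>"
  shows "(\<integral>\<^sup>+x. ennreal \<bar>u x\<bar> \<partial>lborel) \<le> ennreal ((vol + 1) * (\<integral>x. norm (\<xi> x) \<partial>lborel))"
proof -
  have "(\<integral>\<^sup>+x. ennreal (\<bar>indicator \<Omega> x\<bar> ^ CARD('n)) \<partial>lborel) = (\<integral>\<^sup>+x. indicator \<Omega> x \<partial>lborel)"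
    by (intro nn_integral_cong) (auto simp: indicator_def)
  then have "(\<integral>\<^sup>+x. ennreal (\<bar>indicator \<Omega> x\<bar> ^ CARD('n)) \<partial>lborel) \<le> ennreal vol" by (simp add: vol)
  from Sobolev_W[OF dim u _ this vol(2)]
  have "(\<integral>\<^sup>+x. ennreal (\<bar>indicator \<Omega> x\<bar> * \<bar>u x\<bar>) \<partial>lborel) \<le> ennreal ((vol + 1) * (\<integral>x. norm (\<xi> x) \<partial>lborel))" by simp
  moreover have "(\<integral>\<^sup>+x. ennreal (\<bar>indicator \<Omega> x\<bar> * \<bar>u x\<bar>) \<partial>lborel) = (\<integral>\<^sup>+x. ennreal \<bar>u x\<bar> \<partial>lborel)"
    using WD(3)[OF u] by (intro nn_integral_cong) (auto simp: indicator_def)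
  ultimately show ?thesis by simp
qed

text \<open>Integrate \<open>\<partial>\<^sub>i (x\<^sub>i \<Phi>(\<eta>)) = \<Phi>(\<eta>) + x\<^sub>i \<alpha>(\<eta>) \<partial>\<^sub>i \<eta>\<close> and absorb the second term by Young's inequality.\<close>
lemma modular_Poincare:
  obtains C where "0 \<le> C" "\<And>\<eta>. \<eta> \<in> \<T> \<Longrightarrow> nm \<eta> \<le> ennreal C * nm (\<lambda>x. norm (grad \<eta> x))"
proof -
  obtain R where R: "0 < R" "\<And>x. x \<in> \<Omega> \<Longrightarrow> norm x \<le> R" using bounded_\<Omega> unfolding bounded_pos by blast
  \<comment> \<open>On \<Omega> the coordinate is bounded by R, so the weight 1/(2R) leaves half of
    the modular of \<eta> to be absorbed.\<close>
  obtain C where C: "0 \<le> C" "\<And>s t. 0 \<le> s \<Longrightarrow> 0 \<le> t \<Longrightarrow> \<alpha> s * t \<le> 1 / (2 * R) * \<Phi> s + C * \<Phi> t"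
    using young_eps[of "1 / (2 * R)"] R by auto
  have \<alpha>_abs: "\<bar>\<alpha> t\<bar> = \<alpha> \<bar>t\<bar>" for t
    using \<alpha>_nonneg[of t] \<alpha>_nonneg[of "- t"] \<alpha>_odd[of t] by (cases "0 \<le> t") auto
  show ?thesis
  proof
    show "0 \<le> 2 * R * C" using R C by simp
    fix \<eta> assume \<eta>: "\<eta> \<in> \<T>"
    note D = test_functionsD[OF \<eta>]
    \<comment> \<open>Any coordinate direction will do.\<close>
    obtain i :: 'n where True by blast
    let ?h = "\<lambda>x. x $ i * \<Phi> (\<eta> x)"
    have ec: "continuous_on UNIV \<eta>" and pc: "continuous_on UNIV (partial_deriv i \<eta>)"
      using smooth_continuous[OF D(1)] smooth_continuous[OF smooth_partial_deriv[OF D(1)]] by auto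
    have dx: "(\<lambda>x::real^'n. x $ i) differentiable (at x)" for x by (rule smooth_differentiable[OF smooth_component])
    have pdx: "partial_deriv i (\<lambda>x::real^'n. x $ i) x = 1" for x
      using partial_deriv_eq[OF bounded_linear_imp_has_derivative[OF bounded_linear_vec_nth], of i i x] by simp
    have d\<Phi>: "(\<lambda>x. \<Phi> (\<eta> x)) differentiable (at x)" "partial_deriv i (\<lambda>x. \<Phi> (\<eta> x)) x = \<alpha> (\<eta> x) * partial_deriv i \<eta> x" for x
      using partial_deriv_compose[OF \<Phi>_deriv smooth_differentiable[OF D(1)]] by auto
    have eq: "partial_deriv i ?h = (\<lambda>x. x $ i * (\<alpha> (\<eta> x) * partial_deriv i \<eta> x) + \<Phi> (\<eta> x))"
      by (rule ext) (simp add: partial_deriv_mult[OF dx d\<Phi>(1)] d\<Phi>(2) pdx)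
    have ac: "continuous_on UNIV (\<lambda>x. \<alpha> (\<eta> x))" by (rule continuous_on_compose2[OF \<alpha>_cont ec]) auto
    have \<Phi>c: "continuous_on UNIV (\<lambda>x. \<Phi> (\<eta> x))" by (rule continuous_on_compose2[OF \<Phi>_continuous ec]) auto
    have 0: "(\<integral>x. partial_deriv i ?h x \<partial>lborel) = 0"
    proof (rule integral_partial_deriv_zero)
      show "?h differentiable (at x)" for x by (intro differentiable_mult dx d\<Phi>)
      show "continuous_on UNIV (partial_deriv i ?h)" unfolding eq by (intro continuous_intros ac pc \<Phi>c)
      show "bounded {x. ?h x \<noteq> 0}" using D(2) by (rule bounded_subset) auto
    qed
    have i1: "integrable lborel (\<lambda>x. x $ i * (\<alpha> (\<eta> x) * partial_deriv i \<eta> x))"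
      using D(2) by (intro integrable_bounded_support continuous_intros ac pc) (auto elim!: bounded_subset)
    have i2: "integrable lborel (\<lambda>x. \<Phi> (\<eta> x))"
      using D(2) by (intro integrable_bounded_support \<Phi>c) (auto elim!: bounded_subset)
    have gb: "nm (\<lambda>x. norm (grad \<eta> x)) < \<infinity>" by (rule WD(6)[OF W_test[OF \<eta>]])
    have [measurable]: "grad \<eta> \<in> borel_measurable borel" by (rule smooth_measurable(3)[OF D(1)])
    have i3: "integrable lborel (\<lambda>x. \<Phi> (norm (grad \<eta> x)))"
      using gb by (intro integrableI_nonneg) auto
    have "(\<integral>x. \<Phi> (\<eta> x) \<partial>lborel) = - (\<integral>x. x $ i * (\<alpha> (\<eta> x) * partial_deriv i \<eta> x) \<partial>lborel)"
      using 0 i1 i2 by (simp add: eq)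
    also have "\<dots> \<le> (\<integral>x. 1 / 2 * \<Phi> (\<eta> x) + R * C * \<Phi> (norm (grad \<eta> x)) \<partial>lborel)"
      unfolding integral_minus[symmetric]
    proof (rule integral_mono)
      fix x
      show "- (x $ i * (\<alpha> (\<eta> x) * partial_deriv i \<eta> x)) \<le> 1 / 2 * \<Phi> (\<eta> x) + R * C * \<Phi> (norm (grad \<eta> x))"
      proof (cases "x \<in> \<Omega>")
        case True
        have "- (x $ i * (\<alpha> (\<eta> x) * partial_deriv i \<eta> x)) \<le> \<bar>x $ i\<bar> * (\<alpha> \<bar>\<eta> x\<bar> * \<bar>partial_deriv i \<eta> x\<bar>)"
          using abs_ge_minus_self[of "x $ i * (\<alpha> (\<eta> x) * partial_deriv i \<eta> x)"] by (simp add: abs_mult \<alpha>_abs)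
        also have "\<dots> \<le> R * (1 / (2 * R) * \<Phi> \<bar>\<eta> x\<bar> + C * \<Phi> \<bar>partial_deriv i \<eta> x\<bar>)"
          using R component_le_norm_cart[of x i] True
          by (intro mult_mono C(2) mult_nonneg_nonneg \<alpha>_nonneg) (auto intro: order_trans)
        also have "\<dots> = 1 / 2 * \<Phi> (\<eta> x) + R * C * \<Phi> (partial_deriv i \<eta> x)"
          using R by (simp add: field_simps)
        also have "\<dots> \<le> 1 / 2 * \<Phi> (\<eta> x) + R * C * \<Phi> (norm (grad \<eta> x))"
          using \<Phi>_component_le[of "grad \<eta> x" i] R C by (intro add_left_mono mult_left_mono) auto
        finally show ?thesis .
      next
        case False
        then show ?thesis using D(3,4) R C by simp
      qed
    qed (use i1 i2 i3 in auto)
    also have "\<dots> = 1 / 2 * (\<integral>x. \<Phi> (\<eta> x) \<partial>lborel) + R * C * (\<integral>x. \<Phi> (norm (grad \<eta> x)) \<partial>lborel)"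
      using i2 i3 by simp
    finally have "(\<integral>x. \<Phi> (\<eta> x) \<partial>lborel) \<le> 2 * R * C * (\<integral>x. \<Phi> (norm (grad \<eta> x)) \<partial>lborel)" by simp
    then have "ennreal (\<integral>x. \<Phi> (\<eta> x) \<partial>lborel) \<le> ennreal (2 * R * C) * ennreal (\<integral>x. \<Phi> (norm (grad \<eta> x)) \<partial>lborel)"
      using R C by (simp add: ennreal_leI flip: ennreal_mult)
    then show "nm \<eta> \<le> ennreal (2 * R * C) * nm (\<lambda>x. norm (grad \<eta> x))"
      using i2 i3 by (simp add: nn_integral_eq_integral)
  qed
qed

end

section \<open>Existence and uniqueness\<close>

locale dirichlet = growth_domain \<Phi> \<alpha> m \<Omega> for \<Phi> \<alpha> m and \<Omega> :: "(real^'n) set" +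
  fixes f :: "real^'n \<Rightarrow> real" and F :: real
  assumes dim: "CARD('n) \<ge> 2" and shift: "shiftable \<Omega>"
    and f [measurable]: "f \<in> borel_measurable borel"
    and F: "(\<integral>\<^sup>+x. ennreal (\<bar>f x\<bar> ^ CARD('n)) \<partial>lborel) \<le> ennreal F" "0 \<le> F"
begin

section \<open>Energy and coercivity\<close>

definition energy :: "(real^'n \<Rightarrow> real) \<Rightarrow> (real^'n \<Rightarrow> real^'n) \<Rightarrow> real" where
  "energy u \<xi> = (\<integral>x. \<Phi> (norm (\<xi> x)) \<partial>lborel) - (\<integral>x. f x * u x \<partial>lborel)"

lemma W_\<Phi>_integrable: "W u \<xi> \<Longrightarrow> integrable lborel (\<lambda>x. \<Phi> (norm (\<xi> x)))"
  using WD(2,6)[of u \<xi>] by (intro integrableI_nonneg) auto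

lemma W_load:
  assumes u: "W u \<xi>"
  shows "integrable lborel (\<lambda>x. f x * u x)"
    "(\<integral>x. \<bar>f x * u x\<bar> \<partial>lborel) \<le> (F + 1) * (\<integral>x. norm (\<xi> x) \<partial>lborel)"
    "\<bar>\<integral>x. f x * u x \<partial>lborel\<bar> \<le> (F + 1) * (\<integral>x. norm (\<xi> x) \<partial>lborel)"
proof -
  note [measurable] = WD(1)[OF u]
  have le: "(\<integral>\<^sup>+x. ennreal \<bar>f x * u x\<bar> \<partial>lborel) \<le> ennreal ((F + 1) * (\<integral>x. norm (\<xi> x) \<partial>lborel))"
    using Sobolev_W[OF dim u f F] by (simp add: abs_mult)
  then have "(\<integral>\<^sup>+x. ennreal (norm (f x * u x)) \<partial>lborel) < \<infinity>" by (auto intro: order.strict_trans1)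
  then show i: "integrable lborel (\<lambda>x. f x * u x)" by (intro integrableI_bounded) auto
  have "0 \<le> (F + 1) * (\<integral>x. norm (\<xi> x) \<partial>lborel)" using F by (intro mult_nonneg_nonneg Bochner_Integration.integral_nonneg) auto
  then show le': "(\<integral>x. \<bar>f x * u x\<bar> \<partial>lborel) \<le> (F + 1) * (\<integral>x. norm (\<xi> x) \<partial>lborel)"
    using le nn_integral_eq_integral[OF integrable_abs[OF i]] by simp
  have "\<bar>\<integral>x. f x * u x \<partial>lborel\<bar> \<le> (\<integral>x. \<bar>f x * u x\<bar> \<partial>lborel)" by (rule integral_abs_bound)
  with le' show "\<bar>\<integral>x. f x * u x \<partial>lborel\<bar> \<le> (F + 1) * (\<integral>x. norm (\<xi> x) \<partial>lborel)" by linarith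
qed

lemma integral_norm_le_modular:
  assumes "0 < \<epsilon>"
  obtains C where "0 \<le> C" "\<And>u \<xi>. W u \<xi> \<Longrightarrow> (\<integral>x. norm (\<xi> x) \<partial>lborel) \<le> \<epsilon> * (\<integral>x. \<Phi> (norm (\<xi> x)) \<partial>lborel) + C"
proof -
  obtain C where C: "0 \<le> C" "\<And>t. \<bar>t\<bar> \<le> \<epsilon> * \<Phi> t + C" using superlinear[OF assms] by blast
  have indi: "integrable lborel (indicat_real \<Omega>)" using vol by (intro integrable_real_indicator) auto
  show ?thesis
  proof
    show "0 \<le> C * vol" using C vol by simp
    fix u \<xi> assume u: "W u \<xi>"
    have "(\<integral>x. norm (\<xi> x) \<partial>lborel) \<le> (\<integral>x. \<epsilon> * \<Phi> (norm (\<xi> x)) + C * indicator \<Omega> x \<partial>lborel)"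
    proof (rule integral_mono)
      show "norm (\<xi> x) \<le> \<epsilon> * \<Phi> (norm (\<xi> x)) + C * indicator \<Omega> x" for x
        using C(2)[of "norm (\<xi> x)"] WD(4)[OF u, of x] by (cases "x \<in> \<Omega>") auto
      show "integrable lborel (\<lambda>x. norm (\<xi> x))" by (rule integrable_norm[OF W_integrable(3)[OF u]])
      show "integrable lborel (\<lambda>x. \<epsilon> * \<Phi> (norm (\<xi> x)) + C * indicator \<Omega> x)"
        using W_\<Phi>_integrable[OF u] indi by (intro Bochner_Integration.integrable_add integrable_mult_right)
    qed
    also have "\<dots> = \<epsilon> * (\<integral>x. \<Phi> (norm (\<xi> x)) \<partial>lborel) + C * vol"
      using W_\<Phi>_integrable[OF u] indi by (simp add: vol_def)
    finally show "(\<integral>x. norm (\<xi> x) \<partial>lborel) \<le> \<epsilon> * (\<integral>x. \<Phi> (norm (\<xi> x)) \<partial>lborel) + C * vol" .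
  qed
qed

text \<open>The load is at most F + 1 times the L^1 norm of the gradient. With \<epsilon> = 1/(2(F +
  1)) superlinearity turns this into half of the modular plus a constant.\<close>

lemma coercive:
  obtains c where "0 \<le> c" "\<And>u \<xi>. W u \<xi> \<Longrightarrow> (\<integral>x. \<Phi> (norm (\<xi> x)) \<partial>lborel) \<le> 2 * energy u \<xi> + c"
proof -
  have e: "0 < 1 / (2 * (F + 1))" using F by simp
  obtain C where C: "0 \<le> C" "\<And>u \<xi>. W u \<xi> \<Longrightarrow> (\<integral>x. norm (\<xi> x) \<partial>lborel) \<le> 1 / (2 * (F + 1)) * (\<integral>x. \<Phi> (norm (\<xi> x)) \<partial>lborel) + C"
    using integral_norm_le_modular[OF e] by blast
  show ?thesis
  proof
    show "0 \<le> 2 * ((F + 1) * C)" using F C by simp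
    fix u \<xi> assume u: "W u \<xi>"
    have "(F + 1) * (\<integral>x. norm (\<xi> x) \<partial>lborel) \<le> (F + 1) * (1 / (2 * (F + 1)) * (\<integral>x. \<Phi> (norm (\<xi> x)) \<partial>lborel) + C)"
      using C(2)[OF u] F by (intro mult_left_mono) auto
    also have "\<dots> = (\<integral>x. \<Phi> (norm (\<xi> x)) \<partial>lborel) / 2 + (F + 1) * C"
      using F by (simp add: field_simps)
    finally have 1: "(F + 1) * (\<integral>x. norm (\<xi> x) \<partial>lborel) \<le> (\<integral>x. \<Phi> (norm (\<xi> x)) \<partial>lborel) / 2 + (F + 1) * C" .
    have "P \<le> 2 * (P - L) + 2 * K" if "\<bar>L\<bar> \<le> X" "X \<le> P / 2 + K" for P L K X :: real using that by simp
    from this[OF W_load(3)[OF u] 1]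
    show "(\<integral>x. \<Phi> (norm (\<xi> x)) \<partial>lborel) \<le> 2 * energy u \<xi> + 2 * ((F + 1) * C)"
      unfolding energy_def .
  qed
qed

definition Emin :: real where "Emin = (INF \<eta>\<in>\<T>. energy \<eta> (grad \<eta>))"

lemma energy_bdd_below: "bdd_below ((\<lambda>\<eta>. energy \<eta> (grad \<eta>)) ` \<T>)"
proof -
  obtain c where c: "\<And>u \<xi>. W u \<xi> \<Longrightarrow> (\<integral>x. \<Phi> (norm (\<xi> x)) \<partial>lborel) \<le> 2 * energy u \<xi> + c" by (rule coercive) blast
  have "- c / 2 \<le> energy \<eta> (grad \<eta>)" if "\<eta> \<in> \<T>" for \<eta>
  proof -
    have "0 \<le> (\<integral>x. \<Phi> (norm (grad \<eta> x)) \<partial>lborel)" by (intro Bochner_Integration.integral_nonneg) simp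
    then have "0 \<le> 2 * energy \<eta> (grad \<eta>) + c" using c[OF W_test[OF that]] by (rule order_trans)
    then show ?thesis by simp
  qed
  then show ?thesis by (intro bdd_belowI2)
qed

lemma Emin_le: "\<eta> \<in> \<T> \<Longrightarrow> Emin \<le> energy \<eta> (grad \<eta>)"
  unfolding Emin_def by (intro cINF_lower energy_bdd_below)

lemma Emin_near:
  assumes "0 < e" obtains \<eta> where "\<eta> \<in> \<T>" "energy \<eta> (grad \<eta>) \<le> Emin + e"
proof -
  have "Inf ((\<lambda>\<eta>. energy \<eta> (grad \<eta>)) ` \<T>) < Emin + e" using assms by (simp add: Emin_def)
  from cInf_lessD[OF _ this] show ?thesis using test_zero that by fastforce
qed

text \<open>Minimality will be tested with arbitrary members of the closure, whereas
  \<open>Emin\<close> is an infimum over test functions. A test function close to v has energy at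
  most that of v plus e: \<open>\<Phi>_perturb\<close> controls the modular, Sobolev's inequality
  the load.\<close>

lemma Emin_le_W:
  assumes v: "W v \<zeta>" shows "Emin \<le> energy v \<zeta>"
proof -
  define P where "P = (\<integral>x. \<Phi> (norm (\<zeta> x)) \<partial>lborel)"
  have P: "0 \<le> P" unfolding P_def by (intro Bochner_Integration.integral_nonneg) simp
  have "Emin \<le> energy v \<zeta> + e" if e: "0 < e" for e
  proof -
    \<comment> \<open>One half of e pays for the factor 1 + \<epsilon> in front of the modular P,
      the other half for the two errors proportional to \<delta>.\<close>
    define \<epsilon> where "\<epsilon> = e / (2 * (P + 1))"
    have \<epsilon>: "0 < \<epsilon>" "\<epsilon> * P \<le> e / 2" using e P by (auto simp: \<epsilon>_def field_simps)
    obtain C where C: "0 \<le> C" "\<And>\<xi> d::real^'n. \<Phi> (norm (\<xi> + d)) \<le> (1 + \<epsilon>) * \<Phi> (norm \<xi>) + C * \<Phi> (norm d)"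
      using \<Phi>_perturb[OF \<epsilon>(1)] by blast
    define \<delta> where "\<delta> = e / (2 * (C + F + 1))"
    have q: "0 < C + F + 1" using C(1) F(2) by simp
    have \<delta>: "0 < \<delta>" using e q by (simp add: \<delta>_def)
    have "q * (e / (2 * q)) = e / 2" if "0 < q" for q using that by simp
    from this[OF q] have "(C + F + 1) * \<delta> = e / 2" unfolding \<delta>_def .
    then have \<delta>2: "C * \<delta> + (F + 1) * \<delta> = e / 2" by (simp add: algebra_simps)
    obtain \<eta> where \<eta>: "\<eta> \<in> \<T>" "(\<integral>\<^sup>+x. ennreal (norm (\<zeta> x - grad \<eta> x)) \<partial>lborel) \<le> ennreal \<delta>"
      "nm (\<lambda>x. norm (\<zeta> x - grad \<eta> x)) \<le> ennreal \<delta>"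
      by (rule W_L1_approx[OF v \<delta>]) blast
    have t: "W \<eta> (grad \<eta>)" by (rule W_test[OF \<eta>(1)])
    have d: "W (\<lambda>x. v x - \<eta> x) (\<lambda>x. \<zeta> x - grad \<eta> x)" by (rule W_diff[OF v t])
    have a: "(\<integral>x. norm (\<zeta> x - grad \<eta> x) \<partial>lborel) \<le> \<delta>"
      using \<eta>(2) \<delta> nn_integral_eq_integral[OF integrable_norm[OF W_integrable(3)[OF d]]] by simp
    have b: "(\<integral>x. \<Phi> (norm (\<zeta> x - grad \<eta> x)) \<partial>lborel) \<le> \<delta>"
      using \<eta>(3) \<delta> nn_integral_eq_integral[OF W_\<Phi>_integrable[OF d]] by simp
    have "(\<integral>x. \<Phi> (norm (grad \<eta> x)) \<partial>lborel) \<le> (\<integral>x. (1 + \<epsilon>) * \<Phi> (norm (\<zeta> x)) + C * \<Phi> (norm (\<zeta> x - grad \<eta> x)) \<partial>lborel)"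
    proof (rule integral_mono)
      show "\<Phi> (norm (grad \<eta> x)) \<le> (1 + \<epsilon>) * \<Phi> (norm (\<zeta> x)) + C * \<Phi> (norm (\<zeta> x - grad \<eta> x))" for x
        using C(2)[of "\<zeta> x" "grad \<eta> x - \<zeta> x"] by (simp add: norm_minus_commute)
    qed (use W_\<Phi>_integrable[OF t] W_\<Phi>_integrable[OF d] W_\<Phi>_integrable[OF v] in auto)
    also have "\<dots> = (1 + \<epsilon>) * P + C * (\<integral>x. \<Phi> (norm (\<zeta> x - grad \<eta> x)) \<partial>lborel)"
      using W_\<Phi>_integrable[OF d] W_\<Phi>_integrable[OF v] by (simp add: P_def)
    also have "\<dots> \<le> P + e / 2 + C * \<delta>"
    proof -
      have "C * (\<integral>x. \<Phi> (norm (\<zeta> x - grad \<eta> x)) \<partial>lborel) \<le> C * \<delta>" using b C(1) by (rule mult_left_mono)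
      then show ?thesis using \<epsilon>(2) by (simp add: distrib_right)
    qed
    finally have 1: "(\<integral>x. \<Phi> (norm (grad \<eta> x)) \<partial>lborel) \<le> P + e / 2 + C * \<delta>" .
    have "(\<integral>x. f x * (v x - \<eta> x) \<partial>lborel) = (\<integral>x. f x * v x \<partial>lborel) - (\<integral>x. f x * \<eta> x \<partial>lborel)"
      using W_load(1)[OF v] W_load(1)[OF t] by (simp add: right_diff_distrib)
    moreover have "(F + 1) * (\<integral>x. norm (\<zeta> x - grad \<eta> x) \<partial>lborel) \<le> (F + 1) * \<delta>"
      using a F by (intro mult_left_mono) auto
    ultimately have "(\<integral>x. f x * v x \<partial>lborel) - (\<integral>x. f x * \<eta> x \<partial>lborel) \<le> (F + 1) * \<delta>"
      using W_load(3)[OF d] by linarith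
    then have "energy \<eta> (grad \<eta>) \<le> energy v \<zeta> + e" using 1 \<delta>2 unfolding energy_def P_def by linarith
    then show ?thesis using Emin_le[OF \<eta>(1)] by linarith
  qed
  then show ?thesis by (rule field_le_epsilon)
qed

section \<open>Minimising sequences\<close>

text \<open>The midpoint of two test functions has energy at least \<open>Emin\<close>; the linear
  load cancels, and only the convexity gap of the gradients remains.\<close>

lemma integral_gap_le:
  assumes \<eta>: "\<eta> \<in> \<T>" and \<kappa>: "\<kappa> \<in> \<T>"
  shows "integrable lborel (\<lambda>x. gap (grad \<eta> x) (grad \<kappa> x))"
    "(\<integral>x. gap (grad \<eta> x) (grad \<kappa> x) \<partial>lborel) \<le> (energy \<eta> (grad \<eta>) + energy \<kappa> (grad \<kappa>)) / 2 - Emin"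
proof -
  define \<mu> where "\<mu> x = (1 / 2) * \<eta> x + (1 / 2) * \<kappa> x" for x
  have \<mu>: "\<mu> \<in> \<T>" unfolding \<mu>_def[abs_def] by (intro test_add test_cmult \<eta> \<kappa>)
  have g\<mu>: "grad \<mu> x = (1 / 2) *\<^sub>R (grad \<eta> x + grad \<kappa> x)" for x
  proof -
    note sm = test_functionsD(1)[OF \<eta>] test_functionsD(1)[OF \<kappa>]
    show ?thesis unfolding \<mu>_def[abs_def]
      by (simp only: grad_add[OF smooth_cmult[OF sm(1)] smooth_cmult[OF sm(2)]] grad_cmult[OF sm(1)] grad_cmult[OF sm(2)] scaleR_add_right)
  qed
  note i = W_\<Phi>_integrable[OF W_test[OF \<eta>]] W_\<Phi>_integrable[OF W_test[OF \<kappa>]] W_\<Phi>_integrable[OF W_test[OF \<mu>]]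
  note l = W_load(1)[OF W_test[OF \<eta>]] W_load(1)[OF W_test[OF \<kappa>]]
  have eq: "gap (grad \<eta> x) (grad \<kappa> x) = (\<Phi> (norm (grad \<eta> x)) + \<Phi> (norm (grad \<kappa> x))) / 2 - \<Phi> (norm (grad \<mu> x))" for x
    by (simp only: gap_def g\<mu>)
  show "integrable lborel (\<lambda>x. gap (grad \<eta> x) (grad \<kappa> x))" unfolding eq using i by simp
  have "(\<integral>x. f x * \<mu> x \<partial>lborel) = (\<integral>x. (1 / 2) * (f x * \<eta> x) + (1 / 2) * (f x * \<kappa> x) \<partial>lborel)"
    by (simp add: \<mu>_def algebra_simps)
  also have "\<dots> = (1 / 2) * (\<integral>x. f x * \<eta> x \<partial>lborel) + (1 / 2) * (\<integral>x. f x * \<kappa> x \<partial>lborel)" using l by simp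
  finally have "(\<integral>x. f x * \<mu> x \<partial>lborel) = ((\<integral>x. f x * \<eta> x \<partial>lborel) + (\<integral>x. f x * \<kappa> x \<partial>lborel)) / 2" by simp
  moreover have "(\<integral>x. gap (grad \<eta> x) (grad \<kappa> x) \<partial>lborel)
      = ((\<integral>x. \<Phi> (norm (grad \<eta> x)) \<partial>lborel) + (\<integral>x. \<Phi> (norm (grad \<kappa> x)) \<partial>lborel)) / 2 - (\<integral>x. \<Phi> (norm (grad \<mu> x)) \<partial>lborel)"
    unfolding eq using i by simp
  ultimately show "(\<integral>x. gap (grad \<eta> x) (grad \<kappa> x) \<partial>lborel) \<le> (energy \<eta> (grad \<eta>) + energy \<kappa> (grad \<kappa>)) / 2 - Emin"
    using Emin_le[OF \<mu>] unfolding energy_def by (simp add: field_simps)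
qed

text \<open>Coercivity bounds both modulars by a common M, so the \<epsilon>-term of
  \<open>diff_le_gap\<close> contributes at most e/2; the integrated gap is at most \<delta>, so its
  term is at most C \<delta>.\<close>

lemma almost_minimizers_close:
  assumes e: "0 < e"
  obtains \<delta> where "0 < \<delta>" "\<And>\<eta> \<kappa>. \<lbrakk>\<eta> \<in> \<T>; \<kappa> \<in> \<T>; energy \<eta> (grad \<eta>) \<le> Emin + \<delta>; energy \<kappa> (grad \<kappa>) \<le> Emin + \<delta>\<rbrakk>
    \<Longrightarrow> (\<integral>x. norm (grad \<eta> x - grad \<kappa> x) \<partial>lborel) \<le> e"
proof -
  obtain c where c: "0 \<le> c" "\<And>u \<xi>. W u \<xi> \<Longrightarrow> (\<integral>x. \<Phi> (norm (\<xi> x)) \<partial>lborel) \<le> 2 * energy u \<xi> + c" by (rule coercive) blast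
  define M where "M = \<bar>2 * Emin + 2 + c\<bar>"
  have M: "0 \<le> M" by (simp add: M_def)
  define q where "q = vol + 2 * M + 1"
  have q: "0 < q" "vol + 2 * M \<le> q" using vol M by (simp_all add: q_def)
  define \<epsilon> where "\<epsilon> = e / (2 * q)"
  have \<epsilon>: "0 < \<epsilon>" using e q by (simp add: \<epsilon>_def)
  have "\<epsilon> * (vol + 2 * M) \<le> \<epsilon> * q" using \<epsilon> q by (intro mult_left_mono) auto
  also have "\<dots> = e / 2" using q by (simp add: \<epsilon>_def)
  finally have \<epsilon>2: "\<epsilon> * (vol + 2 * M) \<le> e / 2" .
  obtain C where C: "0 \<le> C"
    "\<And>\<xi> \<zeta>::real^'n. norm (\<xi> - \<zeta>) \<le> \<epsilon> * (1 + \<Phi> (norm \<xi>) + \<Phi> (norm \<zeta>)) + C * gap \<xi> \<zeta>"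
    using diff_le_gap[OF \<epsilon>] by metis
  define \<delta> where "\<delta> = min 1 (e / (2 * (C + 1)))"
  have "\<delta> \<le> e / (2 * (C + 1))" by (simp add: \<delta>_def)
  then have "C * \<delta> \<le> C * (e / (2 * (C + 1)))" using C(1) by (rule mult_left_mono)
  also have "\<dots> \<le> e / 2" using C(1) e by (simp add: field_simps)
  finally have \<delta>: "0 < \<delta>" "\<delta> \<le> 1" "C * \<delta> \<le> e / 2" using C(1) e by (auto simp: \<delta>_def)
  have indi: "integrable lborel (indicat_real \<Omega>)" using vol by (intro integrable_real_indicator) auto
  show ?thesis
  proof
    show "0 < \<delta>" by fact
    fix \<eta> \<kappa> assume T: "\<eta> \<in> \<T>" "\<kappa> \<in> \<T>" and E: "energy \<eta> (grad \<eta>) \<le> Emin + \<delta>" "energy \<kappa> (grad \<kappa>) \<le> Emin + \<delta>"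
    note i = W_\<Phi>_integrable[OF W_test[OF T(1)]] W_\<Phi>_integrable[OF W_test[OF T(2)]]
    note g = integral_gap_le[OF T]
    have PM: "(\<integral>x. \<Phi> (norm (grad \<eta> x)) \<partial>lborel) \<le> M" "(\<integral>x. \<Phi> (norm (grad \<kappa> x)) \<partial>lborel) \<le> M"
      using c(2)[OF W_test[OF T(1)]] c(2)[OF W_test[OF T(2)]] E \<delta>(2) unfolding M_def by linarith+
    \<comment> \<open>The constant 1 of \<open>diff_le_gap\<close> becomes the indicator of
      \<Omega>, because both gradients vanish outside; this keeps the bound integrable.\<close>
    have "(\<integral>x. norm (grad \<eta> x - grad \<kappa> x) \<partial>lborel)
      \<le> (\<integral>x. \<epsilon> * (indicator \<Omega> x + \<Phi> (norm (grad \<eta> x)) + \<Phi> (norm (grad \<kappa> x))) + C * gap (grad \<eta> x) (grad \<kappa> x) \<partial>lborel)"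
    proof (rule integral_mono)
      show "integrable lborel (\<lambda>x. norm (grad \<eta> x - grad \<kappa> x))"
        by (rule integrable_norm[OF W_integrable(3)[OF W_diff[OF W_test[OF T(1)] W_test[OF T(2)]]]])
      show "integrable lborel (\<lambda>x. \<epsilon> * (indicator \<Omega> x + \<Phi> (norm (grad \<eta> x)) + \<Phi> (norm (grad \<kappa> x))) + C * gap (grad \<eta> x) (grad \<kappa> x))"
        using i g(1) indi by (intro Bochner_Integration.integrable_add integrable_mult_right)
      show "norm (grad \<eta> x - grad \<kappa> x) \<le> \<epsilon> * (indicator \<Omega> x + \<Phi> (norm (grad \<eta> x)) + \<Phi> (norm (grad \<kappa> x))) + C * gap (grad \<eta> x) (grad \<kappa> x)" for x
      proof (cases "x \<in> \<Omega>")
        case True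
        then show ?thesis using C(2)[of "grad \<eta> x" "grad \<kappa> x"] by simp
      next
        case False
        then have "grad \<eta> x = 0" "grad \<kappa> x = 0" using WD(4)[OF W_test[OF T(1)]] WD(4)[OF W_test[OF T(2)]] by auto
        moreover have "0 \<le> C * gap (0::real^'n) 0" using C(1) gap_nonneg by (rule mult_nonneg_nonneg)
        ultimately show ?thesis using \<epsilon> False by simp
      qed
    qed
    also have "\<dots> = \<epsilon> * (vol + (\<integral>x. \<Phi> (norm (grad \<eta> x)) \<partial>lborel) + (\<integral>x. \<Phi> (norm (grad \<kappa> x)) \<partial>lborel)) + C * (\<integral>x. gap (grad \<eta> x) (grad \<kappa> x) \<partial>lborel)"
      using i g(1) indi by (simp add: vol_def)
    also have "\<dots> \<le> \<epsilon> * (vol + 2 * M) + C * \<delta>"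
    proof -
      have "X \<le> \<delta>" if "X \<le> (a + b) / 2 - q" "a \<le> q + \<delta>" "b \<le> q + \<delta>" for X a b q :: real
        using that by (simp add: add_divide_distrib)
      from this[OF g(2) E] have "C * (\<integral>x. gap (grad \<eta> x) (grad \<kappa> x) \<partial>lborel) \<le> C * \<delta>" using C(1) by (rule mult_left_mono)
      moreover have "vol + a + b \<le> vol + 2 * M" if "a \<le> M" "b \<le> M" for a b using that by simp
      from mult_left_mono[OF this[OF PM]] \<epsilon> have
        "\<epsilon> * (vol + (\<integral>x. \<Phi> (norm (grad \<eta> x)) \<partial>lborel) + (\<integral>x. \<Phi> (norm (grad \<kappa> x)) \<partial>lborel)) \<le> \<epsilon> * (vol + 2 * M)" by simp
      ultimately show ?thesis by (rule add_mono[rotated])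
    qed
    also have "\<dots> \<le> e" using \<epsilon>2 \<delta>(3) by linarith
    finally show "(\<integral>x. norm (grad \<eta> x - grad \<kappa> x) \<partial>lborel) \<le> e" .
  qed
qed

text \<open>The precision of the n-th member is the least of those required for 0, ..., n, so every
  later member also meets the n-th requirement. The divisor vol + 1 cancels the constant in
  \<open>Poincare_W\<close>.\<close>

lemma minimizing_sequence:
  obtains \<eta> where "\<And>n. \<eta> n \<in> \<T>" "\<And>n. energy (\<eta> n) (grad (\<eta> n)) \<le> Emin + (1 / 2) ^ n"
    "\<And>n k. n \<le> k \<Longrightarrow> (\<integral>x. norm (grad (\<eta> k) x - grad (\<eta> n) x) \<partial>lborel) \<le> (1 / 2) ^ n / (vol + 1)"
proof -
  define good where "good n \<delta> \<longleftrightarrow> 0 < \<delta> \<and> (\<forall>\<eta>\<in>\<T>. \<forall>\<kappa>\<in>\<T>. energy \<eta> (grad \<eta>) \<le> Emin + \<delta> \<longrightarrow> energy \<kappa> (grad \<kappa>) \<le> Emin + \<delta>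
    \<longrightarrow> (\<integral>x. norm (grad \<eta> x - grad \<kappa> x) \<partial>lborel) \<le> (1 / 2) ^ n / (vol + 1))" for n \<delta>
  have "\<exists>\<delta>. good n \<delta>" for n
  proof -
    have "0 < (1 / 2) ^ n / (vol + 1)" using vol by simp
    then show ?thesis by (rule almost_minimizers_close) (auto simp: good_def)
  qed
  then obtain \<delta> where \<delta>: "\<And>n. good n (\<delta> n)" by metis
  define \<gamma> where "\<gamma> n = min ((1 / 2) ^ n) (Min (\<delta> ` {..n}))" for n
  have \<gamma>: "0 < \<gamma> n" "\<gamma> n \<le> (1 / 2) ^ n" "k \<le> n \<Longrightarrow> \<gamma> n \<le> \<delta> k" for n k
    using \<delta> by (auto simp: \<gamma>_def good_def min_le_iff_disj)
  have "\<exists>\<eta>. \<eta> \<in> \<T> \<and> energy \<eta> (grad \<eta>) \<le> Emin + \<gamma> n" for n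
    using Emin_near[OF \<gamma>(1)] by metis
  then obtain \<eta> where \<eta>: "\<And>n. \<eta> n \<in> \<T>" "\<And>n. energy (\<eta> n) (grad (\<eta> n)) \<le> Emin + \<gamma> n" by metis
  show ?thesis
  proof (rule that[OF \<eta>(1)])
    show "energy (\<eta> n) (grad (\<eta> n)) \<le> Emin + (1 / 2) ^ n" for n using \<eta>(2)[of n] \<gamma>(2)[of n] by linarith
    show "(\<integral>x. norm (grad (\<eta> k) x - grad (\<eta> n) x) \<partial>lborel) \<le> (1 / 2) ^ n / (vol + 1)" if "n \<le> k" for n k
    proof -
      have "energy (\<eta> n) (grad (\<eta> n)) \<le> Emin + \<delta> n" "energy (\<eta> k) (grad (\<eta> k)) \<le> Emin + \<delta> n"
        using \<eta>(2)[of n] \<eta>(2)[of k] \<gamma>(3)[of n n] \<gamma>(3)[OF that] by linarith+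
      then show ?thesis using \<delta>[of n] \<eta>(1) unfolding good_def by blast
    qed
  qed
qed

lemma minimizer_exists:
  obtains u \<xi> where "W u \<xi>" "energy u \<xi> \<le> Emin"
proof -
  obtain \<eta> where \<eta>: "\<And>n. \<eta> n \<in> \<T>" "\<And>n. energy (\<eta> n) (grad (\<eta> n)) \<le> Emin + (1 / 2) ^ n"
    "\<And>n k. n \<le> k \<Longrightarrow> (\<integral>x. norm (grad (\<eta> k) x - grad (\<eta> n) x) \<partial>lborel) \<le> (1 / 2) ^ n / (vol + 1)"
    using minimizing_sequence by blast
  note t = W_test[OF \<eta>(1)]
  have [measurable]: "\<eta> n \<in> borel_measurable borel" "grad (\<eta> n) \<in> borel_measurable borel" for n
    using WD(1,2)[OF t] by auto
  have d: "W (\<lambda>x. \<eta> k x - \<eta> n x) (\<lambda>x. grad (\<eta> k) x - grad (\<eta> n) x)" for k n by (rule W_diff[OF t t])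
  have small: "(1 / 2) ^ n / (vol + 1) \<le> (1 / 2) ^ n" for n
    using divide_left_mono[of 1 "vol + 1" "(1 / 2) ^ n"] vol(2) by simp
  have G: "(\<integral>\<^sup>+x. ennreal (norm (grad (\<eta> k) x - grad (\<eta> n) x)) \<partial>lborel) \<le> ennreal ((1 / 2) ^ n)" if "n \<le> k" for n k
    using nn_integral_eq_integral[OF integrable_norm[OF W_integrable(3)[OF d]]] \<eta>(3)[OF that] small[of n]
    by (simp add: ennreal_leI)
  have H: "(\<integral>\<^sup>+x. ennreal \<bar>\<eta> k x - \<eta> n x\<bar> \<partial>lborel) \<le> ennreal ((1 / 2) ^ n)" if "n \<le> k" for n k
  proof -
    have "(vol + 1) * (\<integral>x. norm (grad (\<eta> k) x - grad (\<eta> n) x) \<partial>lborel) \<le> (vol + 1) * ((1 / 2) ^ n / (vol + 1))"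
      using vol by (intro mult_left_mono \<eta>(3)[OF that]) auto
    also have "\<dots> = (1 / 2) ^ n" using vol(2) by simp
    finally show ?thesis using Poincare_W[OF dim d[of k n]] by (auto intro: order_trans ennreal_leI)
  qed
  have c\<eta>: "AE x in lborel. convergent (\<lambda>n. \<eta> n x)"
    by (rule L1_Cauchy_AE_convergent) (use H[of n "Suc n" for n] in auto)
  have cg: "AE x in lborel. convergent (\<lambda>n. grad (\<eta> n) x)"
    by (rule L1_Cauchy_AE_convergent) (use G[of n "Suc n" for n] in auto)
  define u where "u x = lim (\<lambda>n. \<eta> n x)" for x
  define \<xi> where "\<xi> x = lim (\<lambda>n. grad (\<eta> n) x)" for x
  have um [measurable]: "u \<in> borel_measurable borel" unfolding u_def[abs_def] by (rule borel_measurable_lim_metric) measurable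
  have \<xi>m [measurable]: "\<xi> \<in> borel_measurable borel" unfolding \<xi>_def[abs_def] by (rule borel_measurable_lim_metric) measurable
  have lu: "AE x in lborel. (\<lambda>n. \<eta> n x) \<longlonglongrightarrow> u x"
    using c\<eta> by eventually_elim (simp add: u_def convergent_LIMSEQ_iff)
  have lg: "AE x in lborel. (\<lambda>n. grad (\<eta> n) x) \<longlonglongrightarrow> \<xi> x"
    using cg by eventually_elim (simp add: \<xi>_def convergent_LIMSEQ_iff)
  have off: "u x = 0" "\<xi> x = 0" if "x \<notin> \<Omega>" for x
    using WD(3,4)[OF t that] by (simp_all add: u_def \<xi>_def)
  have Gl: "(\<integral>\<^sup>+x. ennreal (norm (\<xi> x - grad (\<eta> n) x)) \<partial>lborel) \<le> ennreal ((1 / 2) ^ n)" for n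
  proof (rule nn_integral_le_of_AE_limit)
    show "AE x in lborel. (\<lambda>k. norm (grad (\<eta> k) x - grad (\<eta> n) x)) \<longlonglongrightarrow> norm (\<xi> x - grad (\<eta> n) x)"
      using lg by eventually_elim (intro tendsto_intros)
    show "\<forall>\<^sub>F k in sequentially. (\<integral>\<^sup>+x. ennreal (norm (grad (\<eta> k) x - grad (\<eta> n) x)) \<partial>lborel) \<le> ennreal ((1 / 2) ^ n)"
      by (rule eventually_sequentiallyI[of n]) (rule G)
  qed measurable
  have Hl: "(\<integral>\<^sup>+x. ennreal \<bar>u x - \<eta> n x\<bar> \<partial>lborel) \<le> ennreal ((1 / 2) ^ n)" for n
  proof (rule nn_integral_le_of_AE_limit)
    show "AE x in lborel. (\<lambda>k. \<bar>\<eta> k x - \<eta> n x\<bar>) \<longlonglongrightarrow> \<bar>u x - \<eta> n x\<bar>"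
      using lu by eventually_elim (intro tendsto_intros)
    show "\<forall>\<^sub>F k in sequentially. (\<integral>\<^sup>+x. ennreal \<bar>\<eta> k x - \<eta> n x\<bar> \<partial>lborel) \<le> ennreal ((1 / 2) ^ n)"
      by (rule eventually_sequentiallyI[of n]) (rule H)
  qed measurable
  obtain c where c: "0 \<le> c" "\<And>u \<xi>. W u \<xi> \<Longrightarrow> (\<integral>x. \<Phi> (norm (\<xi> x)) \<partial>lborel) \<le> 2 * energy u \<xi> + c" by (rule coercive) blast
  \<comment> \<open>This bounds the modulars of the functions themselves, not only of their
    gradients, and Fatou's lemma passes the bound on to u.\<close>
  obtain C where C: "0 \<le> C" "\<And>\<eta>. \<eta> \<in> \<T> \<Longrightarrow> nm \<eta> \<le> ennreal C * nm (\<lambda>x. norm (grad \<eta> x))" using modular_Poincare by blast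
  have nmg: "nm (\<lambda>x. norm (grad (\<eta> n) x)) = ennreal (\<integral>x. \<Phi> (norm (grad (\<eta> n) x)) \<partial>lborel)" for n
    using W_\<Phi>_integrable[OF t] by (simp add: nn_integral_eq_integral)
  have nmg_le: "nm (\<lambda>x. norm (grad (\<eta> n) x)) \<le> ennreal (2 * Emin + 2 + c)" for n
  proof -
    have "(1 / 2 :: real) ^ n \<le> 1" by (simp add: power_le_one)
    then have "(\<integral>x. \<Phi> (norm (grad (\<eta> n) x)) \<partial>lborel) \<le> 2 * Emin + 2 + c" using c(2)[OF t[of n]] \<eta>(2)[of n] by linarith
    then show ?thesis unfolding nmg by (rule ennreal_leI)
  qed
  have "nm (\<lambda>x. norm (\<xi> x)) \<le> ennreal (2 * Emin + 2 + c)"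
  proof (rule nn_integral_le_of_AE_limit)
    show "AE x in lborel. (\<lambda>k. \<Phi> (norm (grad (\<eta> k) x))) \<longlonglongrightarrow> \<Phi> (norm (\<xi> x))"
      using lg by eventually_elim (intro mod.\<Psi>_tendsto tendsto_norm)
    show "\<forall>\<^sub>F k in sequentially. nm (\<lambda>x. norm (grad (\<eta> k) x)) \<le> ennreal (2 * Emin + 2 + c)"
      using nmg_le by (intro always_eventually) auto
  qed measurable
  then have \<xi>fin: "nm (\<lambda>x. norm (\<xi> x)) < \<infinity>" by (rule order.strict_trans1) simp
  have "nm u \<le> ennreal C * ennreal (2 * Emin + 2 + c)"
  proof (rule nn_integral_le_of_AE_limit)
    show "AE x in lborel. (\<lambda>k. \<Phi> (\<eta> k x)) \<longlonglongrightarrow> \<Phi> (u x)"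
      using lu by eventually_elim (intro mod.\<Psi>_tendsto)
    have "nm (\<eta> k) \<le> ennreal C * ennreal (2 * Emin + 2 + c)" for k
      by (rule order_trans[OF C(2)[OF \<eta>(1)] mult_left_mono[OF nmg_le]]) simp
    then show "\<forall>\<^sub>F k in sequentially. nm (\<eta> k) \<le> ennreal C * ennreal (2 * Emin + 2 + c)"
      by (intro always_eventually) auto
  qed measurable
  then have ufin: "nm u < \<infinity>" by (rule order.strict_trans1) (simp add: ennreal_mult_less_top)
  have \<xi>i: "nm (\<lambda>x. \<xi> x $ i) < \<infinity>" for i using nm_component_le \<xi>fin by (rule order.strict_trans1)
  \<comment> \<open>The identity on the whole space records the zero boundary values of the L^1
    limit; it is the input of the density theorem.\<close>
  have "weak_grad_on u \<xi>"
  proof (rule weak_grad_on_L1_limit)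
    show "integrable lborel u" using off(1) ufin by (intro nm_finite_integrable um)
    show "integrable lborel (\<lambda>x. \<xi> x $ i)" for i using off(2) \<xi>i by (intro nm_finite_integrable) auto
    fix e :: real assume "0 < e"
    then obtain n where "(1 / 2) ^ n < e" using real_arch_pow_inv[of e "1 / 2"] by auto
    then show "\<exists>\<eta>\<in>\<T>. (\<integral>\<^sup>+x. ennreal \<bar>u x - \<eta> x\<bar> \<partial>lborel) \<le> ennreal e \<and> (\<integral>\<^sup>+x. ennreal (norm (\<xi> x - grad \<eta> x)) \<partial>lborel) \<le> ennreal e"
      using \<eta>(1)[of n] order_trans[OF Gl[of n] ennreal_leI] order_trans[OF Hl[of n] ennreal_leI] by (intro bexI[of _ "\<eta> n"]) auto
  qed
  then have W: "W u \<xi>" using off ufin \<xi>fin by (intro W_density[OF shift um \<xi>m])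
  have load: "(\<integral>x. f x * \<eta> n x \<partial>lborel) \<le> (\<integral>x. f x * u x \<partial>lborel) + (F + 1) * (1 / 2) ^ n" for n
  proof -
    have dn: "W (\<lambda>x. u x - \<eta> n x) (\<lambda>x. \<xi> x - grad (\<eta> n) x)" by (rule W_diff[OF W t])
    have "(\<integral>x. norm (\<xi> x - grad (\<eta> n) x) \<partial>lborel) \<le> (1 / 2) ^ n"
      using Gl[of n] nn_integral_eq_integral[OF integrable_norm[OF W_integrable(3)[OF dn]]] by simp
    then have "(F + 1) * (\<integral>x. norm (\<xi> x - grad (\<eta> n) x) \<partial>lborel) \<le> (F + 1) * (1 / 2) ^ n" using F by (intro mult_left_mono) auto
    moreover have "(\<integral>x. f x * (u x - \<eta> n x) \<partial>lborel) = (\<integral>x. f x * u x \<partial>lborel) - (\<integral>x. f x * \<eta> n x \<partial>lborel)"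
      using W_load(1)[OF W] W_load(1)[OF t] by (simp add: right_diff_distrib)
    ultimately show ?thesis using W_load(3)[OF dn] by linarith
  qed
  \<comment> \<open>\<open>?B n\<close> bounds the modulars of all members from n on: one 2^(-n)
    comes from the energy, F + 1 of them from replacing the load of \<eta> k by that of u.\<close>
  have "(\<integral>x. \<Phi> (norm (\<xi> x)) \<partial>lborel) \<le> Emin + (\<integral>x. f x * u x \<partial>lborel) + (F + 2) * (1 / 2) ^ n" (is "_ \<le> ?B n") for n
  proof -
    have le: "(\<integral>x. \<Phi> (norm (grad (\<eta> k) x)) \<partial>lborel) \<le> ?B n" if "n \<le> k" for k
    proof -
      have "(1 / 2 :: real) ^ k \<le> (1 / 2) ^ n" using that by (intro power_decreasing) auto
      then have "(F + 2) * (1 / 2) ^ k \<le> (F + 2) * (1 / 2) ^ n" using F by (intro mult_left_mono) auto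
      then show ?thesis using \<eta>(2)[of k] load[of k] unfolding energy_def by (simp add: algebra_simps)
    qed
    \<comment> \<open>\<open>ennreal\<close> sends negative numbers to 0, so the bound must be known
      to be nonnegative before returning to real integrals.\<close>
    have "0 \<le> (\<integral>x. \<Phi> (norm (grad (\<eta> n) x)) \<partial>lborel)" by (intro Bochner_Integration.integral_nonneg) simp
    from order_trans[OF this le[OF order_refl]] have B0: "0 \<le> ?B n" .
    have "nm (\<lambda>x. norm (\<xi> x)) \<le> ennreal (?B n)"
    proof (rule nn_integral_le_of_AE_limit)
      show "AE x in lborel. (\<lambda>k. \<Phi> (norm (grad (\<eta> k) x))) \<longlonglongrightarrow> \<Phi> (norm (\<xi> x))"
        using lg by eventually_elim (intro mod.\<Psi>_tendsto tendsto_norm)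
      show "\<forall>\<^sub>F k in sequentially. nm (\<lambda>x. norm (grad (\<eta> k) x)) \<le> ennreal (?B n)"
        by (rule eventually_sequentiallyI[of n]) (simp only: nmg, intro ennreal_leI le)
    qed measurable
    then show ?thesis using B0 nn_integral_eq_integral[OF W_\<Phi>_integrable[OF W]] by simp
  qed
  moreover have "(\<lambda>n. Emin + (\<integral>x. f x * u x \<partial>lborel) + (F + 2) * (1 / 2) ^ n) \<longlonglongrightarrow> Emin + (\<integral>x. f x * u x \<partial>lborel) + (F + 2) * 0"
    by (intro tendsto_intros LIMSEQ_power_zero) simp
  ultimately have "(\<integral>x. \<Phi> (norm (\<xi> x)) \<partial>lborel) \<le> Emin + (\<integral>x. f x * u x \<partial>lborel) + (F + 2) * 0"
    by (intro LIMSEQ_le_const) auto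
  then show ?thesis using W by (intro that[of u \<xi>]) (auto simp: energy_def)
qed

section \<open>The Euler-Lagrange equation and uniqueness\<close>

lemma flux_measurable: "\<xi> \<in> borel_measurable M \<Longrightarrow> (\<lambda>x. flux (\<xi> x :: real^'n)) \<in> borel_measurable M"
  using borel_measurable_continuous_onI[OF flux_continuous] by (rule measurable_compose[rotated])

lemma flux_integrable:
  assumes u: "W u \<xi>" and v: "W v \<zeta>"
  shows "integrable lborel (\<lambda>x. flux (\<xi> x) \<bullet> \<zeta> x)"
proof (rule Bochner_Integration.integrable_bound)
  note [measurable] = WD(2)[OF v] flux_measurable[OF WD(2)[OF u]]
  show "(\<lambda>x. flux (\<xi> x) \<bullet> \<zeta> x) \<in> borel_measurable lborel" by measurable
  show "integrable lborel (\<lambda>x. m * (\<Phi> (norm (\<xi> x)) + \<Phi> (norm (\<zeta> x))))"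
    using W_\<Phi>_integrable[OF u] W_\<Phi>_integrable[OF v] by simp
  show "AE x in lborel. norm (flux (\<xi> x) \<bullet> \<zeta> x) \<le> norm (m * (\<Phi> (norm (\<xi> x)) + \<Phi> (norm (\<zeta> x))))"
    using flux_inner_le m by (intro AE_I2) (auto intro: order_trans[OF _ abs_ge_self])
qed

definition solves :: "(real^'n \<Rightarrow> real) \<Rightarrow> (real^'n \<Rightarrow> real^'n) \<Rightarrow> bool" where
  "solves u \<xi> \<longleftrightarrow> W u \<xi> \<and> (\<forall>v \<zeta>. W v \<zeta> \<longrightarrow> (\<integral>x. flux (\<xi> x) \<bullet> \<zeta> x \<partial>lborel) = (\<integral>x. f x * v x \<partial>lborel))"

lemma solvesD:
  assumes "solves u \<xi>"
  shows "W u \<xi>" "W v \<zeta> \<Longrightarrow> (\<integral>x. flux (\<xi> x) \<bullet> \<zeta> x \<partial>lborel) = (\<integral>x. f x * v x \<partial>lborel)"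
  using assms by (simp_all add: solves_def)

text \<open>Minimality against u + s v, combined with the tangent inequality at the perturbed
  gradient \<xi> + s \<zeta>, gives \<integral> f v \<le> \<integral> flux(\<xi> + s \<zeta>)
  \<bullet> \<zeta> for s > 0. Then s tends to 0 by dominated convergence; convexity replaces
  differentiation of the energy.\<close>

lemma minimizer_variational_inequality:
  assumes u: "W u \<xi>" "energy u \<xi> \<le> Emin" and v: "W v \<zeta>"
  shows "(\<integral>x. f x * v x \<partial>lborel) \<le> (\<integral>x. flux (\<xi> x) \<bullet> \<zeta> x \<partial>lborel)"
proof -
  define s where "s n = 1 / real (Suc n)" for n
  have s: "0 < s n" "s n \<le> 1" for n by (auto simp: s_def)
  have s0: "s \<longlonglongrightarrow> 0" unfolding s_def by (rule LIMSEQ_Suc[OF lim_1_over_n])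
  have Ws: "W (\<lambda>x. u x + s n * v x) (\<lambda>x. \<xi> x + s n *\<^sub>R \<zeta> x)" for n by (rule W_add[OF u(1) W_cmult[OF v]])
  have le: "(\<integral>x. f x * v x \<partial>lborel) \<le> (\<integral>x. flux (\<xi> x + s n *\<^sub>R \<zeta> x) \<bullet> \<zeta> x \<partial>lborel)" for n
  proof -
    have "(\<integral>x. f x * (u x + s n * v x) \<partial>lborel) = (\<integral>x. f x * u x + s n * (f x * v x) \<partial>lborel)" by (simp add: algebra_simps)
    also have "\<dots> = (\<integral>x. f x * u x \<partial>lborel) + s n * (\<integral>x. f x * v x \<partial>lborel)"
      using W_load(1)[OF u(1)] W_load(1)[OF v] by simp
    finally have "s n * (\<integral>x. f x * v x \<partial>lborel) \<le> (\<integral>x. \<Phi> (norm (\<xi> x + s n *\<^sub>R \<zeta> x)) \<partial>lborel) - (\<integral>x. \<Phi> (norm (\<xi> x)) \<partial>lborel)"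
      using u(2) Emin_le_W[OF Ws[of n]] unfolding energy_def by linarith
    also have "\<dots> = (\<integral>x. \<Phi> (norm (\<xi> x + s n *\<^sub>R \<zeta> x)) - \<Phi> (norm (\<xi> x)) \<partial>lborel)"
      using W_\<Phi>_integrable[OF u(1)] W_\<Phi>_integrable[OF Ws[of n]] by simp
    also have "\<dots> \<le> (\<integral>x. s n * (flux (\<xi> x + s n *\<^sub>R \<zeta> x) \<bullet> \<zeta> x) \<partial>lborel)"
    proof (rule integral_mono)
      show "\<Phi> (norm (\<xi> x + s n *\<^sub>R \<zeta> x)) - \<Phi> (norm (\<xi> x)) \<le> s n * (flux (\<xi> x + s n *\<^sub>R \<zeta> x) \<bullet> \<zeta> x)" for x
        using flux_tangent[of "\<xi> x + s n *\<^sub>R \<zeta> x" "\<xi> x"] by simp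
    qed (use W_\<Phi>_integrable[OF u(1)] W_\<Phi>_integrable[OF Ws[of n]] flux_integrable[OF Ws[of n] v] in auto)
    also have "\<dots> = s n * (\<integral>x. flux (\<xi> x + s n *\<^sub>R \<zeta> x) \<bullet> \<zeta> x \<partial>lborel)" by simp
    finally show ?thesis using s(1)[of n] by simp
  qed
  have "(\<lambda>n. \<integral>x. flux (\<xi> x + s n *\<^sub>R \<zeta> x) \<bullet> \<zeta> x \<partial>lborel) \<longlonglongrightarrow> (\<integral>x. flux (\<xi> x) \<bullet> \<zeta> x \<partial>lborel)"
  proof (rule integral_dominated_convergence)
    let ?w = "\<lambda>x. m * (2 powr m * (\<Phi> (norm (\<xi> x)) + \<Phi> (norm (\<zeta> x))) + \<Phi> (norm (\<zeta> x)))"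
    show "integrable lborel ?w" using W_\<Phi>_integrable[OF u(1)] W_\<Phi>_integrable[OF v] by simp
    show "(\<lambda>x. flux (\<xi> x) \<bullet> \<zeta> x) \<in> borel_measurable lborel" using flux_integrable[OF u(1) v] by simp
    show "(\<lambda>x. flux (\<xi> x + s n *\<^sub>R \<zeta> x) \<bullet> \<zeta> x) \<in> borel_measurable lborel" for n using flux_integrable[OF Ws v] by simp
    show "AE x in lborel. norm (flux (\<xi> x + s n *\<^sub>R \<zeta> x) \<bullet> \<zeta> x) \<le> ?w x" for n
    proof (rule AE_I2)
      fix x
      have "\<Phi> (norm (s n *\<^sub>R \<zeta> x)) \<le> \<Phi> (norm (\<zeta> x))"
        using s[of n] by (intro \<Phi>_mono) (simp add: mult_left_le_one_le less_imp_le)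
      then have "2 powr m * (\<Phi> (norm (\<xi> x)) + \<Phi> (norm (s n *\<^sub>R \<zeta> x))) \<le> 2 powr m * (\<Phi> (norm (\<xi> x)) + \<Phi> (norm (\<zeta> x)))"
        by (intro mult_left_mono add_left_mono) auto
      then have "\<Phi> (norm (\<xi> x + s n *\<^sub>R \<zeta> x)) \<le> 2 powr m * (\<Phi> (norm (\<xi> x)) + \<Phi> (norm (\<zeta> x)))"
        using \<Phi>_norm_add[of "\<xi> x" "s n *\<^sub>R \<zeta> x"] by linarith
      then have "m * (\<Phi> (norm (\<xi> x + s n *\<^sub>R \<zeta> x)) + \<Phi> (norm (\<zeta> x))) \<le> ?w x" using m by (intro mult_left_mono) auto
      then show "norm (flux (\<xi> x + s n *\<^sub>R \<zeta> x) \<bullet> \<zeta> x) \<le> ?w x"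
        using flux_inner_le[of "\<xi> x + s n *\<^sub>R \<zeta> x" "\<zeta> x"] by simp
    qed
    show "AE x in lborel. (\<lambda>n. flux (\<xi> x + s n *\<^sub>R \<zeta> x) \<bullet> \<zeta> x) \<longlonglongrightarrow> flux (\<xi> x) \<bullet> \<zeta> x"
    proof (rule AE_I2)
      fix x
      have "(\<lambda>n. \<xi> x + s n *\<^sub>R \<zeta> x) \<longlonglongrightarrow> \<xi> x + 0 *\<^sub>R \<zeta> x" by (intro tendsto_intros s0)
      then have "(\<lambda>n. \<xi> x + s n *\<^sub>R \<zeta> x) \<longlonglongrightarrow> \<xi> x" by simp
      moreover have "\<forall>\<xi>::real^'n. isCont flux \<xi>" using flux_continuous by (simp add: continuous_on_eq_continuous_at)
      then have "isCont flux (\<xi> x)" ..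
      ultimately have "(\<lambda>n. flux (\<xi> x + s n *\<^sub>R \<zeta> x)) \<longlonglongrightarrow> flux (\<xi> x)" by (rule isCont_tendsto_compose[rotated])
      then show "(\<lambda>n. flux (\<xi> x + s n *\<^sub>R \<zeta> x) \<bullet> \<zeta> x) \<longlonglongrightarrow> flux (\<xi> x) \<bullet> \<zeta> x" by (intro tendsto_intros)
    qed
  qed
  then show ?thesis by (rule LIMSEQ_le_const) (use le in auto)
qed

theorem solution_exists: obtains u \<xi> where "solves u \<xi>"
proof -
  obtain u \<xi> where u: "W u \<xi>" "energy u \<xi> \<le> Emin" using minimizer_exists by blast
  have "(\<integral>x. flux (\<xi> x) \<bullet> \<zeta> x \<partial>lborel) = (\<integral>x. f x * v x \<partial>lborel)" if v: "W v \<zeta>" for v \<zeta>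
  proof (rule antisym)
    have "W (\<lambda>x. - v x) (\<lambda>x. - \<zeta> x)" using W_cmult[OF v, of "-1"] by simp
    from minimizer_variational_inequality[OF u this]
    show "(\<integral>x. flux (\<xi> x) \<bullet> \<zeta> x \<partial>lborel) \<le> (\<integral>x. f x * v x \<partial>lborel)" by simp
  qed (rule minimizer_variational_inequality[OF u v])
  then show ?thesis using u(1) that unfolding solves_def by blast
qed

text \<open>Testing both equations with u - w and subtracting gives \<integral> (flux \<xi> - flux
  \<zeta>) \<bullet> (\<xi> - \<zeta>) = 0. Strict monotonicity makes the gradients agree, and
  Poincare's inequality the functions.\<close>

theorem solution_unique:
  assumes u: "solves u \<xi>" and w: "solves w \<zeta>"
  shows "AE x in lborel. w x = u x"
proof -
  have W: "W u \<xi>" "W w \<zeta>" using u w by (auto simp: solves_def)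
  note d = W_diff[OF W]
  have i: "integrable lborel (\<lambda>x. flux (\<xi> x) \<bullet> (\<xi> x - \<zeta> x))" "integrable lborel (\<lambda>x. flux (\<zeta> x) \<bullet> (\<xi> x - \<zeta> x))"
    by (rule flux_integrable[OF W(1) d], rule flux_integrable[OF W(2) d])
  have "(\<integral>x. flux (\<xi> x) \<bullet> (\<xi> x - \<zeta> x) \<partial>lborel) = (\<integral>x. flux (\<zeta> x) \<bullet> (\<xi> x - \<zeta> x) \<partial>lborel)"
    using solvesD(2)[OF u d] solvesD(2)[OF w d] by simp
  then have 0: "(\<integral>x. (flux (\<xi> x) - flux (\<zeta> x)) \<bullet> (\<xi> x - \<zeta> x) \<partial>lborel) = 0"
    using i by (simp add: inner_diff_left)
  have i': "integrable lborel (\<lambda>x. (flux (\<xi> x) - flux (\<zeta> x)) \<bullet> (\<xi> x - \<zeta> x))" using i by (simp add: inner_diff_left)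
  have nn: "0 \<le> (flux (\<xi> x) - flux (\<zeta> x)) \<bullet> (\<xi> x - \<zeta> x)" for x
    using flux_monotone_strict[of "\<zeta> x" "\<xi> x"] by (cases "\<zeta> x = \<xi> x") auto
  have "AE x in lborel. (flux (\<xi> x) - flux (\<zeta> x)) \<bullet> (\<xi> x - \<zeta> x) = 0"
    using integral_nonneg_eq_0_iff_AE[OF i'] nn 0 by auto
  then have \<xi>\<zeta>: "AE x in lborel. norm (\<xi> x - \<zeta> x) = 0"
  proof eventually_elim
    fix x assume "(flux (\<xi> x) - flux (\<zeta> x)) \<bullet> (\<xi> x - \<zeta> x) = 0"
    then show "norm (\<xi> x - \<zeta> x) = 0" using flux_monotone_strict[of "\<zeta> x" "\<xi> x"] by (cases "\<zeta> x = \<xi> x") auto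
  qed
  have "(\<integral>x. norm (\<xi> x - \<zeta> x) \<partial>lborel) = 0" by (rule integral_eq_zero_AE[OF \<xi>\<zeta>])
  then have "(\<integral>\<^sup>+x. ennreal \<bar>u x - w x\<bar> \<partial>lborel) = 0" using Poincare_W[OF dim d] by simp
  then have "AE x in lborel. ennreal \<bar>u x - w x\<bar> = 0"
    using WD(1)[OF d] by (subst (asm) nn_integral_0_iff_AE) auto
  then show ?thesis by eventually_elim simp
qed

end

section \<open>Boundedness\<close>

text \<open>Along the levels k_j = d (1 - 2^(-j)), which increase to d, induction shows \<mu>(k_j)
  \<le> \<mu>(0) q^j: the superlinear power on the right outweighs the shrinking distance of the
  levels.\<close>

lemma Stampacchia_vanishing:
  fixes \<mu> :: "real \<Rightarrow> real"
  assumes nonneg: "\<And>k. 0 \<le> \<mu> k" and anti: "\<And>k h. 0 \<le> k \<Longrightarrow> k \<le> h \<Longrightarrow> \<mu> h \<le> \<mu> k"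
    and A: "0 \<le> A" and \<beta>: "0 < \<beta>"
    and dec: "\<And>k h. 0 \<le> k \<Longrightarrow> k < h \<Longrightarrow> (h - k) * \<mu> h \<le> A * \<mu> k powr (1 + \<beta>)"
  shows "\<exists>d\<ge>0. \<mu> d = 0"
proof (cases "\<mu> 0 = 0")
  case False
  define \<sigma> where "\<sigma> = \<mu> 0"
  have \<sigma>: "0 < \<sigma>" using False nonneg[of 0] by (simp add: \<sigma>_def)
  \<comment> \<open>q^\<beta> = 1/2 compensates the halving of the distances between levels.\<close>
  define q where "q = 2 powr (- (1 / \<beta>)) "
  have q: "0 < q" "q < 1" "q powr \<beta> = 1 / 2"
  proof -
    show "0 < q" by (simp add: q_def)
    have "2 powr (- (1 / \<beta>)) < 2 powr 0" using \<beta> by (intro powr_less_mono) auto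
    then show "q < 1" by (simp add: q_def)
    have "q powr \<beta> = 2 powr (- (1 / \<beta>) * \<beta>)" unfolding q_def by (rule powr_powr)
    then show "q powr \<beta> = 1 / 2" using \<beta> by (simp add: powr_minus_divide)
  qed
  \<comment> \<open>Chosen so that 2 A \<sigma>^\<beta> \<le> d q, which closes the induction; the
    summand 1 keeps d positive when A = 0.\<close>
  define d where "d = 2 * A * \<sigma> powr \<beta> / q + 1"
  have d: "0 < d" using A q by (simp add: d_def add_nonneg_pos)
  have dA: "2 * A * \<sigma> powr \<beta> \<le> d * q" using q by (simp add: d_def field_simps)
  define k where "k j = d * (1 - (1 / 2) ^ j)" for j :: nat
  have k: "0 \<le> k j" "k j \<le> d" "k j < k (Suc j)" "k (Suc j) - k j = d * (1 / 2) ^ Suc j" for j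
    using d by (auto simp: k_def power_le_one algebra_simps)
  have bound: "\<mu> (k j) \<le> \<sigma> * q ^ j" for j
  proof (induction j)
    case 0 then show ?case by (simp add: k_def \<sigma>_def)
  next
    case (Suc j)
    have e: "(1 / 2 :: real) ^ j = (q ^ j) powr \<beta>"
      using q(1) unfolding q(3)[symmetric] by (simp add: powr_powr mult.commute flip: powr_realpow)
    have "(d * (1 / 2) ^ Suc j) * \<mu> (k (Suc j)) \<le> A * \<mu> (k j) powr (1 + \<beta>)"
      using dec[OF k(1,3)] k(4) by metis
    also have "\<dots> \<le> A * (\<sigma> * q ^ j) powr (1 + \<beta>)"
      using Suc A \<beta> nonneg by (intro mult_left_mono powr_mono2) auto
    also have "\<dots> = (A * \<sigma> powr \<beta>) * (\<sigma> * q ^ j) * (1 / 2) ^ j"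
      using \<sigma> q(1) by (simp add: e powr_add powr_mult)
    also have "\<dots> \<le> (d * q / 2) * (\<sigma> * q ^ j) * (1 / 2) ^ j"
      using dA \<sigma> q(1) by (intro mult_right_mono) auto
    also have "\<dots> = (d * (1 / 2) ^ Suc j) * (\<sigma> * q ^ Suc j)" by simp
    finally show ?case using d by simp
  qed
  have "(\<lambda>j. \<sigma> * q ^ j) \<longlonglongrightarrow> \<sigma> * 0" using q by (intro tendsto_intros LIMSEQ_power_zero) auto
  moreover have "\<mu> d \<le> \<sigma> * q ^ j" for j using anti[OF k(1,2)] bound[of j] by (rule order_trans)
  ultimately have "\<mu> d \<le> 0" by (intro LIMSEQ_le_const[of _ "0"]) auto
  with nonneg[of d] d show ?thesis by (intro exI[of _ d]) auto
qed (auto intro: exI[of _ 0])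

section \<open>Chain rule and smooth truncations\<close>

lemma Lipschitz_of_derivative:
  fixes g :: "real \<Rightarrow> real"
  assumes "\<And>t. (g has_real_derivative g' t) (at t)" "\<And>t. 0 \<le> g' t" "\<And>t. g' t \<le> 1"
  shows "\<bar>g a - g b\<bar> \<le> \<bar>a - b\<bar>"
proof -
  have "\<bar>g b - g a\<bar> \<le> b - a" if lt: "a < b" for a b
  proof -
    obtain z where z: "g b - g a = (b - a) * g' z" using MVT2[OF lt, of g g'] assms(1) by blast
    have "\<bar>(b - a) * g' z\<bar> \<le> (b - a) * 1" using lt assms(2,3)[of z] by (simp add: abs_mult)
    with z show ?thesis by simp
  qed
  from this[of a b] this[of b a] show ?thesis by (cases a b rule: linorder_cases) (auto simp: abs_minus_commute)
qed

context growth_domain begin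

text \<open>The composites g(\<eta> n) are test functions because g preserves smoothness and g(0) =
  0. Their gradient error splits into g'(\<eta> n) times the error of \<eta> n, which is small, and
  (g'(u) - g'(\<eta> n)) \<xi>, whose modular tends to 0 by dominated convergence.\<close>

lemma W_compose:
  assumes g: "\<And>t. (g has_real_derivative g' t) (at t)" "continuous_on UNIV g'" "\<And>t. 0 \<le> g' t" "\<And>t. g' t \<le> 1"
    and g0: "g 0 = 0" and sm: "\<And>\<eta>::real^'n \<Rightarrow> real. smooth \<eta> \<Longrightarrow> smooth (\<lambda>x. g (\<eta> x))"
    and u: "W u \<xi>"
  shows "W (\<lambda>x. g (u x)) (\<lambda>x. g' (u x) *\<^sub>R \<xi> x)"
proof -
  note [measurable] = WD(1,2)[OF u]
  have gm [measurable]: "g \<in> borel_measurable borel"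
    using g(1) DERIV_continuous_on by (intro continuous_borel) blast
  have g'm [measurable]: "g' \<in> borel_measurable borel" by (rule continuous_borel[OF g(2)])
  note lip = Lipschitz_of_derivative[of g g', OF g(1,3,4)]
  have shrink: "\<Phi> (norm (g' t *\<^sub>R v)) \<le> \<Phi> (norm v)" for t and v :: "real^'n"
    using g(3,4)[of t] by (intro \<Phi>_mono) (simp add: mult_left_le_one_le)
  obtain \<eta> where \<eta>: "\<And>n. \<eta> n \<in> \<T>" "\<And>n. nm (\<lambda>x. u x - \<eta> n x) \<le> ennreal (1 / Suc n)"
    "\<And>n. nm (\<lambda>x. norm (\<xi> x - grad (\<eta> n) x)) \<le> ennreal (1 / Suc n)" "AE x in lborel. (\<lambda>n. \<eta> n x) \<longlonglongrightarrow> u x"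
    by (rule W_sequence[OF u]) blast
  note D = test_functionsD[OF \<eta>(1)]
  have [measurable]: "\<eta> n \<in> borel_measurable borel" "grad (\<eta> n) \<in> borel_measurable borel" for n
    using smooth_measurable[OF D(1)] by auto
  have T: "(\<lambda>x. g (\<eta> n x)) \<in> \<T>" for n
  proof (rule test_functionsI[OF sm[OF D(1)] test_functions_support(1,2)[OF \<eta>(1)]])
    show "x \<in> closure {x. \<eta> n x \<noteq> 0}" if "g (\<eta> n x) \<noteq> 0" for x
      using that g0 test_functions_support(3)[OF \<eta>(1)] by metis
  qed
  have gr: "grad (\<lambda>x. g (\<eta> n x)) x = g' (\<eta> n x) *\<^sub>R grad (\<eta> n) x" for n x
    by (simp add: vec_eq_iff partial_deriv_compose(1)[OF g(1) smooth_differentiable[OF D(1)]])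
  define a where "a n = nm (\<lambda>x. norm ((g' (u x) - g' (\<eta> n x)) *\<^sub>R \<xi> x))" for n
  have "a \<longlonglongrightarrow> (\<integral>\<^sup>+x. 0 \<partial>(lborel :: (real^'n) measure))"
    unfolding a_def
  proof (rule nn_integral_dominated_convergence[where w = "\<lambda>x. ennreal (\<Phi> (norm (\<xi> x)))"])
    show "AE x in lborel. ennreal (\<Phi> (norm ((g' (u x) - g' (\<eta> n x)) *\<^sub>R \<xi> x))) \<le> ennreal (\<Phi> (norm (\<xi> x)))" for n
    proof (intro AE_I2 ennreal_leI \<Phi>_mono)
      fix x
      have "\<bar>g' (u x) - g' (\<eta> n x)\<bar> \<le> 1" using g(3,4)[of "u x"] g(3,4)[of "\<eta> n x"] by linarith
      then have "\<bar>g' (u x) - g' (\<eta> n x)\<bar> * norm (\<xi> x) \<le> 1 * norm (\<xi> x)" by (rule mult_right_mono) simp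
      then show "\<bar>norm ((g' (u x) - g' (\<eta> n x)) *\<^sub>R \<xi> x)\<bar> \<le> \<bar>norm (\<xi> x)\<bar>" by simp
    qed
    show "AE x in lborel. (\<lambda>n. ennreal (\<Phi> (norm ((g' (u x) - g' (\<eta> n x)) *\<^sub>R \<xi> x)))) \<longlonglongrightarrow> 0"
      using \<eta>(4)
    proof eventually_elim
      fix x assume l: "(\<lambda>n. \<eta> n x) \<longlonglongrightarrow> u x"
      have "isCont g' (u x)" using g(2) by (simp add: continuous_on_eq_continuous_at)
      from isCont_tendsto_compose[OF this l]
      have "(\<lambda>n. norm ((g' (u x) - g' (\<eta> n x)) *\<^sub>R \<xi> x)) \<longlonglongrightarrow> norm ((g' (u x) - g' (u x)) *\<^sub>R \<xi> x)"
        by (intro tendsto_intros)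
      then have "(\<lambda>n. \<Phi> (norm ((g' (u x) - g' (\<eta> n x)) *\<^sub>R \<xi> x))) \<longlonglongrightarrow> \<Phi> 0" by (intro mod.\<Psi>_tendsto) simp
      from tendsto_ennrealI[OF this] show "(\<lambda>n. ennreal (\<Phi> (norm ((g' (u x) - g' (\<eta> n x)) *\<^sub>R \<xi> x)))) \<longlonglongrightarrow> 0" by simp
    qed
    show "(\<integral>\<^sup>+x. ennreal (\<Phi> (norm (\<xi> x))) \<partial>lborel) < \<infinity>" by (rule WD(6)[OF u])
  qed measurable
  moreover have "(\<lambda>n. ennreal (1 / Suc n)) \<longlonglongrightarrow> ennreal 0" by (intro tendsto_ennrealI LIMSEQ_Suc[OF lim_1_over_n])
  ultimately have lim: "(\<lambda>n. ennreal (2 powr m) * (a n + ennreal (1 / Suc n))) \<longlonglongrightarrow> ennreal (2 powr m) * (0 + 0)"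
    by (intro ennreal_tendsto_cmult tendsto_add) auto
  have le1: "nm (\<lambda>x. g (u x) - g (\<eta> n x)) \<le> ennreal (1 / Suc n)" for n
    using lip by (intro order_trans[OF nn_integral_mono \<eta>(2)] ennreal_leI \<Phi>_mono)
  have le2: "nm (\<lambda>x. norm (g' (u x) *\<^sub>R \<xi> x - grad (\<lambda>x. g (\<eta> n x)) x)) \<le> ennreal (2 powr m) * (a n + ennreal (1 / Suc n))" for n
  proof -
    have "nm (\<lambda>x. norm (g' (u x) *\<^sub>R \<xi> x - grad (\<lambda>x. g (\<eta> n x)) x))
      = nm (\<lambda>x. norm ((g' (u x) - g' (\<eta> n x)) *\<^sub>R \<xi> x + g' (\<eta> n x) *\<^sub>R (\<xi> x - grad (\<eta> n) x)))"
      by (simp add: gr algebra_simps)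
    also have "\<dots> \<le> ennreal (2 powr m) * (a n + nm (\<lambda>x. norm (g' (\<eta> n x) *\<^sub>R (\<xi> x - grad (\<eta> n) x))))"
      unfolding a_def by (rule nm_norm_add) measurable
    also have "\<dots> \<le> ennreal (2 powr m) * (a n + ennreal (1 / Suc n))"
      using shrink by (intro mult_left_mono add_left_mono order_trans[OF nn_integral_mono \<eta>(3)] ennreal_leI) auto
    finally show ?thesis .
  qed
  have "\<exists>\<theta>\<in>\<T>. nm (\<lambda>x. g (u x) - \<theta> x) \<le> ennreal e \<and> nm (\<lambda>x. norm (g' (u x) *\<^sub>R \<xi> x - grad \<theta> x)) \<le> ennreal e" if e: "0 < e" for e
  proof -
    have "\<forall>\<^sub>F n in sequentially. ennreal (2 powr m) * (a n + ennreal (1 / Suc n)) < ennreal e"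
      using lim e by (intro order_tendstoD(2)) auto
    moreover have "\<forall>\<^sub>F n in sequentially. 1 / real (Suc n) < e"
      using e by (intro order_tendstoD(2)[OF LIMSEQ_Suc[OF lim_1_over_n]]) auto
    ultimately have "\<forall>\<^sub>F n in sequentially. ennreal (2 powr m) * (a n + ennreal (1 / Suc n)) < ennreal e \<and> 1 / real (Suc n) < e"
      by (rule eventually_conj)
    then obtain n where n: "ennreal (2 powr m) * (a n + ennreal (1 / Suc n)) < ennreal e" "1 / real (Suc n) < e"
      using eventually_happens'[OF sequentially_bot] by blast
    show ?thesis
    proof (intro bexI[OF _ T[of n]] conjI)
      show "nm (\<lambda>x. g (u x) - g (\<eta> n x)) \<le> ennreal e"
        by (rule order_trans[OF le1[of n] ennreal_leI]) (use n(2) in simp)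
      show "nm (\<lambda>x. norm (g' (u x) *\<^sub>R \<xi> x - grad (\<lambda>x. g (\<eta> n x)) x)) \<le> ennreal e"
        using le2[of n] n(1) by simp
    qed
  qed
  moreover have "nm (\<lambda>x. g (u x)) < \<infinity>"
  proof (rule order.strict_trans1[OF nn_integral_mono WD(5)[OF u]])
    show "ennreal (\<Phi> (g (u x))) \<le> ennreal (\<Phi> (u x))" for x
      using lip[of "u x" 0] g0 by (intro ennreal_leI \<Phi>_mono) simp
  qed
  moreover have "nm (\<lambda>x. norm (g' (u x) *\<^sub>R \<xi> x)) < \<infinity>"
    by (rule order.strict_trans1[OF nn_integral_mono WD(6)[OF u]]) (intro ennreal_leI shrink)
  ultimately show ?thesis using WD(3,4)[OF u] g0 unfolding W_def by auto
qed

end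

text \<open>A smooth approximation of \<open>t \<mapsto> max 0 (t - k)\<close>: it is \<open>(t - k) exp (- \<delta> / (t - k))\<close> for \<open>t > k\<close>.\<close>
definition soft_trunc :: "real \<Rightarrow> real \<Rightarrow> real \<Rightarrow> real" where
  "soft_trunc \<delta> k t = (t - k) * flat 1 ((t - k) / \<delta>)"

definition soft_trunc' :: "real \<Rightarrow> real \<Rightarrow> real \<Rightarrow> real" where
  "soft_trunc' \<delta> k t = flat 1 ((t - k) / \<delta>) + (t - k) / \<delta> * flat [:0, 0, 1:] ((t - k) / \<delta>)"

lemma soft_trunc_deriv:
  assumes "0 < \<delta>"
  shows "(soft_trunc \<delta> k has_real_derivative soft_trunc' \<delta> k t) (at t)"
proof -
  have "(1 - pderiv 1) * [:0, 0, 1:] = ([:0, 0, 1:] :: real poly)" by simp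
  then have f: "(flat 1 has_real_derivative flat [:0, 0, 1:] s) (at s)" for s
    using flat_has_real_derivative[of 1 s] by simp
  have l: "((\<lambda>t. (t - k) / \<delta>) has_real_derivative 1 / \<delta>) (at t)" using assms by (auto intro!: derivative_eq_intros)
  have "((\<lambda>t. (t - k) * flat 1 ((t - k) / \<delta>)) has_real_derivative
      (t - k) * (flat [:0, 0, 1:] ((t - k) / \<delta>) * (1 / \<delta>)) + 1 * flat 1 ((t - k) / \<delta>)) (at t)"
    by (rule DERIV_mult'[OF _ DERIV_chain2[OF f l]]) (auto intro!: derivative_eq_intros)
  then show ?thesis by (simp add: soft_trunc_def[abs_def] soft_trunc'_def algebra_simps)
qed

text \<open>For t > k and z = \<delta>/(t - k) the derivative is (1 + z) exp(-z), and 1 + z \<le>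
  exp z.\<close>

lemma soft_trunc'_bounds: "0 < \<delta> \<Longrightarrow> 0 \<le> soft_trunc' \<delta> k t" "0 < \<delta> \<Longrightarrow> soft_trunc' \<delta> k t \<le> 1"
proof -
  assume \<delta>: "0 < \<delta>"
  show "0 \<le> soft_trunc' \<delta> k t"
    using \<delta> by (cases "k < t") (auto simp: soft_trunc'_def flat_def zero_less_divide_iff intro!: add_nonneg_nonneg)
  show "soft_trunc' \<delta> k t \<le> 1"
  proof (cases "k < t")
    case True
    define z where "z = \<delta> / (t - k)"
    have z: "1 / ((t - k) / \<delta>) = z" "0 < z" "(t - k) / \<delta> = 1 / z" using True \<delta> by (auto simp: z_def)
    have "soft_trunc' \<delta> k t = exp (- z) + 1 / z * (z * z * exp (- z))"
      using True \<delta> z(2) by (simp add: soft_trunc'_def flat_def z(1,3))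
    also have "\<dots> = (1 + z) * exp (- z)" using z(2) by (simp add: algebra_simps)
    also have "\<dots> \<le> exp z * exp (- z)" by (intro mult_right_mono) (use exp_ge_add_one_self[of z] in auto)
    finally show ?thesis by (simp add: exp_minus)
  qed (use \<delta> in \<open>simp add: soft_trunc'_def flat_def zero_less_divide_iff\<close>)
qed

lemma soft_trunc'_cont: "continuous_on UNIV (soft_trunc' \<delta> k)"
proof -
  have "continuous_on UNIV (flat p)" for p using flat_has_real_derivative DERIV_continuous_on by blast
  then have "continuous_on UNIV (\<lambda>t. flat p ((t - k) / \<delta>))" for p
    by (rule continuous_on_compose2) (auto intro!: continuous_intros simp: divide_inverse)
  then show ?thesis unfolding soft_trunc'_def[abs_def] divide_inverse
    by (intro continuous_intros) (auto simp: divide_inverse)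
qed

lemma soft_trunc_le: "0 < \<delta> \<Longrightarrow> t \<le> k \<Longrightarrow> soft_trunc \<delta> k t = 0"
  and soft_trunc'_le: "0 < \<delta> \<Longrightarrow> t \<le> k \<Longrightarrow> soft_trunc' \<delta> k t = 0"
  by (auto simp: soft_trunc_def soft_trunc'_def flat_def zero_less_divide_iff)

lemma soft_trunc_mono:
  assumes "0 < \<delta>" "s \<le> t" shows "soft_trunc \<delta> k s \<le> soft_trunc \<delta> k t"
  by (rule DERIV_nonneg_imp_nondecreasing[OF assms(2)])
    (use soft_trunc_deriv[OF assms(1)] soft_trunc'_bounds(1)[OF assms(1)] in blast)

lemma soft_trunc_nonneg: "0 < \<delta> \<Longrightarrow> 0 \<le> soft_trunc \<delta> k t"
  using soft_trunc_mono[of \<delta> k t k] soft_trunc_le[of \<delta> t k] soft_trunc_le[of \<delta> k k] by (cases "t \<le> k") auto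

lemma soft_trunc_gt: "0 < \<delta> \<Longrightarrow> k < t \<Longrightarrow> soft_trunc \<delta> k t = (t - k) * exp (- (\<delta> / (t - k)))"
  by (simp add: soft_trunc_def flat_def)

lemma smooth_soft_trunc: "smooth \<eta> \<Longrightarrow> smooth (\<lambda>x. soft_trunc \<delta> k (\<eta> x))"
  unfolding soft_trunc_def divide_inverse by (intro smooth_intros smooth_flat)

context dirichlet begin

text \<open>Test with g(u), g a smooth truncation at k. As \<Phi>(|\<xi>|) \<le> flux \<xi>
  \<bullet> \<xi>, the equation bounds X = \<integral> g'(u) \<Phi>(|\<xi>|) by (F + 1) Y with Y =
  \<integral> g'(u) |\<xi>|. Superlinearity bounds Y by X/(2(F + 1)) + C \<mu>(k), hence Y \<le> 2 C
  \<mu>(k).\<close>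

lemma level_set_decay:
  assumes u: "solves u \<xi>"
  obtains A where "0 \<le> A" "\<And>k h. 0 \<le> k \<Longrightarrow> k < h \<Longrightarrow>
    (h - k) * measure lborel {x. h < u x} \<le> A * measure lborel {x. k < u x} powr (1 + 1 / CARD('n))"
proof -
  have Wu: "W u \<xi>" by (rule solvesD(1)[OF u])
  note [measurable] = WD(1,2)[OF Wu]
  have e: "0 < 1 / (2 * (F + 1))" using F by simp
  obtain C where C: "0 \<le> C" "\<And>t. \<bar>t\<bar> \<le> 1 / (2 * (F + 1)) * \<Phi> t + C" using superlinear[OF e] by blast
  define \<mu> where "\<mu> k = measure lborel {x. k < u x}" for k
  have sub: "{x. k < u x} \<subseteq> \<Omega>" if "0 \<le> k" for k using WD(3)[OF Wu] that by (metis (mono_tags) mem_Collect_eq not_less subsetI)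
  have fin: "emeasure lborel {x. k < u x} = ennreal (\<mu> k)" if "0 \<le> k" for k
  proof -
    have "emeasure lborel {x. k < u x} < \<infinity>"
      using emeasure_bounded_finite[OF bounded_subset[OF bounded_\<Omega> sub[OF that]]] .
    then show ?thesis by (simp add: \<mu>_def emeasure_eq_ennreal_measure less_top)
  qed
  have soft: "soft_trunc \<delta> k h * \<mu> h \<le> 4 * C * \<mu> k powr (1 + 1 / CARD('n))"
    if k: "0 \<le> k" "k < h" and \<delta>: "0 < \<delta>" for k h \<delta>
  proof -
    define g where "g = soft_trunc \<delta> k"
    define g' where "g' = soft_trunc' \<delta> k"
    have b: "0 \<le> g' t" "g' t \<le> 1" for t unfolding g'_def using soft_trunc'_bounds[OF \<delta>] by auto
    have Wg: "W (\<lambda>x. g (u x)) (\<lambda>x. g' (u x) *\<^sub>R \<xi> x)"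
      unfolding g_def g'_def
      by (rule W_compose[OF soft_trunc_deriv[OF \<delta>] soft_trunc'_cont soft_trunc'_bounds[OF \<delta>]
            soft_trunc_le[OF \<delta> k(1)] smooth_soft_trunc Wu])
    note [measurable] = continuous_borel[OF soft_trunc'_cont[of \<delta> k], folded g'_def] WD(1)[OF Wg]
    have n: "norm (g' (u x) *\<^sub>R \<xi> x) = g' (u x) * norm (\<xi> x)" for x using b by simp
    define X where "X = (\<integral>x. g' (u x) * \<Phi> (norm (\<xi> x)) \<partial>lborel)"
    define Y where "Y = (\<integral>x. g' (u x) * norm (\<xi> x) \<partial>lborel)"
    have iX: "integrable lborel (\<lambda>x. g' (u x) * \<Phi> (norm (\<xi> x)))"
      using b W_\<Phi>_integrable[OF Wu] by (intro integrable_mult_bounded[where B = 1]) auto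
    have iY: "integrable lborel (\<lambda>x. g' (u x) * norm (\<xi> x))"
      using b W_integrable(3)[OF Wu] by (intro integrable_mult_bounded[where B = 1]) auto
    have ik: "integrable lborel (indicat_real {x. k < u x})"
      using fin[OF k(1)] by (intro integrable_real_indicator) auto
    have "X \<le> (\<integral>x. flux (\<xi> x) \<bullet> (g' (u x) *\<^sub>R \<xi> x) \<partial>lborel)"
      unfolding X_def
    proof (rule integral_mono[OF iX flux_integrable[OF Wu Wg]])
      show "g' (u x) * \<Phi> (norm (\<xi> x)) \<le> flux (\<xi> x) \<bullet> (g' (u x) *\<^sub>R \<xi> x)" for x
        using mult_left_mono[OF \<Phi>_le_\<alpha>[of "norm (\<xi> x)"] b(1)[of "u x"]] by (simp add: flux_self mult_ac)
    qed
    also have "\<dots> = (\<integral>x. f x * g (u x) \<partial>lborel)" by (rule solvesD(2)[OF u Wg])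
    also have "\<dots> \<le> (F + 1) * Y" using W_load(3)[OF Wg] unfolding n Y_def by linarith
    finally have XY: "X \<le> (F + 1) * Y" .
    have "Y \<le> (\<integral>x. 1 / (2 * (F + 1)) * (g' (u x) * \<Phi> (norm (\<xi> x))) + C * indicator {x. k < u x} x \<partial>lborel)"
      unfolding Y_def
    proof (rule integral_mono[OF iY])
      show "integrable lborel (\<lambda>x. 1 / (2 * (F + 1)) * (g' (u x) * \<Phi> (norm (\<xi> x))) + C * indicator {x. k < u x} x)"
        by (intro Bochner_Integration.integrable_add integrable_mult_right iX ik)
      show "g' (u x) * norm (\<xi> x) \<le> 1 / (2 * (F + 1)) * (g' (u x) * \<Phi> (norm (\<xi> x))) + C * indicator {x. k < u x} x" for x
      proof (cases "k < u x")
        case True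
        have "g' (u x) * norm (\<xi> x) \<le> g' (u x) * (1 / (2 * (F + 1)) * \<Phi> (norm (\<xi> x)) + C)"
          using C(2)[of "norm (\<xi> x)"] b by (intro mult_left_mono) auto
        also have "\<dots> = 1 / (2 * (F + 1)) * (g' (u x) * \<Phi> (norm (\<xi> x))) + g' (u x) * C" by (simp add: algebra_simps)
        also have "\<dots> \<le> 1 / (2 * (F + 1)) * (g' (u x) * \<Phi> (norm (\<xi> x))) + 1 * C"
          using b C(1) by (intro add_left_mono mult_right_mono)
        finally show ?thesis using True by simp
      next
        case False
        then show ?thesis using soft_trunc'_le[OF \<delta>] by (simp add: g'_def)
      qed
    qed
    also have "\<dots> = 1 / (2 * (F + 1)) * X + C * \<mu> k" using iX ik by (simp add: X_def \<mu>_def)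
    also have "1 / (2 * (F + 1)) * X \<le> 1 / (2 * (F + 1)) * ((F + 1) * Y)" using XY e by (intro mult_left_mono) auto
    also have "1 / (2 * (F + 1)) * ((F + 1) * Y) = Y / 2" using F(2) by (simp add: field_simps)
    finally have Y: "Y \<le> 2 * C * \<mu> k" by simp
    show ?thesis
    proof (cases "\<mu> k = 0")
      case True
      have "\<mu> h \<le> \<mu> k" unfolding \<mu>_def
        using k fin[OF k(1)] by (intro measure_mono_fmeasurable) (auto simp: fmeasurable_def less_top)
      with True have "\<mu> h = 0" using measure_nonneg[of lborel "{x. h < u x}"] by (simp add: \<mu>_def)
      then show ?thesis using C(1) by simp
    next
      case False
      then have \<mu>k: "0 < \<mu> k" using measure_nonneg[of lborel "{x. k < u x}"] by (simp add: \<mu>_def less_le)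
      \<comment> \<open>With this c, the indicator of {u > k} times c has L^N norm 1, so
        \<open>Sobolev_W\<close> applies with F = 1 and gives the factor 2.\<close>
      define c where "c = \<mu> k powr (- (1 / CARD('n)))"
      have c: "0 < c" using \<mu>k by (simp add: c_def)
      have cN: "c ^ CARD('n) * \<mu> k = 1"
      proof -
        have "c ^ CARD('n) = c powr real CARD('n)" using c by (simp add: powr_realpow)
        also have "\<dots> = \<mu> k powr (-1)" by (simp add: c_def powr_powr)
        finally show ?thesis using \<mu>k by (simp add: powr_minus)
      qed
      have m1 [measurable]: "(\<lambda>x. c * indicator {x. k < u x} x) \<in> borel_measurable borel" by measurable
      have "(\<integral>\<^sup>+x. ennreal (\<bar>c * indicator {x. k < u x} x\<bar> ^ CARD('n)) \<partial>lborel)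
        = (\<integral>\<^sup>+x. ennreal (c ^ CARD('n)) * indicator {x. k < u x} x \<partial>lborel)"
        using c by (intro nn_integral_cong) (auto simp: indicator_def)
      also have "\<dots> = ennreal (c ^ CARD('n)) * ennreal (\<mu> k)"
        by (subst nn_integral_cmult_indicator) (auto simp: fin[OF k(1)])
      also have "\<dots> = ennreal 1" using cN c by (subst ennreal_mult[symmetric]) (auto simp: \<mu>_def)
      finally have "(\<integral>\<^sup>+x. ennreal (\<bar>c * indicator {x. k < u x} x\<bar> ^ CARD('n)) \<partial>lborel) \<le> ennreal 1" by simp
      from Sobolev_W[OF dim Wg m1 this]
      have S: "(\<integral>\<^sup>+x. ennreal (\<bar>c * indicator {x. k < u x} x\<bar> * \<bar>g (u x)\<bar>) \<partial>lborel) \<le> ennreal (2 * Y)"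
        unfolding n Y_def by simp
      have "ennreal (c * g h) * emeasure lborel {x. h < u x} = (\<integral>\<^sup>+x. ennreal (c * g h) * indicator {x. h < u x} x \<partial>lborel)"
        by (rule nn_integral_cmult_indicator[symmetric]) measurable
      also have "\<dots> \<le> (\<integral>\<^sup>+x. ennreal (\<bar>c * indicator {x. k < u x} x\<bar> * \<bar>g (u x)\<bar>) \<partial>lborel)"
      proof (rule nn_integral_mono)
        fix x
        show "ennreal (c * g h) * indicator {x. h < u x} x \<le> ennreal (\<bar>c * indicator {x. k < u x} x\<bar> * \<bar>g (u x)\<bar>)"
        proof (cases "h < u x")
          case True
          then have "g h \<le> g (u x)" unfolding g_def by (intro soft_trunc_mono \<delta>) simp
          then have "c * g h \<le> c * \<bar>g (u x)\<bar>" using c by (intro mult_left_mono) auto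
          then show ?thesis using True k c by (simp add: ennreal_leI)
        qed simp
      qed
      also note S
      finally have "ennreal (c * g h * \<mu> h) \<le> ennreal (2 * Y)"
        using fin[of h] k c soft_trunc_nonneg[OF \<delta>, of k h] by (simp add: ennreal_mult g_def \<mu>_def)
      moreover have "0 \<le> Y" unfolding Y_def using b by (intro Bochner_Integration.integral_nonneg) simp
      ultimately have "c * (g h * \<mu> h) \<le> 2 * Y" by (simp add: mult.assoc)
      also have "\<dots> \<le> 4 * C * \<mu> k" using Y by simp
      \<comment> \<open>\<mu>(k) = c \<mu>(k)^(1 + 1/N), so that c cancels.\<close>
      also have "\<dots> = c * (4 * C * \<mu> k powr (1 + 1 / CARD('n)))"
        using \<mu>k by (simp add: c_def powr_add powr_minus)
      finally show ?thesis using c by (simp add: g_def)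
    qed
  qed
  show ?thesis
  proof
    show "0 \<le> 4 * C" using C by simp
    fix k h :: real assume k: "0 \<le> k" "k < h"
    \<comment> \<open>With \<delta> = 1/(n+1) tending to 0, the value at h of the smooth truncation
      tends to h - k.\<close>
    have "(\<lambda>n. (h - k) * exp (- (1 / real (Suc n) / (h - k))) * \<mu> h) \<longlonglongrightarrow> (h - k) * exp (- (0 / (h - k))) * \<mu> h"
      by (intro tendsto_intros LIMSEQ_Suc[OF lim_1_over_n]) (use k in auto)
    moreover have "(h - k) * exp (- (1 / real (Suc n) / (h - k))) * \<mu> h \<le> 4 * C * \<mu> k powr (1 + 1 / CARD('n))" for n
      using soft[OF k, of "1 / real (Suc n)"] soft_trunc_gt[of "1 / real (Suc n)" k h] k by simp
    ultimately have "(h - k) * exp (- (0 / (h - k))) * \<mu> h \<le> 4 * C * \<mu> k powr (1 + 1 / CARD('n))"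
      by (intro LIMSEQ_le_const2) auto
    then show "(h - k) * measure lborel {x. h < u x} \<le> 4 * C * measure lborel {x. k < u x} powr (1 + 1 / CARD('n))"
      by (simp add: \<mu>_def)
  qed
qed

lemma solution_bounded_above:
  assumes u: "solves u \<xi>"
  shows "\<exists>B. AE x in lborel. u x \<le> B"
proof -
  have Wu: "W u \<xi>" by (rule solvesD(1)[OF u])
  note [measurable] = WD(1)[OF Wu]
  have sub: "{x. k < u x} \<subseteq> \<Omega>" if "0 \<le> k" for k using WD(3)[OF Wu] that by (metis (mono_tags) mem_Collect_eq not_less subsetI)
  have fin: "emeasure lborel {x. k < u x} < \<infinity>" if "0 \<le> k" for k
    using emeasure_bounded_finite[OF bounded_subset[OF bounded_\<Omega> sub[OF that]]] .
  obtain A where A: "0 \<le> A" "\<And>k h. 0 \<le> k \<Longrightarrow> k < h \<Longrightarrow>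
    (h - k) * measure lborel {x. h < u x} \<le> A * measure lborel {x. k < u x} powr (1 + 1 / CARD('n))"
    by (rule level_set_decay[OF u]) blast
  have "\<exists>d\<ge>0. measure lborel {x. d < u x} = 0"
  proof (rule Stampacchia_vanishing[OF _ _ A(1) _ A(2)])
    show "measure lborel {x. h < u x} \<le> measure lborel {x. k < u x}" if "0 \<le> k" "k \<le> h" for k h
      using that fin[OF that(1)] by (intro measure_mono_fmeasurable) (auto simp: fmeasurable_def)
  qed auto
  then obtain d where d: "0 \<le> d" "measure lborel {x. d < u x} = 0" by blast
  have "emeasure lborel {x. d < u x} = 0"
    using d(2) fin[OF d(1)] by (simp add: emeasure_eq_ennreal_measure less_top)
  then have "AE x in lborel. x \<notin> {x. d < u x}" by (intro AE_not_in) (auto simp: null_sets_def)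
  then have "AE x in lborel. u x \<le> d" by eventually_elim simp
  then show ?thesis ..
qed

text \<open>The flux is odd, so -u solves the problem with load -f, and its upper bound is the lower
  bound of u.\<close>

theorem solution_bounded:
  assumes u: "solves u \<xi>"
  shows "\<exists>B. AE x in lborel. \<bar>u x\<bar> \<le> B"
proof -
  interpret neg: dirichlet \<Phi> \<alpha> m \<Omega> "\<lambda>x. - f x" F
    by unfold_locales (use dim shift F in auto)
  have "neg.solves (\<lambda>x. - u x) (\<lambda>x. - \<xi> x)"
    unfolding neg.solves_def
  proof (intro conjI allI impI)
    show "W (\<lambda>x. - u x) (\<lambda>x. - \<xi> x)" using W_cmult[OF solvesD(1)[OF u], of "-1"] by simp
    fix v \<zeta> assume "W v \<zeta>"
    moreover have "flux (- \<xi> x) = - flux (\<xi> x)" for x by (simp add: flux_def)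
    ultimately show "(\<integral>x. flux (- \<xi> x) \<bullet> \<zeta> x \<partial>lborel) = (\<integral>x. - f x * v x \<partial>lborel)"
      using solvesD(2)[OF u] by simp
  qed
  from neg.solution_bounded_above[OF this] obtain B' where B': "AE x in lborel. - u x \<le> B'" ..
  obtain B where B: "AE x in lborel. u x \<le> B" using solution_bounded_above[OF u] ..
  have "AE x in lborel. \<bar>u x\<bar> \<le> max B B'" using B B' by eventually_elim auto
  then show ?thesis ..
qed

end

section \<open>The boundary value problem\<close>

text \<open>The preimages under g and h differ by null sets, and Lebesgue measure is
  complete.\<close>

lemma borel_measurable_lebesgue_AE:
  fixes g h :: "'a::euclidean_space \<Rightarrow> real"
  assumes g: "g \<in> borel_measurable lebesgue" and ae: "AE x in lebesgue. g x = h x"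
  shows "h \<in> borel_measurable lebesgue"
  unfolding in_borel_measurable_borel
proof
  fix S :: "real set" assume S: "S \<in> sets borel"
  have "AE x in lebesgue. x \<in> g -` S \<inter> space lebesgue \<longleftrightarrow> x \<in> h -` S \<inter> space lebesgue"
    using ae by eventually_elim auto
  then show "h -` S \<inter> space lebesgue \<in> sets lebesgue"
    by (rule complete_measure.in_sets_AE[OF completion.complete_measure_axioms])
      (use measurable_sets[OF g S] in auto)
qed

lemma borel_measurable_lebesgue_on_AE:
  fixes g h :: "'a::euclidean_space \<Rightarrow> real"
  assumes g: "g \<in> borel_measurable borel" and S: "S \<in> sets borel" and ae: "AE x in lebesgue_on S. h x = g x"
  shows "h \<in> borel_measurable (lebesgue_on S)"
proof (rule borel_measurable_if_D, rule borel_measurable_lebesgue_AE)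
  have "(\<lambda>x. if x \<in> S then g x else 0) \<in> borel_measurable borel" using g S by measurable
  then show "(\<lambda>x. if x \<in> S then g x else 0) \<in> borel_measurable lebesgue" by (intro measurable_completion) simp
  have "AE x in lborel. x \<in> S \<longrightarrow> h x = g x" using ae unfolding AE_lebesgue_on_iff[OF S] .
  then have "AE x in lborel. (if x \<in> S then g x else 0) = (if x \<in> S then h x else 0)" by eventually_elim auto
  then show "AE x in lebesgue. (if x \<in> S then g x else 0) = (if x \<in> S then h x else 0)" by (simp add: AE_completion_iff)
qed

text \<open>\<open>weak_grad\<close> comes from a choice operator; integrability and integrals of
  expressions in it are read off from a Borel version that vanishes off S.\<close>

lemma
  fixes g h :: "'a::euclidean_space \<Rightarrow> real"
  assumes g: "g \<in> borel_measurable borel" and S: "S \<in> sets borel" and ae: "AE x in lebesgue_on S. h x = g x"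
    and off: "\<And>x. x \<notin> S \<Longrightarrow> g x = 0"
  shows integrable_lebesgue_on_AE: "integrable (lebesgue_on S) h \<longleftrightarrow> integrable lborel g"
    and integral_lebesgue_on_AE: "(\<integral>x. h x \<partial>lebesgue_on S) = (\<integral>x. g x \<partial>lborel)"
proof -
  have e: "(\<lambda>x. indicator S x * g x) = g" using off by (auto simp: indicator_def fun_eq_iff)
  note m = borel_measurable_lebesgue_on_AE[OF g S ae] borel_lebesgue_on[OF g]
  show "integrable (lebesgue_on S) h \<longleftrightarrow> integrable lborel g"
    using integrable_cong_AE[OF m ae] integrable_lebesgue_on_borel[OF S g] by (simp add: e)
  show "(\<integral>x. h x \<partial>lebesgue_on S) = (\<integral>x. g x \<partial>lborel)"
    using integral_cong_AE[OF m ae] integral_lebesgue_on_borel[OF S g] by (simp add: e)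
qed

text \<open>For the \<Delta>_2 inequality note that m \<Phi>(s) - s \<alpha>(s) vanishes at 0 and
  has derivative (m - 1) \<alpha>(s) - s \<alpha>'(s), which is nonnegative by the upper bound on
  \<alpha>'/\<phi>.\<close>

lemma growth_Phi:
  fixes \<phi> :: "real \<Rightarrow> real" and m :: real
  assumes even: "\<And>t. t \<noteq> 0 \<Longrightarrow> \<phi> (- t) = \<phi> t"
    and C1: "\<And>t. t \<noteq> 0 \<Longrightarrow> \<phi> field_differentiable (at t)"
    and lim_0: "((\<lambda>t. t * \<phi> t) \<longlongrightarrow> 0) (at 0)"
    and lim_infinity: "filterlim (\<lambda>t. t * \<phi> t) at_top at_top"
    and strict: "strict_mono_on {0<..} (\<lambda>t. t * \<phi> t)"
    and m: "1 \<le> m"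
    and upper: "\<And>t. t > 0 \<Longrightarrow> deriv (\<lambda>s. s * \<phi> s) t / \<phi> t \<le> m - 1"
  shows "growth (Phi \<phi>) (\<lambda>t. t * \<phi> t) m"
proof -
  define \<alpha> where "\<alpha> t = t * \<phi> t" for t
  have \<alpha>0: "\<alpha> 0 = 0" by (simp add: \<alpha>_def)
  have \<alpha>_odd: "\<alpha> (- t) = - \<alpha> t" for t using even[of t] by (cases "t = 0") (auto simp: \<alpha>_def)
  have \<alpha>_diff: "\<alpha> field_differentiable (at t)" if "t \<noteq> 0" for t
    unfolding \<alpha>_def[abs_def] using C1[OF that] by (intro field_differentiable_mult field_differentiable_ident)
  have \<alpha>_cont: "continuous_on UNIV \<alpha>"
  proof -
    have "isCont \<alpha> t" for t
    proof (cases "t = 0")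
      case True
      moreover have "(\<alpha> \<longlongrightarrow> 0) (at 0)" using lim_0 unfolding \<alpha>_def[abs_def] .
      ultimately show ?thesis using \<alpha>0 by (simp add: isCont_def)
    next
      case False
      then show ?thesis using \<alpha>_diff field_differentiable_imp_continuous_at by blast
    qed
    then show ?thesis by (simp add: continuous_on_eq_continuous_at)
  qed
  have less: "\<alpha> s < \<alpha> t" if "0 < s" "s < t" for s t
    using strict that unfolding strict_mono_on_def \<alpha>_def by auto
  \<comment> \<open>\<alpha> is strictly increasing on (0, \<infinity>) with limit 0 at 0, hence at
    least 0 at t/2 and positive at t.\<close>
  have pos: "0 < \<alpha> t" if t: "0 < t" for t
  proof -
    have "(\<alpha> \<longlongrightarrow> 0) (at_right 0)" using lim_0 unfolding \<alpha>_def[abs_def] by (rule filterlim_mono) (auto simp: at_le)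
    moreover have "\<forall>\<^sub>F s in at_right 0. \<alpha> s \<le> \<alpha> (t / 2)"
      using t less[of _ "t / 2"] by (intro eventually_at_rightI[of 0 "t / 2"]) (auto intro: less_imp_le)
    ultimately have "0 \<le> \<alpha> (t / 2)" by (rule tendsto_upperbound) simp
    also have "\<dots> < \<alpha> t" using t by (intro less) auto
    finally show ?thesis .
  qed
  have mono: "strict_mono \<alpha>"
  proof (rule strict_monoI)
    fix s t :: real assume st: "s < t"
    consider "0 < s" | "s = 0" | "s < 0" "0 < t" | "s < 0" "t = 0" | "t < 0" using st by linarith
    then show "\<alpha> s < \<alpha> t"
    proof cases
      case 1 then show ?thesis using less st by simp
    next
      case 2 then show ?thesis using pos[of t] st \<alpha>0 by simp
    next
      case 3 then show ?thesis using pos[of t] pos[of "- s"] \<alpha>_odd[of s] by simp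
    next
      case 4 then show ?thesis using pos[of "- s"] \<alpha>_odd[of s] \<alpha>0 by simp
    next
      case 5 then show ?thesis using less[of "- t" "- s"] \<alpha>_odd[of s] \<alpha>_odd[of t] st by simp
    qed
  qed
  have \<Phi>_deriv: "(Phi \<phi> has_real_derivative \<alpha> t) (at t)" for t
  proof -
    \<comment> \<open>An interval around both 0 and t, so that negative t are covered by the same
      argument.\<close>
    define R where "R = \<bar>t\<bar> + 1"
    have R: "- R < t" "t < R" "- R \<le> 0" "0 \<le> R" by (auto simp: R_def)
    have "((\<lambda>u. LBINT s=ereal 0..ereal u. \<alpha> s) has_vector_derivative \<alpha> t) (at t within {- R..R})"
      using R by (intro interval_integral_FTC2 continuous_on_subset[OF \<alpha>_cont]) auto
    moreover have "at t within {- R..R} = at t" using R by (intro at_within_interior) (simp add: interior_atLeastAtMost_real)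
    ultimately show ?thesis
      by (simp add: Phi_def[abs_def] \<alpha>_def has_real_derivative_iff_has_vector_derivative zero_ereal_def)
  qed
  have \<Phi>0: "Phi \<phi> 0 = 0" by (simp add: Phi_def flip: zero_ereal_def)
  have \<Delta>: "t * \<alpha> t \<le> m * Phi \<phi> t" if t: "0 \<le> t" for t
  proof -
    define G where "G s = m * Phi \<phi> s - s * \<alpha> s" for s
    have "G 0 \<le> G t"
    proof (rule DERIV_nonneg_imp_increasing_open[OF t])
      fix s assume s: "0 < s" "s < t"
      have d: "(\<alpha> has_real_derivative deriv \<alpha> s) (at s)"
        using \<alpha>_diff[of s] s by (simp add: field_differentiable_derivI)
      have D: "(G has_real_derivative m * \<alpha> s - (1 * \<alpha> s + deriv \<alpha> s * s)) (at s)"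
        unfolding G_def by (intro DERIV_diff DERIV_mult DERIV_cmult \<Phi>_deriv DERIV_ident d)
      have \<phi>s: "0 < \<phi> s" using pos[OF s(1)] s(1) by (simp add: \<alpha>_def zero_less_mult_iff)
      have "deriv \<alpha> s \<le> (m - 1) * \<phi> s"
        using upper[OF s(1)] \<phi>s unfolding \<alpha>_def[abs_def] by (simp add: divide_le_eq)
      then have "deriv \<alpha> s * s \<le> (m - 1) * \<phi> s * s" using s by (intro mult_right_mono) auto
      also have "\<dots> = (m - 1) * \<alpha> s" by (simp add: \<alpha>_def)
      finally have "0 \<le> m * \<alpha> s - (1 * \<alpha> s + deriv \<alpha> s * s)" by (simp add: algebra_simps)
      with D show "\<exists>y. (G has_real_derivative y) (at s) \<and> 0 \<le> y" by blast
    next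
      have "continuous_on {0..t} (Phi \<phi>)" using \<Phi>_deriv DERIV_continuous_on has_field_derivative_at_within by blast
      then show "continuous_on {0..t} G"
        unfolding G_def by (intro continuous_intros continuous_on_subset[OF \<alpha>_cont]) auto
    qed
    then show ?thesis by (simp add: G_def \<Phi>0)
  qed
  show ?thesis unfolding \<alpha>_def[abs_def, symmetric]
    by unfold_locales (use \<Phi>_deriv \<Phi>0 \<alpha>_cont \<alpha>_odd mono lim_infinity m \<Delta> in \<open>auto simp: \<alpha>_def[abs_def]\<close>)
qed

lemma (in growth) flux_eq:
  assumes "\<And>t. \<alpha> t = t * \<phi> t"
  shows "flux v = \<phi> (norm v) *\<^sub>R v"
  by (cases "v = 0") (simp_all add: flux_def assms)

section \<open>Weak solutions and the working formulation\<close>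

context dirichlet begin

text \<open>Every integral over \<Omega> in \<open>weak_solution\<close> becomes an integral of
  Borel versions over the whole space; the two implications between \<open>weak_solution\<close> and
  \<open>solves\<close> are then substitutions.\<close>

lemma solves_weak_integrals:
  assumes \<phi>: "\<And>t. \<alpha> t = t * \<phi> t" and h: "AE x in lebesgue_on \<Omega>. h x = f x"
    and u: "W u \<xi>" "AE x in lebesgue_on \<Omega>. weak_grad \<Omega> u' x = \<xi> x"
    and v: "W v \<zeta>" "AE x in lebesgue_on \<Omega>. v' x = v x" "AE x in lebesgue_on \<Omega>. weak_grad \<Omega> v' x = \<zeta> x"
  shows "integrable (lebesgue_on \<Omega>) (\<lambda>x. (\<phi> (norm (weak_grad \<Omega> u' x)) *\<^sub>R weak_grad \<Omega> u' x) \<bullet> weak_grad \<Omega> v' x)"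
    and "integrable (lebesgue_on \<Omega>) (\<lambda>x. h x * v' x)"
    and "(\<integral>x. (\<phi> (norm (weak_grad \<Omega> u' x)) *\<^sub>R weak_grad \<Omega> u' x) \<bullet> weak_grad \<Omega> v' x \<partial>lebesgue_on \<Omega>)
      = (\<integral>x. flux (\<xi> x) \<bullet> \<zeta> x \<partial>lborel)"
    and "(\<integral>x. h x * v' x \<partial>lebesgue_on \<Omega>) = (\<integral>x. f x * v x \<partial>lborel)"
proof -
  have a: "AE x in lebesgue_on \<Omega>. (\<phi> (norm (weak_grad \<Omega> u' x)) *\<^sub>R weak_grad \<Omega> u' x) \<bullet> weak_grad \<Omega> v' x = flux (\<xi> x) \<bullet> \<zeta> x"
    using u(2) v(3) by eventually_elim (simp add: flux_eq[OF \<phi>])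
  have b: "AE x in lebesgue_on \<Omega>. h x * v' x = f x * v x" using h v(2) by eventually_elim simp
  have am: "(\<lambda>x. flux (\<xi> x) \<bullet> \<zeta> x) \<in> borel_measurable borel" using flux_integrable[OF u(1) v(1)] by simp
  have bm: "(\<lambda>x. f x * v x) \<in> borel_measurable borel" using W_load(1)[OF v(1)] by simp
  have a0: "flux (\<xi> x) \<bullet> \<zeta> x = 0" if "x \<notin> \<Omega>" for x using WD(4)[OF v(1) that] by simp
  have b0: "f x * v x = 0" if "x \<notin> \<Omega>" for x using WD(3)[OF v(1) that] by simp
  show "integrable (lebesgue_on \<Omega>) (\<lambda>x. (\<phi> (norm (weak_grad \<Omega> u' x)) *\<^sub>R weak_grad \<Omega> u' x) \<bullet> weak_grad \<Omega> v' x)"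
    using integrable_lebesgue_on_AE[OF am \<Omega>_borel a] a0 flux_integrable[OF u(1) v(1)] by blast
  show "integrable (lebesgue_on \<Omega>) (\<lambda>x. h x * v' x)"
    using integrable_lebesgue_on_AE[OF bm \<Omega>_borel b] b0 W_load(1)[OF v(1)] by blast
  show "(\<integral>x. (\<phi> (norm (weak_grad \<Omega> u' x)) *\<^sub>R weak_grad \<Omega> u' x) \<bullet> weak_grad \<Omega> v' x \<partial>lebesgue_on \<Omega>)
      = (\<integral>x. flux (\<xi> x) \<bullet> \<zeta> x \<partial>lborel)"
    using integral_lebesgue_on_AE[OF am \<Omega>_borel a] a0 by blast
  show "(\<integral>x. h x * v' x \<partial>lebesgue_on \<Omega>) = (\<integral>x. f x * v x \<partial>lborel)"
    using integral_lebesgue_on_AE[OF bm \<Omega>_borel b] b0 by blast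
qed

lemma solves_imp_weak_solution:
  assumes \<phi>: "\<And>t. \<alpha> t = t * \<phi> t" "\<Phi> = Phi \<phi>" and h: "AE x in lebesgue_on \<Omega>. h x = f x" and u: "solves u \<xi>"
  shows "weak_solution \<phi> \<Omega> h u"
  unfolding weak_solution_def \<phi>(2)[symmetric]
proof (intro conjI ballI)
  note Wu = W_in_W10[OF solvesD(1)[OF u]]
  show "u \<in> W10 \<Phi> \<Omega>" by (rule Wu(1))
  fix v' assume "v' \<in> W10 \<Phi> \<Omega>"
  then obtain v \<zeta> where v: "W v \<zeta>" "AE x in lebesgue_on \<Omega>. v' x = v x" "AE x in lebesgue_on \<Omega>. weak_grad \<Omega> v' x = \<zeta> x"
    by (rule W10_imp_W)
  note I = solves_weak_integrals[OF \<phi>(1) h solvesD(1)[OF u] Wu(2) v]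
  show "integrable (lebesgue_on \<Omega>) (\<lambda>x. (\<phi> (norm (weak_grad \<Omega> u x)) *\<^sub>R weak_grad \<Omega> u x) \<bullet> weak_grad \<Omega> v' x)"
    "integrable (lebesgue_on \<Omega>) (\<lambda>x. h x * v' x)" by (rule I)+
  show "(\<integral>x. (\<phi> (norm (weak_grad \<Omega> u x)) *\<^sub>R weak_grad \<Omega> u x) \<bullet> weak_grad \<Omega> v' x \<partial>lebesgue_on \<Omega>) = (\<integral>x. h x * v' x \<partial>lebesgue_on \<Omega>)"
    using I(3,4) solvesD(2)[OF u v(1)] by simp
qed

lemma weak_solution_imp_solves:
  assumes \<phi>: "\<And>t. \<alpha> t = t * \<phi> t" "\<Phi> = Phi \<phi>" and h: "AE x in lebesgue_on \<Omega>. h x = f x" and w: "weak_solution \<phi> \<Omega> h w"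
  obtains u \<xi> where "solves u \<xi>" "AE x in lebesgue_on \<Omega>. w x = u x"
proof -
  have wW: "w \<in> W10 \<Phi> \<Omega>" using w by (simp add: weak_solution_def \<phi>(2))
  obtain u \<xi> where u: "W u \<xi>" "AE x in lebesgue_on \<Omega>. w x = u x" "AE x in lebesgue_on \<Omega>. weak_grad \<Omega> w x = \<xi> x"
    by (rule W10_imp_W[OF wW])
  have "solves u \<xi>"
    unfolding solves_def
  proof (intro conjI allI impI u(1))
    fix v \<zeta> assume v: "W v \<zeta>"
    note I = solves_weak_integrals[OF \<phi>(1) h u(1,3) v _ W_in_W10(2)[OF v]]
    have "v \<in> W10 (Phi \<phi>) \<Omega>" using W_in_W10(1)[OF v] by (simp add: \<phi>(2))
    then have "(\<integral>x. (\<phi> (norm (weak_grad \<Omega> w x)) *\<^sub>R weak_grad \<Omega> w x) \<bullet> weak_grad \<Omega> v x \<partial>lebesgue_on \<Omega>) = (\<integral>x. h x * v x \<partial>lebesgue_on \<Omega>)"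
      using w unfolding weak_solution_def by blast
    then show "(\<integral>x. flux (\<xi> x) \<bullet> \<zeta> x \<partial>lborel) = (\<integral>x. f x * v x \<partial>lborel)" using I(3,4) by simp
  qed
  then show ?thesis using u(2) by (rule that)
qed

end

lemma Lp_space_borel_representative:
  fixes f :: "real^'n \<Rightarrow> real"
  assumes f: "f \<in> Lp_space (real N) \<Omega>" and \<Omega>: "\<Omega> \<in> sets borel" and N: "0 < N"
  obtains f0 F where "f0 \<in> borel_measurable borel" "AE x in lebesgue_on \<Omega>. f x = f0 x"
    "(\<integral>\<^sup>+x. ennreal (\<bar>f0 x\<bar> ^ N) \<partial>lborel) \<le> ennreal F" "0 \<le> F"
proof -
  have fm: "f \<in> borel_measurable (lebesgue_on \<Omega>)" and fi: "integrable (lebesgue_on \<Omega>) (\<lambda>x. \<bar>f x\<bar> powr real N)"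
    using f by (auto simp: Lp_space_def)
  obtain f0 where f0: "f0 \<in> borel_measurable borel" "\<And>x. x \<notin> \<Omega> \<Longrightarrow> f0 x = 0" "AE x in lebesgue_on \<Omega>. f x = f0 x"
    by (rule ex_borel_representative[OF fm \<Omega>]) blast
  have "(\<integral>\<^sup>+x. ennreal (\<bar>f0 x\<bar> ^ N) \<partial>lborel) = (\<integral>\<^sup>+x. ennreal (\<bar>f0 x\<bar> ^ N) \<partial>lebesgue_on \<Omega>)"
    unfolding nn_integral_lebesgue_on[OF \<Omega>] using f0(2) N by (intro nn_integral_cong) (auto simp: indicator_def)
  also have "\<dots> = (\<integral>\<^sup>+x. ennreal (\<bar>f x\<bar> powr real N) \<partial>lebesgue_on \<Omega>)"
    by (rule nn_integral_cong_AE, use f0(3) in eventually_elim) (use N in \<open>auto simp: powr_realpow'\<close>)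
  also have "\<dots> = ennreal (\<integral>x. \<bar>f x\<bar> powr real N \<partial>lebesgue_on \<Omega>)" by (rule nn_integral_eq_integral[OF fi]) simp
  finally show ?thesis using f0(1,3) by (intro that[of f0]) (auto intro!: Bochner_Integration.integral_nonneg)
qed

theorem theorem1p1:
  fixes \<Omega> :: "(real^'n) set" and f :: "real^'n \<Rightarrow> real"
    and \<phi> :: "real \<Rightarrow> real" and l m :: real
  assumes dim: "CARD('n) \<ge> 2"
    and dom: "open \<Omega>" "connected \<Omega>" "\<Omega> \<noteq> {}" "bounded \<Omega>" "smooth_boundary \<Omega>"
    and f: "f \<in> Lp_space (real CARD('n)) \<Omega>"
    and even: "\<And>t. t \<noteq> 0 \<Longrightarrow> \<phi> (- t) = \<phi> t"
    and C1: "\<And>t. t \<noteq> 0 \<Longrightarrow> \<phi> field_differentiable (at t)" "continuous_on (- {0}) (deriv \<phi>)"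
    and lim_0: "((\<lambda>t. t * \<phi> t) \<longlongrightarrow> 0) (at 0)"
    and lim_infinity: "filterlim (\<lambda>t. t * \<phi> t) at_top at_top"
    and strict: "strict_mono_on {0<..} (\<lambda>t. t * \<phi> t)"
    and l: "1 \<le> l" "l < real CARD('n)"
    and m: "1 \<le> m" "m < real CARD('n)"
    and lower: "l - 1 = (INF s\<in>{0<..}. deriv (\<lambda>t. t * \<phi> t) s / \<phi> s)"
    and bounds: "\<And>t. t > 0 \<Longrightarrow> l - 1 \<le> deriv (\<lambda>s. s * \<phi> s) t / \<phi> t \<and>
                                deriv (\<lambda>s. s * \<phi> s) t / \<phi> t \<le> m - 1"
    and a_pos: "(INF t\<in>{0<..}. t powr m / Phi \<phi> t) > 0"
  shows "\<exists>u. weak_solution \<phi> \<Omega> f u \<and>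
             (\<forall>w. weak_solution \<phi> \<Omega> f w \<longrightarrow> (AE x in lebesgue_on \<Omega>. w x = u x)) \<and>
             (l > 1 \<and> (\<exists>r>1. \<exists>c1>0. \<exists>c2>0. \<forall>t.
                  c1 * \<bar>t\<bar> powr r \<le> Phi \<phi> t \<and> Phi \<phi> t \<le> c2 * \<bar>t\<bar> powr r)
                \<longrightarrow> u \<in> Linfty_space \<Omega>)"
proof -
  have \<Omega>b: "\<Omega> \<in> sets borel" using dom(1) by simp
  obtain f0 F where f0: "f0 \<in> borel_measurable borel" "AE x in lebesgue_on \<Omega>. f x = f0 x"
    "(\<integral>\<^sup>+x. ennreal (\<bar>f0 x\<bar> ^ CARD('n)) \<partial>lborel) \<le> ennreal F" "0 \<le> F"
    by (rule Lp_space_borel_representative[OF f \<Omega>b]) auto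
  interpret growth "Phi \<phi>" "\<lambda>t. t * \<phi> t" m
    using even C1(1) lim_0 lim_infinity strict m(1) bounds by (intro growth_Phi) auto
  interpret dirichlet "Phi \<phi>" "\<lambda>t. t * \<phi> t" m \<Omega> f0 F
    by unfold_locales (use dom(1,4) dim f0 smooth_boundary_shiftable[OF dom(1,5)] in auto)
  obtain u \<xi> where u: "solves u \<xi>" by (rule solution_exists)
  have "AE x in lebesgue_on \<Omega>. w x = u x" if w: "weak_solution \<phi> \<Omega> f w" for w
  proof -
    obtain w0 \<zeta> where w0: "solves w0 \<zeta>" "AE x in lebesgue_on \<Omega>. w x = w0 x"
      by (rule weak_solution_imp_solves[OF refl refl f0(2) w])
    have "AE x in lborel. w0 x = u x" by (rule solution_unique[OF u w0(1)])
    then have "AE x in lebesgue_on \<Omega>. w0 x = u x" unfolding AE_lebesgue_on_iff[OF \<Omega>b] by eventually_elim simp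
    with w0(2) show ?thesis by eventually_elim simp
  qed
  moreover have "u \<in> Linfty_space \<Omega>"
  proof -
    obtain B where "AE x in lborel. \<bar>u x\<bar> \<le> B" using solution_bounded[OF u] ..
    then have "AE x in lebesgue_on \<Omega>. \<bar>u x\<bar> \<le> B" unfolding AE_lebesgue_on_iff[OF \<Omega>b] by eventually_elim simp
    then show ?thesis using borel_lebesgue_on[OF WD(1)[OF solvesD(1)[OF u]]] by (auto simp: Linfty_space_def)
  qed
  moreover have "weak_solution \<phi> \<Omega> f u" by (rule solves_imp_weak_solution[OF refl refl f0(2) u])
  ultimately show ?thesis by blast
qed

end
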